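(* Let $F=\dfrac{\beta^2}{\beta-\alpha}$ be a $G$-invariant infinite series metric on the reductive homogeneous Finsler space $G/H$ (of dimension $n$) with a decomposition of the Lie algebra $\mathfrak g=\mathfrak h+\mathfrak m$. Then the $S$-curvature is given by $$S(H,y)=\left[\frac{-(n+1)s^5+(7n+1)s^4-12ns^3+2(2-n)b^2s^2+4(2n-1)b^2s}{2\,(s^3-3s^2+2b^2)^2}\right]\left(\frac1\alpha\big\langle[v,y]_{\mathfrak m},y\big\rangle+\Big(1-\frac2s\Big)\big\langle[v,y]_{\mathfrak m},v\big\rangle\right),$$ where $v\in\mathfrak m$ corresponds to the 1-form $\beta$, $\mathfrak m$ is identified with the tangent space $T_H(G/H)$ of $G/H$ at the origin $H$, and $\alpha=\alpha(y)$, $s=\beta(y)/\alpha(y)$, $b=\|\beta\|_\alpha$.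
   Context: A Finsler metric on a connected smooth $n$-manifold $M$ is a function $F:TM\to[0,\infty)$, smooth on $TM\setminus\{0\}$, whose restriction to each $T_xM$ is a Minkowski norm, i.e. $F$ is positively homogeneous of degree one in $y$ and the Hessian $g_{ij}=\frac12(F^2)_{y^iy^j}$ is positive definite for $y\neq0$. The infinite series $(\alpha,\beta)$-metric is the metric $F=\beta^2/(\beta-\alpha)=\alpha\phi(s)$, $s=\beta/\alpha$, $\phi(s)=s^2/(s-1)$, where $\alpha(x,y)=\sqrt{a_{ij}(x)y^iy^j}$ is (the norm of) a Riemannian metric and $\beta=b_i(x)y^i$ is a 1-form; $\|\beta\|_\alpha$ is the length of $\beta$ with respect to $\alpha$. $G$ is a Lie group and $H$ a compact (isotropy) subgroup, with Lie algebras $\mathfrak g,\mathfrak h$ and $G/H$ connected; reductive means $\mathfrak g=\mathfrak h\oplus\mathfrak m$ as vector spaces with $\mathrm{Ad}(h)\mathfrak m\subset\mathfrak m$ for all $h\in H$. $[\cdot,\cdot]_{\mathfrak m}$ denotes the $\mathfrak m$-component of the Lie bracket. $\mathfrak m$ is identified with $T_H(G/H)$ by $w\mapsto\frac{d}{dt}(\exp(tw)H)|_{t=0}$. $F$ is $G$-invariant if it is preserved by the natural action of $G$. $\langle\cdot,\cdot\rangle$ is the inner product on $\mathfrak m$ given by the Riemannian metric $\alpha$ at the origin; $v\in\mathfrak m$ corresponds to $\beta$ via $\langle v,y\rangle=\beta(y)$ for all $y\in\mathfrak m$ (so $b=|v|$). $S$-curvature: for a basis $\{e_i\}$ of $T_xM$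 let $\sigma_F(x)=\mathrm{Vol}(B^n)/\mathrm{Vol}\{(y^i)\in\mathbb R^n: F(x,y^ie_i)<1\}$ ($B^n$ the Euclidean unit ball), and let $\tau(x,y)=\ln\big(\sqrt{\det(g_{ij}(x,y))}/\sigma_F(x)\big)$ be the distortion. Then $S(x,y)=\frac{d}{dt}\big[\tau(\gamma(t),\dot\gamma(t))\big]_{t=0}$, where $\gamma$ is the geodesic of $F$ with $\gamma(0)=x$, $\dot\gamma(0)=y\ne0$. *)

theory Defs
  imports "HOL-Analysis.Analysis" "HOL-Algebra.Left_Coset"
begin

section \<open>Smooth manifolds\<close>

text \<open>\<open>Ck_on k S f\<close> is meant for open \<open>S\<close> in a Euclidean space, where continuity of
  all iterated directional derivatives is the usual notion of class C^k.\<close>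

primrec Ck_on :: "nat \<Rightarrow> 'a::real_normed_vector set \<Rightarrow> ('a \<Rightarrow> 'b::real_normed_vector) \<Rightarrow> bool" where
  "Ck_on 0 S f \<longleftrightarrow> continuous_on S f"
| "Ck_on (Suc k) S f \<longleftrightarrow>
     (\<forall>x\<in>S. f differentiable (at x)) \<and> (\<forall>v. Ck_on k S (\<lambda>x. frechet_derivative f (at x) v))"

definition smooth_on :: "'a::real_normed_vector set \<Rightarrow> ('a \<Rightarrow> 'b::real_normed_vector) \<Rightarrow> bool" where
  "smooth_on S f \<longleftrightarrow> (\<forall>k. Ck_on k S f)"

text \<open>A chart is a domain together with a coordinate map (only its values on the domain matter).
  A manifold is given by an atlas, not necessarily maximal; its points and its
  topology are recovered from the atlas.\<close>

type_synonym ('m, 'e) chart = "'m set \<times> ('m \<Rightarrow> 'e)"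
type_synonym ('m, 'e) atlas = "('m, 'e) chart set"

definition points :: "('m, 'e) atlas \<Rightarrow> 'm set" where
  "points A = \<Union> (fst ` A)"

definition atlas_topology :: "('m, 'e::euclidean_space) atlas \<Rightarrow> 'm topology" where
  "atlas_topology A =
     topology (\<lambda>W. W \<subseteq> points A \<and> (\<forall>(U, \<phi>)\<in>A. open (\<phi> ` (U \<inter> W))))"

definition smooth_manifold :: "('m, 'e::euclidean_space) atlas \<Rightarrow> bool" where
  "smooth_manifold A \<longleftrightarrow>
     (\<forall>(U, \<phi>)\<in>A. inj_on \<phi> U \<and> open (\<phi> ` U)) \<and>
     (\<forall>(U, \<phi>)\<in>A. \<forall>(V, \<psi>)\<in>A.
        open (\<phi> ` (U \<inter> V)) \<and> smooth_on (\<phi> ` (U \<inter> V)) (\<psi> \<circ> inv_into U \<phi>)) \<and>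
     Hausdorff_space (atlas_topology A) \<and> second_countable (atlas_topology A)"

definition smooth_map ::
  "('m, 'e::euclidean_space) atlas \<Rightarrow> ('k, 'f::euclidean_space) atlas \<Rightarrow> ('m \<Rightarrow> 'k) \<Rightarrow> bool" where
  "smooth_map A B f \<longleftrightarrow>
     f ` points A \<subseteq> points B \<and>
     (\<forall>(U, \<phi>)\<in>A. \<forall>(V, \<psi>)\<in>B.
        open (\<phi> ` (U \<inter> f -` V)) \<and> smooth_on (\<phi> ` (U \<inter> f -` V)) (\<psi> \<circ> f \<circ> inv_into U \<phi>))"

definition prod_atlas :: "('m, 'e) atlas \<Rightarrow> ('k, 'f) atlas \<Rightarrow> ('m \<times> 'k, 'e \<times> 'f) atlas" where
  "prod_atlas A B = {(U \<times> V, map_prod \<phi> \<psi>) | U \<phi> V \<psi>. (U, \<phi>) \<in> A \<and> (V, \<psi>) \<in> B}"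

definition line_atlas :: "(real, real) atlas" where
  "line_atlas = {(UNIV, \<lambda>t. t)}"

text \<open>One chart around each point is singled out, and the tangent space at \<open>x\<close> is the model space,
  a vector being represented by its components in the chart \<open>chart_at A x\<close>.\<close>

definition chart_at :: "('m, 'e) atlas \<Rightarrow> 'm \<Rightarrow> ('m, 'e) chart" where
  "chart_at A x = (SOME c. c \<in> A \<and> x \<in> fst c)"

definition coord_at :: "('m, 'e) atlas \<Rightarrow> 'm \<Rightarrow> 'm \<Rightarrow> 'e" where
  "coord_at A x = snd (chart_at A x)"

definition point_at :: "('m, 'e) atlas \<Rightarrow> 'm \<Rightarrow> 'e \<Rightarrow> 'm" where
  "point_at A x = inv_into (fst (chart_at A x)) (snd (chart_at A x))"

definition tangent_map ::
  "('m, 'e::euclidean_space) atlas \<Rightarrow> ('k, 'f::euclidean_space) atlas \<Rightarrow> ('m \<Rightarrow> 'k) \<Rightarrow> 'm \<Rightarrow> 'e \<Rightarrow> 'f" where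
  "tangent_map A B f x =
     frechet_derivative (coord_at B (f x) \<circ> f \<circ> point_at A x) (at (coord_at A x x))"

definition velocity :: "('m, 'e::euclidean_space) atlas \<Rightarrow> (real \<Rightarrow> 'm) \<Rightarrow> real \<Rightarrow> 'e" where
  "velocity A \<gamma> t = vector_derivative (coord_at A (\<gamma> t) \<circ> \<gamma>) (at t)"

text \<open>The tangent vector at \<open>inv_into U \<phi> z\<close> whose components in the chart \<open>(U, \<phi>)\<close> are \<open>w\<close>.\<close>

definition chart_vec ::
  "('m, 'e::euclidean_space) atlas \<Rightarrow> ('m, 'e) chart \<Rightarrow> 'e \<Rightarrow> 'e \<Rightarrow> 'e" where
  "chart_vec A c z w =
     (case c of (U, \<phi>) \<Rightarrow>
        frechet_derivative (coord_at A (inv_into U \<phi> z) \<circ> inv_into U \<phi>) (at z) w)"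

definition chart_rep ::
  "('m, 'e::euclidean_space) atlas \<Rightarrow> ('m, 'e) chart \<Rightarrow> ('m \<Rightarrow> 'e \<Rightarrow> real) \<Rightarrow> 'e \<Rightarrow> 'e \<Rightarrow> real" where
  "chart_rep A c f z w = f (inv_into (fst c) (snd c) z) (chart_vec A c z w)"

definition chart_domain ::
  "('m, 'e::euclidean_space) atlas \<Rightarrow> ('m, 'e) chart \<Rightarrow> ('m \<Rightarrow> 'e set) \<Rightarrow> ('e \<times> 'e) set" where
  "chart_domain A c D =
     {(z, w). z \<in> snd c ` fst c \<and> chart_vec A c z w \<in> D (inv_into (fst c) (snd c) z)}"

section \<open>Lie groups and reductive homogeneous spaces\<close>

definition lie_group :: "('g, 'z) monoid_scheme \<Rightarrow> ('g, 'e::euclidean_space) atlas \<Rightarrow> bool" where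
  "lie_group G A \<longleftrightarrow>
     group G \<and> smooth_manifold A \<and> points A = carrier G \<and>
     smooth_map (prod_atlas A A) A (\<lambda>(g, h). g \<otimes>\<^bsub>G\<^esub> h) \<and>
     smooth_map A A (\<lambda>g. inv\<^bsub>G\<^esub> g)"

definition Ad :: "('g, 'z) monoid_scheme \<Rightarrow> ('g, 'e::euclidean_space) atlas \<Rightarrow> 'g \<Rightarrow> 'e \<Rightarrow> 'e" where
  "Ad G A g = tangent_map A A (\<lambda>x. g \<otimes>\<^bsub>G\<^esub> x \<otimes>\<^bsub>G\<^esub> inv\<^bsub>G\<^esub> g) \<one>\<^bsub>G\<^esub>"

text \<open>The Lie algebra is the tangent space at \<open>\<one>\<close> with \<open>[X, Y] = ad X Y\<close>, where \<open>ad\<close> is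
  the differential of \<open>Ad\<close> at \<open>\<one>\<close>; this is the bracket of left-invariant vector fields.\<close>

definition lie_bracket ::
  "('g, 'z) monoid_scheme \<Rightarrow> ('g, 'e::euclidean_space) atlas \<Rightarrow> 'e \<Rightarrow> 'e \<Rightarrow> 'e" where
  "lie_bracket G A X Y =
     frechet_derivative (\<lambda>z. Ad G A (point_at A \<one>\<^bsub>G\<^esub> z) Y) (at (coord_at A \<one>\<^bsub>G\<^esub> \<one>\<^bsub>G\<^esub>)) X"

definition one_parameter_subgroup ::
  "('g, 'z) monoid_scheme \<Rightarrow> ('g, 'e::euclidean_space) atlas \<Rightarrow> 'e \<Rightarrow> (real \<Rightarrow> 'g) \<Rightarrow> bool" where
  "one_parameter_subgroup G A X \<gamma> \<longleftrightarrow>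
     smooth_map line_atlas A \<gamma> \<and> (\<forall>s t. \<gamma> (s + t) = \<gamma> s \<otimes>\<^bsub>G\<^esub> \<gamma> t) \<and> velocity A \<gamma> 0 = X"

definition lie_exp :: "('g, 'z) monoid_scheme \<Rightarrow> ('g, 'e::euclidean_space) atlas \<Rightarrow> 'e \<Rightarrow> 'g" where
  "lie_exp G A X = (THE \<gamma>. one_parameter_subgroup G A X \<gamma>) 1"

definition subgroup_algebra ::
  "('g, 'z) monoid_scheme \<Rightarrow> ('g, 'e::euclidean_space) atlas \<Rightarrow> 'g set \<Rightarrow> 'e set" where
  "subgroup_algebra G A H = {X. \<forall>t. lie_exp G A (t *\<^sub>R X) \<in> H}"

text \<open>The smooth structure of \<open>G/H\<close> is determined by the projection being a submersion.\<close>

definition homogeneous_space ::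
  "('g, 'z) monoid_scheme \<Rightarrow> ('g, 'e::euclidean_space) atlas \<Rightarrow> 'g set
     \<Rightarrow> ('g set, 'f::euclidean_space) atlas \<Rightarrow> bool" where
  "homogeneous_space G A H B \<longleftrightarrow>
     smooth_manifold B \<and> points B = lcosets\<^bsub>G\<^esub> H \<and>
     smooth_map A B (\<lambda>g. g <#\<^bsub>G\<^esub> H) \<and>
     (\<forall>g\<in>carrier G. surj (tangent_map A B (\<lambda>g. g <#\<^bsub>G\<^esub> H) g))"

definition reductive_decomposition ::
  "('g, 'z) monoid_scheme \<Rightarrow> ('g, 'e::euclidean_space) atlas \<Rightarrow> 'g set \<Rightarrow> 'e set \<Rightarrow> bool" where
  "reductive_decomposition G A H \<mm> \<longleftrightarrow>
     subspace \<mm> \<and>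
     subgroup_algebra G A H \<inter> \<mm> = {0} \<and>
     (\<forall>X. \<exists>Y\<in>subgroup_algebra G A H. \<exists>Z\<in>\<mm>. X = Y + Z) \<and>
     (\<forall>h\<in>H. Ad G A h ` \<mm> \<subseteq> \<mm>)"

definition m_component ::
  "('g, 'z) monoid_scheme \<Rightarrow> ('g, 'e::euclidean_space) atlas \<Rightarrow> 'g set \<Rightarrow> 'e set \<Rightarrow> 'e \<Rightarrow> 'e" where
  "m_component G A H \<mm> X = (THE Z. Z \<in> \<mm> \<and> X - Z \<in> subgroup_algebra G A H)"

definition origin_vector ::
  "('g, 'z) monoid_scheme \<Rightarrow> ('g, 'e::euclidean_space) atlas \<Rightarrow> 'g set
     \<Rightarrow> ('g set, 'f::euclidean_space) atlas \<Rightarrow> 'e \<Rightarrow> 'f" where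
  "origin_vector G A H B w = velocity B (\<lambda>t. lie_exp G A (t *\<^sub>R w) <#\<^bsub>G\<^esub> H) 0"

section \<open>Finsler metrics\<close>

definition partial :: "'n::finite \<Rightarrow> (real ^ 'n \<Rightarrow> real) \<Rightarrow> real ^ 'n \<Rightarrow> real" where
  "partial i f u = frechet_derivative f (at u) (axis i 1)"

definition fundamental_tensor :: "(real ^ 'n \<Rightarrow> real) \<Rightarrow> real ^ 'n \<Rightarrow> real ^ 'n ^ 'n" where
  "fundamental_tensor N u = (\<chi> i j. partial i (partial j (\<lambda>w. (N w)\<^sup>2)) u / 2)"

text \<open>\<open>D x\<close> is the cone of admissible directions at \<open>x\<close>. A Finsler metric in the classical sense
  is the case \<open>D x = - {0}\<close>. Conic domains are needed because \<open>\<beta>\<^sup>2 / (\<beta> - \<alpha>)\<close> is positive only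
  where \<open>\<beta> > \<alpha>\<close>, so that it is never a Finsler metric on the whole slit tangent bundle.\<close>

definition finsler_metric ::
  "('m, real ^ 'n) atlas \<Rightarrow> ('m \<Rightarrow> (real ^ 'n) set) \<Rightarrow> ('m \<Rightarrow> real ^ 'n \<Rightarrow> real) \<Rightarrow> bool" where
  "finsler_metric B D F \<longleftrightarrow>
     (\<forall>c\<in>B. open (chart_domain B c D) \<and>
            smooth_on (chart_domain B c D) (\<lambda>(z, w). chart_rep B c F z w)) \<and>
     (\<forall>x\<in>points B. 0 \<notin> D x \<and>
        (\<forall>u\<in>D x. F x u \<ge> 0 \<and>
           (\<forall>r>0. r *\<^sub>R u \<in> D x \<and> F x (r *\<^sub>R u) = r * F x u) \<and>
           (\<forall>w. w \<noteq> 0 \<longrightarrow> w \<bullet> (fundamental_tensor (F x) u *v w) > 0)))"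

definition invariant_metric ::
  "('g, 'z) monoid_scheme \<Rightarrow> ('g set, real ^ 'n) atlas
     \<Rightarrow> ('g set \<Rightarrow> (real ^ 'n) set) \<Rightarrow> ('g set \<Rightarrow> real ^ 'n \<Rightarrow> real) \<Rightarrow> bool" where
  "invariant_metric G B D F \<longleftrightarrow>
     (\<forall>g\<in>carrier G. \<forall>x\<in>points B. \<forall>u.
        let T = tangent_map B B (\<lambda>x. g <#\<^bsub>G\<^esub> x) x in
        (T u \<in> D (g <#\<^bsub>G\<^esub> x) \<longleftrightarrow> u \<in> D x) \<and> (u \<in> D x \<longrightarrow> F (g <#\<^bsub>G\<^esub> x) (T u) = F x u))"

text \<open>With \<open>L = F\<^sup>2\<close>, the \<open>i\<close>-th component is one quarter of the sum over \<open>l\<close> of the inverse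
  fundamental tensor entry \<open>i l\<close> times \<open>\<Sum>k. w\<^sub>k \<partial>\<^sup>2L/\<partial>z\<^sub>k\<partial>w\<^sub>l - \<partial>L/\<partial>z\<^sub>l\<close>, where \<open>z\<close> are the coordinates of
  the base point and \<open>w\<close> those of the vector.\<close>

definition spray :: "(real ^ 'n \<Rightarrow> real ^ 'n \<Rightarrow> real) \<Rightarrow> real ^ 'n \<Rightarrow> real ^ 'n \<Rightarrow> real ^ 'n" where
  "spray N z w =
     (let L = (\<lambda>z w. (N z w)\<^sup>2) in
      (1 / 4) *\<^sub>R (matrix_inv (fundamental_tensor (N z) w) *v
        (\<chi> l. (\<Sum>k\<in>UNIV. partial k (\<lambda>z. partial l (L z) w) z * w $ k)
              - partial l (\<lambda>z. L z w) z)))"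

definition geodesic ::
  "('m, real ^ 'n) atlas \<Rightarrow> ('m \<Rightarrow> (real ^ 'n) set) \<Rightarrow> ('m \<Rightarrow> real ^ 'n \<Rightarrow> real)
     \<Rightarrow> real set \<Rightarrow> (real \<Rightarrow> 'm) \<Rightarrow> bool" where
  "geodesic B D F I \<gamma> \<longleftrightarrow>
     continuous_map (top_of_set I) (atlas_topology B) \<gamma> \<and>
     (\<forall>t\<in>I. velocity B \<gamma> t \<in> D (\<gamma> t)) \<and>
     (\<forall>c\<in>B. \<forall>t\<in>I. \<gamma> t \<in> fst c \<longrightarrow>
        (let x = snd c \<circ> \<gamma>; x' = (\<lambda>t. vector_derivative x (at t)) in
         x differentiable (at t) \<and>
         (x' has_vector_derivative (- 2 *\<^sub>R spray (chart_rep B c F) (x t) (x' t))) (at t)))"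

section \<open>Distortion and S-curvature\<close>

text \<open>\<open>\<sigma>\<close> and \<open>det g\<close> depend on a basis of the tangent space, the distortion does not;
  the coordinate basis of \<open>chart_at\<close> is used at every point.\<close>

definition volume_density :: "(real ^ 'n) set \<Rightarrow> (real ^ 'n \<Rightarrow> real) \<Rightarrow> real" where
  "volume_density C N =
     measure lborel (ball (0 :: real ^ 'n) 1) / measure lborel {u \<in> C. N u < 1}"

definition distortion ::
  "('m \<Rightarrow> (real ^ 'n) set) \<Rightarrow> ('m \<Rightarrow> real ^ 'n \<Rightarrow> real) \<Rightarrow> 'm \<Rightarrow> real ^ 'n \<Rightarrow> real" where
  "distortion D F x u =
     ln (sqrt (det (fundamental_tensor (F x) u)) / volume_density (D x) (F x))"

definition S_curvature ::
  "('m, real ^ 'n) atlas \<Rightarrow> ('m \<Rightarrow> (real ^ 'n) set) \<Rightarrow> ('m \<Rightarrow> real ^ 'n \<Rightarrow> real)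
     \<Rightarrow> 'm \<Rightarrow> real ^ 'n \<Rightarrow> real" where
  "S_curvature B D F x u =
     (THE r. \<exists>\<gamma> \<epsilon>. \<epsilon> > 0 \<and> geodesic B D F {- \<epsilon><..<\<epsilon>} \<gamma> \<and> \<gamma> 0 = x \<and> velocity B \<gamma> 0 = u \<and>
        ((\<lambda>t. distortion D F (\<gamma> t) (velocity B \<gamma> t)) has_real_derivative r) (at 0))"

section \<open>The infinite series metric\<close>

definition riemannian_metric ::
  "('m, real ^ 'n) atlas \<Rightarrow> ('m \<Rightarrow> real ^ 'n \<Rightarrow> real ^ 'n \<Rightarrow> real) \<Rightarrow> bool" where
  "riemannian_metric B a \<longleftrightarrow>
     (\<forall>x\<in>points B. bilinear (a x) \<and> (\<forall>u w. a x u w = a x w u) \<and> (\<forall>u. u \<noteq> 0 \<longrightarrow> a x u u > 0)) \<and>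
     (\<forall>(U, \<phi>)\<in>B. \<forall>u w. smooth_on (\<phi> ` U)
        (\<lambda>z. a (inv_into U \<phi> z) (chart_vec B (U, \<phi>) z u) (chart_vec B (U, \<phi>) z w)))"

definition one_form :: "('m, real ^ 'n) atlas \<Rightarrow> ('m \<Rightarrow> real ^ 'n \<Rightarrow> real) \<Rightarrow> bool" where
  "one_form B \<beta> \<longleftrightarrow>
     (\<forall>x\<in>points B. linear (\<beta> x)) \<and>
     (\<forall>c\<in>B. \<forall>u. smooth_on (snd c ` fst c) (\<lambda>z. chart_rep B c \<beta> z u))"

definition riemannian_norm ::
  "('m \<Rightarrow> real ^ 'n \<Rightarrow> real ^ 'n \<Rightarrow> real) \<Rightarrow> 'm \<Rightarrow> real ^ 'n \<Rightarrow> real" where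
  "riemannian_norm a x u = sqrt (a x u u)"

definition one_form_norm ::
  "('m \<Rightarrow> real ^ 'n \<Rightarrow> real ^ 'n \<Rightarrow> real) \<Rightarrow> ('m \<Rightarrow> real ^ 'n \<Rightarrow> real) \<Rightarrow> 'm \<Rightarrow> real" where
  "one_form_norm a \<beta> x = (SUP u\<in>- {0}. \<beta> x u / riemannian_norm a x u)"

definition infinite_series_metric ::
  "('m \<Rightarrow> real ^ 'n \<Rightarrow> real ^ 'n \<Rightarrow> real) \<Rightarrow> ('m \<Rightarrow> real ^ 'n \<Rightarrow> real) \<Rightarrow> 'm \<Rightarrow> real ^ 'n \<Rightarrow> real" where
  "infinite_series_metric a \<beta> x u = (\<beta> x u)\<^sup>2 / (\<beta> x u - riemannian_norm a x u)"

end

(* A geodesic through H lifts to a curve g(t) in G whose body velocity u(t) satisfies the Euler-Poincare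
   equation of the invariant Lagrangian F^2: writing g_u for the fundamental tensor at H,
   2 g_y(k, u'(0)) = D(F^2)(y)[y, k] for all k. By invariance the distortion along the geodesic is the distortion
   at H evaluated on u(t), so S(H, y) = D tau(y) u'(0), and the spray drops out. The determinant of g_u is a
   constant times s^(4n-2) N / (s-1)^(3n) with N = s^3 - 3 s^2 + 2 b^2, so tau depends on the direction
   only through s, and one needs only ds(u'(0)). The functional ds is proportional to g_y(k, -) for a combination
   k of v and y, and for this k the bracket [y, k] is a multiple of [v, y]. *)
theory Submission
  imports Defs
begin

section \<open>Functions of class C^k\<close>

text \<open>The geodesic equation is carried as the Euler-Lagrange equation of F^2 on 2-jets of
  curves. In that form it pulls back along any smooth map: along coordinate changes, and along the
  projection from G to G/H, where the lifted Lagrangian degenerates in the isotropy directions and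
  defines no spray of its own. Invertibility of the fundamental tensor translates between this form
  and the spray in charts of G/H.

  The action of G on G/H is not given as smooth. A local section of the projection, obtained from
  the inverse function theorem, makes each translation differentiable at H and also lifts the
  geodesic.

  The metric lives on a cone of directions, and positivity of F forces beta > alpha there. On this
  cone F >= 4 alpha, so the unit sublevel sets are bounded and have finite positive volume, which
  gives the distortion a meaning and lets it transform correctly.

  S-curvature is a definite description over all geodesics with the given initial velocity. Picard
  iteration supplies one, and the computation assigns the same derivative to every one of
  them.\<close>

lemma Ck_on_has_derivative:
  "Ck_on (Suc k) S f \<Longrightarrow> x \<in> S \<Longrightarrow> (f has_derivative frechet_derivative f (at x)) (at x)"
  using frechet_derivative_works by auto

text \<open>Openness of \<open>S\<close> makes agreement on \<open>S\<close> an agreement near each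
  point, so the two functions share their derivatives at every level.\<close>

lemma Ck_on_cong:
  assumes "open S" "\<And>x. x \<in> S \<Longrightarrow> f x = g x" "Ck_on k S f"
  shows "Ck_on k S g"
  using assms(2,3)
proof (induction k arbitrary: f g)
  case 0
  then show ?case by (simp cong: continuous_on_cong)
next
  case (Suc k)
  have fg: "(f has_derivative D) (at x) \<longleftrightarrow> (g has_derivative D) (at x)" if "x \<in> S" for x D
    using has_derivative_transform_within_open[OF _ assms(1) that, of f D UNIV g]
      has_derivative_transform_within_open[OF _ assms(1) that, of g D UNIV f] Suc.prems(1) by auto
  have D: "frechet_derivative f (at x) = frechet_derivative g (at x)" if "x \<in> S" for x
    unfolding frechet_derivative_def using fg[OF that] by simp
  have "Ck_on k S (\<lambda>x. frechet_derivative g (at x) v)" for v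
  proof (rule Suc.IH)
    show "frechet_derivative f (at x) v = frechet_derivative g (at x) v" if "x \<in> S" for x
      using D[OF that] by simp
    show "Ck_on k S (\<lambda>x. frechet_derivative f (at x) v)" using Suc.prems(2) by simp
  qed
  moreover have "g differentiable (at x)" if "x \<in> S" for x
    using Ck_on_has_derivative[OF Suc.prems(2) that] fg[OF that] by (auto simp: differentiable_def)
  ultimately show ?case by simp
qed

lemma Ck_on_subset: "Ck_on k S f \<Longrightarrow> T \<subseteq> S \<Longrightarrow> Ck_on k T f"
  by (induction k arbitrary: f) (auto intro: continuous_on_subset)

lemma Ck_on_SucD: "Ck_on (Suc k) S f \<Longrightarrow> Ck_on k S f"
proof (induction k arbitrary: f)
  case 0
  then show ?case
    by (auto intro!: continuous_at_imp_continuous_on differentiable_imp_continuous_within)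
next
  case (Suc k)
  show ?case
    unfolding Ck_on.simps(2)[of k]
    using Suc.prems Suc.IH by (simp only: Ck_on.simps(2)[of "Suc k"]) simp
qed

lemma Ck_on_local:
  assumes "\<And>x. x \<in> S \<Longrightarrow> \<exists>T. open T \<and> x \<in> T \<and> Ck_on k T f"
  shows "Ck_on k S f"
  using assms
proof (induction k arbitrary: f)
  case 0
  then have "\<forall>x\<in>S. continuous (at x) f"
    using continuous_on_eq_continuous_at by fastforce
  then show ?case
    by (simp add: continuous_at_imp_continuous_on)
next
  case (Suc k)
  have "f differentiable (at x)" if "x \<in> S" for x
    using Suc.prems[OF that] by auto
  moreover have "Ck_on k S (\<lambda>x. frechet_derivative f (at x) v)" for v
    by (rule Suc.IH) (use Suc.prems in \<open>metis Ck_on.simps(2)\<close>)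
  ultimately show ?case by simp
qed

lemma Ck_on_const: "Ck_on k S (\<lambda>x. c)"
  by (induction k arbitrary: c) auto

lemma Ck_on_bounded_linear:
  assumes "bounded_linear f" shows "Ck_on k S f"
proof (cases k)
  case 0
  then show ?thesis using assms by (simp add: linear_continuous_on)
next
  case (Suc l)
  have "frechet_derivative f (at x) = f" for x
    using bounded_linear_imp_has_derivative[OF assms] frechet_derivative_at by metis
  with Suc show ?thesis
    using assms by (auto simp: Ck_on_const bounded_linear_imp_differentiable)
qed

lemma Ck_on_add:
  assumes "open S" "Ck_on k S f" "Ck_on k S g"
  shows "Ck_on k S (\<lambda>x. f x + g x)"
  using assms(2,3)
proof (induction k arbitrary: f g)
  case 0
  then show ?case by (simp add: continuous_on_add)
next
  case (Suc k)
  have *: "((\<lambda>x. f x + g x) has_derivative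
      (\<lambda>v. frechet_derivative f (at x) v + frechet_derivative g (at x) v)) (at x)" if "x \<in> S" for x
    by (intro has_derivative_add Ck_on_has_derivative[OF Suc.prems(1) that] Ck_on_has_derivative[OF Suc.prems(2) that])
  note D = frechet_derivative_at[OF *, symmetric]
  have "Ck_on k S (\<lambda>x. frechet_derivative (\<lambda>x. f x + g x) (at x) v)" for v
  proof (rule Ck_on_cong[OF assms(1)])
    show "Ck_on k S (\<lambda>x. frechet_derivative f (at x) v + frechet_derivative g (at x) v)"
      using Suc.prems by (intro Suc.IH) auto
  qed (simp add: D)
  then show ?case using * by (auto simp: differentiable_def)
qed

text \<open>One induction serves products, scalar multiples and inner products. The Leibniz rule
  leaves one factor undifferentiated in each term; \<open>Ck_on_SucD\<close> lowers its order to
  match the other factor.\<close>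

lemma (in bounded_bilinear) Ck_on_bilinear:
  assumes "open S" "Ck_on k S f" "Ck_on k S g"
  shows "Ck_on k S (\<lambda>x. prod (f x) (g x))"
  using assms(2,3)
proof (induction k arbitrary: f g)
  case 0
  then show ?case by (simp add: continuous_on)
next
  case (Suc k)
  have *: "((\<lambda>x. prod (f x) (g x)) has_derivative
      (\<lambda>v. prod (f x) (frechet_derivative g (at x) v) + prod (frechet_derivative f (at x) v) (g x))) (at x)"
    if "x \<in> S" for x
    by (intro FDERIV Ck_on_has_derivative[OF Suc.prems(1) that] Ck_on_has_derivative[OF Suc.prems(2) that])
  note D = frechet_derivative_at[OF *, symmetric]
  have "Ck_on k S (\<lambda>x. frechet_derivative (\<lambda>x. prod (f x) (g x)) (at x) v)" for v
  proof (rule Ck_on_cong[OF assms(1)])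
    show "Ck_on k S (\<lambda>x. prod (f x) (frechet_derivative g (at x) v) + prod (frechet_derivative f (at x) v) (g x))"
      using Suc.prems Ck_on_SucD[OF Suc.prems(1)] Ck_on_SucD[OF Suc.prems(2)]
      by (intro Ck_on_add[OF assms(1)] Suc.IH) auto
  qed (simp add: D)
  then show ?case using * by (auto simp: differentiable_def)
qed

lemma (in bounded_linear) Ck_on_linear_compose:
  assumes "open S" "Ck_on k S g"
  shows "Ck_on k S (\<lambda>x. f (g x))"
  using assms(2)
proof (induction k arbitrary: g)
  case 0
  then show ?case by (simp add: continuous_on)
next
  case (Suc k)
  have *: "((\<lambda>x. f (g x)) has_derivative (\<lambda>v. f (frechet_derivative g (at x) v))) (at x)" if "x \<in> S" for x
    by (intro has_derivative Ck_on_has_derivative[OF Suc.prems that])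
  note D = frechet_derivative_at[OF *, symmetric]
  have "Ck_on k S (\<lambda>x. frechet_derivative (\<lambda>x. f (g x)) (at x) v)" for v
  proof (rule Ck_on_cong[OF assms(1)])
    show "Ck_on k S (\<lambda>x. f (frechet_derivative g (at x) v))"
      using Suc.prems by (intro Suc.IH) auto
  qed (simp add: D)
  then show ?case using * by (auto simp: differentiable_def)
qed

lemma Ck_on_sum:
  assumes "open S" "\<And>i. i \<in> I \<Longrightarrow> Ck_on k S (f i)"
  shows "Ck_on k S (\<lambda>x. \<Sum>i\<in>I. f i x)"
  using assms(2)
  by (induction I rule: infinite_finite_induct) (simp_all add: Ck_on_const Ck_on_add[OF assms(1)])

text \<open>\<open>Ck_on\<close> controls the derivative only in fixed directions. This expansion
  reduces a direction that varies with the point to finitely many fixed ones.\<close>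

lemma frechet_derivative_Basis_sum:
  fixes f :: "'a::euclidean_space \<Rightarrow> 'b::real_normed_vector"
  assumes "f differentiable (at x)"
  shows "frechet_derivative f (at x) v = (\<Sum>b\<in>Basis. (v \<bullet> b) *\<^sub>R frechet_derivative f (at x) b)"
proof -
  have "frechet_derivative f (at x) v = frechet_derivative f (at x) (\<Sum>b\<in>Basis. (v \<bullet> b) *\<^sub>R b)"
    by (simp add: euclidean_representation)
  then show ?thesis
    using linear_frechet_derivative[OF assms] by (simp only: linear_sum linear_cmul o_def)
qed

lemma Ck_on_compose:
  fixes g :: "'b::euclidean_space \<Rightarrow> 'c::real_normed_vector"
  assumes "open S" "Ck_on k S f" "Ck_on k T g" "f ` S \<subseteq> T"
  shows "Ck_on k S (\<lambda>x. g (f x))"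
  using assms(2-4)
proof (induction k arbitrary: f g)
  case 0
  then show ?case by (auto intro: continuous_on_compose2)
next
  case (Suc k)
  have "((\<lambda>x. g (f x)) has_derivative
      (\<lambda>v. frechet_derivative g (at (f x)) (frechet_derivative f (at x) v))) (at x)" if "x \<in> S" for x
    using Suc.prems that
    by (intro has_derivative_compose[OF Ck_on_has_derivative[OF Suc.prems(1)] Ck_on_has_derivative[OF Suc.prems(2)]]) auto
  note * = this and D = frechet_derivative_at[OF this, symmetric]
  have "Ck_on k S (\<lambda>x. frechet_derivative (\<lambda>x. g (f x)) (at x) v)" for v
  proof (rule Ck_on_cong[OF assms(1)])
    show "Ck_on k S (\<lambda>x. \<Sum>b\<in>Basis. (frechet_derivative f (at x) v \<bullet> b) *\<^sub>R frechet_derivative g (at (f x)) b)"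
    proof (rule Ck_on_sum[OF assms(1)], rule bounded_bilinear.Ck_on_bilinear[OF bounded_bilinear_scaleR assms(1)])
      fix b
      show "Ck_on k S (\<lambda>x. frechet_derivative f (at x) v \<bullet> b)"
        using Suc.prems(1) by (intro bounded_linear.Ck_on_linear_compose[OF bounded_linear_inner_left assms(1)]) simp
      show "Ck_on k S (\<lambda>x. frechet_derivative g (at (f x)) b)"
        by (rule Suc.IH[OF Ck_on_SucD[OF Suc.prems(1)]]) (use Suc.prems in auto)
    qed
    show "(\<Sum>b\<in>Basis. (frechet_derivative f (at x) v \<bullet> b) *\<^sub>R frechet_derivative g (at (f x)) b) =
        frechet_derivative (\<lambda>x. g (f x)) (at x) v" if "x \<in> S" for x
      using Suc.prems that by (subst D) (auto intro!: frechet_derivative_Basis_sum[symmetric])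
  qed
  then show ?case using * by (auto simp: differentiable_def)
qed

text \<open>The induction closes because the derivative of the inverse is a constant times a product
  of inverses.\<close>

lemma Ck_on_inverse: "Ck_on k (- {0}) (inverse :: real \<Rightarrow> real)"
proof (induction k)
  case 0
  show ?case unfolding Ck_on.simps by (rule continuous_on_inverse[OF continuous_on_id]) simp
next
  case (Suc k)
  have *: "((inverse :: real \<Rightarrow> real) has_derivative (\<lambda>v. - (inverse x * v * inverse x))) (at x)" if "x \<noteq> 0" for x
    using that by (rule has_derivative_inverse')
  note D = frechet_derivative_at[OF *, symmetric]
  have "Ck_on k (- {0}) (\<lambda>x::real. frechet_derivative inverse (at x) v)" for v
  proof (rule Ck_on_cong)
    show "Ck_on k (- {0}) (\<lambda>x::real. (- v) * (inverse x * inverse x))"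
      using bounded_bilinear.Ck_on_bilinear[OF bounded_bilinear_mult _ Ck_on_const
          bounded_bilinear.Ck_on_bilinear[OF bounded_bilinear_mult _ Suc Suc]] by blast
  qed (auto simp: D)
  then show ?case using * by (auto simp: differentiable_def)
qed

section \<open>Smooth functions\<close>

lemma smooth_on_cong:
  "open S \<Longrightarrow> (\<And>x. x \<in> S \<Longrightarrow> f x = g x) \<Longrightarrow> smooth_on S f \<Longrightarrow> smooth_on S g"
  unfolding smooth_on_def by (blast intro: Ck_on_cong)

lemma smooth_on_subset: "smooth_on S f \<Longrightarrow> T \<subseteq> S \<Longrightarrow> smooth_on T f"
  unfolding smooth_on_def by (blast intro: Ck_on_subset)

lemma smooth_on_local:
  "(\<And>x. x \<in> S \<Longrightarrow> \<exists>T. open T \<and> x \<in> T \<and> smooth_on T f) \<Longrightarrow> smooth_on S f"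
  unfolding smooth_on_def by (intro allI Ck_on_local) metis

lemma smooth_on_const [intro, simp]: "smooth_on S (\<lambda>x. c)"
  by (simp add: smooth_on_def Ck_on_const)

lemma smooth_on_bounded_linear: "bounded_linear f \<Longrightarrow> smooth_on S f"
  by (simp add: smooth_on_def Ck_on_bounded_linear)

lemma smooth_on_ident [intro, simp]: "smooth_on S (\<lambda>x. x)"
  by (intro smooth_on_bounded_linear bounded_linear_ident)

lemma smooth_on_fst [intro, simp]: "smooth_on S fst" and smooth_on_snd [intro, simp]: "smooth_on S snd"
  by (intro smooth_on_bounded_linear bounded_linear_fst bounded_linear_snd)+

lemma smooth_on_add:
  "open S \<Longrightarrow> smooth_on S f \<Longrightarrow> smooth_on S g \<Longrightarrow> smooth_on S (\<lambda>x. f x + g x)"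
  unfolding smooth_on_def by (blast intro: Ck_on_add)

lemma smooth_on_scaleR:
  "open S \<Longrightarrow> smooth_on S f \<Longrightarrow> smooth_on S g \<Longrightarrow> smooth_on S (\<lambda>x. f x *\<^sub>R g x)"
  unfolding smooth_on_def by (blast intro: bounded_bilinear.Ck_on_bilinear[OF bounded_bilinear_scaleR])

lemma smooth_on_mult:
  fixes f g :: "_ \<Rightarrow> 'a::real_normed_algebra"
  shows "open S \<Longrightarrow> smooth_on S f \<Longrightarrow> smooth_on S g \<Longrightarrow> smooth_on S (\<lambda>x. f x * g x)"
  unfolding smooth_on_def by (blast intro: bounded_bilinear.Ck_on_bilinear[OF bounded_bilinear_mult])

lemma smooth_on_sum:
  "open S \<Longrightarrow> (\<And>i. i \<in> I \<Longrightarrow> smooth_on S (f i)) \<Longrightarrow> smooth_on S (\<lambda>x. \<Sum>i\<in>I. f i x)"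
  unfolding smooth_on_def by (blast intro: Ck_on_sum)

lemma smooth_on_linear_compose:
  "bounded_linear l \<Longrightarrow> open S \<Longrightarrow> smooth_on S f \<Longrightarrow> smooth_on S (\<lambda>x. l (f x))"
  unfolding smooth_on_def by (blast intro: bounded_linear.Ck_on_linear_compose)

lemma smooth_on_minus: "open S \<Longrightarrow> smooth_on S f \<Longrightarrow> smooth_on S (\<lambda>x. - f x)"
  by (rule smooth_on_linear_compose[OF bounded_linear_minus[OF bounded_linear_ident]])

lemma smooth_on_diff:
  "open S \<Longrightarrow> smooth_on S f \<Longrightarrow> smooth_on S g \<Longrightarrow> smooth_on S (\<lambda>x. f x - g x)"
  unfolding diff_conv_add_uminus by (intro smooth_on_add smooth_on_minus)

lemma smooth_on_compose:
  fixes g :: "'b::euclidean_space \<Rightarrow> 'c::real_normed_vector"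
  shows "open S \<Longrightarrow> smooth_on S f \<Longrightarrow> smooth_on T g \<Longrightarrow> f ` S \<subseteq> T \<Longrightarrow> smooth_on S (\<lambda>x. g (f x))"
  unfolding smooth_on_def by (blast intro: Ck_on_compose)

lemma smooth_on_divide:
  fixes f g :: "_ \<Rightarrow> real"
  assumes "open S" "smooth_on S f" "smooth_on S g" "\<And>x. x \<in> S \<Longrightarrow> g x \<noteq> 0"
  shows "smooth_on S (\<lambda>x. f x / g x)"
proof -
  have "smooth_on (- {0::real}) inverse" by (simp add: smooth_on_def Ck_on_inverse)
  then have "smooth_on S (\<lambda>x. inverse (g x))"
    by (rule smooth_on_compose[OF assms(1,3)]) (use assms(4) in auto)
  then show ?thesis
    unfolding divide_inverse by (rule smooth_on_mult[OF assms(1,2)])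
qed

lemma smooth_on_prod:
  fixes f :: "_ \<Rightarrow> _ \<Rightarrow> real"
  assumes "open S" "\<And>i. i \<in> I \<Longrightarrow> smooth_on S (f i)"
  shows "smooth_on S (\<lambda>x. \<Prod>i\<in>I. f i x)"
  using assms(2) by (induction I rule: infinite_finite_induct) (simp_all add: smooth_on_mult[OF assms(1)])

lemma smooth_on_Pair:
  assumes "open S" "smooth_on S f" "smooth_on S g"
  shows "smooth_on S (\<lambda>x. (f x, g x))"
proof -
  have l: "bounded_linear (\<lambda>x. (x, 0))" and r: "bounded_linear (\<lambda>x. (0, x))"
    by (rule bounded_linear_Pair[OF bounded_linear_ident bounded_linear_zero],
        rule bounded_linear_Pair[OF bounded_linear_zero bounded_linear_ident])
  have "smooth_on S (\<lambda>x. (f x, 0) + (0, g x))"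
    using assms(2,3) unfolding smooth_on_def
    using Ck_on_add[OF assms(1) bounded_linear.Ck_on_linear_compose[OF l assms(1)]
        bounded_linear.Ck_on_linear_compose[OF r assms(1)]] by blast
  then show ?thesis by simp
qed

lemma smooth_on_vec_nth: "open S \<Longrightarrow> smooth_on S f \<Longrightarrow> smooth_on S (\<lambda>x. f x $ i)"
  by (rule smooth_on_linear_compose[OF bounded_linear_vec_nth])

lemma smooth_on_vec_lambda:
  fixes f :: "'n::finite \<Rightarrow> _ \<Rightarrow> real"
  assumes "open S" "\<And>i. smooth_on S (f i)"
  shows "smooth_on S (\<lambda>x. \<chi> i. f i x)"
proof -
  have "smooth_on S (\<lambda>x. \<Sum>i\<in>UNIV. f i x *\<^sub>R axis i 1)"
    by (intro smooth_on_sum[OF assms(1)] smooth_on_scaleR[OF assms(1) assms(2)] smooth_on_const)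
  also have "(\<lambda>x. \<Sum>i\<in>UNIV. f i x *\<^sub>R axis i (1::real)) = (\<lambda>x. \<chi> i. f i x)"
    by (auto simp: vec_eq_iff axis_def if_distrib[of "\<lambda>x. _ * x"] cong: if_cong)
  finally show ?thesis .
qed

lemma smooth_on_continuous: "smooth_on S f \<Longrightarrow> continuous_on S f"
  using Ck_on.simps(1) smooth_on_def by blast

lemma smooth_on_derivative:
  "smooth_on S f \<Longrightarrow> smooth_on S (\<lambda>x. frechet_derivative f (at x) v)"
  by (metis Ck_on.simps(2) smooth_on_def)

lemma smooth_on_differentiable: "smooth_on S f \<Longrightarrow> x \<in> S \<Longrightarrow> f differentiable (at x)"
  by (meson Ck_on.simps(2) smooth_on_def)

lemma smooth_on_has_derivative:
  "smooth_on S f \<Longrightarrow> x \<in> S \<Longrightarrow> (f has_derivative frechet_derivative f (at x)) (at x)"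
  using smooth_on_differentiable frechet_derivative_works by blast

lemma smooth_on_has_derivative_compose:
  assumes "smooth_on S g" "(f has_derivative f') (at q)" "f q \<in> S"
  shows "((\<lambda>x. g (f x)) has_derivative (\<lambda>d. frechet_derivative g (at (f q)) (f' d))) (at q)"
  by (rule has_derivative_compose[OF assms(2) smooth_on_has_derivative[OF assms(1,3)]])

lemma smooth_on_linear_derivative: "smooth_on S f \<Longrightarrow> x \<in> S \<Longrightarrow> linear (frechet_derivative f (at x))"
  by (simp add: linear_frechet_derivative smooth_on_differentiable)

section \<open>Second derivatives: moving directions and symmetry\<close>

lemma smooth_on_derivative_joint:
  fixes f :: "'a::euclidean_space \<Rightarrow> 'b::real_normed_vector"
  assumes "open S" "smooth_on S f"
  shows "smooth_on (S \<times> UNIV) (\<lambda>(x, v). frechet_derivative f (at x) v)"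
proof (rule smooth_on_cong)
  note O = open_Times[OF assms(1) open_UNIV]
  show "smooth_on (S \<times> (UNIV :: 'a set)) (\<lambda>p. \<Sum>b\<in>Basis. (snd p \<bullet> b) *\<^sub>R frechet_derivative f (at (fst p)) b)"
  proof (rule smooth_on_sum[OF O], rule smooth_on_scaleR[OF O])
    fix b :: 'a
    show "smooth_on (S \<times> UNIV) (\<lambda>p. snd p \<bullet> b)"
      by (rule smooth_on_linear_compose[OF bounded_linear_inner_left O smooth_on_snd])
    show "smooth_on (S \<times> UNIV) (\<lambda>p. frechet_derivative f (at (fst p)) b)"
      by (rule smooth_on_compose[OF O smooth_on_fst smooth_on_derivative[OF assms(2)]]) auto
  qed
qed (auto intro!: open_Times assms frechet_derivative_Basis_sum[symmetric] smooth_on_differentiable[OF assms(2)])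

text \<open>Product rule for a derivative evaluated at a moving point in a moving direction. Every
  second-order computation along a curve below goes through it, from jets of curves to the
  bracket.\<close>

lemma has_derivative_eval_derivative:
  fixes g :: "'a::euclidean_space \<Rightarrow> 'b::real_normed_vector"
  assumes S: "open S" "smooth_on S g" "f q \<in> S"
    and f: "(f has_derivative f') (at q)" and h: "(h has_derivative h') (at q)"
  shows "((\<lambda>x. frechet_derivative g (at (f x)) (h x)) has_derivative
    (\<lambda>d. frechet_derivative (\<lambda>p. frechet_derivative g (at p) (h q)) (at (f q)) (f' d)
       + frechet_derivative g (at (f q)) (h' d))) (at q)"
proof -
  let ?D = "\<lambda>x. frechet_derivative g (at x)"
  let ?J = "\<lambda>p. \<Sum>b\<in>Basis. (snd p \<bullet> b) *\<^sub>R ?D (fst p) b"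
  have b: "((\<lambda>x. ?D x b) has_derivative frechet_derivative (\<lambda>x. ?D x b) (at x)) (at x)" if "x \<in> S" for x b
    using smooth_on_has_derivative[OF smooth_on_derivative[OF S(2)] that] .
  \<comment> \<open>The second derivative is expanded over the basis in the same way as
    \<open>?J\<close>, so that the sum produced by differentiating \<open>?J\<close> can be folded
    back.\<close>
  have 1: "frechet_derivative (\<lambda>p. ?D p v) (at (f q)) =
      (\<lambda>d. \<Sum>b\<in>Basis. (v \<bullet> b) *\<^sub>R frechet_derivative (\<lambda>x. ?D x b) (at (f q)) d)" for v
  proof (rule frechet_derivative_at[symmetric], rule has_derivative_transform_within_open[OF _ S(1,3)])
    show "((\<lambda>x. \<Sum>b\<in>Basis. (v \<bullet> b) *\<^sub>R ?D x b) has_derivative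
      (\<lambda>d. \<Sum>b\<in>Basis. (v \<bullet> b) *\<^sub>R frechet_derivative (\<lambda>x. ?D x b) (at (f q)) d)) (at (f q))"
      by (intro has_derivative_sum has_derivative_scaleR_right b S)
  qed (simp add: frechet_derivative_Basis_sum[symmetric] smooth_on_differentiable[OF S(2)])
  have J: "(?J has_derivative
     (\<lambda>d. frechet_derivative (\<lambda>p. ?D p (h q)) (at (f q)) (fst d) + ?D (f q) (snd d))) (at (f q, h q))"
  proof -
    have "((\<lambda>p. (snd p \<bullet> b) *\<^sub>R ?D (fst p) b) has_derivative (\<lambda>d. (h q \<bullet> b) *\<^sub>R
      frechet_derivative (\<lambda>x. ?D x b) (at (f q)) (fst d) + (snd d \<bullet> b) *\<^sub>R ?D (f q) b)) (at (f q, h q))" for b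
    proof -
      have "((\<lambda>p. ?D (fst p) b) has_derivative (\<lambda>d. frechet_derivative (\<lambda>x. ?D x b) (at (f q)) (fst d))) (at (f q, h q))"
        using smooth_on_has_derivative_compose[OF smooth_on_derivative[OF S(2)] has_derivative_fst[OF has_derivative_ident], of "(f q, h q)"]
          S(3) by simp
      moreover have "((\<lambda>p. snd p \<bullet> b) has_derivative (\<lambda>d. snd d \<bullet> b)) (at (f q, h q))"
        by (rule has_derivative_inner_left[OF has_derivative_snd[OF has_derivative_ident]])
      ultimately show ?thesis
        using has_derivative_scaleR[of "\<lambda>p. snd p \<bullet> b" "\<lambda>d. snd d \<bullet> b" "(f q, h q)" UNIV "\<lambda>p. ?D (fst p) b"
            "\<lambda>d. frechet_derivative (\<lambda>x. ?D x b) (at (f q)) (fst d)"] by simp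
    qed
    then have "(?J has_derivative (\<lambda>d. \<Sum>b\<in>Basis. (h q \<bullet> b) *\<^sub>R
      frechet_derivative (\<lambda>x. ?D x b) (at (f q)) (fst d) + (snd d \<bullet> b) *\<^sub>R ?D (f q) b)) (at (f q, h q))"
      by (rule has_derivative_sum)
    then show ?thesis
      by (simp add: 1[of "h q"] sum.distrib frechet_derivative_Basis_sum[OF smooth_on_differentiable[OF S(2,3)], symmetric])
  qed
  have "((\<lambda>(x, v). ?D x v) has_derivative
     (\<lambda>d. frechet_derivative (\<lambda>p. ?D p (h q)) (at (f q)) (fst d) + ?D (f q) (snd d))) (at (f q, h q))"
    by (rule has_derivative_transform_within_open[OF J open_Times[OF S(1) open_UNIV]])
       (auto simp: S frechet_derivative_Basis_sum[symmetric] smooth_on_differentiable[OF S(2)])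
  from has_derivative_compose[OF has_derivative_Pair[OF f h] this] show ?thesis by simp
qed

text \<open>The second difference of \<open>f\<close> over a small parallelogram is symmetric in
  \<open>u\<close> and \<open>v\<close>. Two applications of the mean value theorem turn it into h^2
  times a mixed derivative at a nearby point, in either order, and continuity carries the equality
  to \<open>x\<close>.\<close>

lemma second_derivative_symmetric_real:
  fixes f :: "'a::real_normed_vector \<Rightarrow> real"
  assumes S: "open S" "smooth_on S f" "x \<in> S"
  shows "frechet_derivative (\<lambda>p. frechet_derivative f (at p) u) (at x) v =
    frechet_derivative (\<lambda>p. frechet_derivative f (at p) v) (at x) u"
proof -
  let ?D = "\<lambda>u x. frechet_derivative f (at x) u"
  let ?DD = "\<lambda>u v x. frechet_derivative (?D u) (at x) v"
  obtain e where e: "e > 0" "ball x e \<subseteq> S" using S openE by blast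
  \<comment> \<open>With both coefficients below \<open>c\<close> in absolute value the displacement
    is shorter than \<open>e\<close>; the summand 1 keeps the denominator positive when both vectors
    vanish.\<close>
  define c where "c = e / (norm u + norm v + 1)"
  have c: "c > 0" using e(1) by (auto simp: c_def intro!: divide_pos_pos add_nonneg_pos)
  have in_S: "x + s *\<^sub>R u + t *\<^sub>R v \<in> S" if "\<bar>s\<bar> < c" "\<bar>t\<bar> < c" for s t
  proof -
    have "norm (s *\<^sub>R u + t *\<^sub>R v) \<le> \<bar>s\<bar> * norm u + \<bar>t\<bar> * norm v"
      using norm_triangle_ineq[of "s *\<^sub>R u" "t *\<^sub>R v"] by simp
    also have "\<dots> \<le> c * norm u + c * norm v"
      using that by (intro add_mono mult_right_mono) auto
    also have "\<dots> < c * (norm u + norm v + 1)" using c by (simp add: algebra_simps)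
    also have "\<dots> = e"
      using add_nonneg_pos[OF add_nonneg_nonneg[OF norm_ge_zero norm_ge_zero] zero_less_one, of u v]
      by (simp add: c_def)
    finally have "norm (s *\<^sub>R u + t *\<^sub>R v) < e" .
    moreover have "dist x (x + s *\<^sub>R u + t *\<^sub>R v) = norm (s *\<^sub>R u + t *\<^sub>R v)"
      unfolding dist_norm by (subst norm_minus_commute) (simp add: add.assoc)
    ultimately show ?thesis using e(2) by auto
  qed
  have key: "\<exists>s t. 0 < s \<and> s < h \<and> 0 < t \<and> t < h \<and>
     f (x + h *\<^sub>R u + h *\<^sub>R v) - f (x + h *\<^sub>R u) - f (x + h *\<^sub>R v) + f x = h * h * ?DD u v (x + s *\<^sub>R u + t *\<^sub>R v)"
    if h: "0 < h" "h < c" and in_S: "\<And>s t. \<bar>s\<bar> < c \<Longrightarrow> \<bar>t\<bar> < c \<Longrightarrow> x + s *\<^sub>R u + t *\<^sub>R v \<in> S" for h u v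
  proof -
    have d: "((\<lambda>s. f (x + s *\<^sub>R u + t *\<^sub>R v)) has_real_derivative ?D u (x + s *\<^sub>R u + t *\<^sub>R v)) (at s)"
      if "\<bar>s\<bar> < c" "\<bar>t\<bar> < c" for s t
    proof -
      have "((\<lambda>s. f (x + s *\<^sub>R u + t *\<^sub>R v)) has_derivative (\<lambda>r. ?D (r *\<^sub>R u) (x + s *\<^sub>R u + t *\<^sub>R v))) (at s)"
        by (rule smooth_on_has_derivative_compose[OF S(2)])
           (auto intro!: derivative_eq_intros in_S[OF that])
      moreover have "(\<lambda>r. ?D (r *\<^sub>R u) (x + s *\<^sub>R u + t *\<^sub>R v)) = (*) (?D u (x + s *\<^sub>R u + t *\<^sub>R v))"
        using linear_cmul[OF smooth_on_linear_derivative[OF S(2) in_S[OF that]]]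
        by (auto simp: mult.commute)
      ultimately show ?thesis by (simp only: has_field_derivative_def)
    qed
    have d2: "((\<lambda>t. ?D u (x + s *\<^sub>R u + t *\<^sub>R v)) has_real_derivative ?DD u v (x + s *\<^sub>R u + t *\<^sub>R v)) (at t)"
      if "\<bar>s\<bar> < c" "\<bar>t\<bar> < c" for s t
    proof -
      note S' = smooth_on_derivative[OF S(2)]
      have "((\<lambda>t. ?D u (x + s *\<^sub>R u + t *\<^sub>R v)) has_derivative (\<lambda>r. ?DD u (r *\<^sub>R v) (x + s *\<^sub>R u + t *\<^sub>R v))) (at t)"
        by (rule smooth_on_has_derivative_compose[OF S'])
           (auto intro!: derivative_eq_intros in_S[OF that])
      moreover have "(\<lambda>r. ?DD u (r *\<^sub>R v) (x + s *\<^sub>R u + t *\<^sub>R v)) = (*) (?DD u v (x + s *\<^sub>R u + t *\<^sub>R v))"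
        using linear_cmul[OF smooth_on_linear_derivative[OF S' in_S[OF that]]]
        by (auto simp: mult.commute)
      ultimately show ?thesis by (simp only: has_field_derivative_def)
    qed
    obtain s where s: "0 < s" "s < h"
      "(f (x + h *\<^sub>R u + h *\<^sub>R v) - f (x + h *\<^sub>R u + 0 *\<^sub>R v)) - (f (x + 0 *\<^sub>R u + h *\<^sub>R v) - f (x + 0 *\<^sub>R u + 0 *\<^sub>R v))
         = (h - 0) * (?D u (x + s *\<^sub>R u + h *\<^sub>R v) - ?D u (x + s *\<^sub>R u + 0 *\<^sub>R v))"
    proof -
      have "((\<lambda>s. f (x + s *\<^sub>R u + h *\<^sub>R v) - f (x + s *\<^sub>R u + 0 *\<^sub>R v)) has_real_derivative
         (?D u (x + s *\<^sub>R u + h *\<^sub>R v) - ?D u (x + s *\<^sub>R u + 0 *\<^sub>R v))) (at s)" if "0 \<le> s" "s \<le> h" for s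
        by (intro DERIV_diff d) (use that h in auto)
      from MVT2[OF h(1) this] show thesis using that by auto
    qed
    obtain t where t: "0 < t" "t < h"
      "?D u (x + s *\<^sub>R u + h *\<^sub>R v) - ?D u (x + s *\<^sub>R u + 0 *\<^sub>R v) = (h - 0) * ?DD u v (x + s *\<^sub>R u + t *\<^sub>R v)"
    proof -
      have "((\<lambda>t. ?D u (x + s *\<^sub>R u + t *\<^sub>R v)) has_real_derivative
         ?DD u v (x + s *\<^sub>R u + t *\<^sub>R v)) (at t)" if "0 \<le> t" "t \<le> h" for t
        by (intro d2) (use that h s in auto)
      from MVT2[OF h(1) this] show thesis using that by auto
    qed
    show ?thesis using s t by (intro exI[of _ s] exI[of _ t]) (simp add: algebra_simps)
  qed
  have cont: "continuous (at x) (?DD u v)" for u v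
    using smooth_on_continuous[OF smooth_on_derivative[OF smooth_on_derivative[OF S(2)]]] S
    by (simp add: continuous_on_eq_continuous_at)
  show ?thesis
  proof (rule ccontr)
    assume neq: "?DD u v x \<noteq> ?DD v u x"
    define d where "d = \<bar>?DD u v x - ?DD v u x\<bar> / 2"
    have "d > 0" using neq by (simp add: d_def)
    obtain r1 where r1: "r1 > 0" "\<And>y. dist y x < r1 \<Longrightarrow> dist (?DD u v y) (?DD u v x) < d"
      using cont[of u v] \<open>d > 0\<close> unfolding continuous_at_eps_delta by metis
    obtain r2 where r2: "r2 > 0" "\<And>y. dist y x < r2 \<Longrightarrow> dist (?DD v u y) (?DD v u x) < d"
      using cont[of v u] \<open>d > 0\<close> unfolding continuous_at_eps_delta by metis
    \<comment> \<open>Small enough for the parallelogram to stay in \<open>S\<close> and inside both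
      continuity radii.\<close>
    define h where "h = min (c / 2) (min r1 r2 / (norm u + norm v + 1))"
    have np: "norm u + norm v + 1 > 0" by (simp add: add_nonneg_pos)
    have h: "0 < h" "h < c" using c r1 r2 np by (auto simp: h_def)
    have hr: "h * (norm u + norm v + 1) \<le> min r1 r2"
    proof -
      have "h \<le> min r1 r2 / (norm u + norm v + 1)" by (simp add: h_def)
      then show ?thesis using np by (simp add: pos_le_divide_eq)
    qed
    have near: "dist (x + s *\<^sub>R u + t *\<^sub>R v) x < min r1 r2" if "0 < s" "s < h" "0 < t" "t < h" for s t
    proof -
      have "norm (s *\<^sub>R u + t *\<^sub>R v) \<le> s * norm u + t * norm v"
        using norm_triangle_ineq[of "s *\<^sub>R u" "t *\<^sub>R v"] that by simp
      also have "\<dots> \<le> h * norm u + h * norm v"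
        using that by (intro add_mono mult_right_mono) auto
      also have "\<dots> < h * (norm u + norm v + 1)" using h by (simp add: algebra_simps)
      finally show ?thesis using hr by (simp add: dist_norm add.assoc)
    qed
    obtain s t where 1: "0 < s" "s < h" "0 < t" "t < h"
      "f (x + h *\<^sub>R u + h *\<^sub>R v) - f (x + h *\<^sub>R u) - f (x + h *\<^sub>R v) + f x = h * h * ?DD u v (x + s *\<^sub>R u + t *\<^sub>R v)"
      using key[OF h in_S] by blast
    obtain s' t' where 2: "0 < s'" "s' < h" "0 < t'" "t' < h"
      "f (x + h *\<^sub>R v + h *\<^sub>R u) - f (x + h *\<^sub>R v) - f (x + h *\<^sub>R u) + f x = h * h * ?DD v u (x + s' *\<^sub>R v + t' *\<^sub>R u)"
    proof -
      have "x + s *\<^sub>R v + t *\<^sub>R u \<in> S" if "\<bar>s\<bar> < c" "\<bar>t\<bar> < c" for s t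
        using in_S[OF that(2,1)] by (simp add: add.commute add.left_commute)
      from key[OF h this] show thesis using that by blast
    qed
    have "f (x + h *\<^sub>R u + h *\<^sub>R v) = f (x + h *\<^sub>R v + h *\<^sub>R u)" by (simp add: algebra_simps)
    then have "?DD u v (x + s *\<^sub>R u + t *\<^sub>R v) = ?DD v u (x + s' *\<^sub>R v + t' *\<^sub>R u)"
      using 1(5) 2(5) h by (simp add: diff_diff_eq add.commute)
    moreover have "x + s' *\<^sub>R v + t' *\<^sub>R u = x + t' *\<^sub>R u + s' *\<^sub>R v" by simp
    ultimately have eq: "?DD u v (x + s *\<^sub>R u + t *\<^sub>R v) = ?DD v u (x + t' *\<^sub>R u + s' *\<^sub>R v)" by simp
    have "dist (?DD u v (x + s *\<^sub>R u + t *\<^sub>R v)) (?DD u v x) < d"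
      by (rule r1(2)) (use near[OF 1(1-4)] in simp)
    moreover have "dist (?DD v u (x + t' *\<^sub>R u + s' *\<^sub>R v)) (?DD v u x) < d"
      by (rule r2(2)) (use near[OF 2(3,4,1,2)] in simp)
    ultimately have "\<bar>?DD u v x - ?DD v u x\<bar> < d + d"
      unfolding eq dist_real_def by linarith
    then show False by (simp add: d_def)
  qed
qed

lemma second_derivative_symmetric:
  fixes f :: "'a::real_normed_vector \<Rightarrow> 'b::euclidean_space"
  assumes S: "open S" "smooth_on S f" "x \<in> S"
  shows "frechet_derivative (\<lambda>p. frechet_derivative f (at p) u) (at x) v =
    frechet_derivative (\<lambda>p. frechet_derivative f (at p) v) (at x) u"
proof (rule euclidean_eqI)
  fix b :: 'b
  have f: "smooth_on S (\<lambda>x. f x \<bullet> b)"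
    by (rule smooth_on_linear_compose[OF bounded_linear_inner_left S(1,2)])
  have 1: "frechet_derivative (\<lambda>x. g x \<bullet> b) (at y) u = frechet_derivative g (at y) u \<bullet> b"
    if "smooth_on S g" "y \<in> S" for g :: "'a \<Rightarrow> 'b" and y u
    using frechet_derivative_at[OF has_derivative_inner_left[OF smooth_on_has_derivative[OF that]]]
    by metis
  have 2: "frechet_derivative (\<lambda>p. frechet_derivative (\<lambda>x. f x \<bullet> b) (at p) u) (at x) v
      = frechet_derivative (\<lambda>p. frechet_derivative f (at p) u \<bullet> b) (at x) v" for u v
    by (rule frechet_derivative_transform_within_open[THEN fun_cong, OF _ S(1,3)])
       (auto intro!: smooth_on_differentiable[OF smooth_on_derivative[OF f] S(3)] 1 S)
  show "frechet_derivative (\<lambda>p. frechet_derivative f (at p) u) (at x) v \<bullet> b =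
      frechet_derivative (\<lambda>p. frechet_derivative f (at p) v) (at x) u \<bullet> b"
    using second_derivative_symmetric_real[OF S(1) f S(3)] S
    by (simp add: 2 1[OF smooth_on_derivative])
qed

text \<open>Compactness of a closed ball bounds the finitely many directional derivatives along the
  basis; their sum bounds the operator norm, and the mean value inequality gives the Lipschitz
  constant.\<close>

lemma smooth_on_locally_Lipschitz:
  fixes f :: "'a::euclidean_space \<Rightarrow> 'b::real_normed_vector"
  assumes S: "open S" "smooth_on S f" "x0 \<in> S"
  obtains r L C where "r > 0" "cball x0 r \<subseteq> S" "L \<ge> 0" "C > 0"
    "\<And>x y. x \<in> cball x0 r \<Longrightarrow> y \<in> cball x0 r \<Longrightarrow> norm (f x - f y) \<le> L * norm (x - y)"
    "\<And>x. x \<in> cball x0 r \<Longrightarrow> norm (f x) \<le> C"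
proof -
  obtain r where r: "r > 0" "cball x0 r \<subseteq> S" using S open_contains_cball by metis
  have bnd: "\<exists>M>0. \<forall>x\<in>cball x0 r. norm (g x) \<le> M" if "smooth_on S g" for g :: "'a \<Rightarrow> 'b"
  proof -
    have "compact (g ` cball x0 r)"
      using continuous_on_subset[OF smooth_on_continuous[OF that] r(2)] by (intro compact_continuous_image) auto
    then show ?thesis using compact_imp_bounded bounded_pos by (metis imageI)
  qed
  obtain M where M: "\<And>b x. x \<in> cball x0 r \<Longrightarrow> norm (frechet_derivative f (at x) b) \<le> M b" "\<And>b. M b > 0"
    using bnd[OF smooth_on_derivative[OF S(2)]] by metis
  obtain C where C: "C > 0" "\<And>x. x \<in> cball x0 r \<Longrightarrow> norm (f x) \<le> C"
    using bnd[OF S(2)] by metis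
  define L where "L = (\<Sum>b\<in>(Basis::'a set). M b)"
  have "onorm (frechet_derivative f (at x)) \<le> L" if "x \<in> cball x0 r" for x
  proof (rule onorm_le)
    fix v
    have "norm (frechet_derivative f (at x) v) \<le> (\<Sum>b\<in>Basis. norm ((v \<bullet> b) *\<^sub>R frechet_derivative f (at x) b))"
      using r(2) that by (subst frechet_derivative_Basis_sum) (auto intro!: norm_sum smooth_on_differentiable[OF S(2)] simp del: norm_scaleR)
    also have "\<dots> \<le> (\<Sum>b\<in>Basis. norm v * M b)"
      using M(1)[OF that] less_imp_le[OF M(2)]
      by (intro sum_mono) (auto intro!: mult_mono simp: Basis_le_norm)
    finally show "norm (frechet_derivative f (at x) v) \<le> L * norm v"
      by (simp add: L_def sum_distrib_left mult.commute)
  qed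
  then have "norm (f x - f y) \<le> L * norm (x - y)" if "x \<in> cball x0 r" "y \<in> cball x0 r" for x y
    using r(2) that
    by (intro differentiable_bound[of "cball x0 r" f "\<lambda>x. frechet_derivative f (at x)"])
       (auto intro!: has_derivative_at_withinI smooth_on_has_derivative[OF S(2)])
  moreover have "L \<ge> 0" unfolding L_def by (intro sum_nonneg less_imp_le M(2))
  ultimately show thesis using r C that by blast
qed

section \<open>Ordinary differential equations\<close>

text \<open>Picard-Lindelof: the integral operator is a contraction on the bounded continuous
  functions with values in a closed ball, and its fixed point is the solution.\<close>

lemma ode_solution_exists:
  fixes f :: "'a::euclidean_space \<Rightarrow> 'a"
  assumes "open S" "smooth_on S f" "x0 \<in> S"
  obtains e x where "e > 0" "x 0 = x0"
    "\<And>t. \<bar>t\<bar> < e \<Longrightarrow> x t \<in> S" "\<And>t. \<bar>t\<bar> < e \<Longrightarrow> (x has_vector_derivative f (x t)) (at t)"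
proof -
  obtain r L C where r: "r > 0" "cball x0 r \<subseteq> S" and L: "L \<ge> 0" and C: "C > 0"
    and lip: "\<And>x y. x \<in> cball x0 r \<Longrightarrow> y \<in> cball x0 r \<Longrightarrow> norm (f x - f y) \<le> L * norm (x - y)"
    and bnd: "\<And>x. x \<in> cball x0 r \<Longrightarrow> norm (f x) \<le> C"
    using smooth_on_locally_Lipschitz[OF assms] by metis
  \<comment> \<open>The bound \<open>r / C\<close> keeps the iterates in the ball, and
    \<open>1 / (2 * (L + 1))\<close> makes the contraction factor at most one half; adding 1 to
    \<open>L\<close> covers \<open>L = 0\<close>.\<close>
  define d where "d = min (r / C) (1 / (2 * (L + 1)))"
  have d: "d > 0" using r(1) L C by (simp add: d_def)
  have "d \<le> r / C" "d \<le> 1 / (2 * (L + 1))" by (simp_all add: d_def)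
  then have dC: "C * d \<le> r" and "2 * (L + 1) * d \<le> 1"
    using C L by (simp_all add: field_simps)
  then have dL: "L * d \<le> 1 / 2" using d L by (simp add: algebra_simps)
  \<comment> \<open>Clamping time extends functions from the interval to the whole line, so that the
    iteration can take place in the complete space of bounded continuous functions.\<close>
  define cl where "cl t = max (- d) (min d t)" for t
  have cl: "cl t \<in> {-d..d}" for t using d by (auto simp: cl_def)
  have contf: "continuous_on (cball x0 r) f"
    using continuous_on_subset[OF smooth_on_continuous[OF assms(2)] r(2)] .
  \<comment> \<open>Integrating from \<open>-d\<close> and subtracting the value at 0 treats
    positive and negative times uniformly and gives \<open>I y 0 = 0\<close>.\<close>
  define I where "I y t = integral {-d..t} (\<lambda>s. f (y s)) - integral {-d..0} (\<lambda>s. f (y s))" for y t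
  have I_deriv: "(I y has_vector_derivative f (y t)) (at t within {-d..d})"
    if y: "continuous_on UNIV y" "\<And>s. y s \<in> cball x0 r" and t: "t \<in> {-d..d}" for y t
  proof -
    have "continuous_on {-d..d} (\<lambda>s. f (y s))"
      by (rule continuous_on_compose2[OF contf continuous_on_subset[OF y(1)]]) (use y in auto)
    from has_vector_derivative_diff[OF integral_has_vector_derivative[OF this t] has_vector_derivative_const]
    show ?thesis by (simp add: I_def[abs_def])
  qed
  have I0: "I y 0 = 0" for y by (simp add: I_def)
  have I_bound: "norm (I y t) \<le> C * \<bar>t\<bar>"
    if y: "continuous_on UNIV y" "\<And>s. y s \<in> cball x0 r" and t: "t \<in> {-d..d}" for y t
  proof -
    have "norm (I y t - I y 0) \<le> C * norm (t - 0)"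
    proof (rule differentiable_bound[of "{-d..d}"])
      show "(I y has_derivative (\<lambda>u. u *\<^sub>R f (y s))) (at s within {-d..d})" if "s \<in> {-d..d}" for s
        using I_deriv[OF y that] by (simp add: has_vector_derivative_def)
      show "onorm (\<lambda>u. u *\<^sub>R f (y s)) \<le> C" for s
        by (rule onorm_le) (use mult_right_mono[OF bnd[OF y(2)] abs_ge_zero] in \<open>simp add: mult.commute\<close>)
    qed (use t d in auto)
    then show ?thesis by (simp add: I0)
  qed
  have I_lip: "norm (I y t - I z t) \<le> (L * M) * \<bar>t\<bar>"
    if y: "continuous_on UNIV y" "\<And>s. y s \<in> cball x0 r" and z: "continuous_on UNIV z" "\<And>s. z s \<in> cball x0 r"
      and M: "\<And>s. norm (y s - z s) \<le> M" and t: "t \<in> {-d..d}" for y z t M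
  proof -
    have "norm ((\<lambda>s. I y s - I z s) t - (\<lambda>s. I y s - I z s) 0) \<le> (L * M) * norm (t - 0)"
    proof (rule differentiable_bound[of "{-d..d}"])
      show "((\<lambda>s. I y s - I z s) has_derivative (\<lambda>u. u *\<^sub>R (f (y s) - f (z s)))) (at s within {-d..d})"
        if "s \<in> {-d..d}" for s
        using has_vector_derivative_diff[OF I_deriv[OF y that] I_deriv[OF z that]]
        by (simp add: has_vector_derivative_def)
      show "onorm (\<lambda>u. u *\<^sub>R (f (y s) - f (z s))) \<le> L * M" for s
      proof (rule onorm_le)
        fix u :: real
        have "norm (f (y s) - f (z s)) \<le> L * M"
          using lip[OF y(2) z(2), of s s] mult_left_mono[OF M L, of s] by linarith
        then show "norm (u *\<^sub>R (f (y s) - f (z s))) \<le> L * M * norm u"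
          using mult_left_mono[OF _ abs_ge_zero] by (simp add: mult.commute)
      qed
    qed (use t d in auto)
    then show ?thesis by (simp add: I0)
  qed
  define X where "X = PiC UNIV (\<lambda>_::real. cball x0 r)"
  define T where "T y = Bcontfun (\<lambda>t. x0 + I (apply_bcontfun y) (cl t))" for y
  have yX: "continuous_on UNIV (apply_bcontfun y)" "apply_bcontfun y s \<in> cball x0 r" if "y \<in> X" for y s
    using that by (auto simp: X_def dest!: mem_PiCD)
  have ball: "x0 + I (apply_bcontfun y) (cl t) \<in> cball x0 r" if "y \<in> X" for y t
  proof -
    have "norm (I (apply_bcontfun y) (cl t)) \<le> C * \<bar>cl t\<bar>" by (rule I_bound[OF yX[OF that] cl])
    also have "\<dots> \<le> C * d" using cl[of t] C by (intro mult_left_mono) (auto simp: abs_le_iff)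
    also have "\<dots> \<le> r" by (rule dC)
    finally show ?thesis by (simp add: dist_norm)
  qed
  have T: "apply_bcontfun (T y) = (\<lambda>t. x0 + I (apply_bcontfun y) (cl t))" if "y \<in> X" for y
    unfolding T_def
  proof (rule Bcontfun_inverse, rule bcontfun_normI)
    have "continuous_on {-d..d} (I (apply_bcontfun y))"
      by (rule continuous_on_vector_derivative[OF I_deriv[OF yX[OF that]]])
    moreover have "continuous_on UNIV cl" unfolding cl_def by (intro continuous_intros)
    ultimately have "continuous_on UNIV (\<lambda>t. I (apply_bcontfun y) (cl t))"
      by (rule continuous_on_compose2) (use cl in auto)
    then show "continuous_on UNIV (\<lambda>t. x0 + I (apply_bcontfun y) (cl t))"
      by (rule continuous_on_add[OF continuous_on_const])
    show "norm (x0 + I (apply_bcontfun y) (cl t)) \<le> norm x0 + r" for t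
    proof -
      have "norm (I (apply_bcontfun y) (cl t)) \<le> r" using ball[OF that, of t] by (simp add: dist_norm)
      then show ?thesis using norm_triangle_ineq[of x0 "I (apply_bcontfun y) (cl t)"] by linarith
    qed
  qed
  have "\<exists>!x\<in>X. T x = x"
  proof (rule Banach_fix)
    show "complete X" unfolding X_def unfolding complete_eq_closed by (intro closed_PiC) auto
    have "const_bcontfun x0 \<in> X" using r(1) by (auto simp: X_def mem_PiC_iff)
    then show "X \<noteq> {}" by blast
    show "T ` X \<subseteq> X"
    proof
      fix z assume "z \<in> T ` X"
      then obtain y where "y \<in> X" "z = T y" by blast
      then show "z \<in> X" using ball[OF \<open>y \<in> X\<close>] by (auto simp: X_def mem_PiC_iff T)
    qed
    show "dist (T y) (T z) \<le> 1 / 2 * dist y z" if "y \<in> X" "z \<in> X" for y z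
    proof (rule dist_bound)
      fix t
      have "norm (I (apply_bcontfun y) (cl t) - I (apply_bcontfun z) (cl t)) \<le> (L * dist y z) * \<bar>cl t\<bar>"
        using yX[OF that(1)] yX[OF that(2)] dist_bounded[of y _ z]
        by (intro I_lip cl) (auto simp: dist_norm)
      also have "\<dots> \<le> (L * dist y z) * d"
        using cl[of t] L by (intro mult_left_mono) (auto simp: abs_le_iff)
      also have "\<dots> = (L * d) * dist y z" by simp
      also have "\<dots> \<le> 1 / 2 * dist y z" by (intro mult_right_mono dL) auto
      finally show "dist (apply_bcontfun (T y) t) (apply_bcontfun (T z) t) \<le> 1 / 2 * dist y z"
        by (simp add: T that dist_norm)
    qed
  qed auto
  then obtain x where x: "x \<in> X" "T x = x" by blast
  have x_eq: "apply_bcontfun x t = x0 + I (apply_bcontfun x) (cl t)" for t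
    using T[OF x(1)] x(2) by metis
  show thesis
  proof (rule that[of d "apply_bcontfun x"])
    show "apply_bcontfun x 0 = x0" using x_eq[of 0] d by (simp add: cl_def I0)
    show "apply_bcontfun x t \<in> S" for t using yX(2)[OF x(1)] r(2) by blast
    show "(apply_bcontfun x has_vector_derivative f (apply_bcontfun x t)) (at t)" if "\<bar>t\<bar> < d" for t
    proof -
      have t: "t \<in> {-d<..<d}" using that by auto
      have "(I (apply_bcontfun x) has_vector_derivative f (apply_bcontfun x t)) (at t within {-d<..<d})"
        by (rule has_vector_derivative_within_subset[OF I_deriv[OF yX[OF x(1)]]]) (use t in auto)
      then have "(I (apply_bcontfun x) has_vector_derivative f (apply_bcontfun x t)) (at t)"
        using has_vector_derivative_within_open[OF t open_greaterThanLessThan] by metis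
      from has_vector_derivative_add[OF has_vector_derivative_const[of x0] this]
      have "((\<lambda>t. x0 + I (apply_bcontfun x) t) has_vector_derivative f (apply_bcontfun x t)) (at t)"
        by simp
      then show ?thesis
        by (rule has_vector_derivative_transform_within_open[OF _ _ t])
           (auto simp: x_eq cl_def)
    qed
  qed (rule d)
qed

text \<open>The coincidence set is closed and open in the connected set \<open>I\<close>. For
  openness, the maximal distance \<open>M\<close> of the two solutions on a short interval satisfies
  \<open>M <= M / 2\<close>.\<close>

lemma ode_solution_unique:
  fixes f :: "'a::euclidean_space \<Rightarrow> 'a"
  assumes S: "open S" "smooth_on S f"
    and I: "open I" "connected I" "\<tau> \<in> I"
    and x: "\<And>t. t \<in> I \<Longrightarrow> x t \<in> S" "\<And>t. t \<in> I \<Longrightarrow> (x has_vector_derivative f (x t)) (at t)"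
    and y: "\<And>t. t \<in> I \<Longrightarrow> y t \<in> S" "\<And>t. t \<in> I \<Longrightarrow> (y has_vector_derivative f (y t)) (at t)"
    and eq: "x \<tau> = y \<tau>" and t: "t \<in> I"
  shows "x t = y t"
proof -
  have cx: "continuous_on I x" and cy: "continuous_on I y"
    using x(2) y(2) by (auto intro!: continuous_at_imp_continuous_on has_vector_derivative_continuous)
  define Z where "Z = {t \<in> I. x t - y t = 0}"
  have clZ: "closedin (top_of_set I) Z"
    unfolding Z_def by (intro continuous_closedin_preimage_constant continuous_on_diff cx cy)
  have opZ: "openin (top_of_set I) Z"
    unfolding openin_contains_ball
  proof (intro conjI ballI)
    fix s assume s: "s \<in> Z"
    then have sI: "s \<in> I" and xs: "x s = y s" by (auto simp: Z_def)
    obtain r L C where r: "r > 0" "cball (x s) r \<subseteq> S" and L: "L \<ge> 0"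
      and lip: "\<And>p q. p \<in> cball (x s) r \<Longrightarrow> q \<in> cball (x s) r \<Longrightarrow> norm (f p - f q) \<le> L * norm (p - q)"
      using smooth_on_locally_Lipschitz[OF S x(1)[OF sI]] by metis
    have "isCont x s" "isCont y s"
      using cx cy sI I(1) by (auto simp: continuous_on_eq_continuous_at)
    then obtain d1 d2 where d1: "d1 > 0" "\<And>u. dist u s < d1 \<Longrightarrow> dist (x u) (x s) < r"
      and d2: "d2 > 0" "\<And>u. dist u s < d2 \<Longrightarrow> dist (y u) (y s) < r"
      using r(1) unfolding continuous_at_eps_delta by metis
    obtain d3 where d3: "d3 > 0" "ball s d3 \<subseteq> I" using I(1) sI openE by blast
    \<comment> \<open>Within this radius both solutions stay in the Lipschitz ball and
      \<open>L * d\<close> is at most one half; the outer division by 2 makes the comparisons with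
      \<open>d1\<close>, \<open>d2\<close> and \<open>d3\<close> strict.\<close>
    define d where "d = min (min d1 d2) (min d3 (1 / (L + 1))) / 2"
    have d: "d > 0" "d < d1" "d < d2" "d < d3" using d1 d2 d3 L by (auto simp: d_def min_def)
    have "d * (L + 1) \<le> 1 / 2"
    proof -
      have "min (min d1 d2) (min d3 (1 / (L + 1))) \<le> 1 / (L + 1)" by simp
      then have "d \<le> (1 / (L + 1)) / 2" unfolding d_def by (rule divide_right_mono) simp
      then show ?thesis using L by (simp add: field_simps)
    qed
    then have dL: "L * d \<le> 1 / 2" using d(1) by (simp add: algebra_simps)
    have sub: "cball s d \<subseteq> I" using d d3 by (force simp: dist_commute)
    have ball: "x u \<in> cball (x s) r" "y u \<in> cball (x s) r" if "u \<in> cball s d" for u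
      using d1(2)[of u] d2(2)[of u] that d xs by (auto simp: dist_commute less_imp_le)
    have "continuous_on (cball s d) (\<lambda>u. norm (x u - y u))"
      by (intro continuous_intros continuous_on_subset[OF cx sub] continuous_on_subset[OF cy sub])
    then obtain m where m: "m \<in> cball s d" "\<And>u. u \<in> cball s d \<Longrightarrow> norm (x u - y u) \<le> norm (x m - y m)"
      using continuous_attains_sup[of "cball s d" "\<lambda>u. norm (x u - y u)"] d(1) by auto
    define M where "M = norm (x m - y m)"
    have "norm ((\<lambda>u. x u - y u) m - (\<lambda>u. x u - y u) s) \<le> (L * M) * norm (m - s)"
    proof (rule differentiable_bound[of "cball s d"])
      show "((\<lambda>u. x u - y u) has_derivative (\<lambda>h. h *\<^sub>R (f (x u) - f (y u)))) (at u within cball s d)"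
        if "u \<in> cball s d" for u
      proof -
        have "u \<in> I" using sub that by blast
        from has_vector_derivative_diff[OF x(2)[OF this] y(2)[OF this]]
        show ?thesis unfolding has_vector_derivative_def by (rule has_derivative_at_withinI)
      qed
      show "onorm (\<lambda>h. h *\<^sub>R (f (x u) - f (y u))) \<le> L * M" if "u \<in> cball s d" for u
      proof (rule onorm_le)
        fix h :: real
        have "norm (f (x u) - f (y u)) \<le> L * M"
          using lip[OF ball[OF that]] mult_left_mono[OF m(2)[OF that] L] by (simp add: M_def)
        then show "norm (h *\<^sub>R (f (x u) - f (y u))) \<le> L * M * norm h"
          using mult_left_mono[OF _ abs_ge_zero] by (simp add: mult.commute)
      qed
    qed (use m d in auto)
    also have "\<dots> \<le> (L * M) * d"
      using m(1) L by (intro mult_left_mono) (auto simp: dist_norm norm_minus_commute M_def)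
    also have "\<dots> = (L * d) * M" by simp
    also have "\<dots> \<le> 1 / 2 * M" by (intro mult_right_mono dL) (auto simp: M_def)
    finally have "M \<le> 0" by (simp add: xs M_def)
    then have "x u - y u = 0" if "u \<in> cball s d" for u
      using m(2)[OF that] by (simp add: M_def)
    then show "\<exists>e>0. ball s e \<inter> I \<subseteq> Z"
      using d(1) by (intro exI[of _ d]) (auto simp: Z_def)
  qed (auto simp: Z_def)
  have "\<tau> \<in> Z" using I(3) eq by (simp add: Z_def)
  then have "Z = I" using I(2) opZ clZ by (metis connected_clopen empty_iff)
  then show ?thesis using t by (auto simp: Z_def)
qed

text \<open>Bootstrapping: if \<open>x\<close> is of class C^k, so is \<open>f (x t)\<close>, which
  is the derivative of \<open>x\<close>.\<close>

lemma ode_solution_smooth: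
  fixes f :: "'a::euclidean_space \<Rightarrow> 'a"
  assumes S: "smooth_on S f" and I: "open I"
    and x: "\<And>t. t \<in> I \<Longrightarrow> x t \<in> S" "\<And>t. t \<in> I \<Longrightarrow> (x has_vector_derivative f (x t)) (at t)"
  shows "smooth_on I x"
proof -
  have "Ck_on k I x" for k
  proof (induction k)
    case 0
    then show ?case
      using x(2) by (auto intro!: continuous_at_imp_continuous_on has_vector_derivative_continuous)
  next
    case (Suc k)
    have *: "(x has_derivative (\<lambda>h. h *\<^sub>R f (x t))) (at t)" if "t \<in> I" for t
      using x(2)[OF that] by (simp add: has_vector_derivative_def)
    have "Ck_on k I (\<lambda>t. frechet_derivative x (at t) v)" for v
    proof (rule Ck_on_cong[OF I])
      have "Ck_on k I (\<lambda>t. f (x t))"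
        by (rule Ck_on_compose[OF I Suc, of S]) (use S x in \<open>auto simp: smooth_on_def\<close>)
      then show "Ck_on k I (\<lambda>t. v *\<^sub>R f (x t))"
        by (rule bounded_linear.Ck_on_linear_compose[OF bounded_linear_scaleR_right I])
    qed (simp add: frechet_derivative_at[OF *, symmetric])
    then show ?case using * by (auto simp: differentiable_def)
  qed
  then show ?thesis by (simp add: smooth_on_def)
qed

section \<open>Charts and smooth maps\<close>

definition inv_chart :: "('m, 'e) chart \<Rightarrow> 'e \<Rightarrow> 'm" where
  "inv_chart c = inv_into (fst c) (snd c)"

text \<open>The part of the manifold condition that inverting a chart relies on. It is singled out
  because it passes at once to product atlases and to the line.\<close>

definition inj_charts :: "('m, 'e) atlas \<Rightarrow> bool" where
  "inj_charts A \<longleftrightarrow> (\<forall>c\<in>A. inj_on (snd c) (fst c))"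

lemma smooth_manifold_inj_charts: "smooth_manifold A \<Longrightarrow> inj_charts A"
  by (auto simp: smooth_manifold_def inj_charts_def)

lemma inj_charts_prod: "inj_charts A \<Longrightarrow> inj_charts B \<Longrightarrow> inj_charts (prod_atlas A B)"
  unfolding inj_charts_def prod_atlas_def by (force intro: map_prod_inj_on)

lemma inj_charts_line: "inj_charts line_atlas"
  by (auto simp: inj_charts_def line_atlas_def)

lemma inv_chart_coord: "inj_charts A \<Longrightarrow> c \<in> A \<Longrightarrow> p \<in> fst c \<Longrightarrow> inv_chart c (snd c p) = p"
  by (simp add: inv_chart_def inj_charts_def)

lemma coord_inv_chart: "z \<in> snd c ` fst c \<Longrightarrow> snd c (inv_chart c z) = z"
  by (simp add: inv_chart_def f_inv_into_f)

lemma inv_chart_in: "z \<in> snd c ` fst c \<Longrightarrow> inv_chart c z \<in> fst c"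
  by (simp add: inv_chart_def inv_into_into)

lemma chart_in_points: "c \<in> A \<Longrightarrow> p \<in> fst c \<Longrightarrow> p \<in> points A"
  by (auto simp: points_def)

text \<open>Turns the images that occur in the definitions of atlases and smooth maps into preimages
  under the inverse chart, which intersect and compose well.\<close>

lemma chart_image_iff:
  assumes "inj_charts A" "c \<in> A"
  shows "z \<in> snd c ` (fst c \<inter> W) \<longleftrightarrow> z \<in> snd c ` fst c \<and> inv_chart c z \<in> W"
proof
  assume "z \<in> snd c ` (fst c \<inter> W)"
  then show "z \<in> snd c ` fst c \<and> inv_chart c z \<in> W" using inv_chart_coord[OF assms] by auto
next
  assume z: "z \<in> snd c ` fst c \<and> inv_chart c z \<in> W"
  then have "snd c (inv_chart c z) \<in> snd c ` (fst c \<inter> W)" using inv_chart_in[of z c] by (intro imageI IntI) auto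
  then show "z \<in> snd c ` (fst c \<inter> W)" using z by (simp add: coord_inv_chart)
qed

lemma chart_open: "smooth_manifold A \<Longrightarrow> c \<in> A \<Longrightarrow> open (snd c ` fst c)"
  by (auto simp: smooth_manifold_def)

lemma chart_at:
  assumes "x \<in> points A"
  shows "chart_at A x \<in> A" "x \<in> fst (chart_at A x)"
proof -
  have "\<exists>c. c \<in> A \<and> x \<in> fst c" using assms by (auto simp: points_def)
  from someI_ex[OF this] show "chart_at A x \<in> A" "x \<in> fst (chart_at A x)"
    by (auto simp: chart_at_def)
qed

lemma point_at_eq: "point_at A x = inv_chart (chart_at A x)"
  by (simp add: point_at_def inv_chart_def)

lemma transition:
  assumes "smooth_manifold A" "c \<in> A" "d \<in> A"
  shows "open (snd c ` (fst c \<inter> fst d))" "smooth_on (snd c ` (fst c \<inter> fst d)) (snd d \<circ> inv_chart c)"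
proof -
  have "\<forall>(U, \<phi>)\<in>A. \<forall>(V, \<psi>)\<in>A.
        open (\<phi> ` (U \<inter> V)) \<and> smooth_on (\<phi> ` (U \<inter> V)) (\<psi> \<circ> inv_into U \<phi>)"
    using assms(1) by (simp add: smooth_manifold_def)
  then have "open (snd c ` (fst c \<inter> fst d)) \<and> smooth_on (snd c ` (fst c \<inter> fst d)) (snd d \<circ> inv_chart c)"
    unfolding case_prod_unfold inv_chart_def using assms(2,3) by blast
  then show "open (snd c ` (fst c \<inter> fst d))" "smooth_on (snd c ` (fst c \<inter> fst d)) (snd d \<circ> inv_chart c)"
    by auto
qed

lemma smooth_map_chart:
  assumes "smooth_map A B f" "c \<in> A" "d \<in> B"
  shows "open (snd c ` (fst c \<inter> f -` fst d))" "smooth_on (snd c ` (fst c \<inter> f -` fst d)) (snd d \<circ> f \<circ> inv_chart c)"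
proof -
  have "\<forall>(U, \<phi>)\<in>A. \<forall>(V, \<psi>)\<in>B.
        open (\<phi> ` (U \<inter> f -` V)) \<and> smooth_on (\<phi> ` (U \<inter> f -` V)) (\<psi> \<circ> f \<circ> inv_into U \<phi>)"
    using assms(1) by (simp add: smooth_map_def)
  then have "open (snd c ` (fst c \<inter> f -` fst d)) \<and> smooth_on (snd c ` (fst c \<inter> f -` fst d)) (snd d \<circ> f \<circ> inv_chart c)"
    unfolding case_prod_unfold inv_chart_def using assms(2,3) by blast
  then show "open (snd c ` (fst c \<inter> f -` fst d))" "smooth_on (snd c ` (fst c \<inter> f -` fst d)) (snd d \<circ> f \<circ> inv_chart c)"
    by auto
qed

lemma smooth_map_points: "smooth_map A B f \<Longrightarrow> x \<in> points A \<Longrightarrow> f x \<in> points B"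
  by (auto simp: smooth_map_def)

lemma smooth_mapI:
  assumes "\<And>x. x \<in> points A \<Longrightarrow> f x \<in> points B"
    "\<And>c d z. c \<in> A \<Longrightarrow> d \<in> B \<Longrightarrow> z \<in> snd c ` (fst c \<inter> f -` fst d) \<Longrightarrow>
      \<exists>T. open T \<and> z \<in> T \<and> T \<subseteq> snd c ` (fst c \<inter> f -` fst d) \<and> smooth_on T (snd d \<circ> f \<circ> inv_chart c)"
  shows "smooth_map A B f"
  unfolding smooth_map_def case_prod_unfold
proof (intro conjI ballI)
  show "f ` points A \<subseteq> points B" using assms(1) by blast
  fix c d assume c: "c \<in> A" and d: "d \<in> B"
  show "open (snd c ` (fst c \<inter> f -` fst d))"
    by (subst open_subopen) (use assms(2)[OF c d] in metis)
  show "smooth_on (snd c ` (fst c \<inter> f -` fst d)) (snd d \<circ> f \<circ> inv_into (fst c) (snd c))"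
    unfolding inv_chart_def[symmetric] by (rule smooth_on_local) (use assms(2)[OF c d] in metis)
qed

lemma open_smooth_preimage:
  fixes f :: "'a::real_normed_vector \<Rightarrow> 'b::real_normed_vector"
  assumes "open S" "smooth_on S f" "open T"
  shows "open {x \<in> S. f x \<in> T}"
proof -
  have "{x \<in> S. f x \<in> T} = S \<inter> f -` T" by auto
  then show ?thesis
    using continuous_open_preimage[OF smooth_on_continuous[OF assms(2)] assms(1,3)] by simp
qed

text \<open>Around a given point a chart of the middle manifold is inserted; \<open>T\<close> is the
  open set on which the composite of the two local representatives makes sense and equals the
  representative of the composite.\<close>

lemma smooth_map_compose:
  fixes B :: "('k, 'f::euclidean_space) atlas"
  assumes A: "inj_charts A" and B: "inj_charts B"
    and f: "smooth_map A B f" and g: "smooth_map B C g"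
  shows "smooth_map A C (\<lambda>x. g (f x))"
proof (rule smooth_mapI)
  show "g (f x) \<in> points C" if "x \<in> points A" for x
    using that smooth_map_points[OF f] smooth_map_points[OF g] by blast
next
  fix c d z assume c: "c \<in> A" and d: "d \<in> C" and z: "z \<in> snd c ` (fst c \<inter> (\<lambda>x. g (f x)) -` fst d)"
  then obtain p where p: "p \<in> fst c" "g (f p) \<in> fst d" "z = snd c p" by auto
  have "f p \<in> points B" using smooth_map_points[OF f] chart_in_points[OF c p(1)] by blast
  then obtain e where e: "e \<in> B" "f p \<in> fst e" by (auto simp: points_def)
  let ?f = "snd e \<circ> f \<circ> inv_chart c" and ?g = "snd d \<circ> g \<circ> inv_chart e"
  let ?S = "snd c ` (fst c \<inter> f -` fst e)" and ?R = "snd e ` (fst e \<inter> g -` fst d)"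
  define T where "T = {x \<in> ?S. ?f x \<in> ?R}"
  have T: "open T"
    unfolding T_def by (intro open_smooth_preimage smooth_map_chart[OF f c e(1)] smooth_map_chart[OF g e(1) d])
  have eq: "inv_chart e (?f x) = f (inv_chart c x)" "inv_chart c x \<in> fst c" "g (f (inv_chart c x)) \<in> fst d"
    if "x \<in> T" for x
  proof -
    have x: "x \<in> snd c ` fst c" "f (inv_chart c x) \<in> fst e"
      using that chart_image_iff[OF A c] by (auto simp: T_def)
    then show 1: "inv_chart e (?f x) = f (inv_chart c x)" using inv_chart_coord[OF B e(1)] by simp
    show "inv_chart c x \<in> fst c" by (rule inv_chart_in[OF x(1)])
    have "?f x \<in> ?R" using that by (simp add: T_def)
    then show "g (f (inv_chart c x)) \<in> fst d"
      using 1 chart_image_iff[OF B e(1)] by (metis vimageE)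
  qed
  show "\<exists>T. open T \<and> z \<in> T \<and> T \<subseteq> snd c ` (fst c \<inter> (\<lambda>x. g (f x)) -` fst d) \<and>
      smooth_on T (snd d \<circ> (\<lambda>x. g (f x)) \<circ> inv_chart c)"
  proof (intro exI conjI)
    show "z \<in> T" using p e inv_chart_coord[OF A c] by (auto simp: T_def)
    show "T \<subseteq> snd c ` (fst c \<inter> (\<lambda>x. g (f x)) -` fst d)"
    proof
      fix x assume x: "x \<in> T"
      then have "x \<in> snd c ` fst c" by (auto simp: T_def)
      then show "x \<in> snd c ` (fst c \<inter> (\<lambda>x. g (f x)) -` fst d)"
        using eq(3)[OF x] chart_image_iff[OF A c] by simp
    qed
    have "smooth_on T (\<lambda>x. ?g (?f x))"
      by (rule smooth_on_compose[OF T smooth_on_subset[OF smooth_map_chart(2)[OF f c e(1)]] smooth_map_chart(2)[OF g e(1) d]])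
         (auto simp: T_def)
    moreover have "?g (?f x) = (snd d \<circ> (\<lambda>x. g (f x)) \<circ> inv_chart c) x" if "x \<in> T" for x
      using eq(1)[OF that] by simp
    ultimately show "smooth_on T (snd d \<circ> (\<lambda>x. g (f x)) \<circ> inv_chart c)"
      using smooth_on_cong[OF T] by (metis (no_types, lifting))
  qed (rule T)
qed

text \<open>Freezing the first factor turns smoothness of the multiplication into smoothness of left
  translations.\<close>

lemma smooth_map_const_Pair:
  assumes B: "smooth_manifold B" and a: "a \<in> points A"
  shows "smooth_map B (prod_atlas A B) (\<lambda>x. (a, x))"
proof (rule smooth_mapI)
  fix x assume "x \<in> points B"
  then show "(a, x) \<in> points (prod_atlas A B)"
  proof -
    obtain c d where "c \<in> A" "a \<in> fst c" "d \<in> B" "x \<in> fst d"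
      using a \<open>x \<in> points B\<close> by (auto simp: points_def)
    then have "(fst c \<times> fst d, map_prod (snd c) (snd d)) \<in> prod_atlas A B" "(a, x) \<in> fst c \<times> fst d"
      unfolding prod_atlas_def by (simp_all add: exI[of _ "fst c"]) (metis prod.collapse)
    then show ?thesis using chart_in_points by fastforce
  qed
next
  fix c d z assume c: "c \<in> B" and "d \<in> prod_atlas A B" and z: "z \<in> snd c ` (fst c \<inter> (\<lambda>x. (a, x)) -` fst d)"
  then obtain U \<phi> V \<psi> where d: "d = (U \<times> V, map_prod \<phi> \<psi>)" "(U, \<phi>) \<in> A" "(V, \<psi>) \<in> B"
    by (auto simp: prod_atlas_def)
  have "a \<in> U" using z d by (auto split: if_splits)
  then have eq: "fst c \<inter> (\<lambda>x. (a, x)) -` fst d = fst c \<inter> fst (V, \<psi>)" using d by auto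
  note tr = transition[OF B c d(3)]
  have "smooth_on (snd c ` (fst c \<inter> fst (V, \<psi>))) (\<lambda>z. (\<phi> a, (snd (V, \<psi>) \<circ> inv_chart c) z))"
    by (rule smooth_on_Pair[OF tr(1) smooth_on_const tr(2)])
  then have "smooth_on (snd c ` (fst c \<inter> fst (V, \<psi>))) (snd d \<circ> (\<lambda>x. (a, x)) \<circ> inv_chart c)"
    by (simp add: d comp_def)
  then show "\<exists>T. open T \<and> z \<in> T \<and> T \<subseteq> snd c ` (fst c \<inter> (\<lambda>x. (a, x)) -` fst d) \<and>
      smooth_on T (snd d \<circ> (\<lambda>x. (a, x)) \<circ> inv_chart c)"
    using tr(1) z unfolding eq by blast
qed

lemma smooth_map_local_rep:
  assumes A: "inj_charts A" and f: "smooth_map A B f" and c: "c \<in> A" "p \<in> fst c" and d: "d \<in> B" "f p \<in> fst d"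
  shows "((snd d \<circ> f \<circ> inv_chart c) has_derivative frechet_derivative (snd d \<circ> f \<circ> inv_chart c) (at (snd c p))) (at (snd c p))"
  by (rule smooth_on_has_derivative[OF smooth_map_chart(2)[OF f c(1) d(1)]]) (use c d in auto)

lemma has_derivative_tangent_map:
  assumes "inj_charts A" "smooth_map A B f" "x \<in> points A"
  shows "((coord_at B (f x) \<circ> f \<circ> point_at A x) has_derivative tangent_map A B f x) (at (coord_at A x x))"
  unfolding tangent_map_def coord_at_def point_at_eq
  by (rule smooth_map_local_rep[OF assms(1,2) chart_at[OF assms(3)] chart_at[OF smooth_map_points[OF assms(2,3)]]])

lemma linear_tangent_map:
  assumes "inj_charts A" "smooth_map A B f" "x \<in> points A"
  shows "linear (tangent_map A B f x)"
  using has_derivative_linear[OF has_derivative_tangent_map[OF assms]] .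

text \<open>Here \<open>g\<close> only has to be differentiable at \<open>f x\<close>, because the translations of a homogeneous
  space are not known to be smooth at this stage.\<close>

lemma tangent_map_chain:
  fixes A :: "('m, 'e::euclidean_space) atlas" and B :: "('k, 'f::euclidean_space) atlas"
  assumes A: "smooth_manifold A" and B: "inj_charts B" and f: "smooth_map A B f" and x: "x \<in> points A"
    and g: "((coord_at C (g (f x)) \<circ> g \<circ> point_at B (f x)) has_derivative g') (at (coord_at B (f x) (f x)))"
  shows "((coord_at C (g (f x)) \<circ> (\<lambda>x. g (f x)) \<circ> point_at A x) has_derivative
    (\<lambda>u. g' (tangent_map A B f x u))) (at (coord_at A x x))"
proof -
  note Ai = smooth_manifold_inj_charts[OF A]
  let ?c = "chart_at A x" and ?d = "chart_at B (f x)"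
  have c: "?c \<in> A" "x \<in> fst ?c" and d: "?d \<in> B" "f x \<in> fst ?d"
    using chart_at[OF x] chart_at[OF smooth_map_points[OF f x]] by simp_all
  let ?S = "snd ?c ` (fst ?c \<inter> f -` fst ?d)"
  have xS: "coord_at A x x \<in> ?S" using c d by (auto simp: coord_at_def)
  have px: "point_at A x (coord_at A x x) = x"
    unfolding point_at_eq coord_at_def by (rule inv_chart_coord[OF Ai c])
  have eq: "point_at B (f x) (coord_at B (f x) (f (point_at A x z))) = f (point_at A x z)" if "z \<in> ?S" for z
    using that chart_image_iff[OF Ai c(1)] inv_chart_coord[OF B d(1)] by (auto simp: point_at_eq coord_at_def)
  show ?thesis
  proof (rule has_derivative_transform_within_open[OF _ smooth_map_chart(1)[OF f c(1) d(1)] xS])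
    let ?f = "coord_at B (f x) \<circ> f \<circ> point_at A x" and ?g = "coord_at C (g (f x)) \<circ> g \<circ> point_at B (f x)"
    have "(?g has_derivative g') (at (?f (coord_at A x x)))" using g px by simp
    then show "((\<lambda>z. ?g (?f z)) has_derivative (\<lambda>u. g' (tangent_map A B f x u))) (at (coord_at A x x))"
      by (rule has_derivative_compose[OF has_derivative_tangent_map[OF Ai f x]])
  qed (use eq in simp)
qed

lemma tangent_map_compose:
  assumes A: "smooth_manifold A" and B: "inj_charts B" and f: "smooth_map A B f" and g: "smooth_map B C g"
    and x: "x \<in> points A"
  shows "tangent_map A C (\<lambda>x. g (f x)) x = (\<lambda>u. tangent_map B C g (f x) (tangent_map A B f x u))"
  unfolding tangent_map_def[of A C]
  by (rule frechet_derivative_at[symmetric])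
     (rule tangent_map_chain[OF A B f x has_derivative_tangent_map[OF B g smooth_map_points[OF f x]]])

lemma tangent_map_ident:
  assumes A: "smooth_manifold A" and x: "x \<in> points A"
  shows "tangent_map A A (\<lambda>x. x) x = (\<lambda>u. u)"
  unfolding tangent_map_def
proof (rule frechet_derivative_at[symmetric], rule has_derivative_transform_within_open[OF has_derivative_ident])
  note c = chart_at[OF x]
  show "open (snd (chart_at A x) ` fst (chart_at A x))" by (rule chart_open[OF A c(1)])
  show "coord_at A x x \<in> snd (chart_at A x) ` fst (chart_at A x)" using c(2) by (simp add: coord_at_def)
  show "z = (coord_at A x \<circ> (\<lambda>x. x) \<circ> point_at A x) z" if "z \<in> snd (chart_at A x) ` fst (chart_at A x)" for z
    using coord_inv_chart[OF that] by (simp add: coord_at_def point_at_eq)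
qed

section \<open>The topology of an atlas\<close>

text \<open>The constructor \<open>topology\<close> can be inverted only on predicates satisfying
  \<open>istopology\<close>. Closure under intersections is the delicate axiom: it holds because
  injective charts commute with intersections.\<close>

lemma openin_atlas_topology:
  assumes "inj_charts A"
  shows "openin (atlas_topology A) W \<longleftrightarrow> W \<subseteq> points A \<and> (\<forall>c\<in>A. open (snd c ` (fst c \<inter> W)))"
proof -
  let ?L = "\<lambda>W. W \<subseteq> points A \<and> (\<forall>c\<in>A. open (snd c ` (fst c \<inter> W)))"
  have "istopology ?L"
    unfolding istopology_def
  proof (intro conjI allI impI)
    fix S T assume S: "?L S" and T: "?L T"
    have "snd c ` (fst c \<inter> (S \<inter> T)) = snd c ` (fst c \<inter> S) \<inter> snd c ` (fst c \<inter> T)" if "c \<in> A" for c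
      by (rule Set.set_eqI) (simp only: chart_image_iff[OF assms that] Int_iff, blast)
    then show "S \<inter> T \<subseteq> points A" "\<forall>c\<in>A. open (snd c ` (fst c \<inter> (S \<inter> T)))"
      using S T by auto
  next
    fix K assume K: "\<forall>S\<in>K. ?L S"
    then show "\<Union> K \<subseteq> points A" by blast
    show "\<forall>c\<in>A. open (snd c ` (fst c \<inter> \<Union> K))"
    proof
      fix c assume c: "c \<in> A"
      have "snd c ` (fst c \<inter> \<Union> K) = (\<Union>S\<in>K. snd c ` (fst c \<inter> S))" by blast
      then show "open (snd c ` (fst c \<inter> \<Union> K))" using K c by auto
    qed
  qed
  moreover have "atlas_topology A = topology ?L"
    unfolding atlas_topology_def case_prod_unfold ..
  ultimately show ?thesis by (simp add: topology_inverse')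
qed

lemma openin_chart:
  assumes "smooth_manifold A" "c \<in> A"
  shows "openin (atlas_topology A) (fst c)"
  unfolding openin_atlas_topology[OF smooth_manifold_inj_charts[OF assms(1)]]
  using transition(1)[OF assms(1) _ assms(2)] chart_in_points[OF assms(2)] by auto

lemma continuous_curve_in_chart:
  assumes A: "smooth_manifold A" "c \<in> A" and g: "continuous_map (top_of_set I) (atlas_topology A) \<gamma>"
    and I: "open I"
  shows "open {t \<in> I. \<gamma> t \<in> fst c}"
  using openin_continuous_map_preimage[OF g openin_chart[OF A]] openin_open_eq[OF I] by simp

section \<open>Tangent vectors in charts\<close>

lemma chart_vec_eq:
  "chart_vec A c z = frechet_derivative (snd (chart_at A (inv_chart c z)) \<circ> inv_chart c) (at z)"
  by (cases c) (simp add: chart_vec_def inv_chart_def coord_at_def fun_eq_iff)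

text \<open>Cocycle rule for the Jacobians of coordinate changes, obtained by differentiating the
  identity between the three transition maps near \<open>p\<close>.\<close>

lemma transition_derivative_chain:
  fixes A :: "('m, 'e::euclidean_space) atlas"
  assumes A: "smooth_manifold A" and c: "c \<in> A" "p \<in> fst c" and d: "d \<in> A" "p \<in> fst d" and e: "e \<in> A" "p \<in> fst e"
  shows "frechet_derivative (snd e \<circ> inv_chart c) (at (snd c p)) w =
    frechet_derivative (snd e \<circ> inv_chart d) (at (snd d p)) (frechet_derivative (snd d \<circ> inv_chart c) (at (snd c p)) w)"
proof -
  note Ai = smooth_manifold_inj_charts[OF A]
  have dp: "(snd d \<circ> inv_chart c) (snd c p) = snd d p" by (simp add: inv_chart_coord[OF Ai c])
  have 1: "((snd e \<circ> inv_chart d) has_derivative frechet_derivative (snd e \<circ> inv_chart d) (at (snd d p))) (at (snd d p))"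
    by (rule smooth_on_has_derivative[OF transition(2)[OF A d(1) e(1)]]) (use d e in auto)
  have 2: "((snd d \<circ> inv_chart c) has_derivative frechet_derivative (snd d \<circ> inv_chart c) (at (snd c p))) (at (snd c p))"
    by (rule smooth_on_has_derivative[OF transition(2)[OF A c(1) d(1)]]) (use c d in auto)
  have "((\<lambda>z. (snd e \<circ> inv_chart d) ((snd d \<circ> inv_chart c) z)) has_derivative
      (\<lambda>w. frechet_derivative (snd e \<circ> inv_chart d) (at (snd d p)) (frechet_derivative (snd d \<circ> inv_chart c) (at (snd c p)) w)))
      (at (snd c p))"
    by (rule has_derivative_compose[OF 2]) (use 1 in \<open>simp only: dp\<close>)
  then have "((snd e \<circ> inv_chart c) has_derivative
      (\<lambda>w. frechet_derivative (snd e \<circ> inv_chart d) (at (snd d p)) (frechet_derivative (snd d \<circ> inv_chart c) (at (snd c p)) w)))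
      (at (snd c p))"
  proof (rule has_derivative_transform_within_open[OF _ transition(1)[OF A c(1) d(1)]])
    show "snd c p \<in> snd c ` (fst c \<inter> fst d)" using c d by auto
    show "(snd e \<circ> inv_chart d) ((snd d \<circ> inv_chart c) z) = (snd e \<circ> inv_chart c) z"
      if "z \<in> snd c ` (fst c \<inter> fst d)" for z
      using that chart_image_iff[OF Ai c(1)] inv_chart_coord[OF Ai d(1)] by simp
  qed
  from frechet_derivative_at[OF this] show ?thesis by metis
qed

lemma transition_derivative_self:
  assumes A: "smooth_manifold A" and c: "c \<in> A" "z \<in> snd c ` fst c"
  shows "frechet_derivative (snd c \<circ> inv_chart c) (at z) = (\<lambda>w. w)"
  by (rule frechet_derivative_at[symmetric], rule has_derivative_transform_within_open[OF has_derivative_ident chart_open[OF A c(1)] c(2)])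
     (simp add: coord_inv_chart)

lemma chart_vec_at_self:
  assumes A: "smooth_manifold A" and x: "x \<in> points A"
  shows "chart_vec A (chart_at A x) (coord_at A x x) = (\<lambda>w. w)"
  unfolding chart_vec_eq coord_at_def inv_chart_coord[OF smooth_manifold_inj_charts[OF A] chart_at[OF x]]
  by (rule transition_derivative_self[OF A chart_at(1)[OF x]]) (use chart_at(2)[OF x] in auto)

lemma chart_vec_transition:
  assumes A: "smooth_manifold A" and c: "c \<in> A" "p \<in> fst c" and d: "d \<in> A" "p \<in> fst d"
  shows "chart_vec A c (snd c p) w = chart_vec A d (snd d p) (frechet_derivative (snd d \<circ> inv_chart c) (at (snd c p)) w)"
proof -
  note Ai = smooth_manifold_inj_charts[OF A] and pp = chart_in_points[OF c]
  show ?thesis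
    unfolding chart_vec_eq inv_chart_coord[OF Ai c] inv_chart_coord[OF Ai d]
    by (rule transition_derivative_chain[OF A c d chart_at[OF pp]])
qed

lemma linear_chart_vec:
  assumes A: "smooth_manifold A" and c: "c \<in> A" "z \<in> snd c ` fst c"
  shows "linear (chart_vec A c z)"
proof -
  note i = inv_chart_in[OF c(2)]
  have z: "z = snd c (inv_chart c z)" using coord_inv_chart[OF c(2)] by simp
  note e = chart_at[OF chart_in_points[OF c(1) i]]
  show ?thesis
    unfolding chart_vec_eq
    by (rule smooth_on_linear_derivative[OF transition(2)[OF A c(1) e(1)]]) (use i e z in blast)
qed

text \<open>The Jacobian of the reverse coordinate change is the inverse, by the cocycle rule
  applied to a chart and back.\<close>

lemma chart_vec_inverse:
  assumes A: "smooth_manifold A" and c: "c \<in> A" "p \<in> fst c"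
  obtains l where "linear l" "\<And>w. l (chart_vec A c (snd c p) w) = w" "\<And>w. chart_vec A c (snd c p) (l w) = w"
proof -
  note Ai = smooth_manifold_inj_charts[OF A] and e = chart_at[OF chart_in_points[OF c]]
  let ?e = "chart_at A p"
  let ?l = "frechet_derivative (snd c \<circ> inv_chart ?e) (at (snd ?e p))"
  show thesis
  proof (rule that[of ?l])
    show "linear ?l"
      by (rule smooth_on_linear_derivative[OF transition(2)[OF A e(1) c(1)]]) (use e c in auto)
    show "?l (chart_vec A c (snd c p) w) = w" for w
      unfolding chart_vec_eq inv_chart_coord[OF Ai c]
      using transition_derivative_chain[OF A c e c, of w] transition_derivative_self[OF A c(1), of "snd c p"] c by simp
    show "chart_vec A c (snd c p) (?l w) = w" for w
      unfolding chart_vec_eq inv_chart_coord[OF Ai c]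
      using transition_derivative_chain[OF A e c e, of w] transition_derivative_self[OF A e(1), of "snd ?e p"] e by simp
  qed
qed

text \<open>\<open>velocity\<close> takes components in a chart selected by the moving point, which
  can jump with \<open>t\<close>. Curves are therefore differentiated in one fixed chart and the
  result is transported by \<open>chart_vec\<close>.\<close>

lemma velocity_in_chart:
  assumes A: "smooth_manifold A" and c: "c \<in> A" and T: "open T" "t \<in> T" "\<And>s. s \<in> T \<Longrightarrow> \<gamma> s \<in> fst c"
    and x: "((snd c \<circ> \<gamma>) has_vector_derivative x') (at t)"
  shows "velocity A \<gamma> t = chart_vec A c (snd c (\<gamma> t)) x'"
    "((coord_at A (\<gamma> t) \<circ> \<gamma>) has_vector_derivative velocity A \<gamma> t) (at t)"
proof -
  note Ai = smooth_manifold_inj_charts[OF A] and ct = T(3)[OF T(2)]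
  note e = chart_at[OF chart_in_points[OF c ct]]
  let ?e = "chart_at A (\<gamma> t)"
  have 1: "((snd ?e \<circ> inv_chart c) has_derivative chart_vec A c (snd c (\<gamma> t))) (at (snd c (\<gamma> t)))"
    unfolding chart_vec_eq inv_chart_coord[OF Ai c ct]
    by (rule smooth_on_has_derivative[OF transition(2)[OF A c e(1)]]) (use ct e in auto)
  have "((\<lambda>s. (snd ?e \<circ> inv_chart c) ((snd c \<circ> \<gamma>) s)) has_vector_derivative chart_vec A c (snd c (\<gamma> t)) x') (at t)"
    using has_derivative_compose[OF x[unfolded has_vector_derivative_def], of "snd ?e \<circ> inv_chart c" "chart_vec A c (snd c (\<gamma> t))"] 1
    unfolding has_vector_derivative_def linear_cmul[OF has_derivative_linear[OF 1]] by simp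
  then have "((coord_at A (\<gamma> t) \<circ> \<gamma>) has_vector_derivative chart_vec A c (snd c (\<gamma> t)) x') (at t)"
    by (rule has_vector_derivative_transform_within_open[OF _ T(1,2)])
       (use inv_chart_coord[OF Ai c] T(3) in \<open>simp add: coord_at_def\<close>)
  then show "velocity A \<gamma> t = chart_vec A c (snd c (\<gamma> t)) x'"
    "((coord_at A (\<gamma> t) \<circ> \<gamma>) has_vector_derivative velocity A \<gamma> t) (at t)"
    unfolding velocity_def by (simp_all add: vector_derivative_at)
qed

section \<open>Lie groups\<close>

locale lie_group_on = group G for G :: "('g, 'z) monoid_scheme" (structure) +
  fixes A :: "('g, 'e::euclidean_space) atlas"
  assumes lie_group: "lie_group G A"
begin

lemma manifold: "smooth_manifold A" and points_eq: "points A = carrier G"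
  and smooth_mult: "smooth_map (prod_atlas A A) A (\<lambda>(g, h). g \<otimes> h)"
  and smooth_inv: "smooth_map A A (\<lambda>g. inv g)"
  using lie_group by (auto simp: lie_group_def)

lemmas inj = smooth_manifold_inj_charts[OF manifold]

lemma left_translation_smooth: "g \<in> carrier G \<Longrightarrow> smooth_map A A (\<lambda>x. g \<otimes> x)"
  using smooth_map_compose[OF inj inj_charts_prod[OF inj inj] smooth_map_const_Pair[OF manifold, of g A] smooth_mult]
  by (simp add: points_eq)

definition "c0 = chart_at A \<one>"
definition "O0 = snd c0 ` fst c0"
definition "p = inv_chart c0"
definition "\<eta>0 = snd c0 \<one>"
text \<open>\<open>Om\<close> and \<open>mm\<close>, \<open>Oi\<close> and \<open>ii\<close> are the
  domains and coordinate expressions of multiplication and inversion near the unit, that is, the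
  local Lie group in the chart \<open>c0\<close>.\<close>

definition "Om = {q. fst q \<in> O0 \<and> snd q \<in> O0 \<and> p (fst q) \<otimes> p (snd q) \<in> fst c0}"
definition "mm q = snd c0 (p (fst q) \<otimes> p (snd q))"
definition "Oi = {\<eta> \<in> O0. inv (p \<eta>) \<in> fst c0}"
definition "ii \<eta> = snd c0 (inv (p \<eta>))"

lemma c0: "c0 \<in> A" "\<one> \<in> fst c0"
  using chart_at[of "\<one>" A] by (simp_all add: c0_def points_eq)

lemma O0_open: "open O0" unfolding O0_def by (rule chart_open[OF manifold c0(1)])

lemma \<eta>0: "\<eta>0 \<in> O0" "p \<eta>0 = \<one>"
  using c0 inv_chart_coord[OF inj c0] by (auto simp: \<eta>0_def O0_def p_def)

lemma p_in: "\<eta> \<in> O0 \<Longrightarrow> p \<eta> \<in> fst c0"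
  unfolding O0_def p_def by (rule inv_chart_in)

lemma p_carrier [simp]: "\<eta> \<in> O0 \<Longrightarrow> p \<eta> \<in> carrier G"
  using chart_in_points[OF c0(1) p_in] points_eq by simp

lemma coord_p: "\<eta> \<in> O0 \<Longrightarrow> snd c0 (p \<eta>) = \<eta>"
  unfolding O0_def p_def by (rule coord_inv_chart)

lemma p_coord: "g \<in> fst c0 \<Longrightarrow> p (snd c0 g) = g"
  unfolding p_def by (rule inv_chart_coord[OF inj c0(1)])

lemma coord_in: "g \<in> fst c0 \<Longrightarrow> snd c0 g \<in> O0"
  by (simp add: O0_def)

lemma Om_smooth: "open Om" "smooth_on Om mm"
proof -
  let ?c = "(fst c0 \<times> fst c0, map_prod (snd c0) (snd c0))"
  have c: "?c \<in> prod_atlas A A"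
    unfolding prod_atlas_def
    by (rule CollectI, rule exI[of _ "fst c0"], rule exI[of _ "snd c0"], rule exI[of _ "fst c0"], rule exI[of _ "snd c0"])
       (simp add: c0)
  note ip = inj_charts_prod[OF inj inj]
  have im: "z \<in> snd ?c ` fst ?c \<longleftrightarrow> fst z \<in> O0 \<and> snd z \<in> O0" for z
    by (cases z) (auto simp: O0_def)
  have iv: "inv_chart ?c z = (p (fst z), p (snd z))" if "z \<in> snd ?c ` fst ?c" for z
  proof -
    have "fst z \<in> O0" "snd z \<in> O0" using that im by auto
    then have "snd ?c (p (fst z), p (snd z)) = z" "(p (fst z), p (snd z)) \<in> fst ?c"
      by (simp_all add: coord_p p_in)
    then show ?thesis using inv_chart_coord[OF ip c] by metis
  qed
  have Om: "snd ?c ` (fst ?c \<inter> (\<lambda>(g, h). g \<otimes> h) -` fst c0) = Om"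
    by (rule Set.set_eqI) (use im iv in \<open>auto simp only: chart_image_iff[OF ip c] Om_def vimage_eq mem_Collect_eq case_prod_conv\<close>)
  show "open Om" using smooth_map_chart(1)[OF smooth_mult c c0(1)] unfolding Om .
  show "smooth_on Om mm"
  proof (rule smooth_on_cong[OF \<open>open Om\<close>])
    show "smooth_on Om (snd c0 \<circ> (\<lambda>(g, h). g \<otimes> h) \<circ> inv_chart ?c)"
      using smooth_map_chart(2)[OF smooth_mult c c0(1)] unfolding Om .
    show "(snd c0 \<circ> (\<lambda>(g, h). g \<otimes> h) \<circ> inv_chart ?c) z = mm z" if "z \<in> Om" for z
      using iv[of z] im[of z] that by (simp add: mm_def Om_def)
  qed
qed

lemma Oi_smooth: "open Oi" "smooth_on Oi ii"
proof -
  have eq: "snd c0 ` (fst c0 \<inter> (\<lambda>g. inv g) -` fst c0) = Oi"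
    by (rule Set.set_eqI) (simp add: chart_image_iff[OF inj c0(1)] Oi_def O0_def p_def)
  show "open Oi" using smooth_map_chart(1)[OF smooth_inv c0(1) c0(1)] unfolding eq .
  have "(snd c0 \<circ> (\<lambda>g. inv g) \<circ> inv_chart c0) = ii" by (auto simp: ii_def p_def)
  then show "smooth_on Oi ii" using smooth_map_chart(2)[OF smooth_inv c0(1) c0(1)] unfolding eq by simp
qed

lemma p_mm: "q \<in> Om \<Longrightarrow> p (mm q) = p (fst q) \<otimes> p (snd q)" and mm_in: "q \<in> Om \<Longrightarrow> mm q \<in> O0"
  by (auto simp: Om_def mm_def p_coord coord_in)

lemma Om_unit: "\<eta> \<in> O0 \<Longrightarrow> (\<eta>, \<eta>0) \<in> Om" "\<eta> \<in> O0 \<Longrightarrow> (\<eta>0, \<eta>) \<in> Om"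
  by (auto simp: Om_def \<eta>0 p_in)

lemma mm_unit: "\<eta> \<in> O0 \<Longrightarrow> mm (\<eta>, \<eta>0) = \<eta>" "\<eta> \<in> O0 \<Longrightarrow> mm (\<eta>0, \<eta>) = \<eta>"
  by (auto simp: mm_def \<eta>0 coord_p)

lemma p_ii: "\<eta> \<in> Oi \<Longrightarrow> p (ii \<eta>) = inv (p \<eta>)" and ii_in: "\<eta> \<in> Oi \<Longrightarrow> ii \<eta> \<in> O0" and Oi_O0: "\<eta> \<in> Oi \<Longrightarrow> \<eta> \<in> O0"
  by (auto simp: Oi_def ii_def p_coord coord_in)

lemma \<eta>0_Oi: "\<eta>0 \<in> Oi" "ii \<eta>0 = \<eta>0"
  by (auto simp: Oi_def ii_def \<eta>0 c0 \<eta>0_def[symmetric])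

lemma Om_ii: "\<eta> \<in> Oi \<Longrightarrow> (ii \<eta>, \<eta>) \<in> Om" "\<eta> \<in> Oi \<Longrightarrow> (\<eta>, ii \<eta>) \<in> Om"
  by (auto simp: Om_def ii_in Oi_O0 p_ii c0)

lemma mm_ii: "\<eta> \<in> Oi \<Longrightarrow> mm (ii \<eta>, \<eta>) = \<eta>0" "\<eta> \<in> Oi \<Longrightarrow> mm (\<eta>, ii \<eta>) = \<eta>0"
  by (simp_all add: mm_def p_ii Oi_O0 \<eta>0_def)

lemma mm_assoc:
  assumes "(a, b) \<in> Om" "(b, c) \<in> Om" "(mm (a, b), c) \<in> Om"
  shows "mm (a, mm (b, c)) = mm (mm (a, b), c)" "(a, mm (b, c)) \<in> Om"
  using assms p_mm[OF assms(1)] p_mm[OF assms(2)] mm_in[OF assms(2)] by (auto simp: mm_def Om_def m_assoc)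

section \<open>Left-invariant vector fields in coordinates\<close>

abbreviation Dmm :: "'e \<times> 'e \<Rightarrow> 'e \<times> 'e \<Rightarrow> 'e" where
  "Dmm q \<equiv> frechet_derivative mm (at q)"

lemma mm_has_derivative: "q \<in> Om \<Longrightarrow> (mm has_derivative Dmm q) (at q)"
  by (rule smooth_on_has_derivative[OF Om_smooth(2)])

lemma linear_Dmm: "q \<in> Om \<Longrightarrow> linear (Dmm q)"
  by (rule smooth_on_linear_derivative[OF Om_smooth(2)])

text \<open>The differential at the unit of left translation by \<open>p \<eta>\<close>; as a
  function of \<eta> it is the left-invariant vector field with value \<open>W\<close> at the
  unit.\<close>

definition "M \<eta> W = Dmm (\<eta>, \<eta>0) (0, W)"

lemma linear_M: assumes "\<eta> \<in> O0" shows "linear (M \<eta>)"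
proof -
  have "linear (\<lambda>W. (0::'e, W))" by (simp add: linear_iff)
  from linear_compose[OF this linear_Dmm[OF Om_unit(1)[OF assms]]] show ?thesis
    by (simp add: M_def[abs_def] comp_def)
qed

lemma mm_right_derivative:
  assumes "(a, b) \<in> Om" "(x has_derivative x') (at t)" "x t = b"
  shows "((\<lambda>t. mm (a, x t)) has_derivative (\<lambda>h. Dmm (a, b) (0, x' h))) (at t)"
  using has_derivative_compose[OF has_derivative_Pair[OF has_derivative_const assms(2)], of mm "Dmm (a, b)" a]
    mm_has_derivative[OF assms(1)] assms(3) by simp

lemma mm_left_derivative:
  assumes "(a, b) \<in> Om" "(x has_derivative x') (at t)" "x t = a"
  shows "((\<lambda>t. mm (x t, b)) has_derivative (\<lambda>h. Dmm (a, b) (x' h, 0))) (at t)"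
  using has_derivative_compose[OF has_derivative_Pair[OF assms(2) has_derivative_const], of mm "Dmm (a, b)" b]
    mm_has_derivative[OF assms(1)] assms(3) by simp

lemma M_\<eta>0: "M \<eta>0 W = W" and Dmm_left: "Dmm (\<eta>0, \<eta>0) (W, 0) = W"
proof -
  have 1: "((\<lambda>t. mm (\<eta>0, t)) has_derivative (\<lambda>h. h)) (at \<eta>0)"
    by (rule has_derivative_transform_within_open[OF has_derivative_ident O0_open \<eta>0(1)]) (simp add: mm_unit)
  from has_derivative_unique[OF mm_right_derivative[OF Om_unit(1)[OF \<eta>0(1)] has_derivative_ident] 1]
  show "M \<eta>0 W = W" unfolding M_def by metis
  have 2: "((\<lambda>t. mm (t, \<eta>0)) has_derivative (\<lambda>h. h)) (at \<eta>0)"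
    by (rule has_derivative_transform_within_open[OF has_derivative_ident O0_open \<eta>0(1)]) (simp add: mm_unit)
  from has_derivative_unique[OF mm_left_derivative[OF Om_unit(1)[OF \<eta>0(1)] has_derivative_ident] 2]
  show "Dmm (\<eta>0, \<eta>0) (W, 0) = W" by metis
qed

lemma open_slice: "open {\<zeta>. (a, \<zeta>) \<in> Om}" "open {\<zeta>. (\<zeta>, a) \<in> Om}"
proof -
  have "open (Pair a -` Om)" by (intro open_vimage Om_smooth continuous_intros)
  then show "open {\<zeta>. (a, \<zeta>) \<in> Om}" by (simp add: vimage_def)
  have "open ((\<lambda>\<zeta>. (\<zeta>, a)) -` Om)" by (intro open_vimage Om_smooth continuous_intros)
  then show "open {\<zeta>. (\<zeta>, a) \<in> Om}" by (simp add: vimage_def)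
qed

text \<open>Associativity, differentiated in the third factor at the unit.\<close>

lemma left_invariant_M:
  assumes ab: "(a, b) \<in> Om"
  shows "Dmm (a, b) (0, M b W) = M (mm (a, b)) W"
proof -
  have b: "b \<in> O0" using ab by (simp add: Om_def)
  note c = mm_in[OF ab]
  have 1: "((\<lambda>\<zeta>. mm (a, mm (b, \<zeta>))) has_derivative (\<lambda>h. Dmm (a, b) (0, Dmm (b, \<eta>0) (0, h)))) (at \<eta>0)"
    by (rule mm_right_derivative[OF ab mm_right_derivative[OF Om_unit(1)[OF b] has_derivative_ident]])
       (simp_all add: mm_unit b)
  have 2: "((\<lambda>\<zeta>. mm (mm (a, b), \<zeta>)) has_derivative (\<lambda>h. Dmm (mm (a, b), \<eta>0) (0, h))) (at \<eta>0)"
    by (rule mm_right_derivative[OF Om_unit(1)[OF c] has_derivative_ident]) simp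
  have "((\<lambda>\<zeta>. mm (a, mm (b, \<zeta>))) has_derivative (\<lambda>h. Dmm (mm (a, b), \<eta>0) (0, h))) (at \<eta>0)"
  proof (rule has_derivative_transform_within_open[OF 2])
    show "open ({\<zeta>. (b, \<zeta>) \<in> Om} \<inter> {\<zeta>. (mm (a, b), \<zeta>) \<in> Om})" by (intro open_Int open_slice)
  qed (use Om_unit b c mm_assoc(1)[OF ab] in auto)
  from has_derivative_unique[OF 1 this] show ?thesis unfolding M_def by metis
qed

text \<open>The inverse of \<open>M \<eta>\<close>: left translation of a tangent vector at \<eta>
  back to the unit. Applied to the velocity of a curve it gives the body velocity.\<close>

definition "N \<eta> \<xi> = Dmm (ii \<eta>, \<eta>) (0, \<xi>)"

lemma N_M: assumes "\<eta> \<in> Oi" shows "N \<eta> (M \<eta> W) = W"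
  unfolding N_def by (simp add: left_invariant_M[OF Om_ii(1)[OF assms]] mm_ii(1)[OF assms] M_\<eta>0)

text \<open>\<open>N\<close> is a left inverse of \<open>M\<close>, and in finite dimension an
  injective endomorphism is bijective.\<close>

lemma M_N: assumes "\<eta> \<in> Oi" shows "M \<eta> (N \<eta> \<xi>) = \<xi>"
proof -
  have "inj (M \<eta>)" using N_M[OF assms] by (metis injI)
  then have "surj (M \<eta>)" by (rule linear_inj_imp_surj[OF linear_M[OF Oi_O0[OF assms]]])
  then show ?thesis using N_M[OF assms] by (metis surjD)
qed

section \<open>Second-order terms of the multiplication and the bracket\<close>

lemma M_smooth: "smooth_on O0 (\<lambda>\<eta>. M \<eta> W)"
  unfolding M_def
  by (rule smooth_on_compose[OF O0_open smooth_on_Pair[OF O0_open smooth_on_ident smooth_on_const]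
      smooth_on_derivative[OF Om_smooth(2)]]) (use Om_unit in auto)

text \<open>The mixed second derivative of the multiplication at the unit, \<open>U\<close> acting
  on the left factor and \<open>W\<close> on the right one. Its antisymmetric part gives the Lie
  bracket.\<close>

definition "m12 U W = frechet_derivative (\<lambda>\<eta>. M \<eta> W) (at \<eta>0) U"

lemma m12: "((\<lambda>\<eta>. M \<eta> W) has_derivative (\<lambda>U. m12 U W)) (at \<eta>0)"
  unfolding m12_def by (rule smooth_on_has_derivative[OF M_smooth \<eta>0(1)])

lemma m12_eq: "m12 U W = frechet_derivative (\<lambda>q. Dmm q (0, W)) (at (\<eta>0, \<eta>0)) (U, 0)"
proof -
  note O = Om_unit(1)[OF \<eta>0(1)]
  have "((\<lambda>\<eta>. M \<eta> W) has_derivative (\<lambda>U. frechet_derivative (\<lambda>q. Dmm q (0, W)) (at (\<eta>0, \<eta>0)) (U, 0))) (at \<eta>0)"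
    unfolding M_def
    using smooth_on_has_derivative_compose[OF smooth_on_derivative[OF Om_smooth(2), of "(0, W)"]
        has_derivative_Pair[OF has_derivative_ident has_derivative_const[of \<eta>0]], of \<eta>0] O by simp
  from has_derivative_unique[OF m12 this] show ?thesis by metis
qed

text \<open>\<open>cj\<close> is conjugation of the second argument by the first, in coordinates,
  and \<open>Oc\<close> is a domain on which all intermediate products remain in the chart.\<close>

definition "Oc = {q \<in> Om. fst q \<in> Oi \<and> (mm q, ii (fst q)) \<in> Om}"
definition "cj q = mm (mm q, ii (fst q))"

lemma Oc_smooth: "open Oc" "smooth_on Oc cj"
proof -
  let ?S = "{q \<in> Om. fst q \<in> Oi}"
  have S: "open ?S" by (rule open_smooth_preimage[OF Om_smooth(1) smooth_on_fst Oi_smooth(1)])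
  have f: "smooth_on ?S (\<lambda>q. (mm q, ii (fst q)))"
    by (rule smooth_on_Pair[OF S smooth_on_subset[OF Om_smooth(2)] smooth_on_compose[OF S smooth_on_fst Oi_smooth(2)]]) auto
  have eq: "Oc = {q \<in> ?S. (mm q, ii (fst q)) \<in> Om}" by (auto simp: Oc_def)
  show "open Oc" unfolding eq by (rule open_smooth_preimage[OF S f Om_smooth(1)])
  then show "smooth_on Oc cj"
    unfolding cj_def by (rule smooth_on_compose[OF _ smooth_on_subset[OF f] Om_smooth(2)]) (auto simp: Oc_def)
qed

lemma Oc_unit: "\<eta> \<in> Oi \<Longrightarrow> (\<eta>, \<eta>0) \<in> Oc" "\<eta> \<in> Oi \<Longrightarrow> cj (\<eta>, \<eta>0) = \<eta>0"
  by (auto simp: Oc_def cj_def Om_unit Om_ii mm_unit Oi_O0 mm_ii)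

lemma Oc_slice: "open {\<zeta>. (\<eta>, \<zeta>) \<in> Oc}"
proof -
  have "open (Pair \<eta> -` Oc)" by (intro open_vimage Oc_smooth continuous_intros)
  then show ?thesis by (simp add: vimage_def)
qed

lemma cj_conj: "q \<in> Oc \<Longrightarrow> cj q = snd c0 (p (fst q) \<otimes> p (snd q) \<otimes> inv (p (fst q)))"
  "q \<in> Oc \<Longrightarrow> (cj q, fst q) \<in> Om \<and> mm (cj q, fst q) = mm q"
proof -
  assume q: "q \<in> Oc"
  then have qs: "q \<in> Om" "fst q \<in> Oi" "fst q \<in> O0" "snd q \<in> O0" and q2: "(mm q, ii (fst q)) \<in> Om"
    by (auto simp: Oc_def Om_def)
  show "cj q = snd c0 (p (fst q) \<otimes> p (snd q) \<otimes> inv (p (fst q)))"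
    unfolding cj_def mm_def[of "(mm q, ii (fst q))"] by (simp add: p_mm p_ii qs)
  have pc: "p (cj q) = p (fst q) \<otimes> p (snd q) \<otimes> inv (p (fst q))" and cO: "cj q \<in> O0"
    unfolding cj_def using p_mm[OF q2] mm_in[OF q2] by (simp_all add: p_mm p_ii qs)
  have "p (cj q) \<otimes> p (fst q) = p (fst q) \<otimes> p (snd q)"
    unfolding pc using qs by (simp add: m_assoc)
  then show "(cj q, fst q) \<in> Om \<and> mm (cj q, fst q) = mm q"
    using qs cO by (auto simp: Om_def mm_def)
qed

lemma Ad_eq:
  assumes "\<eta> \<in> Oi"
  shows "Ad G A (p \<eta>) Y = frechet_derivative cj (at (\<eta>, \<eta>0)) (0, Y)"
proof -
  let ?f = "\<lambda>x. p \<eta> \<otimes> x \<otimes> inv p \<eta>"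
  have f1: "?f \<one> = \<one>" using Oi_O0[OF assms] by simp
  have "((\<lambda>\<zeta>. cj (\<eta>, \<zeta>)) has_derivative (\<lambda>h. frechet_derivative cj (at (\<eta>, \<eta>0)) (0, h))) (at \<eta>0)"
    using smooth_on_has_derivative_compose[OF Oc_smooth(2) has_derivative_Pair[OF has_derivative_const[of \<eta>] has_derivative_ident], of \<eta>0]
      Oc_unit(1)[OF assms] by simp
  then have "((coord_at A \<one> \<circ> ?f \<circ> point_at A \<one>) has_derivative
      (\<lambda>h. frechet_derivative cj (at (\<eta>, \<eta>0)) (0, h))) (at \<eta>0)"
    by (rule has_derivative_transform_within_open[OF _ Oc_slice[of \<eta>]])
       (use Oc_unit(1)[OF assms] in \<open>auto simp: coord_at_def point_at_eq c0_def[symmetric] p_def[symmetric] cj_conj\<close>)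
  from frechet_derivative_at[OF this] show ?thesis
    unfolding Ad_def tangent_map_def f1 coord_at_def[of A "\<one>"] c0_def[symmetric] \<eta>0_def[symmetric] by metis
qed

text \<open>Conjugation satisfies \<open>mm (cj q, fst q) = mm q\<close>. Differentiating in the
  conjugated element gives \<open>MB\<close>, which expresses a left-invariant field as a right
  translate of the adjoint action. Differentiating \<open>MB\<close> at the unit yields the bracket
  plus one mixed second derivative, and symmetry identifies the latter with
  \<open>m12 Y X\<close>.\<close>

lemma lie_bracket_eq: "lie_bracket G A X Y = m12 X Y - m12 Y X"
proof -
  \<comment> \<open>\<open>B \<eta>\<close> is the adjoint action of \<open>p \<eta>\<close> on
    \<open>Y\<close>, so its derivative at the unit is the bracket.\<close>
  define B where "B \<eta> = frechet_derivative cj (at (\<eta>, \<eta>0)) (0, Y)" for \<eta>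
  have B_smooth: "smooth_on Oi B"
    unfolding B_def
    by (rule smooth_on_compose[OF Oi_smooth(1) smooth_on_Pair[OF Oi_smooth(1) smooth_on_ident smooth_on_const]
      smooth_on_derivative[OF Oc_smooth(2)]]) (use Oc_unit in auto)
  note B' = smooth_on_has_derivative[OF B_smooth \<eta>0_Oi(1)]
  have br: "lie_bracket G A X Y = frechet_derivative B (at \<eta>0) X"
  proof -
    have "((\<lambda>z. Ad G A (point_at A \<one> z) Y) has_derivative frechet_derivative B (at \<eta>0)) (at \<eta>0)"
      by (rule has_derivative_transform_within_open[OF B' Oi_smooth(1) \<eta>0_Oi(1)])
         (simp add: Ad_eq[symmetric] B_def point_at_eq c0_def[symmetric] p_def[symmetric])
    from frechet_derivative_at[OF this] show ?thesis
      unfolding lie_bracket_def coord_at_def c0_def[symmetric] \<eta>0_def[symmetric] by metis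
  qed
  have MB: "M \<eta> Y = Dmm (\<eta>0, \<eta>) (B \<eta>, 0)" if "\<eta> \<in> Oi" for \<eta>
  proof -
    note O = Oi_O0[OF that]
    have "((\<lambda>\<zeta>. cj (\<eta>, \<zeta>)) has_derivative (\<lambda>h. frechet_derivative cj (at (\<eta>, \<eta>0)) (0, h))) (at \<eta>0)"
      using smooth_on_has_derivative_compose[OF Oc_smooth(2) has_derivative_Pair[OF has_derivative_const[of \<eta>] has_derivative_ident], of \<eta>0]
        Oc_unit(1)[OF that] by simp
    from mm_left_derivative[OF Om_unit(2)[OF O] this Oc_unit(2)[OF that]]
    have "((\<lambda>\<zeta>. mm (cj (\<eta>, \<zeta>), \<eta>)) has_derivative
        (\<lambda>h. Dmm (\<eta>0, \<eta>) (frechet_derivative cj (at (\<eta>, \<eta>0)) (0, h), 0))) (at \<eta>0)" .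
    then have "((\<lambda>\<zeta>. mm (\<eta>, \<zeta>)) has_derivative
        (\<lambda>h. Dmm (\<eta>0, \<eta>) (frechet_derivative cj (at (\<eta>, \<eta>0)) (0, h), 0))) (at \<eta>0)"
      by (rule has_derivative_transform_within_open[OF _ Oc_slice[of \<eta>]])
         (use Oc_unit(1)[OF that] cj_conj(2) in force)+
    from has_derivative_unique[OF mm_right_derivative[OF Om_unit(1)[OF O] has_derivative_ident] this]
    show ?thesis unfolding M_def B_def by metis
  qed
  have B0: "B \<eta>0 = Y" using MB[OF \<eta>0_Oi(1)] by (simp add: M_\<eta>0 Dmm_left)
  have "((\<lambda>\<eta>. Dmm (\<eta>0, \<eta>) (B \<eta>, 0)) has_derivative
     (\<lambda>d. frechet_derivative (\<lambda>q. Dmm q (B \<eta>0, 0)) (at (\<eta>0, \<eta>0)) (0, d) + Dmm (\<eta>0, \<eta>0) (frechet_derivative B (at \<eta>0) d, 0))) (at \<eta>0)"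
  proof (rule has_derivative_eval_derivative[OF Om_smooth])
    show "(\<eta>0, \<eta>0) \<in> Om" by (rule Om_unit(1)[OF \<eta>0(1)])
    show "((\<lambda>\<eta>. (\<eta>0, \<eta>)) has_derivative (\<lambda>d. (0, d))) (at \<eta>0)"
      by (rule has_derivative_Pair[OF has_derivative_const has_derivative_ident])
    show "((\<lambda>\<eta>. (B \<eta>, 0)) has_derivative (\<lambda>d. (frechet_derivative B (at \<eta>0) d, 0))) (at \<eta>0)"
      by (rule has_derivative_Pair[OF B' has_derivative_const])
  qed
  then have "((\<lambda>\<eta>. M \<eta> Y) has_derivative
     (\<lambda>d. frechet_derivative (\<lambda>q. Dmm q (Y, 0)) (at (\<eta>0, \<eta>0)) (0, d) + frechet_derivative B (at \<eta>0) d)) (at \<eta>0)"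
    unfolding B0 Dmm_left
    by (rule has_derivative_transform_within_open[OF _ Oi_smooth(1) \<eta>0_Oi(1)]) (simp add: MB)
  from has_derivative_unique[OF m12 this]
  have "m12 X Y = frechet_derivative (\<lambda>q. Dmm q (Y, 0)) (at (\<eta>0, \<eta>0)) (0, X) + lie_bracket G A X Y"
    unfolding br by metis
  also have "frechet_derivative (\<lambda>q. Dmm q (Y, 0)) (at (\<eta>0, \<eta>0)) (0, X) = m12 Y X"
    unfolding m12_eq by (rule second_derivative_symmetric[OF Om_smooth Om_unit(1)[OF \<eta>0(1)]])
  finally show ?thesis by simp
qed

lemma linear_m12: "linear (\<lambda>U. m12 U W)" "linear (\<lambda>W. m12 U W)"
proof -
  note O = Om_unit(1)[OF \<eta>0(1)]
  show "linear (\<lambda>U. m12 U W)" by (rule has_derivative_linear[OF m12])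
  have "m12 U W = frechet_derivative (\<lambda>q. Dmm q (U, 0)) (at (\<eta>0, \<eta>0)) (0, W)" for W
    unfolding m12_eq by (rule second_derivative_symmetric[OF Om_smooth O])
  then have e: "(\<lambda>W. m12 U W) = frechet_derivative (\<lambda>q. Dmm q (U, 0)) (at (\<eta>0, \<eta>0)) \<circ> (\<lambda>W. (0, W))" by auto
  show "linear (\<lambda>W. m12 U W)" unfolding e
    by (rule linear_compose[OF _ smooth_on_linear_derivative[OF smooth_on_derivative[OF Om_smooth(2)] O]])
       (simp add: linear_iff)
qed

lemma lie_bracket_combination:
  "lie_bracket G A Y (c *\<^sub>R X - d *\<^sub>R Y) = - (c *\<^sub>R lie_bracket G A X Y)"
  using linear_m12 by (simp add: lie_bracket_eq linear_diff[of "\<lambda>W. m12 _ W"] linear_diff[of "\<lambda>U. m12 U _"]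
      linear_cmul[of "\<lambda>W. m12 _ W"] linear_cmul[of "\<lambda>U. m12 U _"] algebra_simps)

end

section \<open>One-parameter subgroups\<close>

context group
begin

lemma local_hom_multiple:
  fixes f :: "real \<Rightarrow> 'a" and e :: real
  assumes f: "\<And>t. \<bar>t\<bar> < e \<Longrightarrow> f t \<in> carrier G"
    and hom: "\<And>s t. \<bar>s\<bar> < e \<Longrightarrow> \<bar>t\<bar> < e \<Longrightarrow> f (s + t) = f s \<otimes> f t"
    and u: "\<bar>real n * u\<bar> < e"
  shows "f (real n * u) = f u [^] n"
  using u
proof (induction n)
  case 0
  then have "f 0 = f 0 \<otimes> f 0" "f 0 \<in> carrier G" using hom[of 0 0] f[of 0] by auto
  then show ?case using l_cancel_one by (metis nat_pow_0 mult_zero_left of_nat_0)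
next
  case (Suc n)
  have "\<bar>real n * u\<bar> \<le> \<bar>real (Suc n) * u\<bar>" "\<bar>u\<bar> \<le> \<bar>real (Suc n) * u\<bar>"
    unfolding abs_mult by (auto intro!: mult_right_mono simp: mult_le_cancel_right1)
  then have b: "\<bar>real n * u\<bar> < e" "\<bar>u\<bar> < e" using Suc.prems by linarith+
  have "f (real (Suc n) * u) = f (real n * u + u)" by (simp add: algebra_simps)
  also have "\<dots> = f (real n * u) \<otimes> f u" by (rule hom[OF b])
  finally show ?case using Suc.IH[OF b(1)] by simp
qed

text \<open>Subdivision: divide \<open>t\<close> by a large \<open>k\<close>, apply
  \<open>f\<close>, and take the k-th power. Two choices of \<open>k\<close> are compared through
  their product.\<close>

lemma local_hom_extends:
  fixes f :: "real \<Rightarrow> 'a" and e :: real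
  assumes e: "e > 0" and f: "\<And>t. \<bar>t\<bar> < e \<Longrightarrow> f t \<in> carrier G"
    and hom: "\<And>s t. \<bar>s\<bar> < e \<Longrightarrow> \<bar>t\<bar> < e \<Longrightarrow> f (s + t) = f s \<otimes> f t"
  obtains F where "\<And>t. F t \<in> carrier G" "\<And>s t. F (s + t) = F s \<otimes> F t" "\<And>t. \<bar>t\<bar> < e \<Longrightarrow> F t = f t"
proof -
  \<comment> \<open>The summand 1 makes the bound on \<open>t / real k\<close> strict and
    \<open>k\<close> positive.\<close>
  define K where "K t = nat \<lceil>\<bar>t\<bar> / e\<rceil> + 1" for t
  have K: "\<bar>t / real k\<bar> < e \<and> k > 0" if "k \<ge> K t" for t k
  proof -
    have "\<bar>t\<bar> / e < real (K t)" unfolding K_def by linarith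
    also have "\<dots> \<le> real k" using that by simp
    finally have "\<bar>t\<bar> / e < real k" .
    moreover have "k > 0" using that by (simp add: K_def)
    ultimately show ?thesis using e by (simp add: field_simps)
  qed
  have indep: "f (t / real k) [^] k = f (t / real l) [^] l" if "k \<ge> K t" "l \<ge> K t" for t k l
  proof -
    have *: "f (t / real k) [^] k = f (t / real (k * l)) [^] (k * l)" if "k \<ge> K t" "l \<ge> K t" for k l
    proof -
      note Kk = K[OF that(1)] and Kl = K[OF that(2)]
      have 1: "real l * (t / real (k * l)) = t / real k" using Kl by simp
      have "\<bar>t / real (k * l)\<bar> \<le> \<bar>t / real k\<bar>"
        using Kk Kl by (auto simp: abs_divide field_simps mult_le_cancel_left1)
      then have c: "f (t / real (k * l)) \<in> carrier G" using Kk f by simp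
      have "f (t / real k) = f (t / real (k * l)) [^] l"
        using local_hom_multiple[of e f l "t / real (k * l)"] f hom Kk 1 by simp
      then show ?thesis using nat_pow_pow[OF c] by (simp add: mult.commute)
    qed
    show ?thesis using *[OF that] *[OF that(2,1)] by (simp add: mult.commute)
  qed
  define F where "F t = f (t / real (K t)) [^] K t" for t
  have F: "F t = f (t / real k) [^] k" if "k \<ge> K t" for t k
    unfolding F_def by (rule indep[OF order_refl that])
  show thesis
  proof
    show "F t \<in> carrier G" for t unfolding F_def using f K[OF order_refl, of t] by simp
    show "F t = f t" if "\<bar>t\<bar> < e" for t
    proof -
      have "real (K t) * (t / real (K t)) = t" using K[OF order_refl, of t] by simp
      then show ?thesis
        unfolding F_def using local_hom_multiple[of e f "K t" "t / real (K t)"] f hom that by simp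
    qed
    show "F (s + t) = F s \<otimes> F t" for s t
    proof -
      define k where "k = K s + K t + K (s + t)"
      have k: "k \<ge> K s" "k \<ge> K t" "k \<ge> K (s + t)" by (auto simp: k_def)
      have b: "\<bar>s / real k\<bar> < e" "\<bar>t / real k\<bar> < e" using K[OF k(1)] K[OF k(2)] by auto
      have comm: "f (s / real k) \<otimes> f (t / real k) = f (t / real k) \<otimes> f (s / real k)"
        using hom[OF b] hom[OF b(2,1)] by (simp add: add.commute)
      have "F (s + t) = f (s / real k + t / real k) [^] k" by (simp add: F[OF k(3)] add_divide_distrib)
      also have "\<dots> = (f (s / real k) \<otimes> f (t / real k)) [^] k" by (simp add: hom[OF b])
      also have "\<dots> = f (s / real k) [^] k \<otimes> f (t / real k) [^] k"
        by (rule pow_mult_distrib[OF comm f[OF b(1)] f[OF b(2)]])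
      finally show ?thesis by (simp add: F[OF k(1)] F[OF k(2)])
    qed
  qed
qed

lemma real_hom_eqI:
  fixes F F' :: "real \<Rightarrow> 'a" and e :: real
  assumes e: "e > 0" and F: "\<And>t. F t \<in> carrier G" "\<And>s t. F (s + t) = F s \<otimes> F t"
    and F': "\<And>t. F' t \<in> carrier G" "\<And>s t. F' (s + t) = F' s \<otimes> F' t"
    and eq: "\<And>t. \<bar>t\<bar> < e \<Longrightarrow> F t = F' t"
  shows "F = F'"
proof
  fix t
  define k where "k = nat \<lceil>\<bar>t\<bar> / e\<rceil> + 1"
  have "\<bar>t\<bar> / e < real k" unfolding k_def by linarith
  moreover have k0: "k > 0" by (simp add: k_def)
  ultimately have k: "\<bar>t / real k\<bar> < e" "k > 0" using e by (simp_all add: field_simps)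
  \<comment> \<open>For a global homomorphism any bound above the absolute value of \<open>t\<close>
    can serve as the \<open>e\<close> of \<open>local_hom_multiple\<close>.\<close>
  have *: "H t = H (t / real k) [^] k" if "\<And>t. H t \<in> carrier G" "\<And>s t. H (s + t) = H s \<otimes> H t" for H :: "real \<Rightarrow> 'a"
    using local_hom_multiple[of "\<bar>t\<bar> + 1" H k "t / real k"] that k(2) by simp
  show "F t = F' t" using *[OF F] *[OF F'] eq[OF k(1)] by simp
qed

end

section \<open>Smooth curves in a manifold\<close>

lemma points_line: "points line_atlas = UNIV"
  by (simp add: points_def line_atlas_def)

lemma smooth_map_line:
  assumes "smooth_map line_atlas A \<gamma>" "d \<in> A"
  shows "open {t. \<gamma> t \<in> fst d}" "smooth_on {t. \<gamma> t \<in> fst d} (snd d \<circ> \<gamma>)"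
proof -
  have l: "(UNIV, \<lambda>t. t) \<in> line_atlas" by (simp add: line_atlas_def)
  have "inv_chart (UNIV, \<lambda>t::real. t) = (\<lambda>t. t)"
    by (auto simp: inv_chart_def fun_eq_iff intro: inv_into_f_f[of "\<lambda>t. t" UNIV, simplified])
  then show "open {t. \<gamma> t \<in> fst d}" "smooth_on {t. \<gamma> t \<in> fst d} (snd d \<circ> \<gamma>)"
    using smooth_map_chart[OF assms(1) l assms(2)] by (simp_all add: vimage_def comp_def)
qed

lemma smooth_map_lineI:
  assumes "\<And>t. \<gamma> t \<in> points A"
    "\<And>d t. d \<in> A \<Longrightarrow> \<gamma> t \<in> fst d \<Longrightarrow> \<exists>T. open T \<and> t \<in> T \<and> \<gamma> ` T \<subseteq> fst d \<and> smooth_on T (snd d \<circ> \<gamma>)"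
  shows "smooth_map line_atlas A \<gamma>"
proof (rule smooth_mapI)
  have i: "inv_chart (UNIV, \<lambda>t::real. t) = (\<lambda>t. t)"
    by (auto simp: inv_chart_def fun_eq_iff intro: inv_into_f_f[of "\<lambda>t. t" UNIV, simplified])
  fix c d z assume c: "c \<in> line_atlas" and d: "d \<in> A" and z: "z \<in> snd c ` (fst c \<inter> \<gamma> -` fst d)"
  have c: "c = (UNIV, \<lambda>t. t)" using c by (simp add: line_atlas_def)
  have "\<gamma> z \<in> fst d" using z c by simp
  from assms(2)[OF d this] obtain T where "open T" "z \<in> T" "\<gamma> ` T \<subseteq> fst d" "smooth_on T (snd d \<circ> \<gamma>)" by blast
  then show "\<exists>T. open T \<and> z \<in> T \<and> T \<subseteq> snd c ` (fst c \<inter> \<gamma> -` fst d) \<and> smooth_on T (snd d \<circ> \<gamma> \<circ> inv_chart c)"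
    by (intro exI[of _ T]) (auto simp: c i comp_def)
qed (rule assms(1))

lemma smooth_map_line_reparam:
  assumes A: "smooth_manifold A" and g: "smooth_map line_atlas A \<gamma>" and f: "smooth_on UNIV f"
  shows "smooth_map line_atlas A (\<lambda>s. \<gamma> (f s))"
proof (rule smooth_map_compose[OF inj_charts_line inj_charts_line _ g])
  show "smooth_map line_atlas line_atlas f"
  proof (rule smooth_map_lineI)
    fix d and s :: real assume "d \<in> line_atlas"
    then have d: "d = (UNIV, \<lambda>t. t)" by (simp add: line_atlas_def)
    show "\<exists>T. open T \<and> s \<in> T \<and> f ` T \<subseteq> fst d \<and> smooth_on T (snd d \<circ> f)"
      using f by (intro exI[of _ UNIV]) (auto simp: d comp_def)
  qed (simp add: points_line)
qed

lemma has_velocity: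
  assumes A: "smooth_manifold A" and g: "smooth_map line_atlas A \<gamma>"
  shows "((coord_at A (\<gamma> t) \<circ> \<gamma>) has_vector_derivative velocity A \<gamma> t) (at t)"
proof -
  have "\<gamma> t \<in> points A"
    using smooth_map_points[OF g, of t] by (simp add: points_line)
  note e = chart_at[OF this]
  have "(snd (chart_at A (\<gamma> t)) \<circ> \<gamma>) differentiable (at t)"
    by (rule smooth_on_differentiable[OF smooth_map_line(2)[OF g e(1)]]) (use e(2) in simp)
  then show ?thesis
    unfolding velocity_def coord_at_def by (rule vector_derivative_works[THEN iffD1])
qed

section \<open>One-parameter subgroups as integral curves\<close>

context lie_group_on
begin

text \<open>Writing the curve at \<open>h\<close> as its value at \<open>t\<close> times its value
  at \<open>h - t\<close> and differentiating at \<open>h = t\<close> exhibits it as an integral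
  curve of the left-invariant field of \<open>X\<close>.\<close>

lemma one_parameter_subgroup_ode:
  assumes "one_parameter_subgroup G A X \<gamma>"
  shows "\<gamma> t \<in> carrier G" "\<gamma> 0 = \<one>" "open {t. \<gamma> t \<in> fst c0}"
    "\<gamma> t \<in> fst c0 \<Longrightarrow> ((snd c0 \<circ> \<gamma>) has_vector_derivative M ((snd c0 \<circ> \<gamma>) t) X) (at t)"
proof -
  have sm: "smooth_map line_atlas A \<gamma>" and hom: "\<And>s t. \<gamma> (s + t) = \<gamma> s \<otimes> \<gamma> t" and v: "velocity A \<gamma> 0 = X"
    using assms by (auto simp: one_parameter_subgroup_def)
  have car: "\<gamma> t \<in> carrier G" for t
    using smooth_map_points[OF sm, of t] by (simp add: points_eq points_line)
  then show "\<gamma> t \<in> carrier G" .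
  show 0: "\<gamma> 0 = \<one>" using hom[of 0 0] car[of 0] by (metis add.left_neutral l_cancel_one)
  show op: "open {t. \<gamma> t \<in> fst c0}" by (rule smooth_map_line(1)[OF sm c0(1)])
  show "((snd c0 \<circ> \<gamma>) has_vector_derivative M ((snd c0 \<circ> \<gamma>) t) X) (at t)" if t: "\<gamma> t \<in> fst c0"
  proof -
    let ?x = "snd c0 \<circ> \<gamma>"
    have x0: "(?x has_vector_derivative X) (at 0)"
      using has_velocity[OF manifold sm, of 0] unfolding v 0 by (simp add: c0_def coord_at_def)
    have "((\<lambda>h. h - t) has_derivative (\<lambda>h. h)) (at t)" by (auto intro!: derivative_eq_intros)
    from has_derivative_compose[OF this, of ?x "\<lambda>h. h *\<^sub>R X"] x0
    have 1: "((\<lambda>h. ?x (h - t)) has_derivative (\<lambda>h. h *\<^sub>R X)) (at t)"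
      by (simp add: has_vector_derivative_def)
    have xt: "?x t \<in> O0" using t by (simp add: coord_in)
    have "((\<lambda>h. mm (?x t, ?x (h - t))) has_derivative (\<lambda>h. Dmm (?x t, \<eta>0) (0, h *\<^sub>R X))) (at t)"
      by (rule mm_right_derivative[OF Om_unit(1)[OF xt] 1]) (simp add: 0 \<eta>0_def)
    moreover have "(\<lambda>h. Dmm (?x t, \<eta>0) (0, h *\<^sub>R X)) = (\<lambda>h. h *\<^sub>R M (?x t) X)"
      using linear_cmul[OF linear_M[OF xt]] by (simp add: M_def)
    ultimately have "((\<lambda>h. mm (?x t, ?x (h - t))) has_vector_derivative M (?x t) X) (at t)"
      unfolding has_vector_derivative_def by simp
    then show ?thesis
    proof (rule has_vector_derivative_transform_within_open)
      have "open ((\<lambda>h. h - t) -` {t. \<gamma> t \<in> fst c0})" by (intro open_vimage op continuous_intros)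
      then show "open ({h. \<gamma> h \<in> fst c0} \<inter> (\<lambda>h. h - t) -` {t. \<gamma> t \<in> fst c0})" using op by blast
      show "t \<in> {h. \<gamma> h \<in> fst c0} \<inter> (\<lambda>h. h - t) -` {t. \<gamma> t \<in> fst c0}" using t 0 c0 by simp
      show "mm (?x t, ?x (h - t)) = ?x h" if "h \<in> {h. \<gamma> h \<in> fst c0} \<inter> (\<lambda>h. h - t) -` {t. \<gamma> t \<in> fst c0}" for h
        using that t hom[of t "h - t"] by (simp add: mm_def p_coord)
    qed
  qed
qed

text \<open>Near 0 both curves solve the same differential equation; homomorphisms of the line are
  determined by their values near 0.\<close>

lemma one_parameter_subgroup_unique:
  assumes "one_parameter_subgroup G A X \<gamma>" "one_parameter_subgroup G A X \<delta>"
  shows "\<gamma> = \<delta>"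
proof -
  note g = one_parameter_subgroup_ode[OF assms(1)] and d = one_parameter_subgroup_ode[OF assms(2)]
  have "open ({t. \<gamma> t \<in> fst c0} \<inter> {t. \<delta> t \<in> fst c0})" "0 \<in> {t. \<gamma> t \<in> fst c0} \<inter> {t. \<delta> t \<in> fst c0}"
    using g(2,3) d(2,3) c0 by auto
  then obtain e where e: "e > 0" "ball 0 e \<subseteq> {t. \<gamma> t \<in> fst c0} \<inter> {t. \<delta> t \<in> fst c0}"
    using openE by blast
  have eq: "\<gamma> t = \<delta> t" if "\<bar>t\<bar> < e" for t
  proof -
    have *: "(snd c0 \<circ> \<gamma>) t = (snd c0 \<circ> \<delta>) t"
    proof (rule ode_solution_unique[OF O0_open M_smooth[of X], where I = "ball 0 e" and \<tau> = 0
          and x = "snd c0 \<circ> \<gamma>" and y = "snd c0 \<circ> \<delta>"])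
      show "(snd c0 \<circ> \<gamma>) s \<in> O0" "((snd c0 \<circ> \<gamma>) has_vector_derivative M ((snd c0 \<circ> \<gamma>) s) X) (at s)"
        "(snd c0 \<circ> \<delta>) s \<in> O0" "((snd c0 \<circ> \<delta>) has_vector_derivative M ((snd c0 \<circ> \<delta>) s) X) (at s)" if "s \<in> ball 0 e" for s
        using that e(2) g(4)[of s] d(4)[of s] coord_in by auto
    qed (use e that g(2) d(2) in auto)
    have "t \<in> ball 0 e" using that by simp
    then have in_c0: "\<gamma> t \<in> fst c0" "\<delta> t \<in> fst c0" using e(2) by auto
    have "p (snd c0 (\<gamma> t)) = p (snd c0 (\<delta> t))" using * by simp
    then show ?thesis unfolding p_coord[OF in_c0(1)] p_coord[OF in_c0(2)] .
  qed
  note hom = assms[unfolded one_parameter_subgroup_def, THEN conjunct2, THEN conjunct1, rule_format]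
  from real_hom_eqI[OF e(1) g(1) hom(1) d(1) hom(2) eq] show ?thesis .
qed

text \<open>The integral curve through the unit is a local homomorphism, because shifting time and
  translating from the left produce solutions of the same equation. Subdivision extends it to the
  line.\<close>

lemma one_parameter_subgroup_exists: "\<exists>\<gamma>. one_parameter_subgroup G A X \<gamma>"
proof -
  obtain e x where e: "e > 0" "x 0 = \<eta>0" and xO: "\<And>t. \<bar>t\<bar> < e \<Longrightarrow> x t \<in> O0"
    and x': "\<And>t. \<bar>t\<bar> < e \<Longrightarrow> (x has_vector_derivative M (x t) X) (at t)"
  proof (rule ode_solution_exists[OF O0_open M_smooth[of X] \<eta>0(1)])
    fix e x assume "e > 0" "x 0 = \<eta>0" "\<And>t. \<bar>t\<bar> < e \<Longrightarrow> x t \<in> O0"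
      "\<And>t. \<bar>t\<bar> < e \<Longrightarrow> (x has_vector_derivative M (x t) X) (at t)"
    then show thesis by (rule that)
  qed
  have cont: "isCont x 0" using x'[of 0] e(1) has_vector_derivative_continuous by auto
  obtain U V where UV: "open U" "open V" "\<eta>0 \<in> U" "\<eta>0 \<in> V" "U \<times> V \<subseteq> Om"
    by (rule open_prod_elim[OF Om_smooth(1) Om_unit(1)[OF \<eta>0(1)]]) (use that in auto)
  have "\<forall>\<^sub>F t in at 0. x t \<in> U \<inter> V"
    using cont UV(1-4) e(2) unfolding isCont_def by (intro topological_tendstoD[of x \<eta>0]) auto
  then obtain d where d: "d > 0" "\<And>t. t \<noteq> 0 \<Longrightarrow> dist t 0 < d \<Longrightarrow> x t \<in> U \<inter> V"
    unfolding eventually_at by auto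
  \<comment> \<open>Half of \<open>e\<close> keeps sums of two times in the interval of the
    solution; \<open>d\<close> keeps pairs of values in the domain of the multiplication.\<close>
  define r where "r = min (e / 2) d"
  have r: "r > 0" "r \<le> e / 2" using e d by (auto simp: r_def)
  have Om: "(x s, x t) \<in> Om" if "\<bar>s\<bar> < r" "\<bar>t\<bar> < r" for s t
  proof -
    have "x u \<in> U \<inter> V" if "\<bar>u\<bar> < r" for u
      using d(2)[of u] that UV(3,4) e(2) by (cases "u = 0") (simp_all add: r_def)
    then have "x s \<in> U" "x t \<in> V" using that by blast+
    then show ?thesis using UV(5) by blast
  qed
  have loc: "p (x (s + t)) = p (x s) \<otimes> p (x t)" if s: "\<bar>s\<bar> < r" and t: "\<bar>t\<bar> < r" for s t
  proof -
    have se: "\<bar>s\<bar> < e" using s r e by simp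
    have "x (s + t) = mm (x s, x t)"
    proof (rule ode_solution_unique[OF O0_open M_smooth[of X], where I = "ball 0 r" and \<tau> = 0 and x = "\<lambda>t. x (s + t)" and y = "\<lambda>t. mm (x s, x t)"])
      fix u assume "u \<in> ball (0::real) r"
      then have u: "\<bar>u\<bar> < r" by simp
      then have su: "\<bar>s + u\<bar> < e" "\<bar>u\<bar> < e" using s r by linarith+
      show "x (s + u) \<in> O0" by (rule xO[OF su(1)])
      have "((\<lambda>u. s + u) has_vector_derivative 1) (at u)" by (auto intro!: derivative_eq_intros)
      from vector_diff_chain_at[OF this] x'[OF su(1)]
      show "((\<lambda>u. x (s + u)) has_vector_derivative M (x (s + u)) X) (at u)"
        by (fastforce simp: comp_def)
      show "mm (x s, x u) \<in> O0" by (rule mm_in[OF Om[OF s u]])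
      have "((\<lambda>u. mm (x s, x u)) has_derivative (\<lambda>h. Dmm (x s, x u) (0, h *\<^sub>R M (x u) X))) (at u)"
        by (rule mm_right_derivative[OF Om[OF s u] x'[OF su(2), unfolded has_vector_derivative_def]]) simp
      moreover have "Dmm (x s, x u) (0, h *\<^sub>R M (x u) X) = h *\<^sub>R M (mm (x s, x u)) X" for h
        using left_invariant_M[OF Om[OF s u], of "h *\<^sub>R X"] linear_cmul[OF linear_M[OF xO[OF su(2)]]]
          linear_cmul[OF linear_M[OF mm_in[OF Om[OF s u]]]] by simp
      ultimately show "((\<lambda>u. mm (x s, x u)) has_vector_derivative M (mm (x s, x u)) X) (at u)"
        unfolding has_vector_derivative_def by simp
    qed (use r(1) t e(2) mm_unit(1)[OF xO[OF se]] in auto)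
    then show ?thesis using p_mm[OF Om[OF s t]] by simp
  qed
  have pc: "p (x t) \<in> carrier G" if "\<bar>t\<bar> < r" for t using xO[of t] that r e(1) by simp
  obtain F where F: "\<And>t. F t \<in> carrier G" "\<And>s t. F (s + t) = F s \<otimes> F t" "\<And>t. \<bar>t\<bar> < r \<Longrightarrow> F t = p (x t)"
    using local_hom_extends[of r "\<lambda>t. p (x t)", OF r(1) pc loc] by blast
  have x_smooth: "smooth_on (ball 0 r) x"
    by (rule ode_solution_smooth[OF M_smooth[of X]]) (use xO x' r e(1) in auto)
  have "smooth_map line_atlas A F"
  proof (rule smooth_map_lineI)
    show "F t \<in> points A" for t using F(1) by (simp add: points_eq)
    fix d t assume d: "d \<in> A" "F t \<in> fst d"
    \<comment> \<open>Near an arbitrary time \<open>t\<close> the extension is the left translate by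
      \<open>F t\<close> of its piece near 0, so smoothness near 0 spreads.\<close>
    note L = smooth_map_chart[OF left_translation_smooth[OF F(1)[of t]] c0(1) d(1)]
    let ?S = "snd c0 ` (fst c0 \<inter> (\<lambda>x. F t \<otimes> x) -` fst d)"
    let ?g = "\<lambda>h. x (h - t)"
    have B: "open (ball t r)" by simp
    have sub: "smooth_on (ball t r) (\<lambda>h. h - t)" by (intro smooth_on_diff) auto
    have g: "smooth_on (ball t r) ?g"
      by (rule smooth_on_compose[OF B sub x_smooth]) (auto simp: dist_norm norm_minus_commute)
    define T where "T = {h \<in> ball t r. ?g h \<in> ?S}"
    have T: "open T" unfolding T_def by (rule open_smooth_preimage[OF B g L(1)])
    have Fh: "F h = F t \<otimes> p (?g h)" if "h \<in> ball t r" for h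
      using F(2)[of t "h - t"] F(3)[of "h - t"] that by (simp add: dist_real_def)
    have im: "F h \<in> fst d" "?g h \<in> O0" if "h \<in> T" for h
      using that Fh[of h] chart_image_iff[OF inj c0(1)] by (auto simp: T_def p_def O0_def)
    have "\<eta>0 \<in> ?S"
      using d(2) F(1) c0 by (auto simp: \<eta>0_def)
    then have "t \<in> T" using r(1) e(2) by (simp add: T_def)
    moreover have "smooth_on T (\<lambda>h. (snd d \<circ> (\<lambda>x. F t \<otimes> x) \<circ> inv_chart c0) (?g h))"
      by (rule smooth_on_compose[OF T smooth_on_subset[OF g] L(2)]) (auto simp: T_def)
    then have "smooth_on T (snd d \<circ> F)"
    proof (rule smooth_on_cong[OF T, rotated])
      show "(snd d \<circ> (\<lambda>x. F t \<otimes> x) \<circ> inv_chart c0) (?g h) = (snd d \<circ> F) h" if "h \<in> T" for h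
        using Fh[of h] that by (simp add: T_def p_def)
    qed
    ultimately show "\<exists>T. open T \<and> t \<in> T \<and> F ` T \<subseteq> fst d \<and> smooth_on T (snd d \<circ> F)"
      using T im(1) by blast
  qed
  moreover have "velocity A F 0 = X"
  proof -
    have F0: "F 0 = \<one>" using F(3)[of 0] r(1) by (simp add: e(2) \<eta>0)
    have "(x has_vector_derivative X) (at 0)" using x'[of 0] e by (simp add: M_\<eta>0)
    then have "((coord_at A \<one> \<circ> F) has_vector_derivative X) (at 0)"
      by (rule has_vector_derivative_transform_within_open[OF _ open_ball[of 0 r]])
         (use r e xO F(3) in \<open>auto simp: coord_at_def c0_def[symmetric] coord_p\<close>)
    then show ?thesis unfolding velocity_def F0 by (rule vector_derivative_at)
  qed
  ultimately show ?thesis using F(2) by (auto simp: one_parameter_subgroup_def)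
qed

text \<open>Rescaling time by \<open>t\<close> turns the subgroup of \<open>X\<close> into that of
  \<open>t *\<^sub>R X\<close>; evaluation at time 1 then agrees with the original curve at time
  \<open>t\<close>.\<close>

lemma one_parameter_subgroup_lie_exp: "one_parameter_subgroup G A X (\<lambda>t. lie_exp G A (t *\<^sub>R X))"
proof -
  obtain \<gamma> where g: "one_parameter_subgroup G A X \<gamma>" using one_parameter_subgroup_exists by blast
  have "lie_exp G A (t *\<^sub>R X) = \<gamma> t" for t
  proof -
    have sm: "smooth_map line_atlas A \<gamma>" and hom: "\<And>s t. \<gamma> (s + t) = \<gamma> s \<otimes> \<gamma> t" and v: "velocity A \<gamma> 0 = X"
      using g by (auto simp: one_parameter_subgroup_def)
    have "one_parameter_subgroup G A (t *\<^sub>R X) (\<lambda>s. \<gamma> (t * s))"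
      unfolding one_parameter_subgroup_def
    proof (intro conjI allI)
      show "smooth_map line_atlas A (\<lambda>s. \<gamma> (t * s))" by (rule smooth_map_line_reparam[OF manifold sm smooth_on_bounded_linear[OF bounded_linear_mult_right]])
      show "\<gamma> (t * (s + s')) = \<gamma> (t * s) \<otimes> \<gamma> (t * s')" for s s' by (simp add: distrib_left hom)
      have 1: "((*) t has_vector_derivative t) (at 0)"
        unfolding has_vector_derivative_def by (auto intro!: derivative_eq_intros)
      have 2: "((coord_at A (\<gamma> 0) \<circ> \<gamma>) has_vector_derivative X) (at (t * 0))"
        using has_velocity[OF manifold sm, of 0] v by simp
      have "((coord_at A (\<gamma> 0) \<circ> \<gamma> \<circ> (*) t) has_vector_derivative t *\<^sub>R X) (at 0)"
        by (rule vector_diff_chain_at[OF 1 2])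
      then show "velocity A (\<lambda>s. \<gamma> (t * s)) 0 = t *\<^sub>R X"
        unfolding velocity_def by (intro vector_derivative_at) (simp add: comp_def)
    qed
    then have "(THE \<gamma>. one_parameter_subgroup G A (t *\<^sub>R X) \<gamma>) = (\<lambda>s. \<gamma> (t * s))"
      using one_parameter_subgroup_unique by (intro the_equality) metis+
    then show ?thesis by (simp add: lie_exp_def)
  qed
  then show ?thesis using g by simp
qed

end

section \<open>Smooth solutions of linear systems and the inverse function theorem\<close>

lemma matrix_inv_mult:
  fixes A :: "real ^ 'n ^ 'n"
  assumes "det A \<noteq> 0"
  shows "A ** matrix_inv A = mat 1" "matrix_inv A ** A = mat 1"
proof -
  have "\<exists>A'. A ** A' = mat 1 \<and> A' ** A = mat 1"
    using assms invertible_det_nz[of A] by (simp add: invertible_def)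
  from someI_ex[OF this] show "A ** matrix_inv A = mat 1" "matrix_inv A ** A = mat 1"
    by (simp_all add: matrix_inv_def)
qed

lemma matrix_inv_vector:
  fixes A :: "real ^ 'n ^ 'n"
  assumes "det A \<noteq> 0"
  shows "A *v x = b \<longleftrightarrow> x = matrix_inv A *v b"
  using matrix_inv_mult[OF assms] by (metis matrix_vector_mul_assoc matrix_vector_mul_lid)

lemma smooth_on_det:
  fixes A :: "'a::real_normed_vector \<Rightarrow> real ^ 'n ^ 'n"
  assumes "open S" "\<And>i j. smooth_on S (\<lambda>x. A x $ i $ j)"
  shows "smooth_on S (\<lambda>x. det (A x))"
  unfolding det_def
  by (rule smooth_on_sum[OF assms(1)], rule smooth_on_mult[OF assms(1) smooth_on_const],
      rule smooth_on_prod[OF assms(1)], rule assms(2))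

text \<open>Cramer's rule writes the solution as quotients of determinants, which are polynomials in
  the entries.\<close>

lemma smooth_on_matrix_inv:
  fixes A :: "'a::real_normed_vector \<Rightarrow> real ^ 'n ^ 'n"
  assumes S: "open S" and A: "\<And>i j. smooth_on S (\<lambda>x. A x $ i $ j)" and b: "\<And>i. smooth_on S (\<lambda>x. b x $ i)"
    and d: "\<And>x. x \<in> S \<Longrightarrow> det (A x) \<noteq> 0"
  shows "smooth_on S (\<lambda>x. matrix_inv (A x) *v b x)"
proof (rule smooth_on_cong[OF S])
  show "smooth_on S (\<lambda>x. \<chi> k. det (\<chi> i j. if j = k then b x $ i else A x $ i $ j) / det (A x))"
  proof (rule smooth_on_vec_lambda[OF S], rule smooth_on_divide[OF S])
    fix k
    show "smooth_on S (\<lambda>x. det (\<chi> i j. if j = k then b x $ i else A x $ i $ j))"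
    proof (rule smooth_on_det[OF S])
      fix i j
      show "smooth_on S (\<lambda>x. (\<chi> i j. if j = k then b x $ i else A x $ i $ j) $ i $ j)"
        using A b by (cases "j = k") simp_all
    qed
    show "smooth_on S (\<lambda>x. det (A x))" by (rule smooth_on_det[OF S A])
  qed (rule d)
  show "(\<chi> k. det (\<chi> i j. if j = k then b x $ i else A x $ i $ j) / det (A x)) = matrix_inv (A x) *v b x"
    if "x \<in> S" for x
    using cramer[OF d[OF that], of "matrix_inv (A x) *v b x" "b x"] matrix_inv_vector[OF d[OF that], of "matrix_inv (A x) *v b x" "b x"]
    by simp
qed

text \<open>Bootstrapping in several variables: the derivative of \<open>g\<close> is a smooth
  function of \<open>g\<close>, so each order of differentiability gives the next.\<close>

lemma smooth_on_autonomous: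
  fixes \<Phi> :: "'b::real_normed_vector \<Rightarrow> 'a::euclidean_space \<Rightarrow> 'a" and g :: "'b \<Rightarrow> 'a"
  assumes V: "open V" and d: "\<And>y. y \<in> V \<Longrightarrow> (g has_derivative (\<lambda>v. \<Phi> v (g y))) (at y)"
    and U: "\<And>v. smooth_on U (\<Phi> v)" "g ` V \<subseteq> U"
  shows "smooth_on V g"
proof -
  have "Ck_on k V g" for k
  proof (induction k)
    case 0
    then show ?case
      by (auto intro!: continuous_at_imp_continuous_on has_derivative_continuous[OF d])
  next
    case (Suc k)
    have "Ck_on k V (\<lambda>y. frechet_derivative g (at y) v)" for v
    proof (rule Ck_on_cong[OF V])
      show "Ck_on k V (\<lambda>y. \<Phi> v (g y))"
        by (rule Ck_on_compose[OF V Suc _ U(2)]) (use U(1) in \<open>simp add: smooth_on_def\<close>)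
      show "\<Phi> v (g y) = frechet_derivative g (at y) v" if "y \<in> V" for y
        using frechet_derivative_at[OF d[OF that]] by metis
    qed
    then show ?case using d by (auto simp: differentiable_def)
  qed
  then show ?thesis by (simp add: smooth_on_def)
qed

text \<open>The inverse function theorem gives a differentiable inverse \<open>g\<close> whose
  derivative is the inverse Jacobian taken at \<open>g y\<close>. That is an autonomous equation,
  and it upgrades \<open>g\<close> to a smooth map.\<close>

lemma smooth_local_inverse:
  fixes f :: "real ^ 'n \<Rightarrow> real ^ 'n"
  assumes U: "open U" "smooth_on U f" "a \<in> U" and id: "frechet_derivative f (at a) = (\<lambda>v. v)"
  obtains V g where "open V" "f a \<in> V" "smooth_on V g" "g (f a) = a"
    "\<And>y. y \<in> V \<Longrightarrow> g y \<in> U" "\<And>y. y \<in> V \<Longrightarrow> f (g y) = y"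
    "(g has_derivative (\<lambda>v. v)) (at (f a))"
proof -
  let ?D = "\<lambda>x. frechet_derivative f (at x)"
  have bl: "bounded_linear (?D x)" if "x \<in> U" for x
    using smooth_on_linear_derivative[OF U(2) that] by (simp add: linear_conv_bounded_linear)
  define f' where "f' x = Blinfun (?D x)" for x
  have f': "blinfun_apply (f' x) = ?D x" if "x \<in> U" for x
    unfolding f'_def by (rule bounded_linear_Blinfun_apply[OF bl[OF that]])
  have der: "(f has_derivative blinfun_apply (f' x)) (at x)" if "x \<in> U" for x
    unfolding f'[OF that] by (rule smooth_on_has_derivative[OF U(2) that])
  have cont: "continuous_on U f'"
  proof (rule continuous_on_blinfun_componentwise)
    fix i :: "real ^ 'n" assume "i \<in> Basis"
    show "continuous_on U (\<lambda>x. blinfun_apply (f' x) i)"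
      using smooth_on_continuous[OF smooth_on_derivative[OF U(2), of i]]
      by (rule continuous_on_eq) (simp add: f')
  qed
  have inv: "id_blinfun o\<^sub>L f' a = id_blinfun"
    by (rule blinfun_eqI) (simp add: f' U(3) id)
  from inverse_function_theorem[OF U(1) der cont U(3) inv]
  obtain U' V g g' where *: "open U'" "U' \<subseteq> U" "a \<in> U'" "open V" "f a \<in> V" "homeomorphism U' V f g"
    and g: "\<And>y. y \<in> V \<Longrightarrow> (g has_derivative (g' y)) (at y)"
    "\<And>y. y \<in> V \<Longrightarrow> g' y = inv_into UNIV (blinfun_apply (f' (g y)))"
    "\<And>y. y \<in> V \<Longrightarrow> bij (blinfun_apply (f' (g y)))" by blast
  have gU: "g y \<in> U" "f (g y) = y" if "y \<in> V" for y
    using *(2,6) that by (auto simp: homeomorphism_def)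
  \<comment> \<open>On this open set the Jacobian is invertible, so the right-hand side of the
    equation for \<open>g\<close> is smooth.\<close>
  define U1 where "U1 = {x \<in> U. det (matrix (?D x)) \<in> - {0}}"
  have sm: "smooth_on U (\<lambda>x. matrix (?D x) $ i $ j)" for i j
    unfolding matrix_def using smooth_on_vec_nth[OF U(1) smooth_on_derivative[OF U(2)]] by simp
  have U1: "open U1"
    unfolding U1_def by (rule open_smooth_preimage[OF U(1) smooth_on_det[OF U(1) sm]]) auto
  have gU1: "g ` V \<subseteq> U1"
  proof
    fix x assume "x \<in> g ` V"
    then obtain y where y: "y \<in> V" "x = g y" by blast
    have "bij (?D x)" using g(3)[OF y(1)] f'[OF gU(1)[OF y(1)]] y(2) by simp
    moreover have "linear (?D x)" using bl[OF gU(1)[OF y(1)]] y(2) by (simp add: bounded_linear.linear)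
    ultimately have "det (matrix (?D x)) \<noteq> 0"
      using det_nz_iff_inj[of "?D x"] bij_is_inj by blast
    then show "x \<in> U1" using gU[OF y(1)] y(2) by (simp add: U1_def)
  qed
  have "smooth_on V g"
  proof (rule smooth_on_autonomous[OF *(4), where U = U1 and \<Phi> = "\<lambda>v x. matrix_inv (matrix (?D x)) *v v"])
    fix y assume y: "y \<in> V"
    have d: "det (matrix (?D (g y))) \<noteq> 0" using gU1 y by (auto simp: U1_def)
    have lin: "linear (?D (g y))" using bl[OF gU(1)[OF y]] by (simp add: bounded_linear.linear)
    have "g' y = (\<lambda>v. matrix_inv (matrix (?D (g y))) *v v)"
    proof
      fix v
      have "?D (g y) (g' y v) = v"
        unfolding g(2)[OF y] f'[OF gU(1)[OF y]]
        using g(3)[OF y] unfolding f'[OF gU(1)[OF y]] by (simp add: bij_is_surj surj_f_inv_f)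
      then have "matrix (?D (g y)) *v g' y v = v" using lin by (simp add: matrix_works linear_matrix_vector_mul_eq)
      then show "g' y v = matrix_inv (matrix (?D (g y))) *v v" using matrix_inv_vector[OF d] by simp
    qed
    then show "(g has_derivative (\<lambda>v. matrix_inv (matrix (?D (g y))) *v v)) (at y)" using g(1)[OF y] by simp
  next
    show "smooth_on U1 (\<lambda>x. matrix_inv (matrix (?D x)) *v v)" for v
      by (rule smooth_on_matrix_inv[OF U1]) (auto simp: U1_def intro: smooth_on_subset[OF sm])
  qed (rule gU1)
  moreover have ga: "g (f a) = a" using *(3,6) by (simp add: homeomorphism_def)
  moreover have "g' (f a) = (\<lambda>v. v)"
    unfolding g(2)[OF *(5)] ga f'[OF U(3)] id using inv_id[unfolded id_def] by simp
  then have "(g has_derivative (\<lambda>v. v)) (at (f a))" using g(1)[OF *(5)] by simp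
  ultimately show thesis using that[OF *(4,5)] gU by blast
qed

section \<open>Homogeneous spaces\<close>

lemma velocity_compose:
  assumes A: "smooth_manifold A" and B: "smooth_manifold B" and f: "smooth_map A B f" and g: "smooth_map line_atlas A \<gamma>"
  shows "velocity B (\<lambda>t. f (\<gamma> t)) t = tangent_map A B f (\<gamma> t) (velocity A \<gamma> t)"
proof -
  note Ai = smooth_manifold_inj_charts[OF A]
  have pt: "\<gamma> t \<in> points A" using smooth_map_points[OF g] by (simp add: points_line)
  note e = chart_at[OF pt]
  let ?f = "coord_at B (f (\<gamma> t)) \<circ> f \<circ> point_at A (\<gamma> t)" and ?x = "coord_at A (\<gamma> t) \<circ> \<gamma>"
  have "((\<lambda>s. ?f (?x s)) has_derivative (\<lambda>h. tangent_map A B f (\<gamma> t) (h *\<^sub>R velocity A \<gamma> t))) (at t)"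
  proof (rule has_derivative_compose[OF has_velocity[OF A g, unfolded has_vector_derivative_def]])
    show "(?f has_derivative tangent_map A B f (\<gamma> t)) (at (?x t))"
      using has_derivative_tangent_map[OF Ai f pt] by simp
  qed
  then have "((\<lambda>s. ?f (?x s)) has_vector_derivative tangent_map A B f (\<gamma> t) (velocity A \<gamma> t)) (at t)"
    unfolding has_vector_derivative_def linear_cmul[OF linear_tangent_map[OF Ai f pt]] .
  then have "((coord_at B (f (\<gamma> t)) \<circ> (\<lambda>t. f (\<gamma> t))) has_vector_derivative tangent_map A B f (\<gamma> t) (velocity A \<gamma> t)) (at t)"
  proof (rule has_vector_derivative_transform_within_open[OF _ smooth_map_line(1)[OF g e(1)]])
    show "t \<in> {s. \<gamma> s \<in> fst (chart_at A (\<gamma> t))}" using e(2) by simp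
    show "?f (?x s) = (coord_at B (f (\<gamma> t)) \<circ> (\<lambda>t. f (\<gamma> t))) s" if "s \<in> {s. \<gamma> s \<in> fst (chart_at A (\<gamma> t))}" for s
      using that inv_chart_coord[OF Ai e(1)] by (simp add: point_at_eq coord_at_def)
  qed
  then show ?thesis unfolding velocity_def by (rule vector_derivative_at)
qed

text \<open>In a chart a zero velocity means a zero derivative, since \<open>chart_vec\<close> is
  injective. The curve is thus locally constant, and the line is connected.\<close>

lemma smooth_curve_const:
  assumes A: "smooth_manifold A" and g: "smooth_map line_atlas A \<gamma>" and v: "\<And>t. velocity A \<gamma> t = 0"
  shows "\<gamma> s = \<gamma> t"
proof (rule connected_local_const[of UNIV])
  show "\<forall>a\<in>UNIV. \<forall>\<^sub>F b in at a. \<gamma> a = \<gamma> b"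
  proof
    fix a
    have "\<gamma> a \<in> points A" using smooth_map_points[OF g] by (simp add: points_line)
    then obtain d where d: "d \<in> A" "\<gamma> a \<in> fst d" by (auto simp: points_def)
    let ?T = "{t. \<gamma> t \<in> fst d}"
    note sm = smooth_map_line[OF g d(1)]
    obtain e where e: "e > 0" "ball a e \<subseteq> ?T" using sm(1) d(2) openE[of ?T a] by auto
    have "((snd d \<circ> \<gamma>) has_derivative (\<lambda>h. 0)) (at u)" if u: "u \<in> ?T" for u
    proof -
      have "(snd d \<circ> \<gamma>) differentiable (at u)" by (rule smooth_on_differentiable[OF sm(2) u])
      then obtain x' where x': "((snd d \<circ> \<gamma>) has_vector_derivative x') (at u)"
        using vector_derivative_works by blast
      have "chart_vec A d (snd d (\<gamma> u)) x' = 0"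
        using velocity_in_chart(1)[OF A d(1) sm(1) u _ x'] v by simp
      moreover have "inj (chart_vec A d (snd d (\<gamma> u)))"
      proof -
        obtain l where "linear l" "\<And>w. l (chart_vec A d (snd d (\<gamma> u)) w) = w"
          "\<And>w. chart_vec A d (snd d (\<gamma> u)) (l w) = w"
          by (rule chart_vec_inverse[OF A d(1), of "\<gamma> u"]) (use u in auto)
        then show ?thesis by (metis injI)
      qed
      moreover have "linear (chart_vec A d (snd d (\<gamma> u)))" using linear_chart_vec[OF A d(1)] u by auto
      ultimately have "x' = 0" by (simp add: linear_injective_0)
      then show ?thesis using x' by (simp add: has_vector_derivative_def)
    qed
    then have "((snd d \<circ> \<gamma>) has_derivative (\<lambda>h. 0)) (at u within ball a e)" if "u \<in> ball a e" for u
      using e(2) that by (blast intro: has_derivative_at_withinI)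
    from has_derivative_zero_constant[OF convex_ball this]
    obtain k where "\<And>b. b \<in> ball a e \<Longrightarrow> (snd d \<circ> \<gamma>) b = k" by blast
    then have c: "snd d (\<gamma> b) = snd d (\<gamma> a)" if "b \<in> ball a e" for b
      using that e(1) by simp
    have "\<gamma> a = \<gamma> b" if "b \<in> ball a e" for b
    proof -
      have "\<gamma> b \<in> fst d" using that e(2) by blast
      then show ?thesis
        using c[OF that] inv_chart_coord[OF smooth_manifold_inj_charts[OF A] d(1)] d(2) by metis
    qed
    then show "\<forall>\<^sub>F b in at a. \<gamma> a = \<gamma> b"
      using e(1) unfolding eventually_at_topological by (intro exI[of _ "ball a e"]) auto
  qed
qed auto

locale homogeneous_on = lie_group_on G A
  for G :: "('g, 'z) monoid_scheme" (structure) and A :: "('g, 'e::euclidean_space) atlas" +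
  fixes H :: "'g set" and B :: "('g set, real ^ 'n) atlas"
  assumes sub: "subgroup H G" and hom: "homogeneous_space G A H B"
begin

lemma B_manifold: "smooth_manifold B" and B_points: "points B = lcosets\<^bsub>G\<^esub> H"
  and pr_smooth: "smooth_map A B (\<lambda>g. g <# H)"
  and pr_surj: "g \<in> carrier G \<Longrightarrow> surj (tangent_map A B (\<lambda>g. g <# H) g)"
  using hom by (auto simp: homogeneous_space_def)

lemmas B_inj = smooth_manifold_inj_charts[OF B_manifold]

lemma H_sub: "H \<subseteq> carrier G" by (rule subgroup.subset[OF sub])

lemma pr_one: "\<one> <# H = H" by (rule lcos_mult_one[OF H_sub])

lemma act_pr: "g \<in> carrier G \<Longrightarrow> h \<in> carrier G \<Longrightarrow> g <# (h <# H) = (g \<otimes> h) <# H"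
  by (rule lcos_m_assoc[OF H_sub])

lemma pr_points: "g \<in> carrier G \<Longrightarrow> g <# H \<in> points B"
  using smooth_map_points[OF pr_smooth] points_eq by simp

lemma H_points: "H \<in> points B" using pr_points[of "\<one>"] pr_one by simp

definition "k0 = chart_at B H"
definition "\<kappa>0 = snd k0 H"
definition "P = tangent_map A B (\<lambda>g. g <# H) \<one>"

lemma k0: "k0 \<in> B" "H \<in> fst k0" using chart_at[OF H_points] by (simp_all add: k0_def)

lemma linear_P: "linear P"
  unfolding P_def by (rule linear_tangent_map[OF inj pr_smooth]) (simp add: points_eq)

lemma surj_P: "surj P" unfolding P_def by (rule pr_surj) simp

definition "pih \<eta> = snd k0 (p \<eta> <# H)"
definition "Op = {\<eta> \<in> O0. p \<eta> <# H \<in> fst k0}"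

lemma pih_smooth: "open Op" "smooth_on Op pih"
proof -
  have eq: "snd c0 ` (fst c0 \<inter> (\<lambda>g. g <# H) -` fst k0) = Op"
    by (rule Set.set_eqI) (simp add: chart_image_iff[OF inj c0(1)] Op_def O0_def p_def)
  show "open Op" using smooth_map_chart(1)[OF pr_smooth c0(1) k0(1)] unfolding eq .
  have "(snd k0 \<circ> (\<lambda>g. g <# H) \<circ> inv_chart c0) = pih" by (auto simp: pih_def p_def)
  then show "smooth_on Op pih" using smooth_map_chart(2)[OF pr_smooth c0(1) k0(1)] unfolding eq by simp
qed

lemma \<eta>0_Op: "\<eta>0 \<in> Op" "pih \<eta>0 = \<kappa>0"
  by (auto simp: Op_def pih_def \<kappa>0_def \<eta>0 pr_one k0)

lemma P_eq: "P = frechet_derivative pih (at \<eta>0)"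
proof -
  have "(coord_at B H \<circ> (\<lambda>g. g <# H) \<circ> point_at A \<one>) = pih"
    by (auto simp: pih_def p_def coord_at_def k0_def point_at_eq c0_def)
  then show ?thesis
    unfolding P_def tangent_map_def pr_one by (simp add: coord_at_def \<eta>0_def c0_def)
qed

text \<open>On the affine slice through the unit along the range of \<open>Q\<close> the projection
  has derivative \<open>P (Q v) = v\<close> at the centre, so it is locally invertible there. The
  inverse, put back into the slice, is a section with derivative \<open>Q\<close>.\<close>

lemma section_exists:
  assumes Q: "linear Q" "\<And>w. P (Q w) = w"
  obtains W \<sigma> where "open W" "\<kappa>0 \<in> W" "smooth_on W \<sigma>" "\<sigma> \<kappa>0 = \<eta>0"
    "\<And>z. z \<in> W \<Longrightarrow> \<sigma> z \<in> Op" "\<And>z. z \<in> W \<Longrightarrow> pih (\<sigma> z) = z" "(\<sigma> has_derivative Q) (at \<kappa>0)"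
proof -
  have Qb: "bounded_linear Q" using Q(1) by (simp add: linear_conv_bounded_linear)
  define h where "h r = \<eta>0 + Q r" for r
  have h_smooth: "smooth_on UNIV h"
    unfolding h_def by (intro smooth_on_add smooth_on_bounded_linear[OF Qb] smooth_on_const open_UNIV)
  have h_der: "(h has_derivative Q) (at r)" for r
    unfolding h_def using bounded_linear_imp_has_derivative[OF Qb] by (auto intro!: derivative_eq_intros)
  define U where "U = {r \<in> UNIV. h r \<in> Op}"
  have U: "open U" unfolding U_def by (rule open_smooth_preimage[OF open_UNIV h_smooth pih_smooth(1)])
  have h0: "h 0 = \<eta>0" using linear_0[OF Q(1)] by (simp add: h_def)
  have sm: "smooth_on U (\<lambda>r. pih (h r))"
    by (rule smooth_on_compose[OF U smooth_on_subset[OF h_smooth] pih_smooth(2)]) (auto simp: U_def)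
  have "((\<lambda>r. pih (h r)) has_derivative (\<lambda>v. P (Q v))) (at 0)"
    unfolding P_eq using smooth_on_has_derivative_compose[OF pih_smooth(2) h_der, of 0] \<eta>0_Op h0 by simp
  then have D: "frechet_derivative (\<lambda>r. pih (h r)) (at 0) = (\<lambda>v. v)"
    unfolding Q(2) by (rule frechet_derivative_at[symmetric])
  have U0: "0 \<in> U" using h0 \<eta>0_Op by (simp add: U_def)
  from smooth_local_inverse[OF U sm U0 D]
  obtain V g where V: "open V" "pih (h 0) \<in> V" "smooth_on V g" "g (pih (h 0)) = 0"
    "\<And>y. y \<in> V \<Longrightarrow> g y \<in> U" "\<And>y. y \<in> V \<Longrightarrow> pih (h (g y)) = y" "(g has_derivative (\<lambda>v. v)) (at (pih (h 0)))"
    by blast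
  show thesis
  proof (rule that[of V "\<lambda>z. h (g z)"])
    show "smooth_on V (\<lambda>z. h (g z))" by (rule smooth_on_compose[OF V(1,3) h_smooth]) simp
    show "((\<lambda>z. h (g z)) has_derivative Q) (at \<kappa>0)"
      using has_derivative_compose[OF V(7) h_der] by (simp add: h0 \<eta>0_Op)
  qed (use V h0 \<eta>0_Op in \<open>auto simp: U_def\<close>)
qed

section \<open>Differentials of the translations of the homogeneous space\<close>

abbreviation "tr g \<equiv> tangent_map B B (\<lambda>x. g <# x) H"

text \<open>Near H the translation by \<open>g\<close> is a local section followed by the smooth map
  sending \<open>x\<close> to the coset of \<open>g \<otimes> x\<close>; this yields its derivative.
  Surjectivity comes from the submersion property at \<open>g\<close> together with invertibility of
  left translation on the group.\<close>

lemma translation_tangent: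
  assumes g: "g \<in> carrier G"
  shows "((coord_at B (g <# H) \<circ> (\<lambda>x. g <# x) \<circ> point_at B H) has_derivative tr g) (at \<kappa>0)"
    "tr g (P u) = tangent_map A B (\<lambda>x. (g \<otimes> x) <# H) \<one> u"
    "tangent_map A B (\<lambda>x. (g \<otimes> x) <# H) \<one> u = tangent_map A B (\<lambda>x. x <# H) g (tangent_map A A (\<lambda>x. g \<otimes> x) \<one> u)"
    "linear (tr g)" "surj (tr g)"
proof -
  have 1: "\<one> \<in> points A" by (simp add: points_eq)
  note L = left_translation_smooth[OF g]
  have pL: "smooth_map A B (\<lambda>x. (g \<otimes> x) <# H)" by (rule smooth_map_compose[OF inj inj L pr_smooth])
  let ?l = "coord_at B (g <# H) \<circ> (\<lambda>x. g <# x) \<circ> point_at B H"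
  let ?m = "coord_at B (g <# H) \<circ> (\<lambda>x. (g \<otimes> x) <# H) \<circ> point_at A \<one>"
  have m: "(?m has_derivative tangent_map A B (\<lambda>x. (g \<otimes> x) <# H) \<one>) (at \<eta>0)"
    using has_derivative_tangent_map[OF inj pL 1] g by (simp add: coord_at_def \<eta>0_def c0_def)
  obtain Q where Q: "linear Q" "\<And>w. P (Q w) = w"
    using linear_surjective_right_inverse[OF linear_P surj_P] by (auto simp: fun_eq_iff)
  obtain W \<sigma> where W: "open W" "\<kappa>0 \<in> W" "smooth_on W \<sigma>" "\<sigma> \<kappa>0 = \<eta>0"
    "\<And>z. z \<in> W \<Longrightarrow> \<sigma> z \<in> Op" "\<And>z. z \<in> W \<Longrightarrow> pih (\<sigma> z) = z" "(\<sigma> has_derivative Q) (at \<kappa>0)"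
    using section_exists[OF Q] by metis
  have "((\<lambda>z. ?m (\<sigma> z)) has_derivative (\<lambda>w. tangent_map A B (\<lambda>x. (g \<otimes> x) <# H) \<one> (Q w))) (at \<kappa>0)"
    by (rule has_derivative_compose[OF W(7)]) (use m W(4) in \<open>simp only:\<close>)
  then have l: "(?l has_derivative (\<lambda>w. tangent_map A B (\<lambda>x. (g \<otimes> x) <# H) \<one> (Q w))) (at \<kappa>0)"
  proof (rule has_derivative_transform_within_open[OF _ W(1,2)])
    fix z assume z: "z \<in> W"
    have O: "\<sigma> z \<in> O0" "p (\<sigma> z) <# H \<in> fst k0" using W(5)[OF z] by (auto simp: Op_def)
    have "point_at B H z = inv_chart k0 (snd k0 (p (\<sigma> z) <# H))"
      using W(6)[OF z] by (simp add: point_at_eq k0_def[symmetric] pih_def)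
    also have "\<dots> = p (\<sigma> z) <# H" by (rule inv_chart_coord[OF B_inj k0(1) O(2)])
    finally show "?m (\<sigma> z) = ?l z"
      using act_pr[OF g p_carrier[OF O(1)]] by (simp add: point_at_eq c0_def[symmetric] p_def)
  qed
  have trg: "tr g = (\<lambda>w. tangent_map A B (\<lambda>x. (g \<otimes> x) <# H) \<one> (Q w))"
    unfolding tangent_map_def[of B B] using frechet_derivative_at[OF l] by (simp add: coord_at_def \<kappa>0_def k0_def)
  show tr: "(?l has_derivative tr g) (at \<kappa>0)" unfolding trg by (rule l)
  show lin: "linear (tr g)" by (rule has_derivative_linear[OF tr])
  show P: "tr g (P u) = tangent_map A B (\<lambda>x. (g \<otimes> x) <# H) \<one> u" for u
  proof -
    have "((coord_at B (g <# H) \<circ> (\<lambda>x. g <# (x <# H)) \<circ> point_at A \<one>) has_derivative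
       (\<lambda>u. tr g (P u))) (at \<eta>0)"
      using tangent_map_chain[OF manifold B_inj pr_smooth 1, of B "\<lambda>x. g <# x" "tr g"] tr
      by (simp add: pr_one P_def coord_at_def \<kappa>0_def k0_def \<eta>0_def c0_def)
    then have "(?m has_derivative (\<lambda>u. tr g (P u))) (at \<eta>0)"
      by (rule has_derivative_transform_within_open[OF _ O0_open \<eta>0(1)])
         (use act_pr[OF g p_carrier] in \<open>simp add: point_at_eq c0_def[symmetric] p_def[symmetric]\<close>)
    from has_derivative_unique[OF this m] show ?thesis by metis
  qed
  show ch: "tangent_map A B (\<lambda>x. (g \<otimes> x) <# H) \<one> u = tangent_map A B (\<lambda>x. x <# H) g (tangent_map A A (\<lambda>x. g \<otimes> x) \<one> u)" for u
    using tangent_map_compose[OF manifold inj L pr_smooth 1] g by simp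
  \<comment> \<open>Differentiating the composite of the translations by the inverse of
    \<open>g\<close> and by \<open>g\<close> gives a right inverse of the differential.\<close>
  have Lsurj: "\<exists>u. tangent_map A A (\<lambda>x. g \<otimes> x) \<one> u = w" for w
  proof -
    have ig: "inv g \<in> carrier G" "g \<in> points A" using g by (simp_all add: points_eq)
    note Li = left_translation_smooth[OF ig(1)]
    have "tangent_map A A (\<lambda>x. g \<otimes> (inv g \<otimes> x)) g =
        (\<lambda>u. tangent_map A A (\<lambda>x. g \<otimes> x) (inv g \<otimes> g) (tangent_map A A (\<lambda>x. inv g \<otimes> x) g u))"
      by (rule tangent_map_compose[OF manifold inj Li L ig(2)])
    moreover have "tangent_map A A (\<lambda>x. g \<otimes> (inv g \<otimes> x)) g = (\<lambda>u. u)"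
    proof -
      have gg: "g \<otimes> (inv g \<otimes> g) = g" using g by simp
      have "tangent_map A A (\<lambda>x. g \<otimes> (inv g \<otimes> x)) g = tangent_map A A (\<lambda>x. x) g"
        unfolding tangent_map_def gg
      proof (rule arg_cong[of _ _ "\<lambda>D. D"], rule frechet_derivative_transform_within_open)
        note e = chart_at[OF ig(2)]
        have "smooth_map A A (\<lambda>x. g \<otimes> (inv g \<otimes> x))" by (rule smooth_map_compose[OF inj inj Li L])
        from has_derivative_tangent_map[OF inj this ig(2)]
        show "coord_at A g \<circ> (\<lambda>x. g \<otimes> (inv g \<otimes> x)) \<circ> point_at A g differentiable at (coord_at A g g)"
          using gg by (auto simp: differentiable_def)
        show "open (snd (chart_at A g) ` fst (chart_at A g))" by (rule chart_open[OF manifold e(1)])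
        show "coord_at A g g \<in> snd (chart_at A g) ` fst (chart_at A g)" using e(2) by (simp add: coord_at_def)
        fix z assume "z \<in> snd (chart_at A g) ` fst (chart_at A g)"
        then have "point_at A g z \<in> carrier G"
          using chart_in_points[OF e(1) inv_chart_in] points_eq by (simp add: point_at_eq)
        then have "g \<otimes> (inv g \<otimes> point_at A g z) = point_at A g z" using g by (simp add: m_assoc[symmetric])
        then show "(coord_at A g \<circ> (\<lambda>x. g \<otimes> (inv g \<otimes> x)) \<circ> point_at A g) z = (coord_at A g \<circ> (\<lambda>x. x) \<circ> point_at A g) z"
          by simp
      qed
      then show ?thesis using tangent_map_ident[OF manifold ig(2)] by simp
    qed
    ultimately have "tangent_map A A (\<lambda>x. g \<otimes> x) (inv g \<otimes> g) (tangent_map A A (\<lambda>x. inv g \<otimes> x) g w) = w"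
      by (metis (no_types))
    then show ?thesis using g by (metis l_inv)
  qed
  show "surj (tr g)"
    unfolding surj_def
  proof
    fix w
    obtain x where "tangent_map A B (\<lambda>x. x <# H) g x = w" using pr_surj[OF g] unfolding surj_def by metis
    moreover obtain u where "tangent_map A A (\<lambda>x. g \<otimes> x) \<one> u = x" using Lsurj by blast
    ultimately have "tr g (P u) = w" using P[of u] ch[of u] by simp
    then show "\<exists>z. w = tr g z" by blast
  qed
qed

section \<open>The isotropy algebra\<close>

lemma exp_curve:
  shows "smooth_map line_atlas A (\<lambda>t. lie_exp G A (t *\<^sub>R X))" "lie_exp G A (0 *\<^sub>R X) = \<one>"
    "velocity A (\<lambda>t. lie_exp G A (t *\<^sub>R X)) 0 = X" "lie_exp G A (t *\<^sub>R X) \<in> carrier G"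
    "lie_exp G A ((s + t) *\<^sub>R X) = lie_exp G A (s *\<^sub>R X) \<otimes> lie_exp G A (t *\<^sub>R X)"
  using one_parameter_subgroup_lie_exp[of X] one_parameter_subgroup_ode(1,2)[OF one_parameter_subgroup_lie_exp[of X]]
  unfolding one_parameter_subgroup_def by auto

lemma origin_vector_eq: "origin_vector G A H B w = P w"
  unfolding origin_vector_def
  using velocity_compose[OF manifold B_manifold pr_smooth exp_curve(1)[of w], of 0] exp_curve(2,3)[of w]
  by (simp add: P_def)

lemma coset_eq_H_iff: "g \<in> carrier G \<Longrightarrow> g <# H = H \<longleftrightarrow> g \<in> H"
proof
  assume g: "g \<in> carrier G" and "g <# H = H"
  then show "g \<in> H" using lcos_self[OF g sub] by simp
next
  assume g: "g \<in> carrier G" and gH: "g \<in> H"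
  show "g <# H = H"
  proof
    show "g <# H \<subseteq> H" using gH subgroup.m_closed[OF sub] by (auto simp: l_coset_def)
    show "H \<subseteq> g <# H"
    proof
      fix h assume h: "h \<in> H"
      then have "inv g \<otimes> h \<in> H" "h = g \<otimes> (inv g \<otimes> h)"
        using gH g H_sub subgroup.m_closed[OF sub] subgroup.m_inv_closed[OF sub]
        by (auto simp: m_assoc[symmetric] subset_iff)
      then show "h \<in> g <# H" unfolding l_coset_def by blast
    qed
  qed
qed

text \<open>The nontrivial direction: at every time the velocity of the projected one-parameter
  subgroup is a translate of \<open>P X\<close>. If \<open>P X\<close> vanishes, the projected curve
  stays at H.\<close>

lemma subgroup_algebra_eq: "X \<in> subgroup_algebra G A H \<longleftrightarrow> P X = 0"
proof
  assume "X \<in> subgroup_algebra G A H"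
  then have "lie_exp G A (t *\<^sub>R X) <# H = H" for t
    using coset_eq_H_iff[OF exp_curve(4)] by (simp add: subgroup_algebra_def)
  then have "origin_vector G A H B X = 0"
    unfolding origin_vector_def velocity_def by (simp add: comp_def)
  then show "P X = 0" by (simp add: origin_vector_eq)
next
  assume PX: "P X = 0"
  define \<gamma> where "\<gamma> t = lie_exp G A (t *\<^sub>R X)" for t
  have sm: "smooth_map line_atlas A \<gamma>" and \<gamma>0: "\<gamma> 0 = \<one>" and v: "velocity A \<gamma> 0 = X"
    and car: "\<gamma> t \<in> carrier G" and add: "\<gamma> (s + t) = \<gamma> s \<otimes> \<gamma> t" for s t
    using exp_curve[where X = X] unfolding \<gamma>_def by simp_all
  have "\<gamma> t <# H = \<gamma> 0 <# H" for t
  proof (rule smooth_curve_const[OF B_manifold])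
    show "smooth_map line_atlas B (\<lambda>t. \<gamma> t <# H)"
      by (rule smooth_map_compose[OF inj_charts_line inj sm pr_smooth])
    fix t
    have "smooth_on UNIV (\<lambda>s::real. s - t)" by (intro smooth_on_diff) auto
    note sh = smooth_map_line_reparam[OF manifold sm this]
    have "((coord_at A (\<gamma> 0) \<circ> \<gamma>) has_vector_derivative X) (at (t - t))"
      using has_velocity[OF manifold sm, of 0] v by simp
    then have "((coord_at A (\<gamma> 0) \<circ> \<gamma> \<circ> (\<lambda>s. s - t)) has_vector_derivative 1 *\<^sub>R X) (at t)"
      by (rule vector_diff_chain_at[rotated]) (auto intro!: derivative_eq_intros simp: has_vector_derivative_def)
    then have vs: "velocity A (\<lambda>s. \<gamma> (s - t)) t = X"
      unfolding velocity_def by (intro vector_derivative_at) (simp add: comp_def)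
    have "(\<lambda>s. \<gamma> s <# H) = (\<lambda>s. (\<gamma> t \<otimes> \<gamma> (s - t)) <# H)"
    proof
      fix s
      have "t + (s - t) = s" by simp
      then show "\<gamma> s <# H = (\<gamma> t \<otimes> \<gamma> (s - t)) <# H" using add[of t "s - t"] by metis
    qed
    then have "velocity B (\<lambda>s. \<gamma> s <# H) t = tangent_map A B (\<lambda>x. (\<gamma> t \<otimes> x) <# H) \<one> X"
      using velocity_compose[OF manifold B_manifold smooth_map_compose[OF inj inj left_translation_smooth[OF car[of t]] pr_smooth] sh, of t]
      unfolding vs by (simp only: diff_self \<gamma>0)
    also have "\<dots> = tr (\<gamma> t) (P X)" by (rule translation_tangent(2)[OF car, symmetric])
    also have "\<dots> = 0" unfolding PX by (rule linear_0[OF translation_tangent(4)[OF car]])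
    finally show "velocity B (\<lambda>t. \<gamma> t <# H) t = 0" .
  qed
  then have "\<gamma> t <# H = H" for t using pr_one \<gamma>0 by metis
  then have "\<gamma> t \<in> H" for t using coset_eq_H_iff[OF car] by blast
  then show "X \<in> subgroup_algebra G A H" by (simp add: subgroup_algebra_def \<gamma>_def)
qed

text \<open>The kernel of \<open>P\<close> is the isotropy algebra, so passing to the
  \<mm>-component does not change the image under \<open>P\<close>, and \<open>P\<close> restricts
  to a bijection from \<mm> onto the tangent space, with inverse \<open>Q\<close>.\<close>

lemma reductive:
  assumes m: "reductive_decomposition G A H \<mm>"
  shows "P (m_component G A H \<mm> X) = P X"
    "\<exists>Q. linear Q \<and> (\<forall>w. P (Q w) = w \<and> Q w \<in> \<mm>) \<and> (\<forall>y\<in>\<mm>. Q (P y) = y)"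
proof -
  have sp: "subspace \<mm>" and int: "subgroup_algebra G A H \<inter> \<mm> = {0}"
    and sum: "\<And>X. \<exists>Y\<in>subgroup_algebra G A H. \<exists>Z\<in>\<mm>. X = Y + Z"
    using m by (auto simp: reductive_decomposition_def)
  have injm: "y = z" if "y \<in> \<mm>" "z \<in> \<mm>" "P y = P z" for y z
  proof -
    have "y - z \<in> \<mm>" "P (y - z) = 0" using that sp linear_diff[OF linear_P] by (auto simp: subspace_diff)
    then have "y - z \<in> subgroup_algebra G A H \<inter> \<mm>" by (simp add: subgroup_algebra_eq)
    then show ?thesis using int by simp
  qed
  have surjm: "\<exists>Z\<in>\<mm>. P Z = P X" for X
  proof -
    obtain Y Z where YZ: "Y \<in> subgroup_algebra G A H" "Z \<in> \<mm>" "X = Y + Z" using sum by blast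
    then have "P X = P Z" using linear_add[OF linear_P] by (simp add: subgroup_algebra_eq)
    then show ?thesis using YZ by auto
  qed
  have "\<exists>!Z. Z \<in> \<mm> \<and> X - Z \<in> subgroup_algebra G A H"
    using surjm[of X] injm linear_diff[OF linear_P] by (auto simp: subgroup_algebra_eq)
  from theI'[OF this] show "P (m_component G A H \<mm> X) = P X"
    unfolding m_component_def[symmetric] using linear_diff[OF linear_P] by (simp add: subgroup_algebra_eq)
  obtain Q where Q: "range Q \<subseteq> \<mm>" "linear Q" "\<And>w. w \<in> P ` \<mm> \<Longrightarrow> P (Q w) = w"
    using linear_exists_right_inverse_on[OF linear_P sp] by auto
  have "P (Q w) = w" for w
  proof -
    obtain X where "P X = w" using surj_P by (metis surjD)
    moreover obtain Z where "Z \<in> \<mm>" "P Z = P X" using surjm by blast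
    ultimately have "w \<in> P ` \<mm>" by (metis imageI)
    then show ?thesis by (rule Q(3))
  qed
  then show "\<exists>Q. linear Q \<and> (\<forall>w. P (Q w) = w \<and> Q w \<in> \<mm>) \<and> (\<forall>y\<in>\<mm>. Q (P y) = y)"
    using Q(1,2) injm by (intro exI[of _ Q]) (auto simp: image_subset_iff)
qed

end

lemma open_slices:
  fixes S :: "('a::topological_space \<times> 'b::topological_space) set"
  assumes "open S" shows "open {w. (z, w) \<in> S}" "open {z. (z, w) \<in> S}"
proof -
  have "open (Pair z -` S)" "open ((\<lambda>z. (z, w)) -` S)"
    using assms by (auto intro!: open_vimage continuous_on_Pair continuous_on_const continuous_on_id)
  then show "open {w. (z, w) \<in> S}" "open {z. (z, w) \<in> S}" by (simp_all add: vimage_def)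
qed

lemma linear_axis_sum:
  fixes f :: "real ^ 'n \<Rightarrow> 'b::real_vector"
  assumes "linear f"
  shows "f w = (\<Sum>i\<in>UNIV. (w $ i) *\<^sub>R f (axis i 1))"
proof -
  have "f w = f (\<Sum>i\<in>UNIV. (w $ i) *\<^sub>R axis i 1)"
    using basis_expansion[of w] by (simp add: scalar_mult_eq_scaleR)
  then show ?thesis by (simp add: linear_sum[OF assms] linear_cmul[OF assms])
qed

lemma chart_vec_eq_0:
  assumes A: "smooth_manifold A" and c: "c \<in> A" "z \<in> snd c ` fst c" and 0: "chart_vec A c z u = 0"
  shows "u = 0"
proof -
  note i = inv_chart_in[OF c(2)] coord_inv_chart[OF c(2)]
  obtain l where l: "linear l" "\<And>w. l (chart_vec A c (snd c (inv_chart c z)) w) = w"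
    "\<And>w. chart_vec A c (snd c (inv_chart c z)) (l w) = w"
    by (rule chart_vec_inverse[OF A c(1) i(1)]) auto
  show ?thesis using l(2)[of u] 0 linear_0[OF l(1)] i(2) by simp
qed

section \<open>The Euler-Lagrange equation\<close>

text \<open>The Euler-Lagrange equation for the 2-jet \<open>(z, w, a)\<close> of a curve.\<close>

definition euler_lagrange :: "('a \<times> 'a \<Rightarrow> real) \<Rightarrow> 'a::euclidean_space \<Rightarrow> 'a \<Rightarrow> 'a \<Rightarrow> bool" where
  "euler_lagrange \<Lambda> z w a \<longleftrightarrow>
     (\<forall>e. frechet_derivative (\<lambda>q. frechet_derivative \<Lambda> (at q) (0, e)) (at (z, w)) (w, a)
        = frechet_derivative \<Lambda> (at (z, w)) (e, 0))"

lemma has_derivative_tangent: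
  fixes \<theta> :: "'b::euclidean_space \<Rightarrow> 'a::real_normed_vector"
  assumes "open S" "smooth_on S \<theta>" "fst q \<in> S"
  shows "((\<lambda>q. (\<theta> (fst q), frechet_derivative \<theta> (at (fst q)) (snd q))) has_derivative
    (\<lambda>d. (frechet_derivative \<theta> (at (fst q)) (fst d),
       frechet_derivative (\<lambda>x. frechet_derivative \<theta> (at x) (snd q)) (at (fst q)) (fst d)
         + frechet_derivative \<theta> (at (fst q)) (snd d)))) (at q)"
  by (rule has_derivative_Pair[OF smooth_on_has_derivative_compose[OF assms(2) has_derivative_fst[OF has_derivative_ident] assms(3)]
        has_derivative_eval_derivative[OF assms has_derivative_fst[OF has_derivative_ident] has_derivative_snd[OF has_derivative_ident]]])

text \<open>Naturality of the Euler-Lagrange equation. A variation \<open>e\<close> is pushed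
  forward by the derivative of \<theta>; the second-derivative terms on the two sides agree by
  symmetry. It is applied with a coordinate change and with the projection from the group.\<close>

lemma euler_lagrange_pullback:
  fixes \<theta> :: "'b::euclidean_space \<Rightarrow> 'a::euclidean_space"
  assumes \<Lambda>: "open \<Omega>" "smooth_on \<Omega> \<Lambda>" and \<theta>: "open S" "smooth_on S \<theta>" and \<Omega>': "open \<Omega>'"
    and sub: "\<And>z w. (z, w) \<in> \<Omega>' \<Longrightarrow> z \<in> S \<and> (\<theta> z, frechet_derivative \<theta> (at z) w) \<in> \<Omega> \<and>
        \<Lambda>' (z, w) = \<Lambda> (\<theta> z, frechet_derivative \<theta> (at z) w)"
    and q: "(z, w) \<in> \<Omega>'"
    and EL: "euler_lagrange \<Lambda> (\<theta> z) (frechet_derivative \<theta> (at z) w)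
       (frechet_derivative (\<lambda>x. frechet_derivative \<theta> (at x) w) (at z) w + frechet_derivative \<theta> (at z) a)"
  shows "euler_lagrange \<Lambda>' z w a"
  unfolding euler_lagrange_def
proof
  fix e
  let ?D = "\<lambda>z. frechet_derivative \<theta> (at z)"
  let ?D2 = "\<lambda>z v u. frechet_derivative (\<lambda>x. ?D x v) (at z) u"
  let ?\<Theta> = "\<lambda>q. (\<theta> (fst q), ?D (fst q) (snd q))"
  let ?L = "\<lambda>q. frechet_derivative \<Lambda> (at q)"
  have zS: "fst q \<in> S" and \<Theta>q: "?\<Theta> q \<in> \<Omega>" and \<Lambda>q: "\<Lambda>' q = \<Lambda> (?\<Theta> q)" if "q \<in> \<Omega>'" for q
    using sub[of "fst q" "snd q"] that by auto
  have D\<Lambda>': "frechet_derivative \<Lambda>' (at q) d = ?L (?\<Theta> q) (?D (fst q) (fst d), ?D2 (fst q) (snd q) (fst d) + ?D (fst q) (snd d))"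
    if "q \<in> \<Omega>'" for q d
  proof -
    have "((\<lambda>q. \<Lambda> (?\<Theta> q)) has_derivative
       (\<lambda>d. ?L (?\<Theta> q) (?D (fst q) (fst d), ?D2 (fst q) (snd q) (fst d) + ?D (fst q) (snd d)))) (at q)"
      by (rule smooth_on_has_derivative_compose[OF \<Lambda>(2) has_derivative_tangent[OF \<theta> zS[OF that]] \<Theta>q[OF that]])
    then have "(\<Lambda>' has_derivative
       (\<lambda>d. ?L (?\<Theta> q) (?D (fst q) (fst d), ?D2 (fst q) (snd q) (fst d) + ?D (fst q) (snd d)))) (at q)"
      by (rule has_derivative_transform_within_open[OF _ \<Omega>' that]) (simp add: \<Lambda>q)
    from fun_cong[OF frechet_derivative_at[OF this, symmetric], of d] show ?thesis .
  qed
  have lin0: "?D x 0 = 0" "?D2 x v 0 = 0" if "x \<in> S" for x v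
    by (rule linear_0[OF smooth_on_linear_derivative[OF \<theta>(2) that]])
       (rule linear_0[OF smooth_on_linear_derivative[OF smooth_on_derivative[OF \<theta>(2), of v] that]])
  have "((\<lambda>q. ?L (?\<Theta> q) (0, ?D (fst q) e)) has_derivative
     (\<lambda>d. frechet_derivative (\<lambda>p. ?L p (0, ?D (fst (z, w)) e)) (at (?\<Theta> (z, w)))
         (?D z (fst d), ?D2 z w (fst d) + ?D z (snd d))
       + ?L (?\<Theta> (z, w)) (0, ?D2 z e (fst d)))) (at (z, w))"
  proof (rule has_derivative_eval_derivative[OF \<Lambda>])
    show "?\<Theta> (z, w) \<in> \<Omega>" by (rule \<Theta>q[OF q])
    show "(?\<Theta> has_derivative (\<lambda>d. (?D z (fst d), ?D2 z w (fst d) + ?D z (snd d)))) (at (z, w))"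
      using has_derivative_tangent[OF \<theta> zS[OF q]] by simp
    have "((\<lambda>q. ?D (fst q) e) has_derivative (\<lambda>d. ?D2 z e (fst d))) (at (z, w))"
      using smooth_on_has_derivative_compose[OF smooth_on_derivative[OF \<theta>(2)] has_derivative_fst[OF has_derivative_ident] zS[OF q]] by simp
    then show "((\<lambda>q. (0, ?D (fst q) e)) has_derivative (\<lambda>d. (0, ?D2 z e (fst d)))) (at (z, w))"
      by (rule has_derivative_Pair[OF has_derivative_const])
  qed
  then have "((\<lambda>q. frechet_derivative \<Lambda>' (at q) (0, e)) has_derivative
     (\<lambda>d. frechet_derivative (\<lambda>p. ?L p (0, ?D z e)) (at (?\<Theta> (z, w)))
         (?D z (fst d), ?D2 z w (fst d) + ?D z (snd d))
       + ?L (?\<Theta> (z, w)) (0, ?D2 z e (fst d)))) (at (z, w))"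
    unfolding fst_conv[of z w]
    by (rule has_derivative_transform_within_open[OF _ \<Omega>' q]) (simp add: D\<Lambda>' lin0 zS)
  from fun_cong[OF frechet_derivative_at[OF this, symmetric], of "(w, a)"]
  have "frechet_derivative (\<lambda>q. frechet_derivative \<Lambda>' (at q) (0, e)) (at (z, w)) (w, a) =
     frechet_derivative (\<lambda>p. ?L p (0, ?D z e)) (at (?\<Theta> (z, w))) (?D z w, ?D2 z w w + ?D z a)
       + ?L (?\<Theta> (z, w)) (0, ?D2 z e w)" unfolding fst_conv snd_conv .
  also have "frechet_derivative (\<lambda>p. ?L p (0, ?D z e)) (at (?\<Theta> (z, w))) (?D z w, ?D2 z w w + ?D z a)
      = ?L (?\<Theta> (z, w)) (?D z e, 0)"
    using EL unfolding euler_lagrange_def by simp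
  also have "?D2 z e w = ?D2 z w e"
    using second_derivative_symmetric[OF \<theta>, of z e w] zS[OF q] by simp
  also have "?L (?\<Theta> (z, w)) (?D z e, 0) + ?L (?\<Theta> (z, w)) (0, ?D2 z w e) = frechet_derivative \<Lambda>' (at (z, w)) (e, 0)"
    using D\<Lambda>'[OF q] linear_add[OF smooth_on_linear_derivative[OF \<Lambda>(2) \<Theta>q[OF q]], of "(?D z e, 0)" "(0, ?D2 z w e)"]
      lin0 zS[OF q] by simp
  finally show "frechet_derivative (\<lambda>q. frechet_derivative \<Lambda>' (at q) (0, e)) (at (z, w)) (w, a) =
    frechet_derivative \<Lambda>' (at (z, w)) (e, 0)" .
qed

text \<open>The transformation law of the 2-jet of a curve, in the form of the acceleration that
  \<open>euler_lagrange_pullback\<close> expects.\<close>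

lemma curve_transform:
  fixes \<theta> :: "'a::euclidean_space \<Rightarrow> 'b::real_normed_vector"
  assumes \<theta>: "open S" "smooth_on S \<theta>" "x t \<in> S"
    and x: "(x has_vector_derivative x' t) (at t)" and x': "(x' has_vector_derivative a) (at t)"
  shows "((\<lambda>t. \<theta> (x t)) has_vector_derivative frechet_derivative \<theta> (at (x t)) (x' t)) (at t)"
    "((\<lambda>t. frechet_derivative \<theta> (at (x t)) (x' t)) has_vector_derivative
       (frechet_derivative (\<lambda>z. frechet_derivative \<theta> (at z) (x' t)) (at (x t)) (x' t) + frechet_derivative \<theta> (at (x t)) a)) (at t)"
proof -
  have l: "linear (frechet_derivative \<theta> (at (x t)))" "linear (frechet_derivative (\<lambda>z. frechet_derivative \<theta> (at z) (x' t)) (at (x t)))"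
    using smooth_on_linear_derivative[OF \<theta>(2,3)] smooth_on_linear_derivative[OF smooth_on_derivative[OF \<theta>(2)] \<theta>(3)] by auto
  show "((\<lambda>t. \<theta> (x t)) has_vector_derivative frechet_derivative \<theta> (at (x t)) (x' t)) (at t)"
    using smooth_on_has_derivative_compose[OF \<theta>(2) x[unfolded has_vector_derivative_def] \<theta>(3)]
    unfolding has_vector_derivative_def linear_cmul[OF l(1)] .
  show "((\<lambda>t. frechet_derivative \<theta> (at (x t)) (x' t)) has_vector_derivative
       (frechet_derivative (\<lambda>z. frechet_derivative \<theta> (at z) (x' t)) (at (x t)) (x' t) + frechet_derivative \<theta> (at (x t)) a)) (at t)"
    using has_derivative_eval_derivative[OF \<theta> x[unfolded has_vector_derivative_def] x'[unfolded has_vector_derivative_def]]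
    unfolding has_vector_derivative_def linear_cmul[OF l(1)] linear_cmul[OF l(2)] scaleR_add_right .
qed

section \<open>The fundamental tensor and the spray\<close>

lemma frechet_derivative_slice:
  fixes f :: "'a::real_normed_vector \<times> 'b::real_normed_vector \<Rightarrow> 'c::real_normed_vector"
  assumes "smooth_on S f" "(z, w) \<in> S"
  shows "frechet_derivative (\<lambda>w. f (z, w)) (at w) v = frechet_derivative f (at (z, w)) (0, v)"
    "frechet_derivative (\<lambda>z. f (z, w)) (at z) u = frechet_derivative f (at (z, w)) (u, 0)"
    "(\<lambda>w. f (z, w)) differentiable (at w)" "(\<lambda>z. f (z, w)) differentiable (at z)"
proof -
  have 1: "((\<lambda>w. f (z, w)) has_derivative (\<lambda>v. frechet_derivative f (at (z, w)) (0, v))) (at w)"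
    by (rule smooth_on_has_derivative_compose[OF assms(1) has_derivative_Pair[OF has_derivative_const has_derivative_ident] assms(2)])
  have 2: "((\<lambda>z. f (z, w)) has_derivative (\<lambda>v. frechet_derivative f (at (z, w)) (v, 0))) (at z)"
    by (rule smooth_on_has_derivative_compose[OF assms(1) has_derivative_Pair[OF has_derivative_ident has_derivative_const] assms(2)])
  show "frechet_derivative (\<lambda>w. f (z, w)) (at w) v = frechet_derivative f (at (z, w)) (0, v)"
    "frechet_derivative (\<lambda>z. f (z, w)) (at z) u = frechet_derivative f (at (z, w)) (u, 0)"
    using frechet_derivative_at[OF 1] frechet_derivative_at[OF 2] by metis+
  show "(\<lambda>w. f (z, w)) differentiable (at w)" "(\<lambda>z. f (z, w)) differentiable (at z)"
    using 1 2 by (auto simp: differentiable_def)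
qed

text \<open>The fundamental tensor as a bilinear form. It makes sense on any normed space, so norms
  pulled back to the Lie algebra can be treated in the same way.\<close>

definition hess :: "('a::real_normed_vector \<Rightarrow> real) \<Rightarrow> 'a \<Rightarrow> 'a \<Rightarrow> 'a \<Rightarrow> real" where
  "hess N u v w = frechet_derivative (\<lambda>x. frechet_derivative (\<lambda>y. (N y)\<^sup>2) (at x) v) (at u) w / 2"

lemma hess_symmetric:
  assumes "open S" "smooth_on S (\<lambda>y. (N y)\<^sup>2)" "u \<in> S"
  shows "hess N u v w = hess N u w v"
  unfolding hess_def using second_derivative_symmetric[OF assms, of v w] by simp

lemma linear_hess:
  assumes "open S" "smooth_on S (\<lambda>y. (N y)\<^sup>2)" "u \<in> S"
  shows "linear (hess N u v)" "linear (\<lambda>v. hess N u v w)"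
proof -
  show l: "linear (hess N u v)" for v
    using smooth_on_linear_derivative[OF smooth_on_derivative[OF assms(2)] assms(3), of v]
    by (auto simp: linear_iff hess_def add_divide_distrib)
  have "(\<lambda>v. hess N u v w) = hess N u w" by (rule ext) (rule hess_symmetric[OF assms])
  then show "linear (\<lambda>v. hess N u v w)" using l[of w] by simp
qed

lemma fundamental_tensor_hess: "fundamental_tensor N u $ i $ j = hess N u (axis j 1) (axis i 1)"
  by (simp add: fundamental_tensor_def partial_def[abs_def] hess_def)

lemma hess_eq:
  assumes "open S" "smooth_on S (\<lambda>y. (N y)\<^sup>2)" "u \<in> S"
  shows "hess N u v w = w \<bullet> (fundamental_tensor N u *v v)"
proof -
  have "hess N u v (axis i 1) = (fundamental_tensor N u *v v) $ i" for i
    unfolding linear_axis_sum[OF linear_hess(2)[OF assms], of v]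
    by (simp add: matrix_vector_mult_def fundamental_tensor_hess mult.commute)
  then show ?thesis
    unfolding linear_axis_sum[OF linear_hess(1)[OF assms], of v w] by (simp add: inner_vec_def)
qed

text \<open>A linear map has no second derivative, so the Hessian transforms as a tensor.\<close>

lemma hess_linear_change:
  fixes T :: "'a::euclidean_space \<Rightarrow> 'b::euclidean_space"
  assumes S: "open S" "u \<in> S" and S': "open S'" "smooth_on S' (\<lambda>y. (N' y)\<^sup>2)"
    and T: "linear T" and sub: "\<And>x. x \<in> S \<Longrightarrow> T x \<in> S' \<and> N x = N' (T x)"
  shows "hess N u v w = hess N' (T u) (T v) (T w)"
proof -
  have T': "(T has_derivative T) (at x)" for x
    using T by (simp add: linear_conv_bounded_linear bounded_linear_imp_has_derivative)
  have 1: "frechet_derivative (\<lambda>y. (N y)\<^sup>2) (at x) v = frechet_derivative (\<lambda>y. (N' y)\<^sup>2) (at (T x)) (T v)" if "x \<in> S" for x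
  proof -
    have "((\<lambda>x. (N' (T x))\<^sup>2) has_derivative (\<lambda>v. frechet_derivative (\<lambda>y. (N' y)\<^sup>2) (at (T x)) (T v))) (at x)"
      using smooth_on_has_derivative_compose[OF S'(2) T'] sub[OF that] by simp
    then have "((\<lambda>x. (N x)\<^sup>2) has_derivative (\<lambda>v. frechet_derivative (\<lambda>y. (N' y)\<^sup>2) (at (T x)) (T v))) (at x)"
      by (rule has_derivative_transform_within_open[OF _ S(1) that]) (simp add: sub)
    from frechet_derivative_at[OF this] show ?thesis by metis
  qed
  have "((\<lambda>x. frechet_derivative (\<lambda>y. (N' y)\<^sup>2) (at (T x)) (T v)) has_derivative
     (\<lambda>w. frechet_derivative (\<lambda>x. frechet_derivative (\<lambda>y. (N' y)\<^sup>2) (at x) (T v)) (at (T u)) (T w))) (at u)"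
    using smooth_on_has_derivative_compose[OF smooth_on_derivative[OF S'(2)] T'] sub[OF S(2)] by simp
  then have "((\<lambda>x. frechet_derivative (\<lambda>y. (N y)\<^sup>2) (at x) v) has_derivative
     (\<lambda>w. frechet_derivative (\<lambda>x. frechet_derivative (\<lambda>y. (N' y)\<^sup>2) (at x) (T v)) (at (T u)) (T w))) (at u)"
    by (rule has_derivative_transform_within_open[OF _ S]) (simp add: 1)
  from frechet_derivative_at[OF this] show ?thesis unfolding hess_def by metis
qed

text \<open>The iterated partial derivatives in the definitions of the tensor and the spray become
  derivatives of one function on the product, where symmetry and linearity are available.\<close>

lemma fundamental_tensor_joint:
  fixes N :: "real ^ 'n \<Rightarrow> real ^ 'n \<Rightarrow> real"
  assumes \<Omega>: "open \<Omega>" and sm: "smooth_on \<Omega> \<Lambda>" and \<Lambda>: "\<Lambda> = (\<lambda>q. (N (fst q) (snd q))\<^sup>2)" and zw: "(z, w) \<in> \<Omega>"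
  shows "partial l (\<lambda>w. (N z w)\<^sup>2) w = frechet_derivative \<Lambda> (at (z, w)) (0, axis l 1)"
    "partial l (\<lambda>z. (N z w)\<^sup>2) z = frechet_derivative \<Lambda> (at (z, w)) (axis l 1, 0)"
    "partial k (\<lambda>z. partial l (\<lambda>w. (N z w)\<^sup>2) w) z
       = frechet_derivative (\<lambda>q. frechet_derivative \<Lambda> (at q) (0, axis l 1)) (at (z, w)) (axis k 1, 0)"
    "fundamental_tensor (N z) w $ i $ j
       = frechet_derivative (\<lambda>q. frechet_derivative \<Lambda> (at q) (0, axis j 1)) (at (z, w)) (0, axis i 1) / 2"
proof -
  have 1: "partial l (\<lambda>w. (N z w)\<^sup>2) w = frechet_derivative \<Lambda> (at (z, w)) (0, axis l 1)" if "(z, w) \<in> \<Omega>" for z w l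
    using frechet_derivative_slice(1)[OF sm that] by (simp add: partial_def \<Lambda>)
  then show "partial l (\<lambda>w. (N z w)\<^sup>2) w = frechet_derivative \<Lambda> (at (z, w)) (0, axis l 1)" using zw by simp
  show "partial l (\<lambda>z. (N z w)\<^sup>2) z = frechet_derivative \<Lambda> (at (z, w)) (axis l 1, 0)"
    using frechet_derivative_slice(2)[OF sm zw] by (simp add: partial_def \<Lambda>)
  let ?f = "\<lambda>l q. frechet_derivative \<Lambda> (at q) (0, axis l 1)"
  note f = smooth_on_derivative[OF sm]
  note o = open_slices(2,1)[OF \<Omega>]
  have "frechet_derivative (\<lambda>z. partial l (\<lambda>w. (N z w)\<^sup>2) w) (at z) = frechet_derivative (\<lambda>z. ?f l (z, w)) (at z)" for l
    by (rule frechet_derivative_transform_within_open[symmetric, OF frechet_derivative_slice(4)[OF f zw] o(1)])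
       (use zw 1 in auto)
  then show "partial k (\<lambda>z. partial l (\<lambda>w. (N z w)\<^sup>2) w) z
       = frechet_derivative (\<lambda>q. frechet_derivative \<Lambda> (at q) (0, axis l 1)) (at (z, w)) (axis k 1, 0)"
    unfolding partial_def[of k] using frechet_derivative_slice(2)[OF f zw] by simp
  have "frechet_derivative (\<lambda>w. partial j (\<lambda>w. (N z w)\<^sup>2) w) (at w) = frechet_derivative (\<lambda>w. ?f j (z, w)) (at w)" for j
    by (rule frechet_derivative_transform_within_open[symmetric, OF frechet_derivative_slice(3)[OF f zw] o(2)])
       (use zw 1 in auto)
  then show "fundamental_tensor (N z) w $ i $ j
       = frechet_derivative (\<lambda>q. frechet_derivative \<Lambda> (at q) (0, axis j 1)) (at (z, w)) (0, axis i 1) / 2"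
    unfolding fundamental_tensor_def using frechet_derivative_slice(1)[OF f zw]
    by (simp add: partial_def[of i])
qed

lemma spray_joint:
  fixes N :: "real ^ 'n \<Rightarrow> real ^ 'n \<Rightarrow> real"
  assumes "open \<Omega>" "smooth_on \<Omega> \<Lambda>" "\<Lambda> = (\<lambda>q. (N (fst q) (snd q))\<^sup>2)" "(z, w) \<in> \<Omega>"
  shows "spray N z w = (1 / 4) *\<^sub>R (matrix_inv (fundamental_tensor (N z) w) *v
    (\<chi> l. frechet_derivative (\<lambda>q. frechet_derivative \<Lambda> (at q) (0, axis l 1)) (at (z, w)) (w, 0)
      - frechet_derivative \<Lambda> (at (z, w)) (axis l 1, 0)))"
proof -
  have "(\<Sum>k\<in>UNIV. frechet_derivative (\<lambda>q. frechet_derivative \<Lambda> (at q) (0, axis l 1)) (at (z, w)) (axis k 1, 0) * w $ k)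
      = frechet_derivative (\<lambda>q. frechet_derivative \<Lambda> (at q) (0, axis l 1)) (at (z, w)) (w, 0)" for l
  proof -
    let ?f = "frechet_derivative (\<lambda>q. frechet_derivative \<Lambda> (at q) (0, axis l 1)) (at (z, w))"
    have l: "linear (\<lambda>u. ?f (u, 0))"
      using linear_compose[of "\<lambda>u. (u, 0)", OF _ smooth_on_linear_derivative[OF smooth_on_derivative[OF assms(2)] assms(4)]]
      by (simp add: linear_iff comp_def)
    show ?thesis using linear_axis_sum[OF l, of w] by (simp add: mult.commute)
  qed
  then show ?thesis
    unfolding spray_def Let_def fundamental_tensor_joint(2,3)[OF assms] by simp
qed

text \<open>Tested on the coordinate vectors, the equation reads
  \<open>?b + 2 *\<^sub>R (?g *v a) = 0\<close>, and the spray is one quarter of the inverse tensor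
  applied to \<open>?b\<close>.\<close>

lemma euler_lagrange_iff_spray:
  fixes N :: "real ^ 'n \<Rightarrow> real ^ 'n \<Rightarrow> real"
  assumes \<Omega>: "open \<Omega>" "smooth_on \<Omega> \<Lambda>" "\<Lambda> = (\<lambda>q. (N (fst q) (snd q))\<^sup>2)" "(z, w) \<in> \<Omega>"
    and d: "det (fundamental_tensor (N z) w) \<noteq> 0"
  shows "euler_lagrange \<Lambda> z w a \<longleftrightarrow> a = - 2 *\<^sub>R spray N z w"
proof -
  let ?g = "fundamental_tensor (N z) w"
  let ?D2 = "\<lambda>v d. frechet_derivative (\<lambda>q. frechet_derivative \<Lambda> (at q) v) (at (z, w)) d"
  let ?D = "frechet_derivative \<Lambda> (at (z, w))"
  let ?b = "\<chi> l. ?D2 (0, axis l 1) (w, 0) - ?D (axis l 1, 0)"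
  have sym: "?D2 v d = ?D2 d v" for v d by (rule second_derivative_symmetric[OF \<Omega>(1,2,4)])
  have lin: "linear (?D2 v)" "linear ?D" for v
    using smooth_on_linear_derivative[OF smooth_on_derivative[OF \<Omega>(2)] \<Omega>(4)] smooth_on_linear_derivative[OF \<Omega>(2,4)] by auto
  have le: "linear (\<lambda>e. ?D2 (0, e) (w, a) - ?D (e, 0))"
  proof -
    have "linear (\<lambda>e. ?D2 (w, a) (0, e))" "linear (\<lambda>e. ?D (e, 0))"
      using linear_compose[of "\<lambda>u. (0, u)", OF _ lin(1)] linear_compose[of "\<lambda>u. (u, 0)", OF _ lin(2)]
      by (simp_all add: linear_iff comp_def)
    from linear_compose_sub[OF this] show ?thesis unfolding sym[of "(w, a)"] .
  qed
  have comp: "?D2 (0, axis l 1) (w, a) - ?D (axis l 1, 0) = (?b + 2 *\<^sub>R (?g *v a)) $ l" for l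
  proof -
    have l0: "linear (\<lambda>a. ?D2 (0, axis l 1) (0, a))"
      using linear_compose[of "\<lambda>u. (0, u)", OF _ lin(1)] by (simp add: linear_iff comp_def)
    have "?D2 (0, axis l 1) (w, a) = ?D2 (0, axis l 1) (w, 0) + ?D2 (0, axis l 1) (0, a)"
      using linear_add[OF lin(1), of _ "(w, 0)" "(0, a)"] by simp
    moreover have "?D2 (0, axis l 1) (0, a) = 2 * (?g *v a) $ l"
      unfolding matrix_vector_mult_def linear_axis_sum[OF l0, of a] using sym[of "(0, axis l 1)"]
      by (simp add: fundamental_tensor_joint(4)[OF \<Omega>] sum_distrib_left mult.commute)
    ultimately show ?thesis by simp
  qed
  have "euler_lagrange \<Lambda> z w a \<longleftrightarrow> (\<forall>e. ?D2 (0, e) (w, a) - ?D (e, 0) = 0)"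
    by (simp add: euler_lagrange_def)
  also have "\<dots> \<longleftrightarrow> (\<forall>l. ?D2 (0, axis l 1) (w, a) - ?D (axis l 1, 0) = 0)"
  proof safe
    fix e assume *: "\<forall>l. ?D2 (0, axis l 1) (w, a) - ?D (axis l 1, 0) = 0"
    show "?D2 (0, e) (w, a) - ?D (e, 0) = 0" unfolding linear_axis_sum[OF le, of e] using * by simp
  qed simp
  also have "\<dots> \<longleftrightarrow> ?b + 2 *\<^sub>R (?g *v a) = 0" unfolding comp by (simp add: vec_eq_iff)
  also have "\<dots> \<longleftrightarrow> ?g *v a = (- 1 / 2) *\<^sub>R ?b"
  proof
    assume "?b + 2 *\<^sub>R (?g *v a) = 0"
    then have "2 *\<^sub>R (?g *v a) = - ?b" by (simp add: add_eq_0_iff)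
    then have "(1 / 2) *\<^sub>R (2 *\<^sub>R (?g *v a)) = (1 / 2) *\<^sub>R (- ?b)" by (rule arg_cong)
    then show "?g *v a = (- 1 / 2) *\<^sub>R ?b" by simp
  next
    assume "?g *v a = (- 1 / 2) *\<^sub>R ?b"
    then show "?b + 2 *\<^sub>R (?g *v a) = 0" by (simp only: scaleR_scaleR) simp
  qed
  also have "\<dots> \<longleftrightarrow> a = matrix_inv ?g *v ((- 1 / 2) *\<^sub>R ?b)" by (rule matrix_inv_vector[OF d])
  also have "matrix_inv ?g *v ((- 1 / 2) *\<^sub>R ?b) = - 2 *\<^sub>R spray N z w"
    unfolding spray_joint[OF \<Omega>(1-4)] by (simp only: matrix_vector_mult_scaleR scaleR_scaleR) simp
  finally show ?thesis .
qed

lemma positive_definite_det: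
  fixes g :: "real ^ 'n ^ 'n"
  assumes "\<And>w. w \<noteq> 0 \<Longrightarrow> w \<bullet> (g *v w) > 0"
  shows "det g \<noteq> 0"
proof -
  have "x = 0" if "g *v x = 0" for x using assms[of x] that by (cases "x = 0") auto
  then have "inj ((*v) g)" by (simp add: linear_injective_0[OF matrix_vector_mul_linear])
  then show ?thesis using det_nz_iff_inj[of "(*v) g"] by (simp add: matrix_of_matrix_vector_mul)
qed

text \<open>Along the segment from the identity to \<open>g\<close> all matrices are positive
  definite, so the determinant never vanishes and keeps the sign it has at the identity.\<close>

lemma positive_definite_det_pos:
  fixes g :: "real ^ 'n ^ 'n"
  assumes g: "\<And>w. w \<noteq> 0 \<Longrightarrow> w \<bullet> (g *v w) > 0"
  shows "det g > 0"
proof (rule ccontr)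
  assume n: "\<not> det g > 0"
  define h where "h t = (\<chi> i j. (1 - t) * (mat 1 :: real ^ 'n ^ 'n) $ i $ j + t * g $ i $ j)" for t :: real
  have "continuous_on {0..1} (\<lambda>t. det (h t))"
    unfolding det_def h_def by (simp, intro continuous_intros)
  moreover have "h 0 = mat 1" "h 1 = g" by (simp_all add: h_def vec_eq_iff)
  ultimately obtain t where t: "0 \<le> t" "t \<le> 1" "det (h t) = 0"
    using IVT2'[of "\<lambda>t. det (h t)" 1 0 0] n by auto
  have "w \<bullet> (h t *v w) > 0" if w: "w \<noteq> 0" for w
  proof -
    have "h t *v w = (1 - t) *\<^sub>R (mat 1 *v w) + t *\<^sub>R (g *v w)"
      by (simp add: h_def vec_eq_iff matrix_vector_mult_def sum_distrib_left sum.distrib[symmetric] algebra_simps)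
    then have e: "w \<bullet> (h t *v w) = (1 - t) * (w \<bullet> w) + t * (w \<bullet> (g *v w))" by (simp add: inner_add_right)
    show ?thesis
    proof (cases "t = 0")
      case False
      then have "t * (w \<bullet> (g *v w)) > 0" using t g[OF w] by simp
      moreover have "(1 - t) * (w \<bullet> w) \<ge> 0" using t by simp
      ultimately show ?thesis unfolding e by linarith
    qed (use w e in simp)
  qed
  from positive_definite_det[OF this] t(3) show False by simp
qed

lemma measure_open_bounded_pos:
  fixes S :: "'a::euclidean_space set"
  assumes "open S" "S \<noteq> {}" "bounded S"
  shows "measure lborel S > 0"
proof -
  obtain x e where x: "e > 0" "ball x e \<subseteq> S" using assms(1,2) by (meson all_not_in_conv open_contains_ball)
  have "0 < measure lborel (ball x e)" using content_ball_pos[OF x(1)] .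
  also have "\<dots> \<le> measure lborel S"
    by (rule measure_mono_fmeasurable[OF x(2)])
       (use assms emeasure_bounded_finite[OF assms(3)] in \<open>auto simp: fmeasurable_def\<close>)
  finally show ?thesis .
qed

section \<open>Geodesics\<close>

locale finsler =
  fixes B :: "('m, real ^ 'n) atlas" and D :: "'m \<Rightarrow> (real ^ 'n) set" and F :: "'m \<Rightarrow> real ^ 'n \<Rightarrow> real"
  assumes manifold: "smooth_manifold B" and finsler: "finsler_metric B D F"
begin

lemmas inj = smooth_manifold_inj_charts[OF manifold]

definition "\<Lambda> c q = (chart_rep B c F (fst q) (snd q))\<^sup>2"
definition "\<Omega> c = chart_domain B c D"

lemma \<Omega>_iff: "(z, w) \<in> \<Omega> c \<longleftrightarrow> z \<in> snd c ` fst c \<and> chart_vec B c z w \<in> D (inv_chart c z)"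
  by (simp add: \<Omega>_def chart_domain_def inv_chart_def)

lemma chart_rep_eq: "chart_rep B c F z w = F (inv_chart c z) (chart_vec B c z w)"
  by (simp add: chart_rep_def inv_chart_def)

lemma \<Omega>_open: "c \<in> B \<Longrightarrow> open (\<Omega> c)"
  using finsler by (simp add: finsler_metric_def \<Omega>_def)

lemma rep_smooth: "c \<in> B \<Longrightarrow> smooth_on (\<Omega> c) (\<lambda>q. chart_rep B c F (fst q) (snd q))"
  using finsler by (simp add: finsler_metric_def \<Omega>_def case_prod_unfold)

lemma \<Lambda>_smooth: assumes "c \<in> B" shows "smooth_on (\<Omega> c) (\<Lambda> c)"
  unfolding \<Lambda>_def power2_eq_square
  by (rule smooth_on_mult[OF \<Omega>_open[OF assms] rep_smooth[OF assms] rep_smooth[OF assms]])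

lemma pos_def: "x \<in> points B \<Longrightarrow> u \<in> D x \<Longrightarrow> w \<noteq> 0 \<Longrightarrow> w \<bullet> (fundamental_tensor (F x) u *v w) > 0"
  and F_nonneg: "x \<in> points B \<Longrightarrow> u \<in> D x \<Longrightarrow> F x u \<ge> 0"
  and D_scale: "x \<in> points B \<Longrightarrow> u \<in> D x \<Longrightarrow> r > 0 \<Longrightarrow> r *\<^sub>R u \<in> D x"
  and F_scale: "x \<in> points B \<Longrightarrow> u \<in> D x \<Longrightarrow> r > 0 \<Longrightarrow> F x (r *\<^sub>R u) = r * F x u"
  using finsler by (auto simp: finsler_metric_def)

lemma D_open: assumes "x \<in> points B" shows "open (D x)" "smooth_on (D x) (F x)"
proof -
  let ?c = "chart_at B x" and ?z = "coord_at B x x"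
  note c = chart_at[OF assms]
  have eq: "(?z, u) \<in> \<Omega> ?c \<longleftrightarrow> u \<in> D x" "chart_rep B ?c F ?z u = F x u" for u
    using c inv_chart_coord[OF inj c] chart_vec_at_self[OF manifold assms]
    by (auto simp: \<Omega>_iff chart_rep_eq coord_at_def)
  have "D x = Pair ?z -` \<Omega> ?c" using eq by auto
  then show op: "open (D x)" using open_slices(1)[OF \<Omega>_open[OF c(1)], of ?z] by (simp add: vimage_def)
  have "smooth_on (D x) (\<lambda>u. (\<lambda>q. chart_rep B ?c F (fst q) (snd q)) (?z, u))"
    by (rule smooth_on_compose[OF op smooth_on_Pair[OF op smooth_on_const smooth_on_ident] rep_smooth[OF c(1)]]) (use eq in auto)
  then show "smooth_on (D x) (F x)" by (simp add: eq)
qed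

lemma F2_smooth: assumes "x \<in> points B" shows "smooth_on (D x) (\<lambda>u. (F x u)\<^sup>2)"
  unfolding power2_eq_square by (rule smooth_on_mult[OF D_open(1)[OF assms] D_open(2)[OF assms] D_open(2)[OF assms]])

text \<open>Positivity is given for components in the selected charts; the injective linear map
  \<open>chart_vec\<close> transports it to any other chart.\<close>

lemma det_chart:
  assumes c: "c \<in> B" and zw: "(z, w) \<in> \<Omega> c"
  shows "det (fundamental_tensor (chart_rep B c F z) w) \<noteq> 0"
proof (rule positive_definite_det)
  fix u :: "real ^ 'n" assume u: "u \<noteq> 0"
  let ?x = "inv_chart c z" and ?C = "chart_vec B c z"
  have z: "z \<in> snd c ` fst c" and Cw: "?C w \<in> D ?x" using zw by (auto simp: \<Omega>_iff)
  have x: "?x \<in> points B" by (rule chart_in_points[OF c inv_chart_in[OF z]])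
  have lin: "linear ?C" by (rule linear_chart_vec[OF manifold c z])
  let ?S = "{w. (z, w) \<in> \<Omega> c}"
  have S: "open ?S" by (rule open_slices(1)[OF \<Omega>_open[OF c]])
  have sm: "smooth_on ?S (\<lambda>w. (chart_rep B c F z w)\<^sup>2)"
    using smooth_on_compose[OF S smooth_on_Pair[OF S smooth_on_const smooth_on_ident] \<Lambda>_smooth[OF c], of z]
    by (auto simp: \<Lambda>_def)
  have "u \<bullet> (fundamental_tensor (chart_rep B c F z) w *v u) = hess (chart_rep B c F z) w u u"
    by (rule hess_eq[OF S sm, symmetric]) (use zw in simp)
  also have "\<dots> = hess (F ?x) (?C w) (?C u) (?C u)"
    by (rule hess_linear_change[OF S _ D_open(1)[OF x] F2_smooth[OF x] lin]) (use zw in \<open>auto simp: \<Omega>_iff chart_rep_eq\<close>)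
  also have "\<dots> = ?C u \<bullet> (fundamental_tensor (F ?x) (?C w) *v ?C u)"
    by (rule hess_eq[OF D_open(1)[OF x] F2_smooth[OF x] Cw])
  also have "?C u \<noteq> 0" using chart_vec_eq_0[OF manifold c z] u by blast
  then have "?C u \<bullet> (fundamental_tensor (F ?x) (?C w) *v ?C u) > 0" by (rule pos_def[OF x Cw])
  finally show "u \<bullet> (fundamental_tensor (chart_rep B c F z) w *v u) > 0" .
qed

lemma euler_lagrange_spray:
  assumes "c \<in> B" "(z, w) \<in> \<Omega> c"
  shows "euler_lagrange (\<Lambda> c) z w a \<longleftrightarrow> a = - 2 *\<^sub>R spray (chart_rep B c F) z w"
  by (rule euler_lagrange_iff_spray[where N = "chart_rep B c F", OF \<Omega>_open[OF assms(1)] \<Lambda>_smooth[OF assms(1)] _ assms(2) det_chart[OF assms]])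
     (simp add: \<Lambda>_def[abs_def])

lemma spray_smooth:
  assumes c: "c \<in> B" shows "smooth_on (\<Omega> c) (\<lambda>q. spray (chart_rep B c F) (fst q) (snd q))"
proof (rule smooth_on_cong[OF \<Omega>_open[OF c]])
  note O = \<Omega>_open[OF c] and sm = \<Lambda>_smooth[OF c]
  let ?b = "\<lambda>q. \<chi> l. frechet_derivative (\<lambda>q. frechet_derivative (\<Lambda> c) (at q) (0, axis l 1)) (at q) (snd q, 0)
      - frechet_derivative (\<Lambda> c) (at q) (axis l 1, 0)"
  let ?g = "\<lambda>q. fundamental_tensor (chart_rep B c F (fst q)) (snd q)"
  have g: "smooth_on (\<Omega> c) (\<lambda>q. ?g q $ i $ j)" for i j
  proof (rule smooth_on_cong[OF O])
    show "smooth_on (\<Omega> c) (\<lambda>q. (1 / 2) *\<^sub>R frechet_derivative (\<lambda>q. frechet_derivative (\<Lambda> c) (at q) (0, axis j 1)) (at q) (0, axis i 1))"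
      by (rule smooth_on_scaleR[OF O smooth_on_const smooth_on_derivative[OF smooth_on_derivative[OF sm]]])
    show "(1 / 2) *\<^sub>R frechet_derivative (\<lambda>q. frechet_derivative (\<Lambda> c) (at q) (0, axis j 1)) (at q) (0, axis i 1) = ?g q $ i $ j"
      if "q \<in> \<Omega> c" for q
      using fundamental_tensor_joint(4)[OF O sm, of "chart_rep B c F" "fst q" "snd q"] that by (simp add: \<Lambda>_def[abs_def])
  qed
  have b: "smooth_on (\<Omega> c) (\<lambda>q. ?b q $ l)" for l
  proof -
    have "smooth_on (\<Omega> c) (\<lambda>q. (\<lambda>(q, v). frechet_derivative (\<lambda>q. frechet_derivative (\<Lambda> c) (at q) (0, axis l 1)) (at q) v) (q, (snd q, 0)))"
      by (rule smooth_on_compose[OF O smooth_on_Pair[OF O smooth_on_ident smooth_on_Pair[OF O smooth_on_snd smooth_on_const]]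
            smooth_on_derivative_joint[OF O smooth_on_derivative[OF sm]]]) auto
    from smooth_on_diff[OF O this smooth_on_derivative[OF sm]] show ?thesis by simp
  qed
  show "smooth_on (\<Omega> c) (\<lambda>q. (1 / 4) *\<^sub>R (matrix_inv (?g q) *v ?b q))"
    by (rule smooth_on_scaleR[OF O smooth_on_const smooth_on_matrix_inv[OF O g b]]) (use det_chart[OF c] in auto)
  show "(1 / 4) *\<^sub>R (matrix_inv (?g q) *v ?b q) = spray (chart_rep B c F) (fst q) (snd q)" if "q \<in> \<Omega> c" for q
    using spray_joint[OF O sm, of "chart_rep B c F" "fst q" "snd q"] that by (simp add: \<Lambda>_def[abs_def])
qed

lemma transition_lagrangian:
  assumes c: "c \<in> B" and d: "d \<in> B" and z: "z \<in> snd c ` (fst c \<inter> fst d)"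
  shows "(z, w) \<in> \<Omega> c \<longleftrightarrow> ((snd d \<circ> inv_chart c) z, frechet_derivative (snd d \<circ> inv_chart c) (at z) w) \<in> \<Omega> d"
    "\<Lambda> c (z, w) = \<Lambda> d ((snd d \<circ> inv_chart c) z, frechet_derivative (snd d \<circ> inv_chart c) (at z) w)"
proof -
  obtain q where q: "q \<in> fst c" "q \<in> fst d" "z = snd c q" using z by blast
  have i: "inv_chart c z = q" "inv_chart d (snd d q) = q" using inv_chart_coord[OF inj] c d q by auto
  note v = chart_vec_transition[OF manifold c q(1) d q(2), of w, folded q(3)]
  show "(z, w) \<in> \<Omega> c \<longleftrightarrow> ((snd d \<circ> inv_chart c) z, frechet_derivative (snd d \<circ> inv_chart c) (at z) w) \<in> \<Omega> d"
    using q i v by (auto simp: \<Omega>_iff)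
  show "\<Lambda> c (z, w) = \<Lambda> d ((snd d \<circ> inv_chart c) z, frechet_derivative (snd d \<circ> inv_chart c) (at z) w)"
    using i v by (simp add: \<Lambda>_def chart_rep_eq)
qed

text \<open>\<open>geodesic\<close> speaks of all charts at once, whereas a solution is constructed
  in one. The equation in \<open>c\<close> is pulled back along the coordinate change from
  \<open>d\<close> to \<open>c\<close> and then read as the spray equation in
  \<open>d\<close>.\<close>

lemma spray_transition:
  assumes c: "c \<in> B" and d: "d \<in> B"
    and x: "open T" "t \<in> T" "\<And>s. s \<in> T \<Longrightarrow> \<gamma> s \<in> fst c \<inter> fst d"
    "\<And>s. s \<in> T \<Longrightarrow> ((snd c \<circ> \<gamma>) has_vector_derivative x' s) (at s)"
    "(x' has_vector_derivative a) (at t)"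
    and dom: "(snd c (\<gamma> t), x' t) \<in> \<Omega> c" and a: "a = - 2 *\<^sub>R spray (chart_rep B c F) (snd c (\<gamma> t)) (x' t)"
  defines "y \<equiv> snd d \<circ> \<gamma>" and "y' \<equiv> \<lambda>t. vector_derivative (snd d \<circ> \<gamma>) (at t)"
  shows "y differentiable (at t)" "(y' has_vector_derivative (- 2 *\<^sub>R spray (chart_rep B d F) (y t) (y' t))) (at t)"
proof -
  let ?x = "snd c \<circ> \<gamma>"
  let ?\<theta> = "snd d \<circ> inv_chart c" and ?\<tau> = "snd c \<circ> inv_chart d"
  let ?S = "snd c ` (fst c \<inter> fst d)" and ?R = "snd d ` (fst d \<inter> fst c)"
  note \<theta> = transition[OF manifold c d] and \<tau> = transition[OF manifold d c]
  have S: "?x s \<in> ?S" "y s \<in> ?R" "?\<theta> (?x s) = y s" "?\<tau> (y s) = ?x s" if "s \<in> T" for s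
    using x(3)[OF that] inv_chart_coord[OF inj c] inv_chart_coord[OF inj d] by (auto simp: y_def)
  define w where "w s = frechet_derivative ?\<theta> (at (?x s)) (x' s)" for s
  have y: "(y has_vector_derivative w s) (at s)" if "s \<in> T" for s
  proof -
    have "((\<lambda>s. ?\<theta> (?x s)) has_vector_derivative w s) (at s)"
      unfolding w_def has_vector_derivative_def
      using smooth_on_has_derivative_compose[OF \<theta>(2) x(4)[OF that, unfolded has_vector_derivative_def] S(1)[OF that]]
        linear_cmul[OF smooth_on_linear_derivative[OF \<theta>(2) S(1)[OF that]]] by (simp only:)
    then show ?thesis
      by (rule has_vector_derivative_transform_within_open[OF _ x(1) that]) (rule S(3))
  qed
  have y'_eq: "y' s = w s" if "s \<in> T" for s
    using vector_derivative_at[OF y[OF that]] by (simp add: y_def y'_def)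
  define ad where "ad = frechet_derivative (\<lambda>z. frechet_derivative ?\<theta> (at z) (x' t)) (at (?x t)) (x' t) + frechet_derivative ?\<theta> (at (?x t)) a"
  have w': "(w has_vector_derivative ad) (at t)"
    unfolding w_def ad_def
    by (rule curve_transform(2)[OF \<theta> S(1)[OF x(2)] x(4)[OF x(2)] x(5)])
  have x'w: "frechet_derivative ?\<tau> (at (y s)) (w s) = x' s" if "s \<in> T" for s
  proof -
    have "((\<lambda>s. ?\<tau> (y s)) has_derivative (\<lambda>h. h *\<^sub>R frechet_derivative ?\<tau> (at (y s)) (w s))) (at s)"
      using smooth_on_has_derivative_compose[OF \<tau>(2) y[OF that, unfolded has_vector_derivative_def] S(2)[OF that]]
        linear_cmul[OF smooth_on_linear_derivative[OF \<tau>(2) S(2)[OF that]]] by (simp only:)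
    then have "(?x has_vector_derivative frechet_derivative ?\<tau> (at (y s)) (w s)) (at s)"
      unfolding has_vector_derivative_def[symmetric]
      by (rule has_vector_derivative_transform_within_open[OF _ x(1) that]) (rule S(4))
    then show ?thesis using x(4)[OF that] vector_derivative_unique_at by blast
  qed
  have "(x' has_vector_derivative
      (frechet_derivative (\<lambda>z. frechet_derivative ?\<tau> (at z) (w t)) (at (y t)) (w t) + frechet_derivative ?\<tau> (at (y t)) ad)) (at t)"
  proof (rule has_vector_derivative_transform_within_open[OF _ x(1,2)])
    show "((\<lambda>s. frechet_derivative ?\<tau> (at (y s)) (w s)) has_vector_derivative
      (frechet_derivative (\<lambda>z. frechet_derivative ?\<tau> (at z) (w t)) (at (y t)) (w t) + frechet_derivative ?\<tau> (at (y t)) ad)) (at t)"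
      by (rule curve_transform(2)[OF \<tau> S(2)[OF x(2)] y[OF x(2)] w'])
  qed (rule x'w)
  \<comment> \<open>The acceleration in \<open>c\<close> is recomputed from the 2-jet in
    \<open>d\<close>, which is the shape in which the pullback consumes it.\<close>
  note a_eq = vector_derivative_unique_at[OF x(5) this]
  have dom': "(y t, w t) \<in> \<Omega> d"
    using transition_lagrangian(1)[OF c d S(1)[OF x(2)], of "x' t"] dom S(3)[OF x(2)] by (simp add: w_def)
  have "euler_lagrange (\<Lambda> d) (y t) (w t) ad"
  proof (rule euler_lagrange_pullback[OF \<Omega>_open[OF c] \<Lambda>_smooth[OF c] \<tau> _ _])
    show "open {q \<in> \<Omega> d. fst q \<in> ?R}" by (rule open_smooth_preimage[OF \<Omega>_open[OF d] smooth_on_fst \<tau>(1)])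
    show "(y t, w t) \<in> {q \<in> \<Omega> d. fst q \<in> ?R}" using dom' S(2)[OF x(2)] by simp
    show "z \<in> ?R \<and> (?\<tau> z, frechet_derivative ?\<tau> (at z) w) \<in> \<Omega> c \<and>
        \<Lambda> d (z, w) = \<Lambda> c (?\<tau> z, frechet_derivative ?\<tau> (at z) w)" if "(z, w) \<in> {q \<in> \<Omega> d. fst q \<in> ?R}" for z w
      using transition_lagrangian[OF d c, of z w] that by auto
    show "euler_lagrange (\<Lambda> c) (?\<tau> (y t)) (frechet_derivative ?\<tau> (at (y t)) (w t))
      (frechet_derivative (\<lambda>x. frechet_derivative ?\<tau> (at x) (w t)) (at (y t)) (w t) + frechet_derivative ?\<tau> (at (y t)) ad)"
      unfolding a_eq[symmetric] x'w[OF x(2)] S(4)[OF x(2)]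
      using euler_lagrange_spray[OF c dom] a by simp
  qed
  then have "ad = - 2 *\<^sub>R spray (chart_rep B d F) (y t) (w t)"
    using euler_lagrange_spray[OF d dom'] by simp
  then have "(w has_vector_derivative - 2 *\<^sub>R spray (chart_rep B d F) (y t) (y' t)) (at t)"
    using w' y'_eq[OF x(2)] by simp
  then show "(y' has_vector_derivative (- 2 *\<^sub>R spray (chart_rep B d F) (y t) (y' t))) (at t)"
    by (rule has_vector_derivative_transform_within_open[OF _ x(1,2)]) (rule y'_eq[symmetric])
  show "y differentiable (at t)"
    using y[OF x(2)] by (auto simp: has_vector_derivative_def differentiable_def)
qed

lemma geodesic_in_chart:
  assumes g: "geodesic B D F I \<gamma>" and I: "open I" and c: "c \<in> B" and t: "t \<in> I" "\<gamma> t \<in> fst c"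
  defines "x \<equiv> snd c \<circ> \<gamma>" and "x' \<equiv> \<lambda>t. vector_derivative (snd c \<circ> \<gamma>) (at t)"
  shows "(x has_vector_derivative x' t) (at t)" "(x t, x' t) \<in> \<Omega> c" "velocity B \<gamma> t = chart_vec B c (x t) (x' t)"
    "\<exists>a. (x' has_vector_derivative a) (at t) \<and> euler_lagrange (\<Lambda> c) (x t) (x' t) a"
proof -
  have cont: "continuous_map (top_of_set I) (atlas_topology B) \<gamma>" and vD: "velocity B \<gamma> t \<in> D (\<gamma> t)"
    and diff: "x differentiable (at t)"
    and x'': "(x' has_vector_derivative (- 2 *\<^sub>R spray (chart_rep B c F) (x t) (x' t))) (at t)"
    using g c t unfolding geodesic_def Let_def x_def x'_def by blast+
  show x: "(x has_vector_derivative x' t) (at t)"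
    unfolding x_def x'_def by (rule vector_derivative_works[THEN iffD1, OF diff[unfolded x_def]])
  show v: "velocity B \<gamma> t = chart_vec B c (x t) (x' t)"
    using velocity_in_chart(1)[OF manifold c continuous_curve_in_chart[OF manifold c cont I], of t] t x by (simp add: x_def)
  show dom: "(x t, x' t) \<in> \<Omega> c"
    using vD t(2) inv_chart_coord[OF inj c t(2)] unfolding v by (simp add: \<Omega>_iff x_def)
  show "\<exists>a. (x' has_vector_derivative a) (at t) \<and> euler_lagrange (\<Lambda> c) (x t) (x' t) a"
    using x'' euler_lagrange_spray[OF c dom] by blast
qed

text \<open>In the selected chart the geodesic equation is a first-order system for position and
  velocity on the open domain of the Lagrangian; \<open>spray_transition\<close> extends the
  conclusion to all other charts.\<close>

lemma geodesic_exists: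
  assumes p: "p \<in> points B" and u: "u \<in> D p"
  obtains \<gamma> e where "e > 0" "geodesic B D F {- e<..<e} \<gamma>" "\<gamma> 0 = p" "velocity B \<gamma> 0 = u"
proof -
  let ?c = "chart_at B p"
  note c = chart_at[OF p]
  let ?f = "\<lambda>q. (snd q, - 2 *\<^sub>R spray (chart_rep B ?c F) (fst q) (snd q))"
  have sm: "smooth_on (\<Omega> ?c) ?f"
    by (intro smooth_on_Pair[OF \<Omega>_open[OF c(1)]] smooth_on_snd smooth_on_scaleR[OF \<Omega>_open[OF c(1)]] smooth_on_const spray_smooth[OF c(1)])
  have q0: "(coord_at B p p, u) \<in> \<Omega> ?c"
    using u c inv_chart_coord[OF inj c] chart_vec_at_self[OF manifold p] by (simp add: \<Omega>_iff coord_at_def)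
  obtain e q where e: "e > 0" and q0: "q 0 = (coord_at B p p, u)" and q\<Omega>: "\<And>t. \<bar>t\<bar> < e \<Longrightarrow> q t \<in> \<Omega> ?c"
    and q': "\<And>t. \<bar>t\<bar> < e \<Longrightarrow> (q has_vector_derivative ?f (q t)) (at t)"
  proof (rule ode_solution_exists[OF \<Omega>_open[OF c(1)] sm q0])
    fix e q assume "e > 0" "q 0 = (coord_at B p p, u)" "\<And>t. \<bar>t\<bar> < e \<Longrightarrow> q t \<in> \<Omega> ?c"
      "\<And>t. \<bar>t\<bar> < e \<Longrightarrow> (q has_vector_derivative ?f (q t)) (at t)"
    then show thesis by (rule that)
  qed
  let ?I = "{- e<..<e}"
  define x x' where "x t = fst (q t)" and "x' t = snd (q t)" for t
  have xim: "x t \<in> snd ?c ` fst ?c" if "t \<in> ?I" for t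
    using q\<Omega>[of t] that by (cases "q t") (auto simp: \<Omega>_iff x_def)
  define \<gamma> where "\<gamma> t = inv_chart ?c (x t)" for t
  have \<gamma>c: "\<gamma> t \<in> fst ?c" "snd ?c (\<gamma> t) = x t" if "t \<in> ?I" for t
    using inv_chart_in[OF xim[OF that]] coord_inv_chart[OF xim[OF that]] by (simp_all add: \<gamma>_def)
  have xd: "(x has_vector_derivative x' t) (at t)"
    "(x' has_vector_derivative - 2 *\<^sub>R spray (chart_rep B ?c F) (x t) (x' t)) (at t)" if "t \<in> ?I" for t
    using has_derivative_fst[OF q'[of t, unfolded has_vector_derivative_def]] has_derivative_snd[OF q'[of t, unfolded has_vector_derivative_def]] that
    by (auto simp: has_vector_derivative_def x_def[abs_def] x'_def[abs_def])
  have cxd: "((snd ?c \<circ> \<gamma>) has_vector_derivative x' t) (at t)" if "t \<in> ?I" for t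
    by (rule has_vector_derivative_transform_within_open[OF xd(1)[OF that] open_greaterThanLessThan that]) (simp add: \<gamma>c)
  have vel: "velocity B \<gamma> t = chart_vec B ?c (x t) (x' t)" if "t \<in> ?I" for t
    using velocity_in_chart(1)[OF manifold c(1) open_greaterThanLessThan that \<gamma>c(1) cxd[OF that]] \<gamma>c(2)[OF that] by simp
  have cont: "continuous_map (top_of_set ?I) (atlas_topology B) \<gamma>"
    unfolding continuous_map_def
  proof (intro conjI allI impI)
    have top: "topspace (atlas_topology B) = points B"
    proof
      show "topspace (atlas_topology B) \<subseteq> points B"
        using openin_topspace[of "atlas_topology B"] unfolding openin_atlas_topology[OF inj] by blast
      show "points B \<subseteq> topspace (atlas_topology B)"
        using openin_subset[OF openin_chart[OF manifold]] by (auto simp: points_def)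
    qed
    show "\<gamma> \<in> topspace (top_of_set ?I) \<rightarrow> topspace (atlas_topology B)"
      unfolding top using chart_in_points[OF c(1) \<gamma>c(1)] by auto
    fix W assume "openin (atlas_topology B) W"
    then have W: "open (snd ?c ` (fst ?c \<inter> W))" using c(1) by (simp add: openin_atlas_topology[OF inj])
    have "continuous_on ?I x"
      by (auto intro!: continuous_at_imp_continuous_on has_vector_derivative_continuous[OF xd(1)])
    from continuous_open_preimage[OF this open_greaterThanLessThan W]
    have "open (?I \<inter> x -` (snd ?c ` (fst ?c \<inter> W)))" .
    moreover have "?I \<inter> x -` (snd ?c ` (fst ?c \<inter> W)) = {t \<in> topspace (top_of_set ?I). \<gamma> t \<in> W}"
      by (rule Set.set_eqI) (use xim in \<open>auto simp only: chart_image_iff[OF inj c(1)] \<gamma>_def vimage_eq Int_iff mem_Collect_eq topspace_euclidean_subtopology\<close>)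
    ultimately show "openin (top_of_set ?I) {t \<in> topspace (top_of_set ?I). \<gamma> t \<in> W}"
      by (metis (no_types, lifting) Int_lower1 openin_open_eq open_greaterThanLessThan)
  qed
  show thesis
  proof (rule that[OF e])
    show "\<gamma> 0 = p" using inv_chart_coord[OF inj c] by (simp add: \<gamma>_def x_def q0 coord_at_def)
    show "velocity B \<gamma> 0 = u"
      using vel[of 0] e chart_vec_at_self[OF manifold p] by (simp add: x_def x'_def q0)
    show "geodesic B D F ?I \<gamma>"
      unfolding geodesic_def Let_def
    proof (intro conjI ballI impI cont)
      show "velocity B \<gamma> t \<in> D (\<gamma> t)" if "t \<in> ?I" for t
        using q\<Omega>[of t] that vel[OF that] by (cases "q t") (auto simp: \<Omega>_iff x_def x'_def \<gamma>_def)
      fix d t assume d: "d \<in> B" and t: "t \<in> ?I" and td: "\<gamma> t \<in> fst d"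
      let ?T = "{t \<in> ?I. \<gamma> t \<in> fst d}"
      have T: "open ?T" by (rule continuous_curve_in_chart[OF manifold d cont open_greaterThanLessThan])
      have dom: "(snd ?c (\<gamma> t), x' t) \<in> \<Omega> ?c"
        using q\<Omega>[of t] t \<gamma>c(2)[OF t] by (cases "q t") (auto simp: x_def x'_def)
      note st = spray_transition[OF c(1) d T, of t \<gamma> x' "- 2 *\<^sub>R spray (chart_rep B ?c F) (x t) (x' t)"]
      show "snd d \<circ> \<gamma> differentiable at t"
        by (rule st(1)) (use t td \<gamma>c cxd xd dom in auto)
      show "((\<lambda>t. vector_derivative (snd d \<circ> \<gamma>) (at t)) has_vector_derivative
         - 2 *\<^sub>R spray (chart_rep B d F) ((snd d \<circ> \<gamma>) t) (vector_derivative (snd d \<circ> \<gamma>) (at t))) (at t)"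
        by (rule st(2)) (use t td \<gamma>c cxd xd dom in auto)
    qed
  qed
qed

text \<open>Homogeneity of degree two turns \<open>hess N u u u\<close> into \<open>(N u)\<^sup>2\<close>.\<close>

lemma F_pos:
  assumes x: "x \<in> points B" and u: "u \<in> D x"
  shows "F x u > 0"
proof -
  have ray: "f' u = g'" if "(f has_derivative f') (at (r *\<^sub>R u))" "\<And>t. t > 0 \<Longrightarrow> f (t *\<^sub>R u) = g t"
      "(g has_real_derivative g') (at r)" "r > 0" for f :: "real ^ 'n \<Rightarrow> real" and f' g g' r
  proof -
    have "((\<lambda>t. t *\<^sub>R u) has_derivative (\<lambda>t. t *\<^sub>R u)) (at r)"
      by (rule has_derivative_scaleR_left[OF has_derivative_ident])
    from has_derivative_compose[OF this that(1)]
    have "((\<lambda>t. f (t *\<^sub>R u)) has_derivative (\<lambda>t. f' (t *\<^sub>R u))) (at r)" .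
    then have "(g has_derivative (\<lambda>t. f' (t *\<^sub>R u))) (at r)"
      by (rule has_derivative_transform_within_open[of _ _ _ _ "{0<..}"]) (use that in auto)
    from fun_cong[OF has_derivative_unique[OF this that(3)[unfolded has_field_derivative_def]], of 1]
    show ?thesis by simp
  qed
  let ?f = "\<lambda>u. (F x u)\<^sup>2"
  let ?D = "\<lambda>v. frechet_derivative ?f (at v) u"
  note sm = F2_smooth[OF x]
  have 1: "?D (r *\<^sub>R u) = 2 * r * ?f u" if r: "r > 0" for r
  proof (rule ray[OF smooth_on_has_derivative[OF sm D_scale[OF x u r]] _ _ r])
    show "?f (t *\<^sub>R u) = t\<^sup>2 * ?f u" if "t > 0" for t
      using F_scale[OF x u that] by (simp add: power_mult_distrib)
    show "((\<lambda>t. t\<^sup>2 * ?f u) has_real_derivative 2 * r * ?f u) (at r)"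
      by (auto intro!: derivative_eq_intros)
  qed
  have "1 *\<^sub>R u \<in> D x" using u by simp
  then have "frechet_derivative ?D (at (1 *\<^sub>R u)) u = 2 * ?f u"
    by (intro ray[OF smooth_on_has_derivative[OF smooth_on_derivative[OF sm]] 1])
       (auto intro!: derivative_eq_intros)
  then have "hess (F x) u u u = ?f u" by (simp add: hess_def)
  then have "?f u = u \<bullet> (fundamental_tensor (F x) u *v u)"
    using hess_eq[OF D_open(1)[OF x] sm u, of u u] by simp
  moreover have "u \<noteq> 0" using finsler x u unfolding finsler_metric_def by blast
  ultimately have "?f u > 0" using pos_def[OF x u] by simp
  then show ?thesis using F_nonneg[OF x u] by (cases "F x u = 0") auto
qed

lemma volume_density_pos:
  assumes x: "x \<in> points B" and u: "u \<in> D x" and bdd: "bounded {u \<in> D x. F x u < 1}"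
  shows "volume_density (D x) (F x) > 0"
proof -
  note D = D_open[OF x]
  have "open {u \<in> D x. F x u < 1}"
  proof -
    have "open (D x \<inter> F x -` {..<1})"
      by (rule continuous_open_preimage[OF smooth_on_continuous[OF D(2)] D(1) open_lessThan])
    moreover have "D x \<inter> F x -` {..<1} = {u \<in> D x. F x u < 1}" by auto
    ultimately show ?thesis by simp
  qed
  \<comment> \<open>Nonemptiness: by homogeneity the rescaled vector has \<open>F\<close>-value one
    half.\<close>
  moreover have "(1 / (2 * F x u)) *\<^sub>R u \<in> {u \<in> D x. F x u < 1}"
    using D_scale[OF x u] F_scale[OF x u] F_pos[OF x u] by simp
  ultimately have "measure lborel {u \<in> D x. F x u < 1} > 0" using measure_open_bounded_pos bdd by blast
  then show ?thesis unfolding volume_density_def by (simp add: content_ball_pos)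
qed

end

section \<open>Volumes under linear maps\<close>

text \<open>The library has the change of variables for linear maps only for well-ordered index types,
  so the index type is replaced by a well-ordered copy.\<close>

typedef 'a ordered_copy = "UNIV :: 'a set" by simp

definition copy_rank :: "'a::finite ordered_copy \<Rightarrow> nat" where
  "copy_rank = (SOME f. inj f)"

lemma inj_copy_rank: "inj copy_rank"
proof -
  have "finite (UNIV :: 'a ordered_copy set)"
    by (rule finite_surj[of "UNIV :: 'a set" _ Abs_ordered_copy]) (auto intro: Abs_ordered_copy_cases)
  then have "\<exists>f :: 'a ordered_copy \<Rightarrow> nat. inj f" using finite_imp_inj_to_nat_seg by blast
  then show ?thesis unfolding copy_rank_def by (rule someI_ex)
qed

instantiation ordered_copy :: (finite) wellorder
begin

definition less_eq_ordered_copy :: "'a ordered_copy \<Rightarrow> 'a ordered_copy \<Rightarrow> bool" where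
  "x \<le> y \<longleftrightarrow> copy_rank x \<le> copy_rank y"

definition less_ordered_copy :: "'a ordered_copy \<Rightarrow> 'a ordered_copy \<Rightarrow> bool" where
  "x < y \<longleftrightarrow> copy_rank x < copy_rank y"

instance
proof
  fix Q :: "'a ordered_copy \<Rightarrow> bool" and a
  assume *: "\<And>x. (\<And>y. y < x \<Longrightarrow> Q y) \<Longrightarrow> Q x"
  show "Q a"
    by (induction a rule: measure_induct_rule[of copy_rank]) (rule *, simp add: less_ordered_copy_def)
qed (auto simp: less_eq_ordered_copy_def less_ordered_copy_def injD[OF inj_copy_rank])

end

instance ordered_copy :: (finite) finite
  by standard (rule finite_surj[of "UNIV :: 'a set" _ Abs_ordered_copy], auto intro: Abs_ordered_copy_cases)

lemma bij_Rep_ordered_copy: "bij Rep_ordered_copy"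
  using type_definition.Rep_range[OF type_definition_ordered_copy] Rep_ordered_copy_inject
  by (auto simp: bij_def inj_on_def)

definition to_copy :: "real ^ 'n \<Rightarrow> real ^ ('n::finite) ordered_copy" where
  "to_copy x = (\<chi> j. x $ Rep_ordered_copy j)"

definition of_copy :: "real ^ ('n::finite) ordered_copy \<Rightarrow> real ^ 'n" where
  "of_copy x = (\<chi> j. x $ Abs_ordered_copy j)"

lemma copy_inverse: "to_copy (of_copy x) = x" "of_copy (to_copy y) = y"
  by (simp_all add: to_copy_def of_copy_def vec_eq_iff Rep_ordered_copy_inverse Abs_ordered_copy_inverse)

lemma linear_copy: "linear to_copy" "linear of_copy"
  by (simp_all add: linear_iff to_copy_def of_copy_def vec_eq_iff)

lemma prod_Basis_cart: "(\<Prod>b\<in>Basis. (x :: real ^ 'n) \<bullet> b) = (\<Prod>i\<in>UNIV. x $ i)"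
proof -
  have B: "(Basis :: (real ^ 'n) set) = range (\<lambda>i. axis i 1)" by (auto simp: Basis_vec_def)
  have "inj (\<lambda>i::'n. axis i (1::real))" by (auto simp: inj_on_def axis_eq_axis)
  from prod.reindex[OF this, of "\<lambda>b. x \<bullet> b"] have "(\<Prod>b\<in>Basis. x \<bullet> b) = (\<Prod>i\<in>UNIV. x \<bullet> axis i 1)"
    unfolding B by simp
  then show ?thesis by (simp add: inner_axis)
qed

lemma to_copy_image: "to_copy ` S = of_copy -` S"
proof
  show "to_copy ` S \<subseteq> of_copy -` S" by (auto simp: copy_inverse)
  show "of_copy -` S \<subseteq> to_copy ` S"
  proof
    fix x assume "x \<in> of_copy -` S"
    then have "to_copy (of_copy x) \<in> to_copy ` S" by blast
    then show "x \<in> to_copy ` S" by (simp add: copy_inverse)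
  qed
qed

text \<open>Lebesgue measure is determined by the volumes of boxes, and relabelling coordinates only
  permutes the side lengths.\<close>

lemma lborel_of_copy: "lborel = distr (lborel :: (real ^ ('n::finite) ordered_copy) measure) borel of_copy"
proof (rule lborel_eqI)
  fix l u :: "real ^ 'n" assume lu: "\<And>b. b \<in> Basis \<Longrightarrow> l \<bullet> b \<le> u \<bullet> b"
  have lu': "l $ i \<le> u $ i" for i using lu[of "axis i 1"] by (auto simp: inner_axis Basis_vec_def)
  have meas: "of_copy \<in> borel_measurable borel"
    by (intro borel_measurable_continuous_onI linear_continuous_on)
       (use linear_copy in \<open>simp add: linear_conv_bounded_linear\<close>)
  have im: "of_copy -` box l u = box (to_copy l) (to_copy u)"
  proof
    show "of_copy -` box l u \<subseteq> box (to_copy l) (to_copy u)"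
      by (auto simp: mem_box_cart to_copy_def of_copy_def) (metis Rep_ordered_copy_inverse)+
    show "box (to_copy l) (to_copy u) \<subseteq> of_copy -` box l u"
      by (auto simp: mem_box_cart to_copy_def of_copy_def) (metis Abs_ordered_copy_inverse UNIV_I)+
  qed
  have "emeasure (distr lborel borel of_copy) (box l u) = emeasure lborel (of_copy -` box l u)"
    using meas by (subst emeasure_distr) auto
  also have "\<dots> = ennreal (\<Prod>b\<in>Basis. (to_copy u - to_copy l) \<bullet> b)"
    unfolding im by (rule emeasure_lborel_box) (use lu' in \<open>auto simp: Basis_vec_def inner_axis to_copy_def\<close>)
  also have "(\<Prod>b\<in>Basis. (to_copy u - to_copy l) \<bullet> b) = (\<Prod>j\<in>UNIV. (u - l) $ Rep_ordered_copy j)"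
    by (simp only: prod_Basis_cart) (simp add: to_copy_def)
  also have "\<dots> = (\<Prod>i\<in>UNIV. (u - l) $ i)"
    by (rule prod.reindex_bij_betw[OF bij_Rep_ordered_copy])
  finally show "emeasure (distr lborel borel of_copy) (box l u) = ennreal (\<Prod>b\<in>Basis. (u - l) \<bullet> b)"
    by (simp only: prod_Basis_cart)
qed simp

lemma measure_to_copy:
  assumes "S \<in> sets borel"
  shows "measure lborel (to_copy ` S) = measure lborel S"
proof -
  have meas: "of_copy \<in> borel_measurable borel"
    by (intro borel_measurable_continuous_onI linear_continuous_on)
       (use linear_copy in \<open>simp add: linear_conv_bounded_linear\<close>)
  have "measure lborel S = measure (distr lborel borel of_copy) S" by (subst lborel_of_copy) simp
  also have "\<dots> = measure lborel (of_copy -` S)" using meas assms by (subst measure_distr) auto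
  finally show ?thesis by (simp add: to_copy_image)
qed

text \<open>Transporting permutations along the relabelling is a bijection that preserves signs, so
  the Leibniz sums agree term by term.\<close>

lemma det_copy: "det (\<chi> i j. A $ Rep_ordered_copy i $ Rep_ordered_copy j) = det (A :: real ^ 'n ^ 'n)"
proof -
  let ?f = "Abs_ordered_copy :: 'n \<Rightarrow> 'n ordered_copy"
  have inj: "inj ?f" by (simp add: inj_def Abs_ordered_copy_inject)
  have range: "range ?f = UNIV" by (auto intro: Abs_ordered_copy_cases)
  let ?m = "map_permutation UNIV ?f"
  have app: "?m q (?f x) = ?f (q x)" for q x by (rule map_permutation_apply[OF inj]) simp
  have bij: "bij_betw ?m {q. q permutes UNIV} {q. q permutes (UNIV :: 'n ordered_copy set)}"
  proof (rule bij_betw_byWitness[where f' = "map_permutation UNIV Rep_ordered_copy"])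
    have bf: "bij_betw ?f UNIV UNIV" and br: "bij_betw (Rep_ordered_copy :: 'n ordered_copy \<Rightarrow> 'n) UNIV UNIV"
      using inj range bij_Rep_ordered_copy by (simp_all add: bij_betw_def bij_def)
    show "\<forall>q\<in>{q. q permutes UNIV}. map_permutation UNIV Rep_ordered_copy (?m q) = q"
      using bf by (auto intro!: map_permutation_compose_inv simp: Abs_ordered_copy_inverse)
    show "\<forall>q\<in>{q. q permutes UNIV}. ?m (map_permutation UNIV Rep_ordered_copy q) = q"
      using br by (auto intro!: map_permutation_compose_inv simp: Rep_ordered_copy_inverse)
    show "?m ` {q. q permutes UNIV} \<subseteq> {q. q permutes UNIV}"
      using map_permutation_permutes[OF bf] by auto
    show "map_permutation UNIV Rep_ordered_copy ` {q. q permutes (UNIV :: 'n ordered_copy set)} \<subseteq> {q. q permutes UNIV}"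
      using map_permutation_permutes[OF br] by auto
  qed
  let ?A = "\<chi> i j. A $ Rep_ordered_copy i $ Rep_ordered_copy j"
  have "det ?A = (\<Sum>q | q permutes UNIV. of_int (sign (?m q)) * (\<Prod>i\<in>UNIV. ?A $ i $ ?m q i))"
    unfolding det_def by (rule sum.reindex_bij_betw[OF bij, symmetric])
  also have "\<dots> = (\<Sum>q | q permutes UNIV. of_int (sign q) * (\<Prod>i\<in>UNIV. A $ i $ q i))"
  proof (rule sum.cong[OF refl])
    fix q assume "q \<in> {q. q permutes (UNIV :: 'n set)}"
    then have "sign (?m q) = sign q" using inj by (intro sign_map_permutation) auto
    moreover have "(\<Prod>i\<in>UNIV. ?A $ i $ ?m q i) = (\<Prod>x\<in>UNIV. ?A $ ?f x $ ?m q (?f x))"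
      using inj range by (intro prod.reindex_bij_betw[symmetric]) (simp add: bij_betw_def)
    moreover have "\<dots> = (\<Prod>x\<in>UNIV. A $ x $ q x)"
      by (simp add: app Abs_ordered_copy_inverse)
    ultimately show "of_int (sign (?m q)) * (\<Prod>i\<in>UNIV. ?A $ i $ ?m q i) = of_int (sign q) * (\<Prod>i\<in>UNIV. A $ i $ q i)"
      by simp
  qed
  finally show ?thesis by (simp add: det_def)
qed

lemma measure_lborel_linear_image:
  fixes T :: "real ^ 'n \<Rightarrow> real ^ 'n"
  assumes T: "linear T" and S: "open S" "bounded S" and im: "open (T ` S)"
  shows "measure lborel (T ` S) = \<bar>det (matrix T)\<bar> * measure lborel S"
proof -
  let ?T = "\<lambda>x. to_copy (T (of_copy x))"
  have lT: "linear ?T"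
    using linear_compose[OF linear_compose[OF linear_copy(2) T] linear_copy(1)] by (simp add: comp_def)
  have opc: "open (to_copy ` U)" if "open U" for U :: "(real ^ 'n) set"
  proof -
    have "continuous_on UNIV (of_copy :: _ \<Rightarrow> real ^ 'n)"
      using linear_copy(2) by (intro linear_continuous_on) (simp add: linear_conv_bounded_linear)
    then show ?thesis unfolding to_copy_image by (rule open_vimage[OF that])
  qed
  have bdd: "bounded (to_copy ` S)"
    using bounded_linear_image[OF S(2)] linear_copy(1) by (simp add: linear_conv_bounded_linear)
  have "to_copy ` S \<in> lmeasurable" using opc[OF S(1)] bdd by (simp add: lmeasurable_open)
  from measure_linear_image[OF lT this]
  have "measure lebesgue (?T ` to_copy ` S) = \<bar>det (matrix ?T)\<bar> * measure lebesgue (to_copy ` S)" .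
  also have "?T ` to_copy ` S = to_copy ` T ` S" by (simp add: image_image copy_inverse)
  also have "measure lebesgue (to_copy ` T ` S) = measure lborel (T ` S)"
    using opc[OF im] measure_to_copy[of "T ` S"] im by (simp add: measure_completion)
  also have "measure lebesgue (to_copy ` S) = measure lborel S"
    using opc[OF S(1)] measure_to_copy[of S] S(1) by (simp add: measure_completion)
  also have "matrix ?T = (\<chi> i j. matrix T $ Rep_ordered_copy i $ Rep_ordered_copy j)"
  proof -
    have "of_copy (axis j 1) = axis (Rep_ordered_copy j) (1 :: real)" for j :: "'n ordered_copy"
      by (auto simp: of_copy_def axis_def vec_eq_iff Rep_ordered_copy_inverse Abs_ordered_copy_inverse)
    then show ?thesis by (simp add: matrix_def to_copy_def)
  qed
  also have "det \<dots> = det (matrix T)" by (rule det_copy)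
  finally show ?thesis .
qed

section \<open>Invariant Finsler metrics\<close>

locale homogeneous_finsler = homogeneous_on G A H B + fin: finsler B D F
  for G :: "('g, 'z) monoid_scheme" (structure) and A :: "('g, 'e::euclidean_space) atlas"
    and H :: "'g set" and B :: "('g set, real ^ 'n) atlas"
    and D :: "'g set \<Rightarrow> (real ^ 'n) set" and F :: "'g set \<Rightarrow> real ^ 'n \<Rightarrow> real" +
  assumes inv: "invariant_metric G B D F"
begin

lemma translation_metric:
  assumes "g \<in> carrier G"
  shows "tr g u \<in> D (g <# H) \<longleftrightarrow> u \<in> D H" "u \<in> D H \<Longrightarrow> F (g <# H) (tr g u) = F H u"
  using inv assms H_points unfolding invariant_metric_def Let_def by blast+

text \<open>With \<open>?M\<close> the matrix of the translation, the root of the determinant of the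
  tensor at H is the absolute value of \<open>det ?M\<close> times that at the translate, while the
  volume of the unit sublevel set grows by the same factor. The two cancel in the quotient.
  Boundedness makes the volume finite, as the change of variables demands.\<close>

lemma distortion_invariant:
  assumes g: "g \<in> carrier G" and u: "u \<in> D H" and bdd: "bounded {u \<in> D H. F H u < 1}"
  shows "distortion D F (g <# H) (tr g u) = distortion D F H u"
proof -
  let ?x = "g <# H" and ?T = "tr g" and ?M = "matrix (tr g)"
  have x: "?x \<in> points B" by (rule pr_points[OF g])
  note T = translation_tangent(4,5)[OF g]
  note DH = fin.D_open[OF H_points] and Dx = fin.D_open[OF x]
  note tm = translation_metric[OF g]
  have M: "?M *v w = ?T w" for w using T(1) by (simp add: matrix_works linear_matrix_vector_mul_eq)
  have "inj ?T" by (rule linear_surj_imp_inj[OF T])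
  then have d: "det ?M \<noteq> 0" using det_nz_iff_inj[OF T(1)] by blast
  let ?g = "fundamental_tensor (F H) u" and ?g' = "fundamental_tensor (F ?x) (?T u)"
  have "?g = transpose ?M ** (?g' ** ?M)"
    unfolding matrix_eq
  proof
    fix v
    have "w \<bullet> (?g *v v) = w \<bullet> ((transpose ?M ** (?g' ** ?M)) *v v)" for w
    proof -
      have "w \<bullet> (?g *v v) = hess (F H) u v w" by (rule hess_eq[OF DH(1) fin.F2_smooth[OF H_points] u, symmetric])
      also have "\<dots> = hess (F ?x) (?T u) (?T v) (?T w)"
        by (rule hess_linear_change[OF DH(1) u Dx(1) fin.F2_smooth[OF x] T(1)]) (use tm in auto)
      also have "\<dots> = ?T w \<bullet> (?g' *v ?T v)"
        by (rule hess_eq[OF Dx(1) fin.F2_smooth[OF x]]) (use tm u in auto)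
      also have "\<dots> = w \<bullet> ((transpose ?M ** (?g' ** ?M)) *v v)"
      proof -
        have "w \<bullet> (transpose ?M *v z) = ?T w \<bullet> z" for z
          by (metis dot_lmul_matrix vector_transpose_matrix M)
        then show ?thesis by (simp only: matrix_vector_mul_assoc[symmetric] M)
      qed
      finally show ?thesis .
    qed
    then show "?g *v v = (transpose ?M ** (?g' ** ?M)) *v v" using vector_eq_ldot by blast
  qed
  then have det: "det ?g = (det ?M)\<^sup>2 * det ?g'" by (simp add: det_mul det_transpose power2_eq_square)
  let ?S = "{u \<in> D H. F H u < 1}" and ?S' = "{u \<in> D ?x. F ?x u < 1}"
  have open1: "open {u \<in> D y. F y u < 1}" if "y \<in> points B" for y
    using open_smooth_preimage[OF fin.D_open[OF that], of "{..<1}"] by simp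
  have im: "?S' = ?T ` ?S"
  proof
    show "?S' \<subseteq> ?T ` ?S"
    proof
      fix v assume v: "v \<in> ?S'"
      obtain w where w: "v = ?T w" using T(2) by (metis surjD)
      then show "v \<in> ?T ` ?S" using v tm by auto
    qed
    show "?T ` ?S \<subseteq> ?S'" using tm by auto
  qed
  have vol: "measure lborel ?S' = \<bar>det ?M\<bar> * measure lborel ?S"
    unfolding im by (rule measure_lborel_linear_image[OF T(1) open1[OF H_points] bdd]) (use open1[OF x] im in simp)
  have "sqrt (det ?g) = \<bar>det ?M\<bar> * sqrt (det ?g')" by (simp add: det real_sqrt_mult)
  then have "sqrt (det ?g') / volume_density (D ?x) (F ?x) = sqrt (det ?g) / volume_density (D H) (F H)"
    using d unfolding volume_density_def vol by simp
  then show ?thesis by (simp add: distortion_def)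
qed

text \<open>The Lagrangian \<open>F\<^sup>2\<close> pulled back to the group, in the chart around the unit.\<close>

definition "\<Theta> q = (pih (fst q), frechet_derivative pih (at (fst q)) (snd q))"
definition "\<Omega>G = {q \<in> Op \<times> UNIV. \<Theta> q \<in> fin.\<Omega> k0}"
definition "LG q = fin.\<Lambda> k0 (\<Theta> q)"
definition "ll u = (F H (P u))\<^sup>2"
definition "UH = {u. P u \<in> D H}"

section \<open>Smoothness and left invariance of the lifted Lagrangian\<close>

lemma Op_prod: "open (Op \<times> (UNIV :: 'e set))" by (intro open_Times pih_smooth open_UNIV)

lemma \<Theta>_smooth: "smooth_on (Op \<times> (UNIV :: 'e set)) \<Theta>"
proof -
  have "smooth_on (Op \<times> (UNIV :: 'e set)) (\<lambda>q. pih (fst q))"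
    by (rule smooth_on_compose[OF Op_prod smooth_on_fst pih_smooth(2)]) auto
  moreover have "smooth_on (Op \<times> UNIV) (\<lambda>q. frechet_derivative pih (at (fst q)) (snd q))"
    using smooth_on_derivative_joint[OF pih_smooth] by (simp add: case_prod_unfold)
  ultimately show ?thesis unfolding \<Theta>_def by (rule smooth_on_Pair[OF Op_prod])
qed

lemma LG_smooth: "open \<Omega>G" "smooth_on \<Omega>G LG"
proof -
  show o: "open \<Omega>G"
    unfolding \<Omega>G_def by (rule open_smooth_preimage[OF Op_prod \<Theta>_smooth fin.\<Omega>_open[OF k0(1)]])
  show "smooth_on \<Omega>G LG"
    unfolding LG_def
    by (rule smooth_on_compose[OF o smooth_on_subset[OF \<Theta>_smooth] fin.\<Lambda>_smooth[OF k0(1)]]) (auto simp: \<Omega>G_def)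
qed

lemma UH_smooth: "open UH" "smooth_on UH ll"
proof -
  have P: "smooth_on UNIV P" using linear_P by (intro smooth_on_bounded_linear) (simp add: linear_conv_bounded_linear)
  have eq: "UH = {u \<in> UNIV. P u \<in> D H}" by (simp add: UH_def)
  show o: "open UH" unfolding eq by (rule open_smooth_preimage[OF open_UNIV P fin.D_open(1)[OF H_points]])
  show "smooth_on UH ll"
    unfolding ll_def
    by (rule smooth_on_compose[OF o smooth_on_subset[OF P subset_UNIV] fin.F2_smooth[OF H_points]]) (auto simp: UH_def)
qed

text \<open>Both sides are derivatives at the unit of the map taking a group element to the coset of
  its product with \<open>p \<eta>\<close>, one read on G/H and the other through \<open>pih\<close>
  and the multiplication in coordinates.\<close>

lemma translation_in_chart:
  assumes \<eta>: "\<eta> \<in> Op"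
  shows "tr (p \<eta>) (P u) = chart_vec B k0 (pih \<eta>) (frechet_derivative pih (at \<eta>) (M \<eta> u))"
proof -
  have O: "\<eta> \<in> O0" and k: "p \<eta> <# H \<in> fst k0" using \<eta> by (auto simp: Op_def)
  note g = p_carrier[OF O]
  let ?g = "p \<eta>" and ?e = "chart_at B (p \<eta> <# H)"
  have ik: "inv_chart k0 (pih \<eta>) = ?g <# H"
    unfolding pih_def by (rule inv_chart_coord[OF B_inj k0(1) k])
  note e = chart_at[OF pr_points[OF g]]
  have d1: "((snd ?e \<circ> inv_chart k0) has_derivative chart_vec B k0 (pih \<eta>)) (at (pih \<eta>))"
    unfolding chart_vec_eq ik
    by (rule smooth_on_has_derivative[OF transition(2)[OF B_manifold k0(1) e(1)]]) (use k e in \<open>auto simp: pih_def\<close>)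
  have d2: "((\<lambda>\<zeta>. mm (\<eta>, \<zeta>)) has_derivative (\<lambda>h. Dmm (\<eta>, \<eta>0) (0, h))) (at \<eta>0)"
    by (rule mm_right_derivative[OF Om_unit(1)[OF O] has_derivative_ident]) simp
  have d3: "((\<lambda>\<zeta>. pih (mm (\<eta>, \<zeta>))) has_derivative (\<lambda>h. frechet_derivative pih (at \<eta>) (M \<eta> h))) (at \<eta>0)"
    using smooth_on_has_derivative_compose[OF pih_smooth(2) d2] \<eta> by (simp add: mm_unit O M_def)
  have d4: "((\<lambda>\<zeta>. (snd ?e \<circ> inv_chart k0) (pih (mm (\<eta>, \<zeta>)))) has_derivative
      (\<lambda>h. chart_vec B k0 (pih \<eta>) (frechet_derivative pih (at \<eta>) (M \<eta> h)))) (at \<eta>0)"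
    by (rule has_derivative_compose[OF d3], unfold mm_unit(1)[OF O], rule d1)
  let ?W = "{\<zeta> \<in> {\<zeta>. (\<eta>, \<zeta>) \<in> Om}. mm (\<eta>, \<zeta>) \<in> Op}"
  have sm: "smooth_on {\<zeta>. (\<eta>, \<zeta>) \<in> Om} (\<lambda>\<zeta>. mm (\<eta>, \<zeta>))"
    by (rule smooth_on_compose[OF open_slice(1) smooth_on_Pair[OF open_slice(1) smooth_on_const smooth_on_ident] Om_smooth(2)]) auto
  have "((coord_at B (?g <# H) \<circ> (\<lambda>x. (?g \<otimes> x) <# H) \<circ> point_at A \<one>) has_derivative
      (\<lambda>h. chart_vec B k0 (pih \<eta>) (frechet_derivative pih (at \<eta>) (M \<eta> h)))) (at \<eta>0)"
  proof (rule has_derivative_transform_within_open[OF d4])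
    show "open ?W" by (rule open_smooth_preimage[OF open_slice(1) sm pih_smooth(1)])
    show "\<eta>0 \<in> ?W" using Om_unit(1)[OF O] \<eta> by (simp add: mm_unit O)
    fix \<zeta> assume z: "\<zeta> \<in> ?W"
    then have "inv_chart k0 (pih (mm (\<eta>, \<zeta>))) = p (mm (\<eta>, \<zeta>)) <# H"
      unfolding pih_def by (intro inv_chart_coord[OF B_inj k0(1)]) (simp add: Op_def)
    then show "(snd ?e \<circ> inv_chart k0) (pih (mm (\<eta>, \<zeta>))) = (coord_at B (?g <# H) \<circ> (\<lambda>x. (?g \<otimes> x) <# H) \<circ> point_at A \<one>) \<zeta>"
      using z p_mm[of "(\<eta>, \<zeta>)"] by (simp add: coord_at_def point_at_eq c0_def[symmetric] p_def[symmetric])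
  qed
  from fun_cong[OF frechet_derivative_at[OF this, symmetric], of u]
  have "tangent_map A B (\<lambda>x. (?g \<otimes> x) <# H) \<one> u = chart_vec B k0 (pih \<eta>) (frechet_derivative pih (at \<eta>) (M \<eta> u))"
    unfolding tangent_map_def using g by (simp add: coord_at_def[of A] c0_def[symmetric] \<eta>0_def[symmetric])
  then show ?thesis unfolding translation_tangent(2)[OF g] .
qed

text \<open>Invariance of the metric in terms of the group: in the left trivialisation by
  \<open>M\<close> the Lagrangian no longer depends on the base point.\<close>

lemma LG_left_invariant:
  assumes \<eta>: "\<eta> \<in> Op"
  shows "(\<eta>, M \<eta> u) \<in> \<Omega>G \<longleftrightarrow> u \<in> UH" "u \<in> UH \<Longrightarrow> LG (\<eta>, M \<eta> u) = ll u"
proof -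
  have O: "\<eta> \<in> O0" and k: "p \<eta> <# H \<in> fst k0" using \<eta> by (auto simp: Op_def)
  note g = p_carrier[OF O]
  have ik: "inv_chart k0 (pih \<eta>) = p \<eta> <# H"
    unfolding pih_def by (rule inv_chart_coord[OF B_inj k0(1) k])
  show "(\<eta>, M \<eta> u) \<in> \<Omega>G \<longleftrightarrow> u \<in> UH"
    using \<eta> k translation_metric(1)[OF g, of "P u"] translation_in_chart[OF \<eta>, of u]
    by (auto simp: \<Omega>G_def \<Theta>_def UH_def fin.\<Omega>_iff ik) (auto simp: pih_def)
  show "LG (\<eta>, M \<eta> u) = ll u" if "u \<in> UH"
    using translation_metric(2)[OF g, of "P u"] translation_in_chart[OF \<eta>, of u] that
    by (simp add: LG_def \<Theta>_def fin.\<Lambda>_def fin.chart_rep_eq ik ll_def UH_def)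
qed

section \<open>Reduction of the Euler-Lagrange equation to the Lie algebra\<close>

lemma M_has_derivative:
  assumes \<eta>: "(f has_derivative f') (at t)" "f t = \<eta>0" and u: "(u has_derivative u') (at t)"
  shows "((\<lambda>t. M (f t) (u t)) has_derivative (\<lambda>h. m12 (f' h) (u t) + u' h)) (at t)"
proof -
  have "((\<lambda>x. Dmm (f x, \<eta>0) (0, u x)) has_derivative
     (\<lambda>d. frechet_derivative (\<lambda>q. Dmm q (0, u t)) (at (f t, \<eta>0)) (f' d, 0) + Dmm (f t, \<eta>0) (0, u' d))) (at t)"
  proof (rule has_derivative_eval_derivative[OF Om_smooth])
    show "(f t, \<eta>0) \<in> Om" using Om_unit(1)[OF \<eta>0(1)] \<eta>(2) by simp
    show "((\<lambda>x. (f x, \<eta>0)) has_derivative (\<lambda>d. (f' d, 0))) (at t)"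
      by (rule has_derivative_Pair[OF \<eta>(1) has_derivative_const])
    show "((\<lambda>x. (0, u x)) has_derivative (\<lambda>d. (0, u' d))) (at t)"
      by (rule has_derivative_Pair[OF has_derivative_const u])
  qed
  then show ?thesis unfolding M_def[symmetric] \<eta>(2) m12_eq[symmetric] M_\<eta>0 .
qed

text \<open>The equation is tested on the left-invariant extension of \<kappa>. Invariance trades
  the derivative of the Lagrangian in the base point for one in the velocity, and the two terms
  containing \<open>m12\<close> combine to the bracket.\<close>

theorem euler_poincare:
  assumes y: "y \<in> UH" and EL: "euler_lagrange LG \<eta>0 y (m12 y y + b)"
  shows "frechet_derivative (\<lambda>u. frechet_derivative ll (at u) \<kappa>) (at y) b
    = frechet_derivative ll (at y) (lie_bracket G A y \<kappa>)"
proof -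
  let ?L = "\<lambda>q. frechet_derivative LG (at q)" and ?l = "\<lambda>u. frechet_derivative ll (at u)"
  have y\<Omega>: "(\<eta>0, y) \<in> \<Omega>G" using LG_left_invariant(1)[OF \<eta>0_Op(1), of y] y by (simp add: M_\<eta>0)
  have linL: "linear (?L (\<eta>0, y))" by (rule smooth_on_linear_derivative[OF LG_smooth(2) y\<Omega>])
  have Dl: "?L (\<eta>, M \<eta> u) (0, M \<eta> k) = ?l u k" if \<eta>: "\<eta> \<in> Op" and u: "u \<in> UH" for \<eta> u k
  proof -
    have "\<eta> \<in> O0" using \<eta> by (simp add: Op_def)
    from linear_M[OF this] have bl: "(M \<eta> has_derivative M \<eta>) (at u)"
      by (simp add: linear_conv_bounded_linear bounded_linear_imp_has_derivative)
    have "((\<lambda>u. LG (\<eta>, M \<eta> u)) has_derivative (\<lambda>k. ?L (\<eta>, M \<eta> u) (0, M \<eta> k))) (at u)"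
      by (rule smooth_on_has_derivative_compose[OF LG_smooth(2) has_derivative_Pair[OF has_derivative_const bl]])
         (use LG_left_invariant(1)[OF \<eta>] u in simp)
    then have "(ll has_derivative (\<lambda>k. ?L (\<eta>, M \<eta> u) (0, M \<eta> k))) (at u)"
      by (rule has_derivative_transform_within_open[OF _ UH_smooth(1) u]) (rule LG_left_invariant(2)[OF \<eta>])
    from fun_cong[OF frechet_derivative_at[OF this], of k] show ?thesis .
  qed
  have lb: "linear (?l y)" by (rule smooth_on_linear_derivative[OF UH_smooth(2) y])
  \<comment> \<open>The Lagrangian is constant along a left-invariant field, so its derivative in
    that direction vanishes.\<close>
  have inv\<eta>: "?L (\<eta>0, y) (k, m12 k y) = 0" for k
  proof -
    have "((\<lambda>\<eta>. LG (\<eta>, M \<eta> y)) has_derivative (\<lambda>k. ?L (\<eta>0, M \<eta>0 y) (k, m12 k y))) (at \<eta>0)"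
      by (rule smooth_on_has_derivative_compose[OF LG_smooth(2) has_derivative_Pair[OF has_derivative_ident m12]])
         (use y\<Omega> in \<open>simp add: M_\<eta>0\<close>)
    moreover have "((\<lambda>\<eta>. LG (\<eta>, M \<eta> y)) has_derivative (\<lambda>k. 0)) (at \<eta>0)"
      by (rule has_derivative_transform_within_open[OF has_derivative_const pih_smooth(1) \<eta>0_Op(1)])
         (rule LG_left_invariant(2)[OF _ y, symmetric])
    ultimately have "(\<lambda>k. ?L (\<eta>0, M \<eta>0 y) (k, m12 k y)) = (\<lambda>k. 0)" by (rule has_derivative_unique)
    from fun_cong[OF this, of k] show ?thesis by (simp add: M_\<eta>0)
  qed
  \<comment> \<open>The momentum paired with the left-invariant extension of \<kappa> is
    differentiated in two ways: here by the product rule on the tangent bundle, in \<open>J2\<close>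
    after the left trivialisation, where only the velocity matters.\<close>
  have J1: "((\<lambda>q. ?L (fst q, M (fst q) (snd q)) (0, M (fst q) \<kappa>)) has_derivative
     (\<lambda>d. frechet_derivative (\<lambda>p. ?L p (0, M \<eta>0 \<kappa>)) (at (\<eta>0, M \<eta>0 y)) (fst d, m12 (fst d) y + snd d)
       + ?L (\<eta>0, M \<eta>0 y) (0, m12 (fst d) \<kappa>))) (at (\<eta>0, y))"
  proof -
    have f: "(fst has_derivative fst) (at (\<eta>0, y))" and s: "(snd has_derivative snd) (at (\<eta>0, y))"
      using bounded_linear_fst bounded_linear_snd by (auto intro: bounded_linear_imp_has_derivative)
    have 1: "((\<lambda>q. (fst q, M (fst q) (snd q))) has_derivative (\<lambda>d. (fst d, m12 (fst d) y + snd d))) (at (\<eta>0, y))"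
      using has_derivative_Pair[OF f M_has_derivative[OF f _ s]] by simp
    have "((\<lambda>q. M (fst q) \<kappa>) has_derivative (\<lambda>d. m12 (fst d) \<kappa>)) (at (\<eta>0, y))"
      using M_has_derivative[OF f _ has_derivative_const[of \<kappa>]] by simp
    note 2 = has_derivative_Pair[OF has_derivative_const this]
    show ?thesis
      using has_derivative_eval_derivative[OF LG_smooth _ 1 2] y\<Omega> by (simp add: M_\<eta>0)
  qed
  have J2: "((\<lambda>q. ?L (fst q, M (fst q) (snd q)) (0, M (fst q) \<kappa>)) has_derivative
     (\<lambda>d. frechet_derivative (\<lambda>u. ?l u \<kappa>) (at y) (snd d))) (at (\<eta>0, y))"
  proof (rule has_derivative_transform_within_open)
    show "((\<lambda>q. ?l (snd q) \<kappa>) has_derivative (\<lambda>d. frechet_derivative (\<lambda>u. ?l u \<kappa>) (at y) (snd d))) (at (\<eta>0, y))"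
      using smooth_on_has_derivative_compose[OF smooth_on_derivative[OF UH_smooth(2)] has_derivative_snd[OF has_derivative_ident], of "(\<eta>0, y)"]
        y by simp
    show "open (Op \<times> UH)" by (intro open_Times pih_smooth UH_smooth)
    show "(\<eta>0, y) \<in> Op \<times> UH" using \<eta>0_Op y by simp
  qed (auto simp: Dl)
  have "frechet_derivative (\<lambda>u. ?l u \<kappa>) (at y) b
     = frechet_derivative (\<lambda>p. ?L p (0, M \<eta>0 \<kappa>)) (at (\<eta>0, M \<eta>0 y)) (y, m12 y y + b) + ?L (\<eta>0, M \<eta>0 y) (0, m12 y \<kappa>)"
    using fun_cong[OF has_derivative_unique[OF J1 J2], of "(y, b)"] by simp
  also have "\<dots> = ?L (\<eta>0, y) (\<kappa>, 0) + ?L (\<eta>0, y) (0, m12 y \<kappa>)"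
    using EL unfolding euler_lagrange_def M_\<eta>0 by simp
  also have "?L (\<eta>0, y) (\<kappa>, 0) = ?L (\<eta>0, y) (\<kappa>, m12 \<kappa> y) - ?L (\<eta>0, y) (0, m12 \<kappa> y)"
    using linear_diff[OF linL, of "(\<kappa>, m12 \<kappa> y)" "(0, m12 \<kappa> y)"] by simp
  also have "?L (\<eta>0, y) (\<kappa>, m12 \<kappa> y) = 0" by (rule inv\<eta>)
  also have "0 - ?L (\<eta>0, y) (0, m12 \<kappa> y) + ?L (\<eta>0, y) (0, m12 y \<kappa>) = ?l y (m12 y \<kappa>) - ?l y (m12 \<kappa> y)"
    using Dl[OF \<eta>0_Op(1) y] by (simp add: M_\<eta>0)
  also have "\<dots> = ?l y (lie_bracket G A y \<kappa>)"
    by (simp add: lie_bracket_eq linear_diff[OF lb])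
  finally show ?thesis .
qed

lemma distortion_along_geodesic:
  assumes m: "reductive_decomposition G A H \<mm>" and y: "y \<in> \<mm>" "P y \<in> D H"
    and bdd: "bounded {u \<in> D H. F H u < 1}"
    and geo: "e > 0" "geodesic B D F {- e<..<e} \<gamma>" "\<gamma> 0 = H" "velocity B \<gamma> 0 = P y"
    and \<tau>: "(distortion D F H has_derivative \<tau>') (at (P y))"
  obtains b where "((\<lambda>t. distortion D F (\<gamma> t) (velocity B \<gamma> t)) has_real_derivative \<tau>' (P b)) (at 0)"
    "\<And>\<kappa>. 2 * hess (F H) (P y) (P \<kappa>) (P b) = frechet_derivative (\<lambda>v. (F H v)\<^sup>2) (at (P y)) (P (lie_bracket G A y \<kappa>))"
proof -
  \<comment> \<open>A section with derivative \<open>Q\<close> at the origin makes the lift start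
    with velocity \<open>y\<close> itself, because \<open>Q\<close> inverts \<open>P\<close> on
    \<mm>.\<close>
  obtain Q where Q: "linear Q" "\<And>w. P (Q w) = w" "Q (P y) = y" using reductive(2)[OF m] y(1) by blast
  obtain W \<sigma> where W: "open W" "\<kappa>0 \<in> W" "smooth_on W \<sigma>" "\<sigma> \<kappa>0 = \<eta>0"
    "\<And>z. z \<in> W \<Longrightarrow> \<sigma> z \<in> Op" "\<And>z. z \<in> W \<Longrightarrow> pih (\<sigma> z) = z" "(\<sigma> has_derivative Q) (at \<kappa>0)"
    using section_exists[OF Q(1,2)] by metis
  let ?I = "{- e<..<e}"
  define x x' where "x = snd k0 \<circ> \<gamma>" and "x' t = vector_derivative (snd k0 \<circ> \<gamma>) (at t)" for t
  have cont: "continuous_map (top_of_set ?I) (atlas_topology B) \<gamma>" using geo(2) by (simp add: geodesic_def)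
  let ?T0 = "{t \<in> ?I. \<gamma> t \<in> fst k0}"
  have T0: "open ?T0" by (rule continuous_curve_in_chart[OF B_manifold k0(1) cont open_greaterThanLessThan])
  note gc = fin.geodesic_in_chart[OF geo(2) open_greaterThanLessThan k0(1), folded x_def]
  have xd: "(x has_vector_derivative x' t) (at t)" and xv: "velocity B \<gamma> t = chart_vec B k0 (x t) (x' t)"
    if "t \<in> ?T0" for t
    using gc(1,3)[of t] that by (auto simp: x_def x'_def)
  have 0: "0 \<in> ?T0" using geo k0 by simp
  obtain a0 where a0: "(x' has_vector_derivative a0) (at 0)" "euler_lagrange (fin.\<Lambda> k0) (x 0) (x' 0) a0"
    using gc(4)[of 0] 0 unfolding x_def[symmetric] x'_def[abs_def] by auto
  have x0: "x 0 = \<kappa>0" by (simp add: x_def geo \<kappa>0_def)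
  have x'0: "x' 0 = P y"
    using xv[OF 0] geo(4) chart_vec_at_self[OF B_manifold H_points]
    by (simp add: x0 \<kappa>0_def k0_def coord_at_def)
  define T where "T = {t \<in> ?T0. x t \<in> W}"
  have contx: "continuous_on ?T0 x"
    by (auto intro!: continuous_at_imp_continuous_on has_vector_derivative_continuous[OF xd])
  have T: "open T"
    using continuous_open_preimage[OF contx T0 W(1)] unfolding T_def by (simp add: Int_def vimage_def)
  have 0: "0 \<in> T" using 0 W x0 by (simp add: T_def)
  have TT: "t \<in> ?T0" "x t \<in> W" if "t \<in> T" for t using that by (auto simp: T_def)
  define \<eta> where "\<eta> t = \<sigma> (x t)" for t
  define \<eta>' where "\<eta>' t = frechet_derivative \<sigma> (at (x t)) (x' t)" for t
  define a where "a = frechet_derivative (\<lambda>z. frechet_derivative \<sigma> (at z) (x' 0)) (at (x 0)) (x' 0) + frechet_derivative \<sigma> (at (x 0)) a0"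
  have \<eta>d: "(\<eta> has_vector_derivative \<eta>' t) (at t)" if "t \<in> T" for t
    unfolding \<eta>_def \<eta>'_def has_vector_derivative_def
    using smooth_on_has_derivative_compose[OF W(3) xd[OF TT(1)[OF that], unfolded has_vector_derivative_def] TT(2)[OF that]]
      linear_cmul[OF smooth_on_linear_derivative[OF W(3) TT(2)[OF that]]] by (simp only:)
  have \<eta>'d: "(\<eta>' has_vector_derivative a) (at 0)"
    unfolding \<eta>'_def a_def by (rule curve_transform(2)[OF W(1,3) TT(2)[OF 0] xd[OF TT(1)[OF 0]] a0(1)])
  have \<eta>_0: "\<eta> 0 = \<eta>0" by (simp add: \<eta>_def x0 W)
  have \<eta>'_0: "\<eta>' 0 = y"
    using frechet_derivative_at[OF W(7)] Q(3) by (simp add: \<eta>'_def x0 x'0)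
  have \<eta>Op: "\<eta> t \<in> Op" "pih (\<eta> t) = x t" if "t \<in> T" for t using W(5,6) TT(2)[OF that] by (auto simp: \<eta>_def)
  have pd: "frechet_derivative pih (at (\<eta> t)) (\<eta>' t) = x' t" if "t \<in> T" for t
  proof -
    have "((\<lambda>t. pih (\<eta> t)) has_derivative (\<lambda>h. h *\<^sub>R frechet_derivative pih (at (\<eta> t)) (\<eta>' t))) (at t)"
      using smooth_on_has_derivative_compose[OF pih_smooth(2) \<eta>d[OF that, unfolded has_vector_derivative_def] \<eta>Op(1)[OF that]]
        linear_cmul[OF smooth_on_linear_derivative[OF pih_smooth(2) \<eta>Op(1)[OF that]]] by (simp only:)
    then have "(x has_vector_derivative frechet_derivative pih (at (\<eta> t)) (\<eta>' t)) (at t)"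
      unfolding has_vector_derivative_def[symmetric]
      by (rule has_vector_derivative_transform_within_open[OF _ T that]) (rule \<eta>Op(2))
    then show ?thesis using xd[OF TT(1)[OF that]] vector_derivative_unique_at by blast
  qed
  \<comment> \<open>The lift projects back to the geodesic, so the acceleration downstairs is the
    transform of that of the lift; this is what the pullback along \<open>pih\<close>
    requires.\<close>
  have a0_eq: "a0 = frechet_derivative (\<lambda>z. frechet_derivative pih (at z) (\<eta>' 0)) (at (\<eta> 0)) (\<eta>' 0) + frechet_derivative pih (at (\<eta> 0)) a"
  proof (rule vector_derivative_unique_at[OF a0(1)])
    show "(x' has_vector_derivative (frechet_derivative (\<lambda>z. frechet_derivative pih (at z) (\<eta>' 0)) (at (\<eta> 0)) (\<eta>' 0) + frechet_derivative pih (at (\<eta> 0)) a)) (at 0)"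
      by (rule has_vector_derivative_transform_within_open[OF curve_transform(2)[OF pih_smooth \<eta>Op(1)[OF 0] \<eta>d[OF 0] \<eta>'d] T 0]) (rule pd)
  qed
  have EL: "euler_lagrange LG \<eta>0 y a"
  proof (rule euler_lagrange_pullback[OF fin.\<Omega>_open[OF k0(1)] fin.\<Lambda>_smooth[OF k0(1)] pih_smooth LG_smooth(1)])
    show "z \<in> Op \<and> (pih z, frechet_derivative pih (at z) w) \<in> fin.\<Omega> k0 \<and>
        LG (z, w) = fin.\<Lambda> k0 (pih z, frechet_derivative pih (at z) w)" if "(z, w) \<in> \<Omega>G" for z w
      using that by (simp add: \<Omega>G_def LG_def \<Theta>_def)
    show "(\<eta>0, y) \<in> \<Omega>G" using LG_left_invariant(1)[OF \<eta>0_Op(1), of y] y by (simp add: M_\<eta>0 UH_def)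
    show "euler_lagrange (fin.\<Lambda> k0) (pih \<eta>0) (frechet_derivative pih (at \<eta>0) y)
       (frechet_derivative (\<lambda>x. frechet_derivative pih (at x) y) (at \<eta>0) y + frechet_derivative pih (at \<eta>0) a)"
      using a0(2) a0_eq pd[OF 0] by (simp add: \<eta>_0 \<eta>'_0 x0 \<eta>0_Op)
  qed
  let ?TN = "{t \<in> T. \<eta> t \<in> Oi}"
  have cont\<eta>: "continuous_on T \<eta>"
    by (auto intro!: continuous_at_imp_continuous_on has_vector_derivative_continuous[OF \<eta>d])
  have TN: "open ?TN"
    using continuous_open_preimage[OF cont\<eta> T Oi_smooth(1)] by (simp add: Int_def vimage_def)
  have z0: "0 \<in> ?TN" using 0 \<eta>0_Oi \<eta>_0 by simp
  \<comment> \<open>The body velocity of the lift. It is defined by \<open>N\<close>, hence only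
    while the lift stays in the domain of the inversion.\<close>
  define u where "u t = N (\<eta> t) (\<eta>' t)" for t
  have Mu: "M (\<eta> t) (u t) = \<eta>' t" if "t \<in> ?TN" for t using M_N that by (simp add: u_def)
  have u0: "u 0 = y" using Mu[OF z0] by (simp add: \<eta>_0 \<eta>'_0 M_\<eta>0)
  obtain b where b: "(u has_vector_derivative b) (at 0)"
  proof -
    let ?f = "\<lambda>t. (ii (\<eta> t), \<eta> t)"
    have \<eta>D: "(\<eta> has_derivative (\<lambda>h. h *\<^sub>R \<eta>' 0)) (at 0)" using \<eta>d[OF 0] by (simp add: has_vector_derivative_def)
    have 1: "(?f has_derivative (\<lambda>h. (frechet_derivative ii (at (\<eta> 0)) (h *\<^sub>R \<eta>' 0), h *\<^sub>R \<eta>' 0))) (at 0)"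
      by (rule has_derivative_Pair[OF smooth_on_has_derivative_compose[OF Oi_smooth(2) \<eta>D] \<eta>D]) (use z0 in simp)
    have 2: "((\<lambda>t. (0, \<eta>' t)) has_derivative (\<lambda>h. (0, h *\<^sub>R a))) (at 0)"
      by (rule has_derivative_Pair[OF has_derivative_const]) (use \<eta>'d in \<open>simp add: has_vector_derivative_def\<close>)
    have "u differentiable (at 0)"
      unfolding u_def N_def differentiable_def
      using has_derivative_eval_derivative[OF Om_smooth _ 1 2] Om_ii(1)[of "\<eta> 0"] z0 by blast
    then show thesis using that vector_derivative_works by blast
  qed
  \<comment> \<open>Differentiating \<open>\<eta>' = M \<eta> u\<close> splits the acceleration into
    the term \<open>m12 y y\<close> from the moving frame and the derivative \<open>b\<close> of the
    body velocity.\<close>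
  have a_eq: "a = m12 y y + b"
  proof (rule vector_derivative_unique_at[OF \<eta>'d])
    have "((\<lambda>t. M (\<eta> t) (u t)) has_derivative (\<lambda>h. m12 (h *\<^sub>R \<eta>' 0) (u 0) + h *\<^sub>R b)) (at 0)"
      by (rule M_has_derivative[OF \<eta>d[OF 0, unfolded has_vector_derivative_def] \<eta>_0 b[unfolded has_vector_derivative_def]])
    then have "((\<lambda>t. M (\<eta> t) (u t)) has_vector_derivative (m12 y y + b)) (at 0)"
      unfolding has_vector_derivative_def \<eta>'_0 u0
      by (simp only: linear_cmul[OF has_derivative_linear[OF m12]] scaleR_add_right)
    then show "(\<eta>' has_vector_derivative (m12 y y + b)) (at 0)"
      by (rule has_vector_derivative_transform_within_open[OF _ TN z0]) (rule Mu)
  qed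
  have yU: "y \<in> UH" using y by (simp add: UH_def)
  show thesis
  proof (rule that)
    show "2 * hess (F H) (P y) (P \<kappa>) (P b) = frechet_derivative (\<lambda>v. (F H v)\<^sup>2) (at (P y)) (P (lie_bracket G A y \<kappa>))" for \<kappa>
    proof -
      have P': "(P has_derivative P) (at y)"
        using linear_P by (simp add: linear_conv_bounded_linear bounded_linear_imp_has_derivative)
      have "(ll has_derivative (\<lambda>w. frechet_derivative (\<lambda>v. (F H v)\<^sup>2) (at (P y)) (P w))) (at y)"
        unfolding ll_def by (rule smooth_on_has_derivative_compose[OF fin.F2_smooth[OF H_points] P' y(2)])
      from fun_cong[OF frechet_derivative_at[OF this]]
      have l: "frechet_derivative (\<lambda>v. (F H v)\<^sup>2) (at (P y)) (P w) = frechet_derivative ll (at y) w" for w .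
      have "hess (\<lambda>u. F H (P u)) y \<kappa> b = hess (F H) (P y) (P \<kappa>) (P b)"
        by (rule hess_linear_change[OF UH_smooth(1) yU fin.D_open(1)[OF H_points] fin.F2_smooth[OF H_points] linear_P])
           (simp add: UH_def)
      then have "2 * hess (F H) (P y) (P \<kappa>) (P b) = frechet_derivative (\<lambda>u. frechet_derivative ll (at u) \<kappa>) (at y) b"
        by (simp add: hess_def ll_def[abs_def])
      also have "\<dots> = frechet_derivative ll (at y) (lie_bracket G A y \<kappa>)"
        by (rule euler_poincare[OF yU]) (use EL a_eq in simp)
      finally show ?thesis unfolding l .
    qed
    have lP: "linear P" by (rule linear_P)
    have "((\<lambda>t. P (u t)) has_derivative (\<lambda>h. P (h *\<^sub>R b))) (at 0)"
      using bounded_linear.has_derivative[OF _ b[unfolded has_vector_derivative_def], of P] lP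
      by (simp add: linear_conv_bounded_linear)
    from has_derivative_compose[OF this, of "distortion D F H" \<tau>'] \<tau>
    have "((\<lambda>t. distortion D F H (P (u t))) has_derivative (\<lambda>h. \<tau>' (P (h *\<^sub>R b)))) (at 0)" by (simp add: u0)
    then have "((\<lambda>t. distortion D F H (P (u t))) has_derivative (\<lambda>h. \<tau>' (P b) * h)) (at 0)"
      by (simp add: linear_cmul[OF lP] linear_cmul[OF has_derivative_linear[OF \<tau>]] mult.commute)
    then have "((\<lambda>t. distortion D F (\<gamma> t) (velocity B \<gamma> t)) has_derivative (\<lambda>h. \<tau>' (P b) * h)) (at 0)"
    proof (rule has_derivative_transform_within_open[OF _ TN z0])
      fix t assume t: "t \<in> ?TN"
      then have tT: "t \<in> T" by simp
      note Opt = \<eta>Op[OF tT]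
      have O: "\<eta> t \<in> O0" using Opt by (simp add: Op_def)
      have g: "\<gamma> t = p (\<eta> t) <# H"
      proof -
        have "inv_chart k0 (snd k0 (\<gamma> t)) = \<gamma> t" using inv_chart_coord[OF B_inj k0(1)] TT(1)[OF tT] by simp
        moreover have "inv_chart k0 (pih (\<eta> t)) = p (\<eta> t) <# H"
          unfolding pih_def using inv_chart_coord[OF B_inj k0(1)] Opt(1) by (simp add: Op_def)
        ultimately show ?thesis using Opt(2) by (simp add: x_def)
      qed
      \<comment> \<open>The actual velocity is the translate of the projected body velocity, so
        invariance moves the distortion back to H.\<close>
      have v: "velocity B \<gamma> t = tr (p (\<eta> t)) (P (u t))"
        unfolding xv[OF TT(1)[OF tT]] translation_in_chart[OF Opt(1)] Mu[OF t] pd[OF tT] Opt(2) ..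
      have "velocity B \<gamma> t \<in> D (\<gamma> t)" using geo(2) tT by (auto simp: geodesic_def T_def)
      then have "P (u t) \<in> D H" unfolding g v using translation_metric(1)[OF p_carrier[OF O]] by blast
      from distortion_invariant[OF p_carrier[OF O] this bdd]
      show "distortion D F H (P (u t)) = distortion D F (\<gamma> t) (velocity B \<gamma> t)" by (simp add: g v)
    qed
    then show "((\<lambda>t. distortion D F (\<gamma> t) (velocity B \<gamma> t)) has_real_derivative \<tau>' (P b)) (at 0)"
      by (simp add: has_field_derivative_def)
  qed
qed

end

section \<open>The infinite series Minkowski norm\<close>

lemma det_replace_row:
  fixes l :: "real ^ 'n" and p :: "'n \<Rightarrow> real"
  assumes "finite S" "k \<notin> S"
  shows "det (\<chi> i. if i = k then l else if i \<in> S then axis i 1 + p i *s l else axis i 1) = l $ k"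
  using assms
proof (induction S rule: finite_induct)
  case empty
  have "transpose (\<chi> i. if i = k then l else axis i 1) = (\<chi> i j. if j = k then (mat 1 *v l) $ i else (mat 1 :: real ^ 'n ^ 'n) $ i $ j)"
    unfolding matrix_vector_mul_lid by (auto simp: vec_eq_iff transpose_def mat_def axis_def)
  then have "det (transpose (\<chi> i. if i = k then l else axis i 1)) = l $ k"
    using cramer_lemma[where k=k and x=l and A="mat 1 :: real ^ 'n ^ 'n"] by (simp only: det_I mult_1_right)
  then show ?case by (simp only: det_transpose empty_iff if_False)
next
  case (insert j S)
  \<comment> \<open>The matrix before row \<open>j\<close> is treated. The multiple of
    \<open>l\<close> added to row \<open>j\<close> repeats row \<open>k\<close>, so by
    multilinearity it contributes zero.\<close>
  let ?c = "\<lambda>i. if i = k then l else if i \<in> S then axis i 1 + p i *s l else axis i 1"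
  have "(\<chi> i. if i = k then l else if i \<in> insert j S then axis i 1 + p i *s l else axis i 1)
      = (\<chi> i. if i = j then axis j 1 + p j *s l else ?c i)"
    using insert by (auto simp: vec_eq_iff)
  moreover have "(\<chi> i. if i = j then axis j 1 else ?c i) = (\<chi> i. ?c i)"
    using insert by (auto simp: vec_eq_iff)
  moreover have "det (\<chi> i. if i = j then l else ?c i) = 0"
    by (rule det_identical_rows[of j k]) (use insert in \<open>auto simp: row_def vec_eq_iff\<close>)
  ultimately show ?case using insert by (simp add: det_row_add det_row_mul)
qed

text \<open>The rows are perturbed one at a time. By multilinearity row \<open>k\<close> adds
  \<open>p $ k\<close> times a determinant in which that row is replaced by the functional, and
  \<open>det_replace_row\<close> evaluates it.\<close>

lemma det_rank_one:
  fixes l :: "real ^ 'n \<Rightarrow> real"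
  assumes l: "linear l"
  shows "det (matrix (\<lambda>w. w + l w *\<^sub>R p)) = 1 + l p"
proof -
  define lv where "lv = (\<chi> j. l (axis j 1))"
  have ind: "det (\<chi> i. if i \<in> S then axis i 1 + p $ i *s lv else axis i 1) = 1 + (\<Sum>i\<in>S. p $ i * lv $ i)" if "finite S" for S
    using that
  proof (induction S rule: finite_induct)
    case empty
    have "(\<chi> i. axis i 1) = (mat 1 :: real ^ 'n ^ 'n)" by (auto simp: vec_eq_iff mat_def axis_def)
    then show ?case by simp
  next
    case (insert k S)
    let ?c = "\<lambda>i. if i \<in> S then axis i 1 + p $ i *s lv else axis i 1"
    have "(\<chi> i. if i \<in> insert k S then axis i 1 + p $ i *s lv else axis i 1)
        = (\<chi> i. if i = k then axis k 1 + p $ k *s lv else ?c i)"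
      using insert by (auto simp: vec_eq_iff)
    moreover have "(\<chi> i. if i = k then axis k 1 else ?c i) = (\<chi> i. ?c i)"
      using insert by (auto simp: vec_eq_iff)
    moreover have "det (\<chi> i. if i = k then lv else ?c i) = lv $ k"
      by (rule det_replace_row) (use insert in auto)
    ultimately show ?case using insert by (simp add: det_row_add det_row_mul)
  qed
  have "matrix (\<lambda>w. w + l w *\<^sub>R p) = (\<chi> i. if i \<in> UNIV then axis i 1 + p $ i *s lv else axis i 1)"
    by (auto simp: vec_eq_iff matrix_def lv_def axis_def)
  moreover have "l p = (\<Sum>i\<in>UNIV. p $ i * lv $ i)"
    using linear_axis_sum[OF l, of p] by (simp add: lv_def)
  ultimately show ?thesis using ind[of UNIV] by simp
qed

lemma det_scaleR: "det (c *\<^sub>R (A :: real ^ 'n ^ 'n)) = c ^ CARD('n) * det A"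
proof -
  have "c *\<^sub>R A = matrix ((*\<^sub>R) c) ** A"
    by (simp add: matrix_eq matrix_vector_mul_assoc[symmetric] matrix_works scaleR_matrix_vector_assoc linear_matrix_vector_mul_eq)
  then show ?thesis by (simp add: det_mul)
qed

section \<open>The norm, its differential and its Hessian\<close>

locale infinite_series_norm =
  fixes ip :: "real ^ 'n \<Rightarrow> real ^ 'n \<Rightarrow> real" and \<beta> :: "real ^ 'n \<Rightarrow> real" and V :: "real ^ 'n"
  assumes bil: "bilinear ip" and sym: "ip u w = ip w u" and pos: "u \<noteq> 0 \<Longrightarrow> ip u u > 0"
    and \<beta>: "ip V w = \<beta> w"
begin

definition "\<alpha> u = sqrt (ip u u)"
definition "Fm u = (\<beta> u)\<^sup>2 / (\<beta> u - \<alpha> u)"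
definition "C = {u. \<beta> u > \<alpha> u}"
definition "s u = \<beta> u / \<alpha> u"
text \<open>\<open>ds u\<close> is the differential of \<open>s\<close> at \<open>u\<close>, and
  \<open>dF u\<close> that of \<open>Fm\<close>, written with the differential
  \<open>ip u w / \<alpha> u\<close> of \<alpha>.\<close>

definition "ds u w = (\<beta> w - s u * (ip u w / \<alpha> u)) / \<alpha> u"
definition "dF u w = ((s u)\<^sup>2 * (ip u w / \<alpha> u) + ((s u)\<^sup>2 - 2 * s u) * \<beta> w) / (s u - 1)\<^sup>2"
definition "N u = s u ^ 3 - 3 * (s u)\<^sup>2 + 2 * ip V V"

lemma lin: "linear (ip u)" "linear (\<lambda>w. ip w u)"
  using bil by (auto simp: bilinear_def)

lemmas ip_simps = linear_add[OF lin(1)] linear_add[OF lin(2)] linear_cmul[OF lin(1)] linear_cmul[OF lin(2)]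
  linear_diff[OF lin(1)] linear_diff[OF lin(2)] linear_0[OF lin(1)] linear_0[OF lin(2)]

lemma linear_\<beta>: "linear \<beta>" using lin(1)[of V] by (simp add: \<beta>[abs_def])

lemma bb: "bounded_bilinear ip" using bil by (simp add: bilinear_conv_bounded_bilinear)

lemma \<alpha>_sq: "(\<alpha> u)\<^sup>2 = ip u u"
  using pos[of u] ip_simps by (cases "u = 0") (auto simp: \<alpha>_def)

lemma \<alpha>_nonneg: "\<alpha> u \<ge> 0" unfolding \<alpha>_def using \<alpha>_sq[of u] by (metis real_sqrt_ge_zero zero_le_power2)

lemma C_pos: assumes "u \<in> C" shows "\<alpha> u > 0" "\<beta> u > \<alpha> u" "s u > 1" "u \<noteq> 0"
proof -
  show b: "\<beta> u > \<alpha> u" using assms by (simp add: C_def)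
  show u: "u \<noteq> 0" using b linear_0[OF linear_\<beta>] by (auto simp: \<alpha>_def ip_simps)
  show "\<alpha> u > 0" using pos[OF u] by (simp add: \<alpha>_def)
  then show "s u > 1" using b by (simp add: s_def)
qed

lemma cauchy_schwarz: "(ip u w)\<^sup>2 \<le> ip u u * ip w w"
proof (cases "w = 0")
  case False
  then have w: "ip w w > 0" by (rule pos)
  let ?r = "ip u w / ip w w"
  have "0 \<le> ip (u - ?r *\<^sub>R w) (u - ?r *\<^sub>R w)"
    using pos[of "u - ?r *\<^sub>R w"] by (cases "u - ?r *\<^sub>R w = 0") (auto simp: ip_simps)
  also have "\<dots> = ip u u - (ip u w)\<^sup>2 / ip w w"
    using w by (simp add: ip_simps sym[of w u] power2_eq_square field_simps)
  finally show ?thesis using w by (simp add: field_simps)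
qed (simp add: ip_simps)

text \<open>By Cauchy-Schwarz s^2 is at most b^2, and N = s^2 (s - 1) + 2 (b^2 - s^2) with s >
  1.\<close>

lemma N_pos: assumes "u \<in> C" shows "N u > 0"
proof -
  note c = C_pos[OF assms]
  have "(s u)\<^sup>2 \<le> ip V V"
    using cauchy_schwarz[of V u] c by (simp add: \<beta> s_def power_divide \<alpha>_sq pos_divide_le_eq pos)
  moreover have "N u = (s u)\<^sup>2 * (s u - 1) + 2 * (ip V V - (s u)\<^sup>2)"
    by (simp add: N_def power2_eq_square power3_eq_cube algebra_simps)
  moreover have "(s u)\<^sup>2 * (s u - 1) > 0" using c by simp
  ultimately show ?thesis by (simp only:) (rule add_pos_nonneg, simp_all)
qed

lemma \<beta>_deriv: "(\<beta> has_derivative \<beta>) (at u)"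
  using linear_\<beta> by (simp add: linear_conv_bounded_linear bounded_linear_imp_has_derivative)

lemma \<alpha>_deriv: assumes "u \<noteq> 0" shows "(\<alpha> has_derivative (\<lambda>w. ip u w / \<alpha> u)) (at u)"
proof -
  have "((\<lambda>u. ip u u) has_derivative (\<lambda>w. ip u w + ip w u)) (at u)"
    by (rule bounded_bilinear.FDERIV[OF bb has_derivative_ident has_derivative_ident])
  then have "((\<lambda>u. ip u u) has_derivative (\<lambda>w. 2 * ip u w)) (at u)"
    by (rule has_derivative_eq_rhs) (use sym in \<open>auto simp: fun_eq_iff\<close>)
  from has_derivative_real_sqrt[OF pos[OF assms] this]
  show ?thesis unfolding \<alpha>_def[abs_def] by (rule has_derivative_eq_rhs) (simp add: fun_eq_iff, simp only: divide_inverse simp_thms)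
qed

lemma ip_deriv: "((\<lambda>u. ip u v) has_derivative (\<lambda>w. ip w v)) (at u)"
  using lin(2) by (simp add: linear_conv_bounded_linear bounded_linear_imp_has_derivative)

lemma C_open: "open C"
proof -
  have ii: "continuous_on UNIV (\<lambda>u. ip u u)"
    by (rule bounded_bilinear.continuous_on[OF bb continuous_on_id continuous_on_id])
  have "continuous_on UNIV \<alpha>" unfolding \<alpha>_def by (rule continuous_on_real_sqrt[OF ii])
  moreover have "continuous_on UNIV \<beta>"
    using linear_\<beta> by (intro linear_continuous_on) (simp add: linear_conv_bounded_linear)
  ultimately show ?thesis unfolding C_def by (rule open_Collect_less)
qed

lemma Fm_eq: assumes "u \<in> C" shows "Fm u = \<alpha> u * ((s u)\<^sup>2 / (s u - 1))"
proof -
  note c = C_pos[OF assms]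
  have "s u * \<alpha> u = \<beta> u" using c by (simp add: s_def)
  then have "Fm u = (s u * \<alpha> u)\<^sup>2 / (s u * \<alpha> u - \<alpha> u)" by (simp add: Fm_def)
  also have "s u * \<alpha> u - \<alpha> u = \<alpha> u * (s u - 1)" by (simp add: algebra_simps)
  finally show ?thesis using c by (simp add: power2_eq_square)
qed

lemma F2_deriv:
  assumes "u \<in> C"
  shows "((\<lambda>u. (Fm u)\<^sup>2) has_derivative
    (\<lambda>w. 2 * \<beta> u ^ 3 * (\<beta> u * (ip u w / \<alpha> u) + (\<beta> u - 2 * \<alpha> u) * \<beta> w) / (\<beta> u - \<alpha> u) ^ 3)) (at u)"
proof -
  note c = C_pos[OF assms]
  have d: "\<beta> u - \<alpha> u \<noteq> 0" using c by simp
  have alg: "real 2 * ((real 2 * b * B ^ (2 - 1) * e - B\<^sup>2 * (b - a)) / (e * e)) * (B\<^sup>2 / e) ^ (2 - 1)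
      = 2 * B ^ 3 * (B * a + (B - 2 * A) * b) / e ^ 3"
    if "e \<noteq> 0" "e = B - A" for A B e a b :: real
  proof -
    have A: "A = B - e" using that(2) by simp
    show ?thesis unfolding A using that(1) by (simp add: field_simps power2_eq_square power3_eq_cube)
  qed
  show ?thesis unfolding Fm_def[abs_def]
    by (rule has_derivative_eq_rhs[OF has_derivative_power[OF has_derivative_divide'[OF
          has_derivative_power[OF \<beta>_deriv] has_derivative_diff[OF \<beta>_deriv \<alpha>_deriv[OF c(4)]] d]]])
       (rule ext, rule alg[OF d refl])
qed

lemma F2_deriv_dF: assumes "u \<in> C" shows "frechet_derivative (\<lambda>u. (Fm u)\<^sup>2) (at u) w = 2 * Fm u * dF u w"
proof -
  note c = C_pos[OF assms]
  have B: "\<beta> u = s u * \<alpha> u" using c by (simp add: s_def)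
  have alg: "2 * (x * A) ^ 3 * (x * A * a + (x * A - 2 * A) * b) / (A * e) ^ 3
     = 2 * (A * (x\<^sup>2 / e)) * ((x\<^sup>2 * a + (x\<^sup>2 - 2 * x) * b) / e\<^sup>2)" if "A \<noteq> 0" "e \<noteq> 0" for x A e a b :: real
    using that by (simp add: field_simps power2_eq_square power3_eq_cube)
  have "frechet_derivative (\<lambda>u. (Fm u)\<^sup>2) (at u) w
     = 2 * \<beta> u ^ 3 * (\<beta> u * (ip u w / \<alpha> u) + (\<beta> u - 2 * \<alpha> u) * \<beta> w) / (\<beta> u - \<alpha> u) ^ 3"
    using fun_cong[OF frechet_derivative_at[OF F2_deriv[OF assms], symmetric]] .
  also have "\<beta> u - \<alpha> u = \<alpha> u * (s u - 1)" unfolding B by (simp add: algebra_simps)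
  also have "2 * \<beta> u ^ 3 * (\<beta> u * (ip u w / \<alpha> u) + (\<beta> u - 2 * \<alpha> u) * \<beta> w) / (\<alpha> u * (s u - 1)) ^ 3 = 2 * Fm u * dF u w"
    unfolding Fm_eq[OF assms] dF_def B
    by (rule alg) (use c in auto)
  finally show ?thesis .
qed

lemma s_deriv: assumes "u \<in> C" shows "(s has_derivative ds u) (at u)"
proof -
  note c = C_pos[OF assms]
  have "((\<lambda>u. \<beta> u / \<alpha> u) has_derivative (\<lambda>w. - \<beta> u * (inverse (\<alpha> u) * (ip u w / \<alpha> u) * inverse (\<alpha> u)) + \<beta> w / \<alpha> u)) (at u)"
    by (rule has_derivative_divide[OF \<beta>_deriv \<alpha>_deriv[OF c(4)]]) (use c in simp)
  moreover have "- \<beta> u * (inverse (\<alpha> u) * (ip u w / \<alpha> u) * inverse (\<alpha> u)) + \<beta> w / \<alpha> u = ds u w" for w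
    using c(1) by (simp add: ds_def s_def field_simps)
  ultimately show ?thesis unfolding s_def[abs_def] by simp
qed

text \<open>With phi(s) = s^2 / (s - 1), the coefficient of the angular form is phi (phi - s phi'),
  and that of the square of \<open>ds\<close> is alpha^2 phi phi''.\<close>

lemma hess_Fm:
  assumes "u \<in> C"
  shows "hess Fm u v w = dF u v * dF u w + (s u) ^ 4 / (s u - 1) ^ 3 * (ip v w - ip u v / \<alpha> u * (ip u w / \<alpha> u))
     + 2 * (\<alpha> u)\<^sup>2 * (s u)\<^sup>2 / (s u - 1) ^ 4 * ds u v * ds u w"
proof -
  note c = C_pos[OF assms]
  have d: "\<beta> u - \<alpha> u \<noteq> 0" using c by simp
  let ?X = "\<lambda>u. 2 * \<beta> u ^ 3 * (\<beta> u * (ip u v / \<alpha> u) + (\<beta> u - 2 * \<alpha> u) * \<beta> v) / (\<beta> u - \<alpha> u) ^ 3"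
  let ?av = "ip u v / \<alpha> u" and ?aw = "ip u w / \<alpha> u"
  have a': "((\<lambda>u. ip u v / \<alpha> u) has_derivative (\<lambda>w. (ip v w - ?av * (ip u w / \<alpha> u)) / \<alpha> u)) (at u)"
  proof -
    have "((\<lambda>u. ip u v / \<alpha> u) has_derivative (\<lambda>w. - ip u v * (inverse (\<alpha> u) * (ip u w / \<alpha> u) * inverse (\<alpha> u)) + ip w v / \<alpha> u)) (at u)"
      by (rule has_derivative_divide[OF ip_deriv \<alpha>_deriv[OF c(4)]]) (use c in simp)
    moreover have "- ip u v * (inverse (\<alpha> u) * (ip u w / \<alpha> u) * inverse (\<alpha> u)) + ip w v / \<alpha> u = (ip v w - ?av * (ip u w / \<alpha> u)) / \<alpha> u" for w
      using c(1) by (simp add: field_simps sym[of w v])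
    ultimately show ?thesis by simp
  qed
  have "(?X has_derivative (\<lambda>w. 6 * (\<beta> u)\<^sup>2 * \<beta> w * (\<beta> u * ?av + (\<beta> u - 2 * \<alpha> u) * \<beta> v) / (\<beta> u - \<alpha> u) ^ 3
     + 2 * \<beta> u ^ 3 * (\<beta> w * ?av + \<beta> u * ((ip v w - ?av * (ip u w / \<alpha> u)) / \<alpha> u) + (\<beta> w - 2 * (ip u w / \<alpha> u)) * \<beta> v) / (\<beta> u - \<alpha> u) ^ 3
     - 6 * \<beta> u ^ 3 * (\<beta> u * ?av + (\<beta> u - 2 * \<alpha> u) * \<beta> v) * (\<beta> w - ip u w / \<alpha> u) / (\<beta> u - \<alpha> u) ^ 4)) (at u)"
    (is "(_ has_derivative ?X') _")
  proof -
    let ?Y = "\<lambda>u. 2 * \<beta> u ^ 3 * (\<beta> u * (ip u v / \<alpha> u) + (\<beta> u - 2 * \<alpha> u) * \<beta> v)"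
    have Y: "(?Y has_derivative (\<lambda>w. 6 * (\<beta> u)\<^sup>2 * \<beta> w * (\<beta> u * ?av + (\<beta> u - 2 * \<alpha> u) * \<beta> v)
       + 2 * \<beta> u ^ 3 * (\<beta> w * ?av + \<beta> u * ((ip v w - ?av * (ip u w / \<alpha> u)) / \<alpha> u) + (\<beta> w - 2 * (ip u w / \<alpha> u)) * \<beta> v))) (at u)"
    proof -
      have alg: "2 * B ^ 3 * (B * av' + b * av + ((B - 2 * A) * 0 + (b - 2 * a') * bv)) + real 3 * b * B ^ (3 - 1) * 2 * (B * av + (B - 2 * A) * bv)
         = 6 * B\<^sup>2 * b * (B * av + (B - 2 * A) * bv) + 2 * B ^ 3 * (b * av + B * av' + (b - 2 * a') * bv)" for A B b av bv av' a' :: real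
        by (simp add: algebra_simps)
      show ?thesis
        by (rule has_derivative_eq_rhs[OF has_derivative_mult[OF
            has_derivative_mult[OF has_derivative_const has_derivative_power[OF \<beta>_deriv]]
            has_derivative_add[OF has_derivative_mult[OF \<beta>_deriv a'] has_derivative_mult[OF
              has_derivative_diff[OF \<beta>_deriv has_derivative_mult[OF has_derivative_const \<alpha>_deriv[OF c(4)]]] has_derivative_const]]]])
           (rule ext, use alg in \<open>simp add: mult_ac\<close>)
    qed
    have Z: "((\<lambda>u. (\<beta> u - \<alpha> u) ^ 3) has_derivative (\<lambda>w. 3 * (\<beta> u - \<alpha> u)\<^sup>2 * (\<beta> w - ip u w / \<alpha> u))) (at u)"
      by (rule has_derivative_eq_rhs[OF has_derivative_power[OF has_derivative_diff[OF \<beta>_deriv \<alpha>_deriv[OF c(4)]]]])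
         (simp add: fun_eq_iff mult_ac)
    have alg: "- (2 * z * y) * (inverse (e ^ 3) * (3 * e\<^sup>2 * k) * inverse (e ^ 3)) + (y1 + y2) / e ^ 3
       = y1 / e ^ 3 + y2 / e ^ 3 - 6 * z * y * k / e ^ 4" if "e \<noteq> 0" for z y y1 y2 e k :: real
    proof -
      have "inverse (e ^ 3) * (3 * e\<^sup>2 * k) * inverse (e ^ 3) = 3 * k / e ^ 4"
        using that by (simp add: field_simps)
      then show ?thesis by (simp add: add_divide_distrib)
    qed
    show ?thesis
      by (rule has_derivative_eq_rhs[OF has_derivative_divide[OF Y Z]]) (use d in simp, rule ext, rule alg[OF d])
  qed
  then have "((\<lambda>u. frechet_derivative (\<lambda>u. (Fm u)\<^sup>2) (at u) v) has_derivative ?X') (at u)"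
    by (rule has_derivative_transform_within_open[OF _ C_open assms])
       (rule fun_cong[OF frechet_derivative_at[OF F2_deriv]])
  from fun_cong[OF frechet_derivative_at[OF this, symmetric], of w]
  have h: "hess Fm u v w = ?X' w / 2" unfolding hess_def by simp
  have B: "\<beta> u = s u * \<alpha> u" using c by (simp add: s_def)
  \<comment> \<open>After cancelling the powers of \<open>A\<close> both sides are brought over the
    common denominator \<open>e ^ 4\<close> and the numerators compared as polynomials.\<close>
  have alg: "(6 * (s * A)\<^sup>2 * bw * (s * A * av + (s * A - 2 * A) * bv) / (A * e) ^ 3
     + 2 * (s * A) ^ 3 * (bw * av + s * A * ((q - av * aw) / A) + (bw - 2 * aw) * bv) / (A * e) ^ 3
     - 6 * (s * A) ^ 3 * (s * A * av + (s * A - 2 * A) * bv) * (bw - aw) / (A * e) ^ 4) / 2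
    = (s\<^sup>2 * av + (s\<^sup>2 - 2 * s) * bv) / e\<^sup>2 * ((s\<^sup>2 * aw + (s\<^sup>2 - 2 * s) * bw) / e\<^sup>2)
     + s ^ 4 / e ^ 3 * (q - av * aw) + 2 * A\<^sup>2 * s\<^sup>2 / e ^ 4 * ((bv - s * av) / A) * ((bw - s * aw) / A)"
    if "A \<noteq> 0" "e \<noteq> 0" "e = s - 1" for s A av aw bv bw q e :: real
  proof -
    have "(6 * (s * A)\<^sup>2 * bw * (s * A * av + (s * A - 2 * A) * bv) / (A * e) ^ 3
     + 2 * (s * A) ^ 3 * (bw * av + s * A * ((q - av * aw) / A) + (bw - 2 * aw) * bv) / (A * e) ^ 3
     - 6 * (s * A) ^ 3 * (s * A * av + (s * A - 2 * A) * bv) * (bw - aw) / (A * e) ^ 4) / 2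
     = (3 * s\<^sup>2 * bw * (s * av + (s - 2) * bv) * e + s ^ 3 * (bw * av + s * (q - av * aw) + (bw - 2 * aw) * bv) * e
        - 3 * s ^ 3 * (s * av + (s - 2) * bv) * (bw - aw)) / e ^ 4"
      using that(1,2) by (simp add: field_simps) (simp add: eval_nat_numeral algebra_simps)
    also have "\<dots> = ((s\<^sup>2 * av + (s\<^sup>2 - 2 * s) * bv) * (s\<^sup>2 * aw + (s\<^sup>2 - 2 * s) * bw)
       + s ^ 4 * (q - av * aw) * e + 2 * s\<^sup>2 * (bv - s * av) * (bw - s * aw)) / e ^ 4"
      unfolding that(3) by (rule arg_cong[of _ _ "\<lambda>x. x / _"]) (simp add: eval_nat_numeral algebra_simps)
    also have "\<dots> = (s\<^sup>2 * av + (s\<^sup>2 - 2 * s) * bv) / e\<^sup>2 * ((s\<^sup>2 * aw + (s\<^sup>2 - 2 * s) * bw) / e\<^sup>2)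
     + s ^ 4 / e ^ 3 * (q - av * aw) + 2 * A\<^sup>2 * s\<^sup>2 / e ^ 4 * ((bv - s * av) / A) * ((bw - s * aw) / A)"
    proof -
      have "e ^ 4 = e\<^sup>2 * e\<^sup>2" "e ^ 4 = e ^ 3 * e" by (simp_all add: eval_nat_numeral)
      then have "x * y / e ^ 4 = x / e\<^sup>2 * (y / e\<^sup>2)" "z * e / e ^ 4 = z / e ^ 3" for x y z
        using that(2) by simp_all
      moreover have "2 * s\<^sup>2 * x * y / e ^ 4 = 2 * A\<^sup>2 * s\<^sup>2 / e ^ 4 * (x / A) * (y / A)" for x y
        using that(1) by (simp add: power2_eq_square)
      ultimately show ?thesis by (simp only: add_divide_distrib) simp
    qed
    finally show ?thesis .
  qed
  have e: "\<beta> u - \<alpha> u = \<alpha> u * (s u - 1)" unfolding B by (simp add: algebra_simps)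
  show ?thesis
    unfolding h e ds_def dF_def unfolding B by (rule alg) (use c in auto)
qed

text \<open>This is phi (phi - s phi' + (b^2 - s^2) phi''), the factor with which the Hessian acts
  in the direction of the gradient of \<open>s\<close>.\<close>

definition "W u = (s u)\<^sup>2 * N u / (s u - 1) ^ 4"

section \<open>Diagonalising the Hessian by a shear\<close>

lemma ds_self: "u \<in> C \<Longrightarrow> ds u u = 0"
  using C_pos[of u] by (simp add: ds_def s_def \<alpha>_sq[symmetric] power2_eq_square)

lemma linear_ds: "linear (ds u)"
  using linear_\<beta> lin(1)[of u] by (simp add: linear_iff ds_def algebra_simps add_divide_distrib diff_divide_distrib)

lemma linear_t: "linear (\<lambda>w. ip u w / \<alpha> u)"
  using lin(1)[of u] by (simp add: linear_iff add_divide_distrib)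

text \<open>The gradient of \<open>s\<close> at \<open>u\<close> with respect to
  \<open>ip\<close>.\<close>

definition "S u = (1 / \<alpha> u) *\<^sub>R (V - (s u / \<alpha> u) *\<^sub>R u)"

lemma ip_S: "ip (S u) w = ds u w"
  by (simp add: S_def ip_simps ds_def \<beta>)

lemma ds_S: assumes "u \<in> C" shows "ds u (S u) = (ip V V - (s u)\<^sup>2) / (\<alpha> u)\<^sup>2"
proof -
  have "ds u (S u) = (1 / \<alpha> u) * ds u V"
    using linear_cmul[OF linear_ds] linear_diff[OF linear_ds] ds_self[OF assms] by (simp add: S_def)
  also have "ds u V = (ip V V - s u * (\<beta> u / \<alpha> u)) / \<alpha> u" by (simp add: ds_def \<beta>[symmetric] sym[of u V])
  finally show ?thesis by (simp add: s_def power2_eq_square)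
qed

text \<open>F = alpha phi(s) differentiated by the product rule: a radial part phi d(alpha) and a
  part alpha phi' ds.\<close>

lemma dF_eq: assumes "u \<in> C"
  shows "dF u w = (s u)\<^sup>2 / (s u - 1) * (ip u w / \<alpha> u) + \<alpha> u * (((s u)\<^sup>2 - 2 * s u) / (s u - 1)\<^sup>2) * ds u w"
proof -
  have alg: "(x\<^sup>2 * a + (x\<^sup>2 - 2 * x) * b) / (x - 1)\<^sup>2 = x\<^sup>2 / (x - 1) * a + A * ((x\<^sup>2 - 2 * x) / (x - 1)\<^sup>2) * ((b - x * a) / A)"
    if "x > 1" "A > 0" for x a b A :: real
  proof -
    have "x\<^sup>2 / (x - 1) * a = x\<^sup>2 * (x - 1) * a / (x - 1)\<^sup>2" using that by (simp add: power2_eq_square)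
    moreover have "A * ((x\<^sup>2 - 2 * x) / (x - 1)\<^sup>2) * ((b - x * a) / A) = (x\<^sup>2 - 2 * x) * (b - x * a) / (x - 1)\<^sup>2"
      using that by simp
    moreover have "x\<^sup>2 * a + (x\<^sup>2 - 2 * x) * b = x\<^sup>2 * (x - 1) * a + (x\<^sup>2 - 2 * x) * (b - x * a)"
      by (simp add: power2_eq_square algebra_simps)
    ultimately show ?thesis by (simp only: add_divide_distrib[symmetric])
  qed
  show ?thesis unfolding dF_def ds_def by (rule alg) (use C_pos[OF assms] in auto)
qed

text \<open>The logarithmic derivative phi'/phi. With this factor the shear along \<open>u\<close>
  absorbs the \<open>ds\<close> part of \<open>dF\<close> into the radial part.\<close>

definition "k u = ((s u)\<^sup>2 - 2 * s u) / ((s u)\<^sup>2 * (s u - 1))"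

text \<open>The shear \<open>R u\<close> turns \<open>dF u\<close> into a multiple of \<open>ip u\<close>, so that \<open>hess Fm u\<close> becomes \<open>ip\<close>
  plus squares of two functionals that are orthogonal with respect to \<open>ip\<close>.\<close>

definition "R u w = w + ds u w *\<^sub>R (k u *\<^sub>R u)"

text \<open>Adding multiples of \<open>u\<close> changes neither \<open>ds u\<close>, which vanishes
  on \<open>u\<close>, nor the angular form, which has \<open>u\<close> in its kernel. Only the
  square of \<open>dF u\<close> is altered, and it becomes a square of the radial
  functional.\<close>

lemma hess_R:
  assumes "u \<in> C"
  defines "c \<equiv> (s u) ^ 4 / (s u - 1) ^ 3"
  shows "hess Fm u v w = c * ip (R u v) (R u w) + (((s u)\<^sup>2 / (s u - 1))\<^sup>2 - c) * (ip u (R u v) / \<alpha> u) * (ip u (R u w) / \<alpha> u)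
     + 2 * (\<alpha> u)\<^sup>2 * (s u)\<^sup>2 / (s u - 1) ^ 4 * ds u (R u v) * ds u (R u w)"
    "ds u (R u w) = ds u w"
proof -
  note cc = C_pos[OF assms(1)]
  have d: "ds u (R u w) = ds u w" for w
    using linear_add[OF linear_ds] linear_cmul[OF linear_ds] ds_self[OF assms(1)] by (simp add: R_def)
  then show "ds u (R u w) = ds u w" .
  have t: "ip u (R u w) / \<alpha> u = ip u w / \<alpha> u + k u * \<alpha> u * ds u w" for w
    using cc(1) by (simp add: R_def ip_simps \<alpha>_sq[symmetric] power2_eq_square add_divide_distrib)
  have dFt: "dF u w = (s u)\<^sup>2 / (s u - 1) * (ip u (R u w) / \<alpha> u)" for w
  proof -
    have "(s u)\<^sup>2 / (s u - 1) * (k u * \<alpha> u * ds u w) = \<alpha> u * (((s u)\<^sup>2 - 2 * s u) / (s u - 1)\<^sup>2) * ds u w"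
      using cc by (simp add: k_def power2_eq_square)
    then show ?thesis unfolding t dF_eq[OF assms(1)] by (simp only: distrib_left)
  qed
  have ang: "ip (R u v) (R u w) - ip u (R u v) / \<alpha> u * (ip u (R u w) / \<alpha> u) = ip v w - ip u v / \<alpha> u * (ip u w / \<alpha> u)"
  proof -
    have "ip (R u v) (R u w) = ip v w + ds u w * k u * ip u v + ds u v * k u * ip u w + ds u v * k u * (ds u w * k u * (\<alpha> u)\<^sup>2)"
      by (simp add: R_def ip_simps \<alpha>_sq sym[of v u] algebra_simps)
    then show ?thesis unfolding t using cc(1) by (simp add: field_simps power2_eq_square)
  qed
  show "hess Fm u v w = c * ip (R u v) (R u w) + (((s u)\<^sup>2 / (s u - 1))\<^sup>2 - c) * (ip u (R u v) / \<alpha> u) * (ip u (R u w) / \<alpha> u)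
     + 2 * (\<alpha> u)\<^sup>2 * (s u)\<^sup>2 / (s u - 1) ^ 4 * ds u (R u v) * ds u (R u w)"
    unfolding hess_Fm[OF assms(1)] ang[symmetric] dFt d c_def by (simp add: algebra_simps power2_eq_square)
qed

lemma W_eq: assumes "u \<in> C"
  shows "(s u) ^ 4 / (s u - 1) ^ 3 + 2 * (\<alpha> u)\<^sup>2 * (s u)\<^sup>2 / (s u - 1) ^ 4 * ds u (S u) = W u"
proof -
  note c = C_pos[OF assms]
  have alg: "x ^ 4 / (x - 1) ^ 3 + 2 * A\<^sup>2 * x\<^sup>2 / (x - 1) ^ 4 * ((b - x\<^sup>2) / A\<^sup>2) = x\<^sup>2 * (x ^ 3 - 3 * x\<^sup>2 + 2 * b) / (x - 1) ^ 4"
    if "x > 1" "A > 0" for x A b :: real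
  proof -
    have "x ^ 4 / (x - 1) ^ 3 = x ^ 4 * (x - 1) / (x - 1) ^ 4" using that by (simp add: eval_nat_numeral)
    moreover have "2 * A\<^sup>2 * x\<^sup>2 / (x - 1) ^ 4 * ((b - x\<^sup>2) / A\<^sup>2) = 2 * x\<^sup>2 * (b - x\<^sup>2) / (x - 1) ^ 4" using that by simp
    moreover have "x\<^sup>2 * (x ^ 3 - 3 * x\<^sup>2 + 2 * b) = x ^ 4 * (x - 1) + 2 * x\<^sup>2 * (b - x\<^sup>2)"
      by (simp add: eval_nat_numeral algebra_simps)
    ultimately show ?thesis by (simp only: add_divide_distrib)
  qed
  show ?thesis unfolding ds_S[OF assms] W_def N_def by (rule alg) (use c in auto)
qed

text \<open>The shear carries the chosen vector to \<open>S u\<close>, which is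
  \<open>ip\<close>-orthogonal to \<open>u\<close>. The radial term disappears, and the other two
  are multiples of \<open>ds u w\<close> whose coefficients add up to \<open>W u\<close>.\<close>

lemma hess_gradient:
  assumes "u \<in> C"
  shows "hess Fm u (S u - (k u * ds u (S u)) *\<^sub>R u) w = W u * ds u w"
proof -
  let ?\<kappa> = "S u - (k u * ds u (S u)) *\<^sub>R u"
  have d: "ds u ?\<kappa> = ds u (S u)"
    using linear_diff[OF linear_ds] linear_cmul[OF linear_ds] ds_self[OF assms] by simp
  then have "R u ?\<kappa> = S u" by (simp add: R_def mult.commute)
  moreover have "ip u (S u) = 0" using ip_S[of u u] ds_self[OF assms] sym by simp
  moreover have "ip (S u) (R u w) = ds u w" unfolding ip_S by (rule hess_R(2)[OF assms])
  ultimately have "hess Fm u ?\<kappa> w = (s u) ^ 4 / (s u - 1) ^ 3 * ds u w + 2 * (\<alpha> u)\<^sup>2 * (s u)\<^sup>2 / (s u - 1) ^ 4 * ds u (S u) * ds u w"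
    unfolding hess_R(1)[OF assms] by (simp add: hess_R(2)[OF assms])
  also have "\<dots> = W u * ds u w" unfolding W_eq[OF assms, symmetric] by (simp add: algebra_simps)
  finally show ?thesis .
qed

text \<open>In the sheared frame the tensor is \<open>c\<close> times the Gram matrix of
  \<open>ip\<close> composed with two rank-one perturbations of the identity, along the orthogonal
  vectors \<open>u\<close> and \<open>S u\<close>. The shear has determinant 1 because
  \<open>ds u u = 0\<close>, and the perturbations contribute \<open>f / c\<close> and
  \<open>W u / c\<close>.\<close>

lemma det_fundamental_tensor:
  assumes C: "u \<in> C" and U: "open U" "u \<in> U" "smooth_on U (\<lambda>u. (Fm u)\<^sup>2)"
  shows "det (fundamental_tensor Fm u) = det (\<chi> i j. ip (axis i 1) (axis j 1)) * (s u ^ (4 * CARD('n) - 2) * N u / (s u - 1) ^ (3 * CARD('n)))"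
proof -
  note cc = C_pos[OF C]
  let ?A = "(\<chi> i j. ip (axis i 1) (axis j 1)) :: real ^ 'n ^ 'n"
  \<comment> \<open>\<open>c\<close>, \<open>f\<close> and \<open>q\<close> give the coefficients in
    \<open>hess_R\<close>: \<open>c\<close> for \<open>ip\<close>, \<open>f - c\<close> for the
    radial square, \<open>q\<close> for the square of \<open>ds u\<close>.\<close>
  define c where "c = (s u) ^ 4 / (s u - 1) ^ 3"
  define f where "f = ((s u)\<^sup>2 / (s u - 1))\<^sup>2"
  define q where "q = 2 * (\<alpha> u)\<^sup>2 * (s u)\<^sup>2 / (s u - 1) ^ 4"
  define E1 where "E1 w = w + (ip u w / \<alpha> u) *\<^sub>R (((f - c) / c / \<alpha> u) *\<^sub>R u)" for w
  define E2 where "E2 w = w + ds u w *\<^sub>R ((q / c) *\<^sub>R S u)" for w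
  have c0: "c > 0" using cc by (simp add: c_def)
  have ipA: "v \<bullet> (?A *v w) = ip v w" for v w
  proof -
    have "ip v w = (\<Sum>i\<in>UNIV. v $ i * ip (axis i 1) w)"
      using linear_axis_sum[OF lin(2), of v w] by simp
    also have "\<dots> = (\<Sum>i\<in>UNIV. v $ i * (\<Sum>j\<in>UNIV. w $ j * ip (axis i 1) (axis j 1)))"
      by (rule sum.cong[OF refl]) (simp only: linear_axis_sum[OF lin(1), of _ w] real_scaleR_def)
    finally show ?thesis by (simp add: inner_vec_def matrix_vector_mult_def mult.commute)
  qed
  have one: "linear (\<lambda>w. w + l w *\<^sub>R p)" if "linear l" for l and p :: "real ^ 'n"
    using that by (simp add: linear_iff algebra_simps)
  have lR: "linear (R u)" unfolding R_def[abs_def] by (rule one[OF linear_ds])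
  have lE1: "linear E1" unfolding E1_def[abs_def] by (rule one[OF linear_t])
  have lE2: "linear E2" unfolding E2_def[abs_def] by (rule one[OF linear_ds])
  have m: "matrix f *v w = f w" if "linear f" for f :: "real ^ 'n \<Rightarrow> real ^ 'n" and w
    using that by (simp add: matrix_works linear_matrix_vector_mul_eq)
  let ?G = "transpose (matrix (R u)) ** (c *\<^sub>R (?A ** (matrix E1 ** (matrix E2 ** matrix (R u)))))"
  have uS: "ip u (S u) = 0" using ip_S[of u u] ds_self[OF C] sym[of u "S u"] by simp
  have entry: "w \<bullet> (?G *v v) = hess Fm u v w" for v w
  proof -
    have "w \<bullet> (?G *v v) = R u w \<bullet> ((c *\<^sub>R (?A ** (matrix E1 ** (matrix E2 ** matrix (R u))))) *v v)"
      unfolding matrix_vector_mul_assoc[symmetric] dot_lmul_matrix[symmetric] vector_transpose_matrix m[OF lR] ..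
    also have "\<dots> = c * ip (R u w) (E1 (E2 (R u v)))"
      by (simp only: scaleR_matrix_vector_assoc[symmetric] matrix_vector_mul_assoc[symmetric] m[OF lR] m[OF lE1] m[OF lE2] inner_scaleR_right ipA)
    also have "E1 (E2 (R u v)) = R u v + (ds u (R u v) * (q / c)) *\<^sub>R S u + (ip u (R u v) / \<alpha> u * ((f - c) / c / \<alpha> u)) *\<^sub>R u"
      using uS by (simp add: E1_def E2_def ip_simps)
    also have "ip (R u w) \<dots> = ip (R u v) (R u w) + (ds u (R u v) * (q / c)) * ds u (R u w)
        + (ip u (R u v) / \<alpha> u * ((f - c) / c / \<alpha> u)) * ip u (R u w)"
      by (simp only: ip_simps sym[of "R u w"] ip_S real_scaleR_def)
    also have "c * \<dots> = c * ip (R u v) (R u w) + (f - c) * (ip u (R u v) / \<alpha> u) * (ip u (R u w) / \<alpha> u)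
        + q * ds u (R u v) * ds u (R u w)"
      using c0 by (simp add: distrib_left)
    also have "\<dots> = hess Fm u v w" unfolding hess_R(1)[OF C] c_def f_def q_def ..
    finally show ?thesis .
  qed
  have "fundamental_tensor Fm u = ?G"
    unfolding matrix_eq
  proof
    fix v
    have "w \<bullet> (fundamental_tensor Fm u *v v) = w \<bullet> (?G *v v)" for w
      unfolding entry by (rule hess_eq[OF U(1,3,2), symmetric])
    then show "fundamental_tensor Fm u *v v = ?G *v v" using vector_eq_ldot by blast
  qed
  then have "det (fundamental_tensor Fm u) = det ?G" by (rule arg_cong)
  also have "det ?G = det (matrix (R u)) * (c ^ CARD('n) * (det ?A * (det (matrix E1) * (det (matrix E2) * det (matrix (R u))))))"
    by (simp only: det_mul det_scaleR det_transpose)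
  also have "det (matrix (R u)) = 1"
    unfolding R_def[abs_def] det_rank_one[OF linear_ds] linear_cmul[OF linear_ds] using ds_self[OF C] by simp
  also have "det (matrix E1) = f / c"
  proof -
    have "det (matrix E1) = 1 + ip u (((f - c) / c / \<alpha> u) *\<^sub>R u) / \<alpha> u"
      unfolding E1_def[abs_def] by (rule det_rank_one[OF linear_t])
    also have "\<dots> = 1 + (f - c) / c" using cc(1) by (simp add: ip_simps \<alpha>_sq[symmetric] power2_eq_square)
    finally show ?thesis using c0 by (simp add: diff_divide_distrib)
  qed
  also have "det (matrix E2) = W u / c"
  proof -
    have "det (matrix E2) = 1 + ds u ((q / c) *\<^sub>R S u)"
      unfolding E2_def[abs_def] by (rule det_rank_one[OF linear_ds])
    also have "\<dots> = (c + q * ds u (S u)) / c"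
      using c0 by (simp add: linear_cmul[OF linear_ds] add_divide_distrib)
    finally show ?thesis unfolding W_eq[OF C, symmetric] c_def q_def .
  qed
  finally have "det (fundamental_tensor Fm u) = det ?A * (c ^ CARD('n) * (f / c * (W u / c)))"
    by (simp only: mult_1_left mult_1_right mult_ac)
  also have "c ^ CARD('n) * (f / c * (W u / c)) = s u ^ (4 * CARD('n) - 2) * N u / (s u - 1) ^ (3 * CARD('n))"
  proof -
    have alg: "(x\<^sup>2 / e)\<^sup>2 / (x ^ 4 / e ^ 3) * (x\<^sup>2 * M / e ^ 4 / (x ^ 4 / e ^ 3)) = M / x\<^sup>2" if "x \<noteq> 0" "e \<noteq> 0" for x e M :: real
      using that by (simp add: field_simps)
    have "f / c * (W u / c) = N u / (s u)\<^sup>2"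
      unfolding f_def c_def W_def by (rule alg) (use cc in auto)
    moreover have "c ^ CARD('n) = s u ^ (4 * CARD('n)) / (s u - 1) ^ (3 * CARD('n))"
      by (simp add: c_def power_divide power_mult)
    moreover have "s u ^ (4 * CARD('n)) = s u ^ (4 * CARD('n) - 2) * (s u)\<^sup>2"
    proof -
      \<comment> \<open>The subtraction on natural numbers is exact because the dimension is
        positive.\<close>
      have "4 * CARD('n) = (4 * CARD('n) - 2) + 2" using zero_less_card_finite[where 'a='n] by linarith
      then show ?thesis by (metis power_add)
    qed
    ultimately show ?thesis using cc by simp
  qed
  finally show ?thesis .
qed

text \<open>For s > 1 the minimum of s^2 / (s - 1) is 4, attained at s = 2; the inequality is the
  nonnegativity of (s - 2)^2.\<close>

lemma F_bound: assumes "u \<in> C" shows "4 * \<alpha> u \<le> Fm u"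
proof -
  note c = C_pos[OF assms]
  have "4 * (s u - 1) \<le> (s u)\<^sup>2" using zero_le_power2[of "s u - 2"] by (simp add: power2_eq_square algebra_simps)
  then have "4 \<le> (s u)\<^sup>2 / (s u - 1)" using c by (simp add: pos_le_divide_eq)
  then show ?thesis unfolding Fm_eq[OF assms] using mult_left_mono[OF _ \<alpha>_nonneg] by (simp only: mult.commute[of 4])
qed

text \<open>On the compact Euclidean unit sphere \<alpha> has a positive minimum, so it dominates
  the Euclidean norm; \<open>F_bound\<close> then bounds \<alpha> on the sublevel set.\<close>

lemma bounded_sublevel: "bounded {u \<in> C. Fm u < 1}"
proof -
  have "compact (sphere (0::real ^ 'n) 1)" by simp
  moreover have "sphere (0::real ^ 'n) 1 \<noteq> {}" by simp
  moreover have "continuous_on (sphere 0 1) \<alpha>"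
    unfolding \<alpha>_def[abs_def] by (rule continuous_on_real_sqrt[OF bounded_bilinear.continuous_on[OF bb continuous_on_id continuous_on_id]])
  ultimately obtain x where x: "x \<in> sphere 0 1" "\<And>y. y \<in> sphere 0 1 \<Longrightarrow> \<alpha> x \<le> \<alpha> y"
    by (rule continuous_attains_inf[THEN bexE]) auto
  have "x \<noteq> 0" using x(1) by auto
  then have ax: "\<alpha> x > 0" using pos by (simp add: \<alpha>_def)
  have "norm u \<le> 1 / \<alpha> x" if "u \<in> C" "Fm u < 1" for u
  proof -
    have u: "u \<noteq> 0" by (rule C_pos(4)[OF that(1)])
    have "\<alpha> x \<le> \<alpha> ((1 / norm u) *\<^sub>R u)" using u by (intro x(2)) simp
    also have "\<dots> = \<alpha> u / norm u" by (simp add: \<alpha>_def ip_simps real_sqrt_divide real_sqrt_mult)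
    finally have "\<alpha> x * norm u \<le> \<alpha> u" using u by (simp add: pos_le_divide_eq)
    also have "\<dots> \<le> 1" using F_bound[OF that(1)] that(2) \<alpha>_nonneg[of u] by linarith
    finally show ?thesis using ax by (simp add: pos_le_divide_eq mult.commute)
  qed
  then show ?thesis by (auto simp: bounded_iff)
qed

text \<open>Cauchy-Schwarz bounds the quotient, and the vector \<open>V\<close> attains the
  bound.\<close>

lemma norm_\<beta>: assumes "V \<noteq> 0" shows "(SUP u\<in>- {0}. \<beta> u / \<alpha> u) = \<alpha> V"
proof (rule cSup_eq_maximum)
  have "\<alpha> V > 0" using pos[OF assms] by (simp add: \<alpha>_def)
  then have "\<beta> V / \<alpha> V = \<alpha> V" by (simp add: \<beta>[symmetric] \<alpha>_sq[symmetric] power2_eq_square)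
  then show "\<alpha> V \<in> (\<lambda>u. \<beta> u / \<alpha> u) ` (- {0})" using assms by (intro image_eqI[of _ _ V]) auto
  fix x assume "x \<in> (\<lambda>u. \<beta> u / \<alpha> u) ` (- {0})"
  then obtain u where u: "u \<noteq> 0" "x = \<beta> u / \<alpha> u" by blast
  have au: "\<alpha> u > 0" using pos[OF u(1)] by (simp add: \<alpha>_def)
  have "(\<beta> u)\<^sup>2 \<le> (\<alpha> V * \<alpha> u)\<^sup>2"
    using cauchy_schwarz[of V u] by (simp add: \<beta> power_mult_distrib \<alpha>_sq)
  then have "\<beta> u \<le> \<alpha> V * \<alpha> u" by (rule power2_le_imp_le) (simp add: \<alpha>_nonneg)
  then show "x \<le> \<alpha> V" using au u(2) by (simp add: pos_divide_le_eq)
qed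

text \<open>The volume density and the Gram determinant do not depend on the direction, so what
  remains is half the logarithmic derivative of the \<open>s\<close>-dependent factor of the
  determinant.\<close>

lemma distortion_gradient:
  assumes U: "open U" "u \<in> U" "U \<subseteq> C" "smooth_on U (\<lambda>u. (Fm u)\<^sup>2)" and \<sigma>: "\<sigma> > 0"
    and pd: "\<And>w. w \<noteq> 0 \<Longrightarrow> w \<bullet> (fundamental_tensor Fm u *v w) > 0"
  shows "((\<lambda>u. ln (sqrt (det (fundamental_tensor Fm u)) / \<sigma>)) has_derivative
    (\<lambda>w. ((4 * real CARD('n) - 2) / s u + (3 * (s u)\<^sup>2 - 6 * s u) / N u - 3 * real CARD('n) / (s u - 1)) / 2 * ds u w)) (at u)"
proof -
  let ?n = "CARD('n)" and ?K = "det (\<chi> i j. ip (axis i 1) (axis j 1)) :: real"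
  have uC: "u \<in> C" using U by blast
  note c = C_pos[OF uC] and Np = N_pos[OF uC] and sd = s_deriv[OF uC]
  \<comment> \<open>The sign of the Gram determinant is read off from the positive tensor, as the
    other factor is positive.\<close>
  have K: "?K > 0"
  proof -
    have "0 < ?K * (s u ^ (4 * ?n - 2) * N u / (s u - 1) ^ (3 * ?n))"
      using positive_definite_det_pos[OF pd] unfolding det_fundamental_tensor[OF uC U(1,2,4)] .
    moreover have "s u ^ (4 * ?n - 2) * N u / (s u - 1) ^ (3 * ?n) > 0" using c Np by simp
    ultimately show ?thesis using zero_less_mult_pos2 by blast
  qed
  have n: "real (4 * ?n - 2) = 4 * real ?n - 2" using zero_less_card_finite[where 'a='n] by (subst of_nat_diff) auto
  have eq: "ln (sqrt (det (fundamental_tensor Fm v)) / \<sigma>)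
      = (ln ?K + (4 * real ?n - 2) * ln (s v) + ln (N v) - 3 * real ?n * ln (s v - 1)) / 2 - ln \<sigma>" if v: "v \<in> U" for v
  proof -
    have vC: "v \<in> C" using U v by blast
    note cv = C_pos[OF vC] and Nv = N_pos[OF vC]
    have p: "s v ^ (4 * ?n - 2) > 0" "(s v - 1) ^ (3 * ?n) > 0" using cv by auto
    have "ln (?K * (s v ^ (4 * ?n - 2) * N v / (s v - 1) ^ (3 * ?n)))
      = ln ?K + (4 * real ?n - 2) * ln (s v) + ln (N v) - 3 * real ?n * ln (s v - 1)"
      using K Nv p cv by (simp add: ln_mult ln_div ln_realpow n)
    moreover have "?K * (s v ^ (4 * ?n - 2) * N v / (s v - 1) ^ (3 * ?n)) > 0" using K Nv p by simp
    moreover have "ln (sqrt r / \<sigma>) = ln r / 2 - ln \<sigma>" if "r > 0" for r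
      using that \<sigma> by (simp add: ln_div ln_sqrt)
    ultimately show ?thesis
      unfolding det_fundamental_tensor[OF vC U(1) v U(4)] by (simp only:)
  qed
  have Nd: "(N has_derivative (\<lambda>w. (3 * (s u)\<^sup>2 - 6 * s u) * ds u w)) (at u)"
    unfolding N_def[abs_def] by (auto intro!: derivative_eq_intros sd simp: fun_eq_iff algebra_simps)
  have "((\<lambda>v. (ln ?K + (4 * real ?n - 2) * ln (s v) + ln (N v) - 3 * real ?n * ln (s v - 1)) / 2 - ln \<sigma>) has_derivative
    (\<lambda>w. ((4 * real ?n - 2) / s u + (3 * (s u)\<^sup>2 - 6 * s u) / N u - 3 * real ?n / (s u - 1)) / 2 * ds u w)) (at u)"
  proof -
    have 1: "((\<lambda>v. ln (s v)) has_derivative (\<lambda>w. ds u w * inverse (s u))) (at u)"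
      by (rule has_derivative_ln[OF _ sd]) (use c in simp)
    have 2: "((\<lambda>v. ln (N v)) has_derivative (\<lambda>w. (3 * (s u)\<^sup>2 - 6 * s u) * ds u w * inverse (N u))) (at u)"
      by (rule has_derivative_ln[OF Np Nd])
    have 3: "((\<lambda>v. ln (s v - 1)) has_derivative (\<lambda>w. (ds u w - 0) * inverse (s u - 1))) (at u)"
      by (rule has_derivative_ln[OF _ has_derivative_diff[OF sd has_derivative_const]]) (use c in simp)
    have alg: "(0 + m * (d * inverse x) + p * d * inverse y - l * ((d - 0) * inverse (x - 1))) / 2 - 0
        = (m / x + p / y - l / (x - 1)) / 2 * d" for m d x p y l :: real
      by (simp only: divide_inverse diff_0_right add_0_left distrib_right left_diff_distrib distrib_left right_diff_distrib mult_ac)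
    show ?thesis
      by (rule has_derivative_eq_rhs[OF has_derivative_diff[OF bounded_linear.has_derivative[OF bounded_linear_divide
            has_derivative_diff[OF has_derivative_add[OF has_derivative_add[OF has_derivative_const has_derivative_mult_right[OF 1]] 2]
              has_derivative_mult_right[OF 3]]] has_derivative_const]])
         (rule ext, rule alg)
  qed
  then show ?thesis
    by (rule has_derivative_transform_within_open[OF _ U(1,2)]) (simp add: eq)
qed

text \<open>Here \<open>z\<close> stands for the derivative of the body velocity and
  \<open>q\<close> for the bracket of \<open>v\<close> and \<open>y\<close>, both projected to the
  tangent space at H. The hypothesis is solved for \<open>ds u z\<close> in \<open>alg1\<close>, and
  \<open>alg2\<close> collects the polynomial in s.\<close>

lemma S_curvature_value:
  assumes u: "u \<in> C" and z: "W u * ds u z = - (Fm u * dF u q / \<alpha> u)"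
  shows "((4 * n - 2) / s u + (3 * (s u)\<^sup>2 - 6 * s u) / N u - 3 * n / (s u - 1)) / 2 * ds u z =
    (- (n + 1) * s u ^ 5 + (7 * n + 1) * s u ^ 4 - 12 * n * s u ^ 3
       + 2 * (2 - n) * ip V V * (s u)\<^sup>2 + 4 * (2 * n - 1) * ip V V * s u)
    / (2 * (N u)\<^sup>2) * (1 / \<alpha> u * ip q u + (1 - 2 / s u) * \<beta> q)"
proof -
  note c = C_pos[OF u] and Np = N_pos[OF u]
  have alg1: "d = - ((x - 1) * x\<^sup>2 * (t + (1 - 2 / x) * b) / M)"
    if "x\<^sup>2 * M / (x - 1) ^ 4 * d = - (x\<^sup>2 / (x - 1) * ((x\<^sup>2 * t + (x\<^sup>2 - 2 * x) * b) / (x - 1)\<^sup>2))"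
      "x > 1" "M > 0" for x M d t b :: real
  proof -
    define e where "e = x - 1"
    have e: "e \<noteq> 0" "x \<noteq> 0" using that by (auto simp: e_def)
    have "x\<^sup>2 * t + (x\<^sup>2 - 2 * x) * b = x\<^sup>2 * (t + (1 - 2 / x) * b)"
      using e by (simp add: field_simps power2_eq_square)
    with that(1) have "x\<^sup>2 * M / e ^ 4 * d = - (x\<^sup>2 / e * (x\<^sup>2 * (t + (1 - 2 / x) * b) / e\<^sup>2))" by (simp only: e_def)
    moreover have "x\<^sup>2 / e * (x\<^sup>2 * r / e\<^sup>2) = x\<^sup>2 * M / e ^ 4 * (e * x\<^sup>2 * r / M)" for r
      using e that(3) by (simp add: field_simps power2_eq_square eval_nat_numeral)
    ultimately have "x\<^sup>2 * M / e ^ 4 * d = x\<^sup>2 * M / e ^ 4 * - (e * x\<^sup>2 * (t + (1 - 2 / x) * b) / M)" by simp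
    then show ?thesis using e that(3) unfolding e_def[symmetric] by (simp only: mult_cancel_left) auto
  qed
  have "(s u)\<^sup>2 * N u / (s u - 1) ^ 4 * ds u z
      = - ((s u)\<^sup>2 / (s u - 1) * (((s u)\<^sup>2 * (ip u q / \<alpha> u) + ((s u)\<^sup>2 - 2 * s u) * \<beta> q) / (s u - 1)\<^sup>2))"
    using z c(1) unfolding W_def Fm_eq[OF u] dF_def by simp
  from alg1[OF this c(3) Np]
  have d: "ds u z = - ((s u - 1) * (s u)\<^sup>2 * (ip u q / \<alpha> u + (1 - 2 / s u) * \<beta> q) / N u)" .
  have alg2: "((4 * n - 2) / x + (3 * x\<^sup>2 - 6 * x) / M - 3 * n / (x - 1)) / 2 * - ((x - 1) * x\<^sup>2 * r / M) =
    (- (n + 1) * x ^ 5 + (7 * n + 1) * x ^ 4 - 12 * n * x ^ 3 + 2 * (2 - n) * b * x\<^sup>2 + 4 * (2 * n - 1) * b * x) / (2 * M\<^sup>2) * r"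
    if "x > 1" "M > 0" "M = x ^ 3 - 3 * x\<^sup>2 + 2 * b" for x M r b :: real
  proof -
    define e where "e = x - 1"
    have e: "e \<noteq> 0" "x \<noteq> 0" "M \<noteq> 0" using that by (auto simp: e_def)
    have "((4 * n - 2) / x + (3 * x\<^sup>2 - 6 * x) / M - 3 * n / e) / 2 * - (e * x\<^sup>2 * r / M)
      = - (((4 * n - 2) * x * e * M + (3 * x\<^sup>2 - 6 * x) * e * x\<^sup>2 - 3 * n * x\<^sup>2 * M) / (2 * M\<^sup>2) * r)"
      using e by (simp add: field_simps power2_eq_square)
    also have "(4 * n - 2) * x * e * M + (3 * x\<^sup>2 - 6 * x) * e * x\<^sup>2 - 3 * n * x\<^sup>2 * M
      = - (- (n + 1) * x ^ 5 + (7 * n + 1) * x ^ 4 - 12 * n * x ^ 3 + 2 * (2 - n) * b * x\<^sup>2 + 4 * (2 * n - 1) * b * x)"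
      unfolding e_def that(3) by (simp add: eval_nat_numeral algebra_simps)
    finally have "((4 * n - 2) / x + (3 * x\<^sup>2 - 6 * x) / M - 3 * n / e) / 2 * - (e * x\<^sup>2 * r / M)
      = - (- (- (n + 1) * x ^ 5 + (7 * n + 1) * x ^ 4 - 12 * n * x ^ 3 + 2 * (2 - n) * b * x\<^sup>2 + 4 * (2 * n - 1) * b * x) / (2 * M\<^sup>2) * r)" .
    then show ?thesis unfolding e_def by (simp only: minus_divide_left[symmetric] mult_minus_left minus_minus)
  qed
  show ?thesis
    unfolding d by (subst alg2[OF c(3) Np N_def]) (simp add: sym[of q u])
qed

end

section \<open>S-curvature of the homogeneous infinite series metric\<close>

theorem theorem4p2:
  fixes G :: "('g, 'z) monoid_scheme"
    and A :: "('g, 'e::euclidean_space) atlas"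
    and H :: "'g set"
    and B :: "('g set, real ^ 'n) atlas"
    and \<mm> :: "'e set"
    and a :: "'g set \<Rightarrow> real ^ 'n \<Rightarrow> real ^ 'n \<Rightarrow> real"
    and \<beta> :: "'g set \<Rightarrow> real ^ 'n \<Rightarrow> real"
    and D :: "'g set \<Rightarrow> (real ^ 'n) set"
    and v y :: 'e
  assumes "lie_group G A"
    and "subgroup H G" and "compactin (atlas_topology A) H"
    and "homogeneous_space G A H B" and "connected_space (atlas_topology B)"
    and "reductive_decomposition G A H \<mm>"
    and "riemannian_metric B a" and "one_form B \<beta>"
    and "finsler_metric B D (infinite_series_metric a \<beta>)"
    and "invariant_metric G B D (infinite_series_metric a \<beta>)"
    and "v \<in> \<mm>"
    and "\<forall>w\<in>\<mm>. a H (origin_vector G A H B v) (origin_vector G A H B w)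
               = \<beta> H (origin_vector G A H B w)"
    and "y \<in> \<mm>" and "origin_vector G A H B y \<in> D H"
  shows "let n = real CARD('n);
             \<iota> = origin_vector G A H B;
             \<alpha> = riemannian_norm a H (\<iota> y);
             s = \<beta> H (\<iota> y) / \<alpha>;
             b = one_form_norm a \<beta> H;
             ip = (\<lambda>w z. a H (\<iota> w) (\<iota> z));
             vy = m_component G A H \<mm> (lie_bracket G A v y)
         in S_curvature B D (infinite_series_metric a \<beta>) H (\<iota> y) =
            (- (n + 1) * s ^ 5 + (7 * n + 1) * s ^ 4 - 12 * n * s ^ 3
               + 2 * (2 - n) * b\<^sup>2 * s\<^sup>2 + 4 * (2 * n - 1) * b\<^sup>2 * s)
            / (2 * (s ^ 3 - 3 * s\<^sup>2 + 2 * b\<^sup>2)\<^sup>2)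
            * (1 / \<alpha> * ip vy y + (1 - 2 / s) * ip vy v)"
proof -
  let ?F = "infinite_series_metric a \<beta>" and ?P = "origin_vector G A H B"
  let ?V = "?P v" and ?q = "?P (m_component G A H \<mm> (lie_bracket G A v y))"
  have G: "group G" using assms(1) by (simp add: lie_group_def)
  have B: "smooth_manifold B" using assms(4) by (simp add: homogeneous_space_def)
  interpret X: homogeneous_finsler G A H B D ?F
    by (intro homogeneous_finsler.intro homogeneous_on.intro lie_group_on.intro lie_group_on_axioms.intro
        homogeneous_on_axioms.intro finsler.intro homogeneous_finsler_axioms.intro) (fact G B assms)+
  have P: "?P w = X.P w" for w by (rule X.origin_vector_eq)
  note Hp = X.H_points
  note a = assms(7)[unfolded riemannian_metric_def, THEN conjunct1, rule_format, OF Hp]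
  have l\<beta>: "linear (\<beta> H)" using assms(8) Hp by (simp add: one_form_def)
  have "\<exists>Q. linear Q \<and> (\<forall>w. X.P (Q w) = w \<and> Q w \<in> \<mm>) \<and> (\<forall>y\<in>\<mm>. Q (X.P y) = y)"
    by (rule X.reductive(2)[OF assms(6)])
  \<comment> \<open>The relation between \<open>v\<close> and \<beta> is given on \<mm>; through
    \<open>Q\<close> every tangent vector at H comes from \<mm>, so the relation holds on the whole
    tangent space.\<close>
  then obtain Q where Q: "\<And>w. X.P (Q w) = w" "\<And>w. Q w \<in> \<mm>" by blast
  interpret I: infinite_series_norm "a H" "\<beta> H" ?V
  proof
    show "a H ?V w = \<beta> H w" for w using assms(12)[rule_format, OF Q(2), of w] by (simp add: P Q)
  qed (use a in auto)
  have \<alpha>: "riemannian_norm a H = I.\<alpha>" by (simp add: fun_eq_iff riemannian_norm_def I.\<alpha>_def)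
  have F: "?F H = I.Fm" by (simp add: fun_eq_iff infinite_series_metric_def I.Fm_def \<alpha>)
  \<comment> \<open>The numerator of F is a square, so positivity of F on the cone decides the sign
    of the denominator.\<close>
  have DC: "D H \<subseteq> I.C"
  proof
    fix u assume "u \<in> D H"
    from X.fin.F_pos[OF Hp this] have "(\<beta> H u)\<^sup>2 / (\<beta> H u - I.\<alpha> u) > 0" by (simp add: F I.Fm_def)
    then have "\<beta> H u - I.\<alpha> u > 0" by (simp add: zero_less_divide_iff not_less[symmetric])
    then show "u \<in> I.C" by (simp add: I.C_def)
  qed
  have bdd: "bounded {u \<in> D H. ?F H u < 1}"
    unfolding F by (rule bounded_subset[OF I.bounded_sublevel]) (use DC in auto)
  let ?u = "?P y" and ?n = "real CARD('n)"
  have u: "?u \<in> D H" by (rule assms(14))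
  then have uC: "?u \<in> I.C" using DC by blast
  note c = I.C_pos[OF uC]
  \<comment> \<open>The direction \<open>?u\<close> has \<beta> > \<alpha> > 0, which excludes a
    vanishing 1-form at H.\<close>
  have V: "?V \<noteq> 0"
  proof
    assume "?V = 0"
    then have "\<beta> H ?u = 0" using I.\<beta>[of ?u] I.ip_simps by simp
    then show False using c I.\<alpha>_nonneg[of ?u] by simp
  qed
  have b: "(one_form_norm a \<beta> H)\<^sup>2 = a H ?V ?V"
    unfolding one_form_norm_def \<alpha> I.norm_\<beta>[OF V] by (rule I.\<alpha>_sq)
  let ?\<tau> = "\<lambda>w. ((4 * ?n - 2) / I.s ?u + (3 * (I.s ?u)\<^sup>2 - 6 * I.s ?u) / I.N ?u - 3 * ?n / (I.s ?u - 1)) / 2 * I.ds ?u w"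
  let ?r = "(- (?n + 1) * I.s ?u ^ 5 + (7 * ?n + 1) * I.s ?u ^ 4 - 12 * ?n * I.s ?u ^ 3
       + 2 * (2 - ?n) * a H ?V ?V * (I.s ?u)\<^sup>2 + 4 * (2 * ?n - 1) * a H ?V ?V * I.s ?u)
    / (2 * (I.N ?u)\<^sup>2) * (1 / I.\<alpha> ?u * a H ?q ?u + (1 - 2 / I.s ?u) * \<beta> H ?q)"
  have \<tau>: "(distortion D ?F H has_derivative ?\<tau>) (at ?u)"
    unfolding distortion_def[abs_def] F
    by (rule I.distortion_gradient[OF X.fin.D_open(1)[OF Hp] u DC X.fin.F2_smooth[OF Hp, unfolded F]
        X.fin.volume_density_pos[OF Hp u bdd, unfolded F] X.fin.pos_def[OF Hp u, unfolded F]])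
  have q: "?q = X.P (lie_bracket G A v y)" by (simp add: P X.reductive(1)[OF assms(6)])
  have val: "((\<lambda>t. distortion D ?F (\<gamma> t) (velocity B \<gamma> t)) has_real_derivative ?r) (at 0)"
    if geo: "e > 0" "geodesic B D ?F {- e<..<e} \<gamma>" "\<gamma> 0 = H" "velocity B \<gamma> 0 = ?u" for \<gamma> e
  proof -
    obtain z where z: "((\<lambda>t. distortion D ?F (\<gamma> t) (velocity B \<gamma> t)) has_real_derivative ?\<tau> (X.P z)) (at 0)"
      "\<And>\<kappa>. 2 * hess (?F H) (X.P y) (X.P \<kappa>) (X.P z)
        = frechet_derivative (\<lambda>v. (?F H v)\<^sup>2) (at (X.P y)) (X.P (lie_bracket G A y \<kappa>))"
      by (rule X.distortion_along_geodesic[OF assms(6,13) u[unfolded P] bdd geo[unfolded P] \<tau>[unfolded P]]) (auto simp: P)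
    \<comment> \<open>The coefficients are chosen so that \<kappa> projects to the vector of
      \<open>hess_gradient\<close>: \<open>S ?u\<close> supplies \<open>1 / \<alpha>\<close> times
      \<open>v\<close> and one multiple of \<open>y\<close>, and the shear correction
      \<open>l\<close> supplies the other.\<close>
    define l where "l = I.k ?u * I.ds ?u (I.S ?u)"
    define d where "d = 1 / I.\<alpha> ?u * (I.s ?u / I.\<alpha> ?u) + l"
    define \<kappa> where "\<kappa> = (1 / I.\<alpha> ?u) *\<^sub>R v - d *\<^sub>R y"
    have "X.P \<kappa> = (1 / I.\<alpha> ?u) *\<^sub>R ?V - d *\<^sub>R ?u"
      by (simp only: \<kappa>_def linear_diff[OF X.linear_P] linear_cmul[OF X.linear_P] P)
    then have "X.P \<kappa> = I.S ?u - (I.k ?u * I.ds ?u (I.S ?u)) *\<^sub>R ?u"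
      unfolding l_def[symmetric] unfolding I.S_def d_def by (simp add: scaleR_diff_right scaleR_add_left)
    then have "2 * (I.W ?u * I.ds ?u (X.P z)) = frechet_derivative (\<lambda>v. (I.Fm v)\<^sup>2) (at ?u) (X.P (lie_bracket G A y \<kappa>))"
      using z(2)[of \<kappa>] I.hess_gradient[OF uC, of "X.P z"] by (simp add: P F)
    also have "\<dots> = 2 * I.Fm ?u * I.dF ?u (X.P (lie_bracket G A y \<kappa>))" by (rule I.F2_deriv_dF[OF uC])
    \<comment> \<open>The \<open>y\<close> part of \<kappa> drops out of the bracket, and exchanging
      its arguments produces the minus sign.\<close>
    also have "X.P (lie_bracket G A y \<kappa>) = - ((1 / I.\<alpha> ?u) *\<^sub>R ?q)"
      by (simp add: \<kappa>_def X.lie_bracket_combination q linear_neg[OF X.linear_P] linear_cmul[OF X.linear_P])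
    also have "I.dF ?u \<dots> = - (I.dF ?u ?q / I.\<alpha> ?u)"
      using c by (simp add: I.dF_def linear_neg[OF I.lin(1)] linear_cmul[OF I.lin(1)] linear_neg[OF I.linear_\<beta>]
          linear_cmul[OF I.linear_\<beta>] field_simps)
    finally have "I.W ?u * I.ds ?u (X.P z) = - (I.Fm ?u * I.dF ?u ?q / I.\<alpha> ?u)" by simp
    from z(1)[unfolded I.S_curvature_value[OF uC this]] show ?thesis .
  qed
  obtain \<gamma> e where \<gamma>: "e > 0" "geodesic B D ?F {- e<..<e} \<gamma>" "\<gamma> 0 = H" "velocity B \<gamma> 0 = ?u"
    by (rule X.fin.geodesic_exists[OF Hp u])
  have "S_curvature B D ?F H ?u = ?r"
    unfolding S_curvature_def
  \<comment> \<open>The constructed geodesic is a witness; for uniqueness, \<open>val\<close>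
    computes the derivative along any geodesic with the same initial data.\<close>
  proof (rule the_equality)
    show "\<exists>\<gamma> \<epsilon>. \<epsilon> > 0 \<and> geodesic B D ?F {- \<epsilon><..<\<epsilon>} \<gamma> \<and> \<gamma> 0 = H \<and> velocity B \<gamma> 0 = ?u \<and>
        ((\<lambda>t. distortion D ?F (\<gamma> t) (velocity B \<gamma> t)) has_real_derivative ?r) (at 0)"
      using \<gamma> val[OF \<gamma>] by blast
    show "r = ?r" if "\<exists>\<gamma> \<epsilon>. \<epsilon> > 0 \<and> geodesic B D ?F {- \<epsilon><..<\<epsilon>} \<gamma> \<and> \<gamma> 0 = H \<and> velocity B \<gamma> 0 = ?u \<and>
        ((\<lambda>t. distortion D ?F (\<gamma> t) (velocity B \<gamma> t)) has_real_derivative r) (at 0)" for r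
      using that DERIV_unique[OF _ val] by blast
  qed
  moreover have "a H ?q ?V = \<beta> H ?q" by (simp only: I.sym[of ?q ?V] I.\<beta>)
  ultimately show ?thesis
    unfolding Let_def b \<alpha> I.N_def I.s_def by simp
qed

end
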